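(* Let $k$ be an algebraically closed field of prime characteristic $p>2$. Consider the following Hopf algebras over $k$: (1) the $p^2q$-dimensional bosonization $R\# kG$ of the rank two Nichols algebra $R$ of Jordan type over a cyclic group $G$ of order $q$, where $q$ is divisible by $p$; (2) when $p=q=3$, a lifting $H$ of $R\# kG$, that is, $H=H(\epsilon,\mu,\tau)$ for some $\epsilon\in\{0,1\}$ and $\mu,\tau\in k$. Then the cohomology rings $\mathrm{H}^*(R\# kG,k)$ and $\mathrm{H}^*(H,k)$ are finitely generated as $k$-algebras.
   Context: For an augmented $k$-algebra $\Lambda$ with augmentation $\varepsilon:\Lambda\to k$, $k$ denotes the trivial left module given by $\varepsilon$ and $\mathrm{H}^*(\Lambda,k):=\mathrm{Ext}^*_\Lambda(k,k)$, a graded $k$-algebra under Yoneda (equivalently cup) product. $R=k\langle x,y\rangle/(x^p,\ y^p,\ yx-xy-\tfrac12x^2)$, the rank two Nichols algebra of Jordan type, of dimension $p^2$ with basis $\{x^iy^j\mid 0\le i,j\le p-1\}$. $G=\langle g\rangle$ is cyclic of order $q$ with $p\mid q$, acting on $R$ by algebra automorphisms with ${}^gx=x$, ${}^gy=x+y$. As an algebra, the bosonization $R\# kG$ is the smash product (skew group algebra): it is $R\otimes kG$ as a vector space, with $g r=({}^gr)g$ for $r\in R$. The augmentation (counit) is $\varepsilon(x)=\varepsilon(y)=0$, $\varepsilon(g)=1$. For $k$ of characteristic $3$, $\epsilon\in\{0,1\}$ and $\mu,\tau\in k$, $H(\epsilon,\mu,\tau)$ is the $27$-dimensional pointed Hopf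 algebra generated as an algebra by $g,x,y$ with relations $$g^3=1,\quad x^3=\epsilon x,\quad y^3=-\epsilon y^2-(\mu\epsilon-\tau-\mu^2)y,$$ $$yg-gy=xg+\mu(g-g^2),\quad xg-gx=-\epsilon(g-g^2),$$ $$yx-xy=-x^2+(\mu+\epsilon)x+\epsilon y+\tau(1-g^2),$$ with coproduct $\Delta(x)=x\otimes1+g\otimes x$, $\Delta(y)=y\otimes1+g\otimes y$, $\Delta(g)=g\otimes g$ and counit $\varepsilon(x)=\varepsilon(y)=0$, $\varepsilon(g)=1$. It has vector space basis $\{(g-1)^ix^jy^l\mid 0\le i,j,l\le2\}$. These are the liftings of $R\# kG$ (pointed Hopf algebras whose associated graded Hopf algebra for the coradical filtration is $R\# kG$) considered in the case $p=q=3$. *)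

theory Defs
  imports
    "HOL-Computational_Algebra.Polynomial"
    "HOL-Library.Poly_Mapping"
    "HOL-Algebra.Elementary_Groups"
    "HOL-Algebra.Group_Action"
    "HOL-Algebra.QuotRing"
    "HOL-Algebra.Module"
begin

text \<open>
  A \<open>k\<close>-algebra is represented by a record of type \<open>('k, 'a) module\<close>: its ring fields
  together with the scalar multiplication by \<open>'k\<close>.  A left module over a ring with elements of type
  \<open>'a\<close> is represented by a record of type \<open>('a, 'm) module\<close>; the fields \<open>mult\<close> and
  \<open>one\<close> of such a record carry no information.
\<close>


section \<open>Algebras given by generators and relations\<close>

datatype 'x free_word = Word (letters: "'x list")

instantiation free_word :: (type) monoid_add
begin

definition zero_free_word :: "'a free_word" where
  "0 = Word []"

definition plus_free_word :: "'a free_word \<Rightarrow> 'a free_word \<Rightarrow> 'a free_word" where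
  "u + v = Word (letters u @ letters v)"

instance
  by standard (simp_all add: zero_free_word_def plus_free_word_def)

end

text \<open>The free algebra is the monoid algebra of the free monoid; multiplication is the convolution
  product on \<^type>\<open>poly_mapping\<close>.\<close>

type_synonym ('x, 'k) free_algebra = "'x free_word \<Rightarrow>\<^sub>0 'k"

definition gen :: "'x \<Rightarrow> ('x, 'k::ring_1) free_algebra" where
  "gen x = Poly_Mapping.single (Word [x]) 1"

definition scalar :: "'k::ring_1 \<Rightarrow> ('x, 'k) free_algebra" where
  "scalar c = Poly_Mapping.single 0 c"

definition eval_free :: "('x \<Rightarrow> 'k) \<Rightarrow> ('x, 'k::comm_ring_1) free_algebra \<Rightarrow> 'k" where
  "eval_free v f =
     (\<Sum>w\<in>Poly_Mapping.keys f. Poly_Mapping.lookup f w * prod_list (map v (letters w)))"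

definition free_ring :: "('x, 'k::ring_1) free_algebra ring" where
  "free_ring = \<lparr>carrier = UNIV, mult = (*), one = 1, zero = 0, add = (+)\<rparr>"

definition presented_class ::
    "('x, 'k::ring_1) free_algebra set \<Rightarrow> ('x, 'k) free_algebra \<Rightarrow> ('x, 'k) free_algebra set" where
  "presented_class S f = (Idl\<^bsub>free_ring\<^esub> S) +>\<^bsub>free_ring\<^esub> f"

definition presented_algebra ::
    "('x, 'k::ring_1) free_algebra set \<Rightarrow> ('k, ('x, 'k) free_algebra set) module" where
  "presented_algebra S =
     (let Q = free_ring Quot (Idl\<^bsub>free_ring\<^esub> S) in
      \<lparr>carrier = carrier Q, mult = mult Q, one = one Q, zero = zero Q, add = add Q,
       smult = (\<lambda>c a. mult Q (presented_class S (scalar c)) a)\<rparr>)"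

text \<open>The augmentation sending each generator \<open>x\<close> to \<open>v x\<close>, for \<open>v\<close> satisfying the relations.\<close>

definition presented_aug ::
    "('x \<Rightarrow> 'k) \<Rightarrow> ('x, 'k::comm_ring_1) free_algebra set \<Rightarrow> 'k" where
  "presented_aug v X = the_elem (eval_free v ` X)"


section \<open>Smash products with finite groups\<close>

definition algebra_action ::
    "('g, 'c) monoid_scheme \<Rightarrow> ('k, 'r) module \<Rightarrow> ('g \<Rightarrow> 'r \<Rightarrow> 'r) \<Rightarrow> bool" where
  "algebra_action G A \<rho> \<longleftrightarrow>
     group_action G (carrier A) \<rho> \<and>
     (\<forall>a\<in>carrier G. \<rho> a \<in> ring_hom A A \<and>
        (\<forall>c. \<forall>r\<in>carrier A. \<rho> a (c \<odot>\<^bsub>A\<^esub> r) = c \<odot>\<^bsub>A\<^esub> \<rho> a r))"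

text \<open>For finite \<open>G\<close>, a function \<open>f\<close> stands for the element \<open>\<Sum>a. f a \<otimes> a\<close> of
  \<open>A \<otimes> kG\<close>; the product is determined by \<open>(r \<otimes> a) (s \<otimes> b) = r (\<rho> a s) \<otimes> ab\<close>.\<close>

definition smash_product ::
    "('k, 'r) module \<Rightarrow> ('g, 'c) monoid_scheme \<Rightarrow> ('g \<Rightarrow> 'r \<Rightarrow> 'r) \<Rightarrow> ('k, 'g \<Rightarrow> 'r) module" where
  "smash_product A G \<rho> =
     \<lparr>carrier = carrier G \<rightarrow>\<^sub>E carrier A,
      mult = (\<lambda>f h. \<lambda>c\<in>carrier G.
                \<Oplus>\<^bsub>A\<^esub>a\<in>carrier G. f a \<otimes>\<^bsub>A\<^esub> \<rho> a (h (inv\<^bsub>G\<^esub> a \<otimes>\<^bsub>G\<^esub> c))),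
      one = (\<lambda>c\<in>carrier G. if c = \<one>\<^bsub>G\<^esub> then \<one>\<^bsub>A\<^esub> else \<zero>\<^bsub>A\<^esub>),
      zero = (\<lambda>c\<in>carrier G. \<zero>\<^bsub>A\<^esub>),
      add = (\<lambda>f h. \<lambda>c\<in>carrier G. f c \<oplus>\<^bsub>A\<^esub> h c),
      smult = (\<lambda>t f. \<lambda>c\<in>carrier G. t \<odot>\<^bsub>A\<^esub> f c)\<rparr>"

definition smash_aug ::
    "('g, 'c) monoid_scheme \<Rightarrow> ('r \<Rightarrow> 'k::comm_monoid_add) \<Rightarrow> ('g \<Rightarrow> 'r) \<Rightarrow> 'k" where
  "smash_aug G \<epsilon> f = (\<Sum>a\<in>carrier G. \<epsilon> (f a))"


section \<open>The Jordan plane Nichols algebra and the liftings\<close>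

datatype jordan_gen = JX | JY

definition jordan_relations :: "nat \<Rightarrow> (jordan_gen, 'k::field) free_algebra set" where
  "jordan_relations p =
     (let x = gen JX; y = gen JY in
      {x ^ p, y ^ p, y * x - x * y - scalar (1 / 2) * x ^ 2})"

definition jordan_algebra ::
    "nat \<Rightarrow> ('k::field, (jordan_gen, 'k) free_algebra set) module" where
  "jordan_algebra p = presented_algebra (jordan_relations p)"

definition jordan_x :: "nat \<Rightarrow> (jordan_gen, 'k::field) free_algebra set" where
  "jordan_x p = presented_class (jordan_relations p) (gen JX)"

definition jordan_y :: "nat \<Rightarrow> (jordan_gen, 'k::field) free_algebra set" where
  "jordan_y p = presented_class (jordan_relations p) (gen JY)"

definition jordan_aug :: "(jordan_gen, 'k::field) free_algebra set \<Rightarrow> 'k" where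
  "jordan_aug = presented_aug (\<lambda>_. 0)"

datatype lifting_gen = LG | LX | LY

definition lifting_relations ::
    "'k \<Rightarrow> 'k \<Rightarrow> 'k \<Rightarrow> (lifting_gen, 'k::field) free_algebra set" where
  "lifting_relations e \<mu> \<tau> =
     (let g = gen LG; x = gen LX; y = gen LY in
      {g ^ 3 - 1,
       x ^ 3 - scalar e * x,
       y ^ 3 - (- scalar e * y ^ 2 - scalar (\<mu> * e - \<tau> - \<mu> ^ 2) * y),
       (y * g - g * y) - (x * g + scalar \<mu> * (g - g ^ 2)),
       (x * g - g * x) - (- scalar e * (g - g ^ 2)),
       (y * x - x * y) -
         (- (x ^ 2) + scalar (\<mu> + e) * x + scalar e * y + scalar \<tau> * (1 - g ^ 2))})"

definition lifting_algebra ::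
    "'k \<Rightarrow> 'k \<Rightarrow> 'k \<Rightarrow> ('k::field, (lifting_gen, 'k) free_algebra set) module" where
  "lifting_algebra e \<mu> \<tau> = presented_algebra (lifting_relations e \<mu> \<tau>)"

definition lifting_aug :: "(lifting_gen, 'k::field) free_algebra set \<Rightarrow> 'k" where
  "lifting_aug = presented_aug (\<lambda>z. case z of LG \<Rightarrow> 1 | LX \<Rightarrow> 0 | LY \<Rightarrow> 0)"


section \<open>Left modules and projective resolutions\<close>

text \<open>The library locale \<^locale>\<open>module\<close> requires a commutative base ring.\<close>

locale left_module = R?: ring R + M?: abelian_group M
  for R (structure) and M :: "('a, 'm, 'c) module_scheme" (structure) +
  assumes smult_closed:
      "\<lbrakk>a \<in> carrier R; u \<in> carrier M\<rbrakk> \<Longrightarrow> a \<odot>\<^bsub>M\<^esub> u \<in> carrier M"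
    and smult_l_distr:
      "\<lbrakk>a \<in> carrier R; b \<in> carrier R; u \<in> carrier M\<rbrakk> \<Longrightarrow>
        (a \<oplus>\<^bsub>R\<^esub> b) \<odot>\<^bsub>M\<^esub> u = a \<odot>\<^bsub>M\<^esub> u \<oplus>\<^bsub>M\<^esub> b \<odot>\<^bsub>M\<^esub> u"
    and smult_r_distr:
      "\<lbrakk>a \<in> carrier R; u \<in> carrier M; v \<in> carrier M\<rbrakk> \<Longrightarrow>
        a \<odot>\<^bsub>M\<^esub> (u \<oplus>\<^bsub>M\<^esub> v) = a \<odot>\<^bsub>M\<^esub> u \<oplus>\<^bsub>M\<^esub> a \<odot>\<^bsub>M\<^esub> v"
    and smult_assoc:
      "\<lbrakk>a \<in> carrier R; b \<in> carrier R; u \<in> carrier M\<rbrakk> \<Longrightarrow>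
        (a \<otimes>\<^bsub>R\<^esub> b) \<odot>\<^bsub>M\<^esub> u = a \<odot>\<^bsub>M\<^esub> (b \<odot>\<^bsub>M\<^esub> u)"
    and smult_one:
      "u \<in> carrier M \<Longrightarrow> \<one>\<^bsub>R\<^esub> \<odot>\<^bsub>M\<^esub> u = u"

definition module_hom ::
    "('a, 'r) ring_scheme \<Rightarrow> ('a, 'm, 'c) module_scheme \<Rightarrow> ('a, 'n, 'd) module_scheme
      \<Rightarrow> ('m \<Rightarrow> 'n) set" where
  "module_hom R M N =
     {f \<in> carrier M \<rightarrow>\<^sub>E carrier N.
        (\<forall>u\<in>carrier M. \<forall>v\<in>carrier M. f (u \<oplus>\<^bsub>M\<^esub> v) = f u \<oplus>\<^bsub>N\<^esub> f v) \<and>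
        (\<forall>a\<in>carrier R. \<forall>u\<in>carrier M. f (a \<odot>\<^bsub>M\<^esub> u) = a \<odot>\<^bsub>N\<^esub> f u)}"

text \<open>Projectivity is the lifting property.  The types over which the test modules range lose
  nothing: \<open>'m \<Rightarrow> 'a\<close> contains the free module on the set \<open>carrier M\<close>, and lifting the identity
  of \<open>M\<close> along its canonical surjection already makes \<open>M\<close> a direct summand of it.\<close>

definition projective_module ::
    "('a, 'r) ring_scheme \<Rightarrow> ('a, 'm) module \<Rightarrow> bool" where
  "projective_module R M \<longleftrightarrow>
     left_module R M \<and>
     (\<forall>(N :: ('a, 'm \<Rightarrow> 'a) module) (Q :: ('a, 'm) module) \<pi> f.
        left_module R N \<and> left_module R Q \<and>
        \<pi> \<in> module_hom R N Q \<and> \<pi> ` carrier N = carrier Q \<and> f \<in> module_hom R M Q \<longrightarrow>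
        (\<exists>h\<in>module_hom R M N. \<forall>u\<in>carrier M. \<pi> (h u) = f u))"

text \<open>\<open>\<cdots> \<rightarrow> P 2 \<rightarrow> P 1 \<rightarrow> P 0 \<rightarrow> N \<rightarrow> 0\<close> with \<open>d n : P (Suc n) \<rightarrow> P n\<close> and \<open>\<eta> : P 0 \<rightarrow> N\<close>.\<close>

definition projective_resolution ::
    "('a, 'r) ring_scheme \<Rightarrow> ('a, 'n) module \<Rightarrow> (nat \<Rightarrow> ('a, 'm) module)
      \<Rightarrow> (nat \<Rightarrow> 'm \<Rightarrow> 'm) \<Rightarrow> ('m \<Rightarrow> 'n) \<Rightarrow> bool" where
  "projective_resolution R N P d \<eta> \<longleftrightarrow>
     (\<forall>n. projective_module R (P n)) \<and>
     (\<forall>n. d n \<in> module_hom R (P (Suc n)) (P n)) \<and>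
     \<eta> \<in> module_hom R (P 0) N \<and>
     \<eta> ` carrier (P 0) = carrier N \<and>
     d 0 ` carrier (P 1) = {u \<in> carrier (P 0). \<eta> u = \<zero>\<^bsub>N\<^esub>} \<and>
     (\<forall>n. d (Suc n) ` carrier (P (Suc (Suc n))) =
            {u \<in> carrier (P (Suc n)). d n u = \<zero>\<^bsub>P n\<^esub>})"


section \<open>The cohomology ring of an augmented algebra\<close>

definition trivial_module :: "('a \<Rightarrow> 'k::field) \<Rightarrow> ('a, 'k) module" where
  "trivial_module \<epsilon> =
     \<lparr>carrier = UNIV, mult = (*), one = 1, zero = 0, add = (+), smult = (\<lambda>a c. \<epsilon> a * c)\<rparr>"

text \<open>In this section \<open>A\<close> is an algebra over the field \<open>'k\<close> with augmentation \<open>\<epsilon>\<close> and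
  \<open>(P, d, \<eta>)\<close> is a projective resolution of the trivial module.  The \<open>n\<close>-th
  group \<open>Ext\<^sup>n(k,k)\<close> is the cohomology of \<open>Hom(P n, k)\<close>, its elements being the classes
  of cocycles modulo coboundaries.\<close>

definition cocycles ::
    "('a, 'r) ring_scheme \<Rightarrow> ('a \<Rightarrow> 'k::field) \<Rightarrow> (nat \<Rightarrow> ('a, 'm) module)
      \<Rightarrow> (nat \<Rightarrow> 'm \<Rightarrow> 'm) \<Rightarrow> nat \<Rightarrow> ('m \<Rightarrow> 'k) set" where
  "cocycles A \<epsilon> P d n =
     {f \<in> module_hom A (P n) (trivial_module \<epsilon>). \<forall>u\<in>carrier (P (Suc n)). f (d n u) = 0}"

definition coboundaries ::
    "('a, 'r) ring_scheme \<Rightarrow> ('a \<Rightarrow> 'k::field) \<Rightarrow> (nat \<Rightarrow> ('a, 'm) module)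
      \<Rightarrow> (nat \<Rightarrow> 'm \<Rightarrow> 'm) \<Rightarrow> nat \<Rightarrow> ('m \<Rightarrow> 'k) set" where
  "coboundaries A \<epsilon> P d n =
     (case n of
        0 \<Rightarrow> {\<lambda>u\<in>carrier (P 0). 0}
      | Suc m \<Rightarrow> (\<lambda>h. compose (carrier (P n)) h (d m)) ` module_hom A (P m) (trivial_module \<epsilon>))"

definition ext_class ::
    "('a, 'r) ring_scheme \<Rightarrow> ('a \<Rightarrow> 'k::field) \<Rightarrow> (nat \<Rightarrow> ('a, 'm) module)
      \<Rightarrow> (nat \<Rightarrow> 'm \<Rightarrow> 'm) \<Rightarrow> nat \<Rightarrow> ('m \<Rightarrow> 'k) \<Rightarrow> ('m \<Rightarrow> 'k) set" where
  "ext_class A \<epsilon> P d n f =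
     (\<lambda>b. \<lambda>u\<in>carrier (P n). f u + b u) ` coboundaries A \<epsilon> P d n"

text \<open>Operations on classes are given by the union over all representatives, which is again a single
  class since the operations are well-defined.\<close>

definition ext_group ::
    "('a, 'r) ring_scheme \<Rightarrow> ('a \<Rightarrow> 'k::field) \<Rightarrow> (nat \<Rightarrow> ('a, 'm) module)
      \<Rightarrow> (nat \<Rightarrow> 'm \<Rightarrow> 'm) \<Rightarrow> nat \<Rightarrow> ('k, ('m \<Rightarrow> 'k) set) module" where
  "ext_group A \<epsilon> P d n =
     \<lparr>carrier = ext_class A \<epsilon> P d n ` cocycles A \<epsilon> P d n,
      mult = undefined,
      one = undefined,
      zero = ext_class A \<epsilon> P d n (\<lambda>u\<in>carrier (P n). 0),
      add = (\<lambda>X Y. \<Union>f\<in>X. \<Union>h\<in>Y. ext_class A \<epsilon> P d n (\<lambda>u\<in>carrier (P n). f u + h u)),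
      smult = (\<lambda>c X. \<Union>f\<in>X. ext_class A \<epsilon> P d n (\<lambda>u\<in>carrier (P n). c * f u))\<rparr>"

text \<open>Chain maps \<open>F i : P (m + i) \<rightarrow> P i\<close> lifting a cocycle \<open>f : P m \<rightarrow> k\<close>.\<close>

definition chain_lifts ::
    "('a, 'r) ring_scheme \<Rightarrow> (nat \<Rightarrow> ('a, 'm) module) \<Rightarrow> (nat \<Rightarrow> 'm \<Rightarrow> 'm) \<Rightarrow> ('m \<Rightarrow> 'k)
      \<Rightarrow> nat \<Rightarrow> ('m \<Rightarrow> 'k) \<Rightarrow> (nat \<Rightarrow> 'm \<Rightarrow> 'm) set" where
  "chain_lifts A P d \<eta> m f =
     {F. (\<forall>i. F i \<in> module_hom A (P (m + i)) (P i)) \<and>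
         (\<forall>u\<in>carrier (P m). \<eta> (F 0 u) = f u) \<and>
         (\<forall>i. \<forall>u\<in>carrier (P (m + Suc i)). d i (F (Suc i) u) = F i (d (m + i) u))}"

text \<open>The Yoneda product \<open>Ext\<^sup>n(k,k) \<times> Ext\<^sup>m(k,k) \<rightarrow> Ext\<^sup>m\<^sup>+\<^sup>n(k,k)\<close>: the product of the classes
  of \<open>h\<close> and \<open>f\<close> is the class of \<open>h \<circ> F n\<close>, where \<open>F\<close> lifts \<open>f\<close>.\<close>

definition yoneda_product ::
    "('a, 'r) ring_scheme \<Rightarrow> ('a \<Rightarrow> 'k::field) \<Rightarrow> (nat \<Rightarrow> ('a, 'm) module)
      \<Rightarrow> (nat \<Rightarrow> 'm \<Rightarrow> 'm) \<Rightarrow> ('m \<Rightarrow> 'k) \<Rightarrow> nat \<Rightarrow> nat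
      \<Rightarrow> ('m \<Rightarrow> 'k) set \<Rightarrow> ('m \<Rightarrow> 'k) set \<Rightarrow> ('m \<Rightarrow> 'k) set" where
  "yoneda_product A \<epsilon> P d \<eta> n m X Y =
     (\<Union>h\<in>X. \<Union>f\<in>Y. \<Union>F\<in>chain_lifts A P d \<eta> m f.
        ext_class A \<epsilon> P d (m + n) (compose (carrier (P (m + n))) h (F n)))"

text \<open>The graded algebra \<open>H\<^sup>*(A,k) = \<Oplus>n. Ext\<^sup>n(k,k)\<close>.\<close>

definition cohomology_ring ::
    "('a, 'r) ring_scheme \<Rightarrow> ('a \<Rightarrow> 'k::field) \<Rightarrow> (nat \<Rightarrow> ('a, 'm) module)
      \<Rightarrow> (nat \<Rightarrow> 'm \<Rightarrow> 'm) \<Rightarrow> ('m \<Rightarrow> 'k) \<Rightarrow> ('k, nat \<Rightarrow> ('m \<Rightarrow> 'k) set) module" where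
  "cohomology_ring A \<epsilon> P d \<eta> =
     (let E = ext_group A \<epsilon> P d in
      \<lparr>carrier = {U. (\<forall>n. U n \<in> carrier (E n)) \<and> finite {n. U n \<noteq> \<zero>\<^bsub>E n\<^esub>}},
       mult = (\<lambda>U V n. \<Oplus>\<^bsub>E n\<^esub>i\<in>{..n}. yoneda_product A \<epsilon> P d \<eta> i (n - i) (U i) (V (n - i))),
       one = (\<lambda>n. if n = 0 then ext_class A \<epsilon> P d 0 \<eta> else \<zero>\<^bsub>E n\<^esub>),
       zero = (\<lambda>n. \<zero>\<^bsub>E n\<^esub>),
       add = (\<lambda>U V n. U n \<oplus>\<^bsub>E n\<^esub> V n),
       smult = (\<lambda>c U n. c \<odot>\<^bsub>E n\<^esub> U n)\<rparr>)"


section \<open>Finite generation\<close>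

inductive_set generated_subalgebra :: "('k, 'h) module \<Rightarrow> 'h set \<Rightarrow> 'h set"
  for A :: "('k, 'h) module" and S :: "'h set" where
  one: "\<one>\<^bsub>A\<^esub> \<in> generated_subalgebra A S"
| incl: "s \<in> S \<Longrightarrow> s \<in> generated_subalgebra A S"
| add: "\<lbrakk>a \<in> generated_subalgebra A S; b \<in> generated_subalgebra A S\<rbrakk> \<Longrightarrow>
    a \<oplus>\<^bsub>A\<^esub> b \<in> generated_subalgebra A S"
| mult: "\<lbrakk>a \<in> generated_subalgebra A S; b \<in> generated_subalgebra A S\<rbrakk> \<Longrightarrow>
    a \<otimes>\<^bsub>A\<^esub> b \<in> generated_subalgebra A S"
| smult: "a \<in> generated_subalgebra A S \<Longrightarrow> c \<odot>\<^bsub>A\<^esub> a \<in> generated_subalgebra A S"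

definition finitely_generated_algebra :: "('k, 'h) module \<Rightarrow> bool" where
  "finitely_generated_algebra A \<longleftrightarrow>
     (\<exists>S. finite S \<and> S \<subseteq> carrier A \<and> generated_subalgebra A S = carrier A)"

end

(* Let A be one of the algebras and k its trivial module.  Ordered monomials in h = g - 1, x, y (of
   weights 1, 2, 3) with bounded exponents form a basis of A, and modulo terms of lower weight A is a
   tensor product of three truncated polynomial rings.  Its trivial module therefore has a free
   resolution F, with one generator for every c : {h, x, y} -> nat, whose differential and whose
   comparison with the tensor product of three periodic complexes agree up to lower weight.  Chain maps
   F(n+2) -> F(n) that shift c by 2 in one slot, up to lower weight, exist as soon as the 2-cochains dual
   to the relations h^q, x^p, y^p are cocycles; this is seen by evaluating the second differential on
   suitable vectors of an explicit representation.  Through these chain maps, leading terms and Dickson's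
   lemma express every cocycle of large degree by cocycles of smaller degree, and the criterion on the
   Ext ring turns this into finite generation. *)
theory Submission
  imports Defs "HOL-Algebra.Multiplicative_Group"
begin

section \<open>Left modules\<close>

text \<open>The homology of F is k in degree 0 and zero elsewhere. So the recursive construction of
  a shifting chain map meets a single obstruction, the origin coordinate at its first step, which
  vanishes when the 2-cochain dual to the power relation is a cocycle; all later steps are lifts
  through an exact complex. Weights stay bounded because the contracting homotopy of the tensor
  product preserves weight. The cocycle condition is tested in a module M with a vector z ~= 0
  killed by h, x and y: pushed along k -> M, 1 |-> z, the 2-cochain becomes the coboundary of an
  explicit 1-cochain v, and that map is injective. The test needs the second differential in closed
  form, so the resolution is built upwards from a prescribed one. It is enough that pulling back
  along the shifting maps moves leading cells by 2 in one slot, so Dickson's lemma is applied to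
  exponents and not to a polynomial ring acting on cohomology. The weights 1, 2, 3 work because they
  increase along h, x, y, which makes every correction term of the three commutators lighter than
  the product that is swapped.\<close>

lemma (in left_module) smult_zero_left: "u : carrier M ==> \<zero> \<odot>\<^bsub>M\<^esub> u = \<zero>\<^bsub>M\<^esub>"
proof -
 assume u: "u : carrier M"
 have "\<zero> \<odot>\<^bsub>M\<^esub> u \<oplus>\<^bsub>M\<^esub> \<zero> \<odot>\<^bsub>M\<^esub> u = \<zero> \<odot>\<^bsub>M\<^esub> u"
  using smult_l_distr[of \<zero> \<zero> u] u by simp
 then show ?thesis using smult_closed[of \<zero> u] u by (simp add: M.add.l_cancel_one')
qed

lemma (in left_module) smult_zero_right: "a : carrier R ==> a \<odot>\<^bsub>M\<^esub> \<zero>\<^bsub>M\<^esub> = \<zero>\<^bsub>M\<^esub>"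
proof -
 assume a: "a : carrier R"
 have "a \<odot>\<^bsub>M\<^esub> \<zero>\<^bsub>M\<^esub> \<oplus>\<^bsub>M\<^esub> a \<odot>\<^bsub>M\<^esub> \<zero>\<^bsub>M\<^esub> = a \<odot>\<^bsub>M\<^esub> \<zero>\<^bsub>M\<^esub>"
  using smult_r_distr[of a "\<zero>\<^bsub>M\<^esub>" "\<zero>\<^bsub>M\<^esub>"] a by simp
 then show ?thesis using smult_closed[of a "\<zero>\<^bsub>M\<^esub>"] a by (simp add: M.add.l_cancel_one')
qed

lemma (in left_module) smult_minus_right:
 assumes a: "a : carrier R" and u: "u : carrier M"
 shows "a \<odot>\<^bsub>M\<^esub> (\<ominus>\<^bsub>M\<^esub> u) = \<ominus>\<^bsub>M\<^esub> (a \<odot>\<^bsub>M\<^esub> u)"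
proof (rule sym, rule M.minus_equality)
 show "a \<odot>\<^bsub>M\<^esub> (\<ominus>\<^bsub>M\<^esub> u) \<oplus>\<^bsub>M\<^esub> a \<odot>\<^bsub>M\<^esub> u = \<zero>\<^bsub>M\<^esub>"
  using smult_r_distr[of a "\<ominus>\<^bsub>M\<^esub> u" u] a u by (simp add: M.l_neg smult_zero_right)
qed (use a u smult_closed in auto)

lemma (in left_module) finsum_smult_right:
 assumes a: "a : carrier R" and f: "f : X \<rightarrow> carrier M" and X: "finite X"
 shows "a \<odot>\<^bsub>M\<^esub> (\<Oplus>\<^bsub>M\<^esub>x\<in>X. f x) = (\<Oplus>\<^bsub>M\<^esub>x\<in>X. a \<odot>\<^bsub>M\<^esub> f x)"
 using X f
proof (induction X)
 case empty
 then show ?case using a by (simp add: smult_zero_right)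
next
 case (insert x F)
 then show ?case using a smult_closed
  by (simp add: smult_r_distr Pi_def)
qed

lemma left_module_abelian_monoid: "left_module A M ==> abelian_monoid M"
 by (simp add: left_module_def abelian_group_def)

lemma module_hom_closed: "f : module_hom A M N ==> u : carrier M ==> f u : carrier N"
 unfolding module_hom_def by (blast dest: PiE_mem)

lemma module_hom_add:
 "f : module_hom A M N ==> u : carrier M ==> v : carrier M ==>
  f (u \<oplus>\<^bsub>M\<^esub> v) = f u \<oplus>\<^bsub>N\<^esub> f v"
 by (simp add: module_hom_def)

lemma module_hom_smult:
 "f : module_hom A M N ==> a : carrier A ==> u : carrier M ==>
  f (a \<odot>\<^bsub>M\<^esub> u) = a \<odot>\<^bsub>N\<^esub> f u"
 by (simp add: module_hom_def)

lemma module_hom_extensional: "f : module_hom A M N ==> f : extensional (carrier M)"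
 by (auto simp: module_hom_def PiE_def)

lemma module_hom_restrictI:
 assumes M: "left_module A M"
  and "!!u. u : carrier M ==> f u : carrier N"
  and "!!u v. u : carrier M ==> v : carrier M ==> f (u \<oplus>\<^bsub>M\<^esub> v) = f u \<oplus>\<^bsub>N\<^esub> f v"
  and "!!a u. a : carrier A ==> u : carrier M ==> f (a \<odot>\<^bsub>M\<^esub> u) = a \<odot>\<^bsub>N\<^esub> f u"
 shows "restrict f (carrier M) : module_hom A M N"
proof -
 interpret left_module A M by fact
 show ?thesis using assms smult_closed by (auto simp: module_hom_def)
qed

lemma module_hom_zero:
 assumes M: "left_module A M" and N: "left_module A N" and f: "f : module_hom A M N"
 shows "f \<zero>\<^bsub>M\<^esub> = \<zero>\<^bsub>N\<^esub>"
proof -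
 interpret M: left_module A M by fact
 interpret N: left_module A N by fact
 have "f \<zero>\<^bsub>M\<^esub> \<oplus>\<^bsub>N\<^esub> f \<zero>\<^bsub>M\<^esub> = f \<zero>\<^bsub>M\<^esub>"
  using module_hom_add[OF f, of "\<zero>\<^bsub>M\<^esub>" "\<zero>\<^bsub>M\<^esub>"] by simp
 then show ?thesis using module_hom_closed[OF f, of "\<zero>\<^bsub>M\<^esub>"] by (simp add: N.M.add.l_cancel_one')
qed

lemma module_hom_minus:
 assumes M: "left_module A M" and N: "left_module A N" and f: "f : module_hom A M N"
  and u: "u : carrier M"
 shows "f (\<ominus>\<^bsub>M\<^esub> u) = \<ominus>\<^bsub>N\<^esub> f u"
proof -
 interpret M: left_module A M by fact
 interpret N: left_module A N by fact
 have "f (\<ominus>\<^bsub>M\<^esub> u) \<oplus>\<^bsub>N\<^esub> f u = \<zero>\<^bsub>N\<^esub>"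
  using module_hom_add[OF f, of "\<ominus>\<^bsub>M\<^esub> u" u] u module_hom_zero[OF M N f]
  by (simp add: M.M.l_neg)
 then show ?thesis using module_hom_closed[OF f] u by (simp add: N.M.minus_equality)
qed

lemma module_hom_diff_apply:
 assumes M: "left_module A M" and N: "left_module A N" and f: "f : module_hom A M N"
  and u: "u : carrier M" "v : carrier M"
 shows "f (u \<ominus>\<^bsub>M\<^esub> v) = f u \<ominus>\<^bsub>N\<^esub> f v"
proof -
 interpret M: left_module A M by fact
 show ?thesis using u by (simp add: a_minus_def module_hom_add[OF f] module_hom_minus[OF M N f])
qed

lemma module_hom_finsum:
 assumes M: "left_module A M" and N: "left_module A N" and f: "f : module_hom A M N"
  and X: "finite X" and g: "g : X \<rightarrow> carrier M"
 shows "f (\<Oplus>\<^bsub>M\<^esub>x\<in>X. g x) = (\<Oplus>\<^bsub>N\<^esub>x\<in>X. f (g x))"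
proof -
 interpret M: left_module A M by fact
 interpret N: left_module A N by fact
 show ?thesis using X g
 proof (induction X)
  case empty
  then show ?case by (simp add: module_hom_zero[OF M N f])
 next
  case (insert x F)
  then show ?case by (simp add: Pi_def module_hom_add[OF f] module_hom_closed[OF f])
 qed
qed

lemma module_hom_compose:
 assumes "left_module A M" "f : module_hom A M N" "g : module_hom A N L"
 shows "compose (carrier M) g f : module_hom A M L"
 unfolding compose_def
 by (rule module_hom_restrictI)
  (use assms in \<open>auto simp: module_hom_add[OF assms(2)] module_hom_add[OF assms(3)]
    module_hom_smult[OF assms(2)] module_hom_smult[OF assms(3)]
    module_hom_closed[OF assms(2)] module_hom_closed[OF assms(3)]\<close>)

lemma module_hom_sum:
 assumes M: "left_module A M" and N: "left_module A N"
  and f: "f : module_hom A M N" and g: "g : module_hom A M N"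
 shows "(\<lambda>u\<in>carrier M. f u \<oplus>\<^bsub>N\<^esub> g u) : module_hom A M N"
proof -
 interpret N: left_module A N by fact
 show ?thesis
  by (rule module_hom_restrictI[OF M])
   (use module_hom_closed[OF f] module_hom_closed[OF g] in
    \<open>simp_all add: module_hom_add[OF f] module_hom_add[OF g] module_hom_smult[OF f]
     module_hom_smult[OF g] N.smult_r_distr N.M.a_ac\<close>)
qed

lemma module_hom_diff:
 assumes M: "left_module A M" and N: "left_module A N"
  and f: "f : module_hom A M N" and g: "g : module_hom A M N"
 shows "(\<lambda>u\<in>carrier M. f u \<ominus>\<^bsub>N\<^esub> g u) : module_hom A M N"
proof -
 interpret N: left_module A N by fact
 show ?thesis
  by (rule module_hom_restrictI[OF M])
   (use module_hom_closed[OF f] module_hom_closed[OF g] in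
    \<open>simp_all add: module_hom_add[OF f] module_hom_add[OF g] module_hom_smult[OF f] a_minus_def
     module_hom_smult[OF g] N.smult_r_distr N.smult_minus_right N.M.minus_add N.M.a_ac\<close>)
qed

section \<open>Projectivity as a lifting property against modules of any type\<close>

section \<open>Lifting along module homomorphisms\<close>

text \<open>Only the values of \<open>f\<close> have to lie in the image of \<open>\<pi>\<close>; in
  this form maps can be lifted into the kernels of a complex without forming submodules. The test
  modules \<open>Y\<close> and \<open>Z\<close> are arguments because a lifting property against
  modules of all types at once cannot be a single HOL predicate.\<close>

definition lifts_along ::
  "('a, 'r) ring_scheme => ('a, 'm) module => ('a, 'y) module => ('a, 'z) module => bool" where
 "lifts_along A M Y Z \<longleftrightarrow>
   (\<forall>\<pi> f. \<pi> : module_hom A Y Z & f : module_hom A M Z &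
    (ALL u:carrier M. f u : \<pi> ` carrier Y) -->
    (EX h:module_hom A M Y. ALL u:carrier M. \<pi> (h u) = f u))"

lemma lifts_alongE:
 assumes "lifts_along A M Y Z" "\<pi> : module_hom A Y Z" "f : module_hom A M Z"
  "!!u. u : carrier M ==> f u : \<pi> ` carrier Y"
 obtains h where "h : module_hom A M Y" "!!u. u : carrier M ==> \<pi> (h u) = f u"
 using assms unfolding lifts_along_def by metis

text \<open>Lift \<open>f\<close> composed with \<open>r\<close> from \<open>L\<close>, then
  precompose with the section \<open>s\<close>. It serves twice: a projective module is a retract of
  a free one, and the explicit free modules of the resolution are compared with
  \<open>free_module\<close> through their coordinates.\<close>

lemma lifts_along_retract:
 assumes M: "left_module A M" and L: "lifts_along A L Y Z"
  and r: "r : module_hom A L M" and s: "s : module_hom A M L"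
  and rs: "!!u. u : carrier M ==> r (s u) = u" and Lm: "left_module A L"
 shows "lifts_along A M Y Z"
 unfolding lifts_along_def
proof (intro allI impI, elim conjE)
 fix \<pi> f
 assume pi: "\<pi> : module_hom A Y Z" and f: "f : module_hom A M Z"
  and im: "ALL u:carrier M. f u : \<pi> ` carrier Y"
 have fr: "compose (carrier L) f r : module_hom A L Z"
  by (rule module_hom_compose[OF Lm r f])
 obtain h where h: "h : module_hom A L Y"
  and ph: "!!u. u : carrier L ==> \<pi> (h u) = compose (carrier L) f r u"
  by (rule lifts_alongE[OF L pi fr]) (use im module_hom_closed[OF r] in \<open>auto simp: compose_eq\<close>)
 have "compose (carrier M) h s : module_hom A M Y"
  by (rule module_hom_compose[OF M s h])
 moreover have "ALL u:carrier M. \<pi> (compose (carrier M) h s u) = f u"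
  using ph module_hom_closed[OF s] rs by (simp add: compose_eq)
 ultimately show "EX h:module_hom A M Y. ALL u:carrier M. \<pi> (h u) = f u" by blast
qed

text \<open>Coefficients are total functions on \<open>'x\<close> supported in \<open>X\<close>. For
  \<open>X = carrier M\<close> the elements then have type \<open>'m => 'a\<close>, the very type
  over which \<open>projective_module\<close> quantifies its test modules.\<close>

definition free_module :: "('a, 'r) ring_scheme => 'x set => ('a, 'x => 'a) module" where
 "free_module A X =
   \<lparr>carrier = {c. (ALL x. c x : carrier A) & finite {x. c x ~= \<zero>\<^bsub>A\<^esub>} & {x. c x ~= \<zero>\<^bsub>A\<^esub>} \<subseteq> X},
   mult = undefined, one = undefined, zero = (%x. \<zero>\<^bsub>A\<^esub>),
   add = (%c c' x. c x \<oplus>\<^bsub>A\<^esub> c' x), smult = (%a c x. a \<otimes>\<^bsub>A\<^esub> c x)\<rparr>"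

lemma free_module_left_module:
 fixes A :: "('a, 'r) ring_scheme" and X :: "'x set"
 assumes "ring A"
 shows "left_module A (free_module A X)"
proof -
 interpret A: ring A by fact
 have fin: "finite {x. c x \<oplus>\<^bsub>A\<^esub> c' x ~= \<zero>\<^bsub>A\<^esub>} & {x. c x \<oplus>\<^bsub>A\<^esub> c' x ~= \<zero>\<^bsub>A\<^esub>} \<subseteq> X"
  if "finite {x. c x ~= \<zero>\<^bsub>A\<^esub>}" "finite {x. c' x ~= \<zero>\<^bsub>A\<^esub>}" "{x. c x ~= \<zero>\<^bsub>A\<^esub>} \<subseteq> X" "{x. c' x ~= \<zero>\<^bsub>A\<^esub>} \<subseteq> X"
  for c c' :: "'x => 'a"
 proof -
  have *: "{x. c x \<oplus>\<^bsub>A\<^esub> c' x ~= \<zero>\<^bsub>A\<^esub>} \<subseteq> {x. c x ~= \<zero>\<^bsub>A\<^esub>} \<union> {x. c' x ~= \<zero>\<^bsub>A\<^esub>}" by auto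
  then show ?thesis using that finite_subset[OF *] by blast
 qed
 have fin2: "finite {x. a \<otimes>\<^bsub>A\<^esub> c x ~= \<zero>\<^bsub>A\<^esub>} & {x. a \<otimes>\<^bsub>A\<^esub> c x ~= \<zero>\<^bsub>A\<^esub>} \<subseteq> X"
  if "finite {x. c x ~= \<zero>\<^bsub>A\<^esub>}" "{x. c x ~= \<zero>\<^bsub>A\<^esub>} \<subseteq> X" "a : carrier A"
  for a and c :: "'x => 'a"
 proof -
  have *: "{x. a \<otimes>\<^bsub>A\<^esub> c x ~= \<zero>\<^bsub>A\<^esub>} \<subseteq> {x. c x ~= \<zero>\<^bsub>A\<^esub>}" using that by auto
  then show ?thesis using that finite_subset[OF *] by blast
 qed
 have neg: "EX y. ((ALL x. y x : carrier A) & finite {x. y x ~= \<zero>\<^bsub>A\<^esub>} & {x. y x ~= \<zero>\<^bsub>A\<^esub>} \<subseteq> X) &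
     (%xa. y xa \<oplus>\<^bsub>A\<^esub> x xa) = (%x. \<zero>\<^bsub>A\<^esub>)"
  if "ALL xa. x xa : carrier A" "finite {xa. x xa ~= \<zero>\<^bsub>A\<^esub>}" "{xa. x xa ~= \<zero>\<^bsub>A\<^esub>} \<subseteq> X"
  for x :: "'x => 'a"
 proof (intro exI conjI)
  have *: "{y. \<ominus>\<^bsub>A\<^esub> x y ~= \<zero>\<^bsub>A\<^esub>} \<subseteq> {y. x y ~= \<zero>\<^bsub>A\<^esub>}" by auto
  show "finite {y. \<ominus>\<^bsub>A\<^esub> x y ~= \<zero>\<^bsub>A\<^esub>}" "{y. \<ominus>\<^bsub>A\<^esub> x y ~= \<zero>\<^bsub>A\<^esub>} \<subseteq> X"
   using that finite_subset[OF *] * by blast+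
 qed (use that in \<open>auto simp: A.l_neg\<close>)
 let ?C = "{c. (ALL x. c x : carrier A) & finite {x. c x ~= \<zero>\<^bsub>A\<^esub>} & {x. c x ~= \<zero>\<^bsub>A\<^esub>} \<subseteq> X}"
 have cl: "(%x. c x \<oplus>\<^bsub>A\<^esub> c' x) : ?C" if "c : ?C" "c' : ?C" for c c'
  using that fin[of c c'] by blast
 have cl2: "(%x. a \<otimes>\<^bsub>A\<^esub> c x) : ?C" if "c : ?C" "a : carrier A" for a c
  using that fin2[of c a] by blast
 have neg': "EX y:?C. (%xa. y xa \<oplus>\<^bsub>A\<^esub> c xa) = (%x. \<zero>\<^bsub>A\<^esub>)" if "c : ?C" for c
  using that neg[of c] by blast
 have mem: "c x : carrier A" if "c : ?C" for c x using that by blast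
 have fm: "carrier (free_module A X) = ?C" "add (free_module A X) = (%c c' x. c x \<oplus>\<^bsub>A\<^esub> c' x)"
  "zero (free_module A X) = (%x. \<zero>\<^bsub>A\<^esub>)" "smult (free_module A X) = (%a c x. a \<otimes>\<^bsub>A\<^esub> c x)"
  by (simp_all add: free_module_def)
 show ?thesis
 proof (intro left_module.intro left_module_axioms.intro abelian_groupI, unfold fm)
  show "ring A" by fact
  show "(%x. \<zero>\<^bsub>A\<^esub>) : ?C" by simp
 qed ((rule cl cl2 neg'; assumption) | (rule ext, simp only: mem A.a_assoc A.l_distr A.r_distr A.m_assoc A.l_one A.l_zero)
   | (rule ext, rule A.a_comm; rule mem; assumption))+
qed

definition free_ev :: "('a, 'r) ring_scheme => ('a, 'y) module => ('x => 'y) => ('x => 'a) => 'y" where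
 "free_ev A Y y c = (\<Oplus>\<^bsub>Y\<^esub>x\<in>{x. c x ~= \<zero>\<^bsub>A\<^esub>}. c x \<odot>\<^bsub>Y\<^esub> y x)"

lemma free_ev_superset:
 assumes Y: "left_module A Y" and y: "!!x. x : X ==> y x : carrier Y"
  and c: "c : carrier (free_module A X)" and S: "finite S" "{x. c x ~= \<zero>\<^bsub>A\<^esub>} \<subseteq> S" "S \<subseteq> X"
 shows "free_ev A Y y c = (\<Oplus>\<^bsub>Y\<^esub>x\<in>S. c x \<odot>\<^bsub>Y\<^esub> y x)"
proof -
 interpret Y: left_module A Y by fact
 show ?thesis unfolding free_ev_def
  by (rule Y.M.add.finprod_mono_neutral_cong_left)
   (use assms in \<open>auto simp: free_module_def Y.smult_zero_left intro!: Y.smult_closed\<close>)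
qed

lemma free_ev_hom:
 assumes A: "ring A" and Y: "left_module A Y" and y: "!!x. x : X ==> y x : carrier Y"
 shows "restrict (free_ev A Y y) (carrier (free_module A X)) : module_hom A (free_module A X) Y"
proof (rule module_hom_restrictI[OF free_module_left_module[OF A]])
 interpret A: ring A by fact
 interpret Y: left_module A Y by fact
 fix u assume u: "u : carrier (free_module A X)"
 have uc: "!!x. u x : carrier A" and uf: "finite {x. u x ~= \<zero>\<^bsub>A\<^esub>}" and us: "{x. u x ~= \<zero>\<^bsub>A\<^esub>} \<subseteq> X"
  using u by (auto simp: free_module_def)
 show "free_ev A Y y u : carrier Y" unfolding free_ev_def
  by (rule Y.M.finsum_closed) (use us uc y in \<open>auto intro!: Y.smult_closed\<close>)
 {
  fix v assume v: "v : carrier (free_module A X)"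
  have vc: "!!x. v x : carrier A" and vf: "finite {x. v x ~= \<zero>\<^bsub>A\<^esub>}" and vs: "{x. v x ~= \<zero>\<^bsub>A\<^esub>} \<subseteq> X"
   using v by (auto simp: free_module_def)
  let ?S = "{x. u x ~= \<zero>\<^bsub>A\<^esub>} \<union> {x. v x ~= \<zero>\<^bsub>A\<^esub>}"
  have uv: "u \<oplus>\<^bsub>free_module A X\<^esub> v : carrier (free_module A X)"
   using left_module_abelian_monoid[OF free_module_left_module[OF A]] u v
   by (rule abelian_monoid.a_closed)
  have uv': "(u \<oplus>\<^bsub>free_module A X\<^esub> v) = (%x. u x \<oplus>\<^bsub>A\<^esub> v x)" by (simp add: free_module_def)
  have "free_ev A Y y (u \<oplus>\<^bsub>free_module A X\<^esub> v) = (\<Oplus>\<^bsub>Y\<^esub>x\<in>?S. (u x \<oplus>\<^bsub>A\<^esub> v x) \<odot>\<^bsub>Y\<^esub> y x)"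
   by (subst free_ev_superset[OF Y y uv, where S = ?S]) (use uf vf us vs in \<open>auto simp: uv'\<close>)
  also have "\<dots> = (\<Oplus>\<^bsub>Y\<^esub>x\<in>?S. u x \<odot>\<^bsub>Y\<^esub> y x \<oplus>\<^bsub>Y\<^esub> v x \<odot>\<^bsub>Y\<^esub> y x)"
   by (rule Y.M.finsum_cong') (use us vs uc vc y in \<open>auto intro!: Y.smult_closed Y.smult_l_distr Y.M.a_closed\<close>)
  also have "\<dots> = (\<Oplus>\<^bsub>Y\<^esub>x\<in>?S. u x \<odot>\<^bsub>Y\<^esub> y x) \<oplus>\<^bsub>Y\<^esub> (\<Oplus>\<^bsub>Y\<^esub>x\<in>?S. v x \<odot>\<^bsub>Y\<^esub> y x)"
   by (rule Y.M.finsum_addf) (use us vs uc vc y in \<open>auto intro!: Y.smult_closed\<close>)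
  also have "\<dots> = free_ev A Y y u \<oplus>\<^bsub>Y\<^esub> free_ev A Y y v"
   using free_ev_superset[OF Y y u, where S = ?S] free_ev_superset[OF Y y v, where S = ?S] uf vf us vs by auto
  finally show "free_ev A Y y (u \<oplus>\<^bsub>free_module A X\<^esub> v) = free_ev A Y y u \<oplus>\<^bsub>Y\<^esub> free_ev A Y y v" .
 }
 {
  fix a assume a: "a : carrier A"
  have au: "a \<odot>\<^bsub>free_module A X\<^esub> u : carrier (free_module A X)"
   by (rule left_module.smult_closed[OF free_module_left_module[OF A] a u])
  have au': "(a \<odot>\<^bsub>free_module A X\<^esub> u) = (%x. a \<otimes>\<^bsub>A\<^esub> u x)" by (simp add: free_module_def)
  have "free_ev A Y y (a \<odot>\<^bsub>free_module A X\<^esub> u)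
    = (\<Oplus>\<^bsub>Y\<^esub>x\<in>{x. u x ~= \<zero>\<^bsub>A\<^esub>}. (a \<otimes>\<^bsub>A\<^esub> u x) \<odot>\<^bsub>Y\<^esub> y x)"
   by (subst free_ev_superset[OF Y y au, where S = "{x. u x ~= \<zero>\<^bsub>A\<^esub>}"]) (use uf us a in \<open>auto simp: au'\<close>)
  also have "\<dots> = (\<Oplus>\<^bsub>Y\<^esub>x\<in>{x. u x ~= \<zero>\<^bsub>A\<^esub>}. a \<odot>\<^bsub>Y\<^esub> (u x \<odot>\<^bsub>Y\<^esub> y x))"
   by (rule Y.M.finsum_cong') (use us uc y a in \<open>auto intro!: Y.smult_closed Y.smult_assoc\<close>)
  also have "\<dots> = a \<odot>\<^bsub>Y\<^esub> free_ev A Y y u" unfolding free_ev_def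
   by (rule Y.finsum_smult_right[symmetric]) (use us uc y a uf in \<open>auto intro!: Y.smult_closed\<close>)
  finally show "free_ev A Y y (a \<odot>\<^bsub>free_module A X\<^esub> u) = a \<odot>\<^bsub>Y\<^esub> free_ev A Y y u" .
 }
qed

lemma free_ev_natural:
 assumes Y: "left_module A Y" and Z: "left_module A Z" and y: "!!x. x : X ==> y x : carrier Y"
  and k: "k : module_hom A Y Z" and z: "!!x. x : X ==> k (y x) = z x"
  and c: "c : carrier (free_module A X)"
 shows "k (free_ev A Y y c) = free_ev A Z z c"
proof -
 interpret Y: left_module A Y by fact
 interpret Z: left_module A Z by fact
 have uc: "!!x. c x : carrier A" and uf: "finite {x. c x ~= \<zero>\<^bsub>A\<^esub>}" and us: "{x. c x ~= \<zero>\<^bsub>A\<^esub>} \<subseteq> X"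
  using c by (auto simp: free_module_def)
 have "k (free_ev A Y y c) = (\<Oplus>\<^bsub>Z\<^esub>x\<in>{x. c x ~= \<zero>\<^bsub>A\<^esub>}. k (c x \<odot>\<^bsub>Y\<^esub> y x))"
  unfolding free_ev_def
  by (rule module_hom_finsum[OF Y Z k uf]) (use us uc y in \<open>auto intro!: Y.smult_closed\<close>)
 also have "\<dots> = free_ev A Z z c" unfolding free_ev_def
 proof (rule Z.M.finsum_cong'[OF refl])
  have zc: "z x : carrier Z" if "x : X" for x
   using module_hom_closed[OF k y[OF that]] z[OF that] by simp
  then show "(%x. c x \<odot>\<^bsub>Z\<^esub> z x) : {x. c x ~= \<zero>\<^bsub>A\<^esub>} \<rightarrow> carrier Z"
   using us uc by (auto intro: Z.smult_closed)
  fix x assume "x : {x. c x ~= \<zero>\<^bsub>A\<^esub>}"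
  then have "x : X" using us by blast
  then show "k (c x \<odot>\<^bsub>Y\<^esub> y x) = c x \<odot>\<^bsub>Z\<^esub> z x"
   using module_hom_smult[OF k uc y] z by simp
 qed
 finally show ?thesis .
qed

definition free_unit :: "('a, 'r) ring_scheme => 'x => 'x => 'a" where
 "free_unit A x = (%x'. if x' = x then \<one>\<^bsub>A\<^esub> else \<zero>\<^bsub>A\<^esub>)"

lemma free_unit_closed: "ring A ==> x : X ==> free_unit A x : carrier (free_module A X)"
 by (auto simp: free_unit_def free_module_def ring.ring_simprules intro: finite_subset[of _ "{x}"])

lemma free_ev_unit:
 assumes A: "ring A" and Y: "left_module A Y" and y: "!!x. x : X ==> y x : carrier Y" and x: "x : X"
 shows "free_ev A Y y (free_unit A x) = y x"
proof -
 interpret Y: left_module A Y by fact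
 have "free_ev A Y y (free_unit A x) = (\<Oplus>\<^bsub>Y\<^esub>x'\<in>{x}. free_unit A x x' \<odot>\<^bsub>Y\<^esub> y x')"
  by (rule free_ev_superset[OF Y y free_unit_closed[OF A x]]) (auto simp: x free_unit_def)
 then show ?thesis using y[OF x] by (simp add: Y.smult_one free_unit_def)
qed

lemma free_decomp:
 assumes A: "ring A" and c: "c : carrier (free_module A X)"
 shows "free_ev A (free_module A X) (free_unit A) c = c"
proof
 fix x0
 interpret A: ring A by fact
 let ?F = "free_module A X"
 interpret F: left_module A ?F by (rule free_module_left_module[OF A])
 have uc: "!!x. c x : carrier A" and uf: "finite {x. c x ~= \<zero>\<^bsub>A\<^esub>}" and us: "{x. c x ~= \<zero>\<^bsub>A\<^esub>} \<subseteq> X"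
  using c by (auto simp: free_module_def)
 have "(\<Oplus>\<^bsub>?F\<^esub>x\<in>S. c x \<odot>\<^bsub>?F\<^esub> free_unit A x) x0 = (if x0 : S then c x0 else \<zero>\<^bsub>A\<^esub>)"
  if "finite S" "S \<subseteq> X" for S
  using that
 proof (induction S)
  case empty
  have "\<zero>\<^bsub>?F\<^esub> x0 = \<zero>\<^bsub>A\<^esub>" by (simp add: free_module_def)
  then show ?case by simp
 next
  case (insert x S)
  have cl: "c x \<odot>\<^bsub>?F\<^esub> free_unit A x : carrier ?F" if "x : X" for x
   using that by (intro F.smult_closed uc free_unit_closed A)
  have "(\<Oplus>\<^bsub>?F\<^esub>x\<in>insert x S. c x \<odot>\<^bsub>?F\<^esub> free_unit A x) =
    c x \<odot>\<^bsub>?F\<^esub> free_unit A x \<oplus>\<^bsub>?F\<^esub> (\<Oplus>\<^bsub>?F\<^esub>x\<in>S. c x \<odot>\<^bsub>?F\<^esub> free_unit A x)"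
   by (rule F.M.finsum_insert) (use insert cl in auto)
  moreover have "!!a b. (a \<oplus>\<^bsub>?F\<^esub> b) x0 = a x0 \<oplus>\<^bsub>A\<^esub> b x0" by (simp add: free_module_def)
  moreover have "(c x \<odot>\<^bsub>?F\<^esub> free_unit A x) x0 = (if x0 = x then c x else \<zero>\<^bsub>A\<^esub>)"
   using uc by (simp add: free_module_def free_unit_def)
  ultimately show ?case using insert uc by auto
 qed
 from this[OF uf us] show "free_ev A ?F (free_unit A) c x0 = c x0"
  unfolding free_ev_def by auto
qed

text \<open>Choose preimages \<open>y x\<close> of the images of the unit vectors and extend
  linearly. The result lifts \<open>f\<close> since every element is the combination of unit vectors
  in \<open>free_decomp\<close>, and evaluation is natural in homomorphisms.\<close>

lemma lifts_along_free:
 assumes A: "ring A" and Y: "left_module A Y" and Z: "left_module A Z"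
 shows "lifts_along A (free_module A X) Y Z"
 unfolding lifts_along_def
proof (intro allI impI, elim conjE)
 let ?F = "free_module A X"
 fix \<pi> f
 assume pi: "\<pi> : module_hom A Y Z" and f: "f : module_hom A ?F Z"
  and im: "ALL u:carrier ?F. f u : \<pi> ` carrier Y"
 have "ALL x:X. EX y:carrier Y. \<pi> y = f (free_unit A x)"
  using im free_unit_closed[OF A] by (metis imageE)
 then obtain y where y: "!!x. x : X ==> y x : carrier Y" "!!x. x : X ==> \<pi> (y x) = f (free_unit A x)"
  by metis
 have "\<pi> (free_ev A Y y c) = f c" if c: "c : carrier ?F" for c
 proof -
  have "\<pi> (free_ev A Y y c) = free_ev A Z (%x. f (free_unit A x)) c"
   by (rule free_ev_natural[OF Y Z y(1) pi y(2) c])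
  moreover have "f (free_ev A ?F (free_unit A) c) = free_ev A Z (%x. f (free_unit A x)) c"
   by (rule free_ev_natural[OF free_module_left_module[OF A] Z free_unit_closed[OF A] f refl c])
  ultimately show ?thesis using free_decomp[OF A c] by simp
 qed
 then show "EX h:module_hom A ?F Y. ALL u:carrier ?F. \<pi> (h u) = f u"
  using free_ev_hom[OF A Y y(1)] by (intro bexI[where x = "restrict (free_ev A Y y) (carrier ?F)"]) auto
qed

text \<open>The definition of projectivity is used once, for the canonical surjection from the free
  module on \<open>carrier M\<close> and the identity of \<open>M\<close>. The resulting section
  makes \<open>M\<close> a retract of a free module, and free modules lift against modules of every
  type.\<close>

lemma lifts_along_projective:
 fixes A :: "('a, 'r) ring_scheme" and M :: "('a, 'm) module"
 assumes M: "projective_module A M" and Y: "left_module A Y" and Z: "left_module A Z"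
 shows "lifts_along A M Y Z"
proof -
 have Ml: "left_module A M" using M by (simp add: projective_module_def)
 then have A: "ring A" by (simp add: left_module_def)
 interpret M: left_module A M by fact
 let ?L = "free_module A (carrier M)"
 have L: "left_module A ?L" by (rule free_module_left_module[OF A])
 let ?r = "restrict (free_ev A M (%u. u)) (carrier ?L)"
 have r: "?r : module_hom A ?L M" by (rule free_ev_hom[OF A Ml]) simp
 have surj: "?r ` carrier ?L = carrier M"
 proof
  show "?r ` carrier ?L \<subseteq> carrier M" using module_hom_closed[OF r] by blast
  show "carrier M \<subseteq> ?r ` carrier ?L"
  proof
   fix u assume u: "u : carrier M"
   then have "u = ?r (free_unit A u)" using free_ev_unit[OF A Ml _ u, of "%u. u"] free_unit_closed[OF A u] by simp
   then show "u : ?r ` carrier ?L" using free_unit_closed[OF A u] by blast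
  qed
 qed
 have id: "(\<lambda>u\<in>carrier M. u) : module_hom A M M"
  by (rule module_hom_restrictI[OF Ml]) auto
 have "EX h:module_hom A M ?L. ALL u:carrier M. ?r (h u) = (\<lambda>u\<in>carrier M. u) u"
  using M L Ml r surj id unfolding projective_module_def by blast
 then obtain s where s: "s : module_hom A M ?L" and rs: "!!u. u : carrier M ==> ?r (s u) = u"
  by (metis restrict_apply')
 show ?thesis by (rule lifts_along_retract[OF Ml lifts_along_free[OF A Y Z] r s rs L])
qed

section \<open>Comparison theorem and null homotopies\<close>

section \<open>Comparison of resolutions\<close>

text \<open>Projectivity is separated off, as its definition is tied to the type of the modules;
  where it matters it enters through \<open>lifts_along\<close>. Thus the explicit resolution and
  the given one are treated alike.\<close>

definition exact_resolution ::
  "('a, 'r) ring_scheme => ('a, 'n) module => (nat => ('a, 'm) module)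
   => (nat => 'm => 'm) => ('m => 'n) => bool" where
 "exact_resolution A N P d \<eta> \<longleftrightarrow>
   (ALL n. left_module A (P n)) &
   (ALL n. d n : module_hom A (P (Suc n)) (P n)) &
   \<eta> : module_hom A (P 0) N &
   \<eta> ` carrier (P 0) = carrier N &
   d 0 ` carrier (P 1) = {u : carrier (P 0). \<eta> u = \<zero>\<^bsub>N\<^esub>} &
   (ALL n. d (Suc n) ` carrier (P (Suc (Suc n))) =
      {u : carrier (P (Suc n)). d n u = \<zero>\<^bsub>P n\<^esub>})"

lemma projective_resolution_exact:
 "projective_resolution A N P d \<eta> ==> exact_resolution A N P d \<eta>"
 by (simp add: projective_resolution_def exact_resolution_def projective_module_def)

locale resolution =
 fixes A :: "('a, 'r) ring_scheme" and N :: "('a, 'n) module" and P :: "nat => ('a, 'm) module"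
  and d :: "nat => 'm => 'm" and \<eta> :: "'m => 'n"
 assumes exact: "exact_resolution A N P d \<eta>" and N: "left_module A N"
begin

lemma P: "left_module A (P n)"
 and d: "d n : module_hom A (P (Suc n)) (P n)"
 and \<eta>: "\<eta> : module_hom A (P 0) N"
 and \<eta>_surj: "\<eta> ` carrier (P 0) = carrier N"
 and exact0: "d 0 ` carrier (P (Suc 0)) = {u : carrier (P 0). \<eta> u = \<zero>\<^bsub>N\<^esub>}"
 and exactS: "d (Suc n) ` carrier (P (Suc (Suc n))) = {u : carrier (P (Suc n)). d n u = \<zero>\<^bsub>P n\<^esub>}"
 using exact by (simp_all add: exact_resolution_def)

lemma \<eta>d: "u : carrier (P (Suc 0)) ==> \<eta> (d 0 u) = \<zero>\<^bsub>N\<^esub>"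
 using exact0 by blast

lemma dd: "u : carrier (P (Suc (Suc n))) ==> d n (d (Suc n) u) = \<zero>\<^bsub>P n\<^esub>"
 using exactS[of n] by blast

lemma d_closed: "u : carrier (P (Suc n)) ==> d n u : carrier (P n)"
 by (rule module_hom_closed[OF d])

text \<open>The source is a complex with the lifting property, so that besides a resolution also a
  shifted one such as \<open>%i. P (m + i)\<close> can stand there; this is how lifts of cocycles
  arise.\<close>

lemma chain_lift_exists:
 fixes S :: "nat => ('a, 's) module"
 assumes S: "!!i. left_module A (S i)" and s: "!!i. s i : module_hom A (S (Suc i)) (S i)"
  and ss: "!!i u. u : carrier (S (Suc (Suc i))) ==> s i (s (Suc i) u) = \<zero>\<^bsub>S i\<^esub>"
  and l0: "lifts_along A (S 0) (P 0) N" and l: "!!i. lifts_along A (S (Suc i)) (P (Suc i)) (P i)"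
  and f: "f : module_hom A (S 0) N" and fs: "!!u. u : carrier (S (Suc 0)) ==> f (s 0 u) = \<zero>\<^bsub>N\<^esub>"
 obtains F where "!!i. F i : module_hom A (S i) (P i)" "!!u. u : carrier (S 0) ==> \<eta> (F 0 u) = f u"
  "!!i u. u : carrier (S (Suc i)) ==> d i (F (Suc i) u) = F i (s i u)"
proof -
 have sc: "s i u : carrier (S i)" if "u : carrier (S (Suc i))" for i u
  using that by (rule module_hom_closed[OF s])
 \<comment> \<open>The last clause is what the next lift needs: the composite with \<open>s\<close>
   already takes values in the image of \<open>d i\<close>.\<close>
 define Q where "Q i F \<longleftrightarrow> F : module_hom A (S i) (P i) & (i = 0 --> (ALL u:carrier (S 0). \<eta> (F u) = f u)) &
   (ALL u:carrier (S (Suc i)). F (s i u) : d i ` carrier (P (Suc i)))" for i F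
 have "EX F. ALL i. Q i (F i) & (ALL u:carrier (S (Suc i)). d i (F (Suc i) u) = F i (s i u))"
 proof (rule dependent_nat_choice)
  obtain F where F: "F : module_hom A (S 0) (P 0)" "!!u. u : carrier (S 0) ==> \<eta> (F u) = f u"
   by (rule lifts_alongE[OF l0 \<eta> f]) (use module_hom_closed[OF f] \<eta>_surj in auto)
  have "F (s 0 u) : d 0 ` carrier (P (Suc 0))" if "u : carrier (S (Suc 0))" for u
   using F(2)[OF sc[OF that]] fs[OF that] module_hom_closed[OF F(1) sc[OF that]] by (simp add: exact0)
  then show "EX F. Q 0 F" using F by (auto simp: Q_def)
 next
  fix F i
  assume Q: "Q i F"
  then have F: "F : module_hom A (S i) (P i)"
   and Fs: "!!u. u : carrier (S (Suc i)) ==> F (s i u) : d i ` carrier (P (Suc i))"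
   by (auto simp: Q_def)
  have Fs': "compose (carrier (S (Suc i))) F (s i) : module_hom A (S (Suc i)) (P i)"
   by (rule module_hom_compose[OF S s F])
  obtain F' where F': "F' : module_hom A (S (Suc i)) (P (Suc i))"
   and dF: "!!u. u : carrier (S (Suc i)) ==> d i (F' u) = compose (carrier (S (Suc i))) F (s i) u"
   by (rule lifts_alongE[OF l d Fs']) (use Fs in \<open>auto simp: compose_eq\<close>)
  have "F' (s (Suc i) u) : d (Suc i) ` carrier (P (Suc (Suc i)))" if u: "u : carrier (S (Suc (Suc i)))" for u
  proof -
   have "d i (F' (s (Suc i) u)) = \<zero>\<^bsub>P i\<^esub>"
    using dF[OF sc[OF u]] ss[OF u] module_hom_zero[OF S P F] sc[OF u] by (simp add: compose_eq)
   then show ?thesis using module_hom_closed[OF F' sc[OF u]] by (simp add: exactS)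
  qed
  then show "EX F'. Q (Suc i) F' & (ALL u:carrier (S (Suc i)). d i (F' u) = F (s i u))"
   using F' dF by (intro exI[of _ F']) (auto simp: Q_def compose_eq)
 qed
 then obtain F where "!!i. Q i (F i)" "!!i u. u : carrier (S (Suc i)) ==> d i (F (Suc i) u) = F i (s i u)"
  by blast
 then show ?thesis using that[of F] by (auto simp: Q_def)
qed

text \<open>A full homotopy is not recorded. Degree by degree it is enough that
  \<open>G - H s\<close> takes values in boundaries, since it will only be fed to cocycles, which
  kill boundaries.\<close>

lemma null_homotopy:
 fixes S :: "nat => ('a, 's) module"
 assumes S: "!!i. left_module A (S i)" and s: "!!i. s i : module_hom A (S (Suc i)) (S i)"
  and ss: "!!i u. u : carrier (S (Suc (Suc i))) ==> s i (s (Suc i) u) = \<zero>\<^bsub>S i\<^esub>"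
  and l: "!!i. lifts_along A (S i) (P (Suc i)) (P i)"
  and G: "!!i. G i : module_hom A (S i) (P i)" and G0: "!!u. u : carrier (S 0) ==> \<eta> (G 0 u) = \<zero>\<^bsub>N\<^esub>"
  and dG: "!!i u. u : carrier (S (Suc i)) ==> d i (G (Suc i) u) = G i (s i u)"
 shows "EX H:module_hom A (S j) (P (Suc j)). ALL u:carrier (S (Suc j)).
   G (Suc j) u \<ominus>\<^bsub>P (Suc j)\<^esub> H (s j u) : d (Suc j) ` carrier (P (Suc (Suc j)))"
proof -
 have sc: "s i u : carrier (S i)" if "u : carrier (S (Suc i))" for i u
  using that by (rule module_hom_closed[OF s])
 have step: "EX H:module_hom A (S j) (P (Suc j)). ALL u:carrier (S (Suc j)).
   G (Suc j) u \<ominus>\<^bsub>P (Suc j)\<^esub> H (s j u) : d (Suc j) ` carrier (P (Suc (Suc j)))"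
  if K: "K : module_hom A (S j) (P j)" and Kim: "!!u. u : carrier (S j) ==> K u : d j ` carrier (P (Suc j))"
   and Ks: "!!u. u : carrier (S (Suc j)) ==> K (s j u) = G j (s j u)" for K j
 proof -
  obtain H where H: "H : module_hom A (S j) (P (Suc j))" and dH: "!!u. u : carrier (S j) ==> d j (H u) = K u"
   by (rule lifts_alongE[OF l d K]) (use Kim in auto)
  interpret Pj: left_module A "P j" by (rule P)
  interpret Pj1: left_module A "P (Suc j)" by (rule P)
  have "G (Suc j) u \<ominus>\<^bsub>P (Suc j)\<^esub> H (s j u) : d (Suc j) ` carrier (P (Suc (Suc j)))"
   if u: "u : carrier (S (Suc j))" for u
  proof -
   have c: "G (Suc j) u : carrier (P (Suc j))" "H (s j u) : carrier (P (Suc j))" "G j (s j u) : carrier (P j)"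
    using module_hom_closed[OF G u] module_hom_closed[OF H sc[OF u]] module_hom_closed[OF G sc[OF u]] by auto
   have "d j (G (Suc j) u \<ominus>\<^bsub>P (Suc j)\<^esub> H (s j u)) = \<zero>\<^bsub>P j\<^esub>"
    using c by (simp add: module_hom_diff_apply[OF P P d] dG[OF u] dH[OF sc[OF u]] Ks[OF u]) (simp add: a_minus_def Pj.M.r_neg)
   then show ?thesis using c by (simp add: exactS)
  qed
  then show ?thesis using H by blast
 qed
 show ?thesis
 proof (induction j)
  case 0
  show ?case
   by (rule step[OF G]) (use G0 module_hom_closed[OF G] in \<open>auto simp: exact0\<close>)
 next
  case (Suc j)
  then obtain H where H: "H : module_hom A (S j) (P (Suc j))"
   and Him: "!!u. u : carrier (S (Suc j)) ==> G (Suc j) u \<ominus>\<^bsub>P (Suc j)\<^esub> H (s j u) : d (Suc j) ` carrier (P (Suc (Suc j)))"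
   by blast
  interpret Pj1: left_module A "P (Suc j)" by (rule P)
  have Hs: "compose (carrier (S (Suc j))) H (s j) : module_hom A (S (Suc j)) (P (Suc j))"
   by (rule module_hom_compose[OF S s H])
  \<comment> \<open>The part of \<open>G\<close> left over by the previous homotopy. On values of
    \<open>s\<close> it agrees with \<open>G\<close>, because \<open>s s = 0\<close>, so the
    one-step construction applies to it.\<close>
  let ?K = "\<lambda>u\<in>carrier (S (Suc j)). G (Suc j) u \<ominus>\<^bsub>P (Suc j)\<^esub> compose (carrier (S (Suc j))) H (s j) u"
  show ?case
  proof (rule step[of ?K])
   show "?K : module_hom A (S (Suc j)) (P (Suc j))" by (rule module_hom_diff[OF S P G Hs])
   show "?K u : d (Suc j) ` carrier (P (Suc (Suc j)))" if "u : carrier (S (Suc j))" for u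
    using Him[OF that] that by (simp add: compose_eq)
   show "?K (s (Suc j) u) = G (Suc j) (s (Suc j) u)" if u: "u : carrier (S (Suc (Suc j)))" for u
    using sc[OF u] ss[OF u] module_hom_zero[OF S P H] module_hom_closed[OF G sc[OF u]]
    by (simp add: compose_eq a_minus_def)
  qed
 qed
qed

text \<open>A chain map over the zero map is killed in cohomology.\<close>

lemma null_homotopic_cocycle:
 fixes S :: "nat => ('a, 's) module"
 assumes S: "!!i. left_module A (S i)" and s: "!!i. s i : module_hom A (S (Suc i)) (S i)"
  and ss: "!!i u. u : carrier (S (Suc (Suc i))) ==> s i (s (Suc i) u) = \<zero>\<^bsub>S i\<^esub>"
  and l: "!!i. lifts_along A (S i) (P (Suc i)) (P i)"
  and G: "!!i. G i : module_hom A (S i) (P i)" and G0: "!!u. u : carrier (S 0) ==> \<eta> (G 0 u) = \<zero>\<^bsub>N\<^esub>"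
  and dG: "!!i u. u : carrier (S (Suc i)) ==> d i (G (Suc i) u) = G i (s i u)"
  and K: "left_module A K" and h: "h : module_hom A (P n) K"
  and hd: "!!u. u : carrier (P (Suc n)) ==> h (d n u) = \<zero>\<^bsub>K\<^esub>"
 shows "(n = 0 --> (ALL u:carrier (S 0). h (G 0 u) = \<zero>\<^bsub>K\<^esub>)) &
  (ALL j. n = Suc j --> (EX b:module_hom A (S j) K. ALL u:carrier (S n). h (G n u) = b (s j u)))"
proof (intro conjI impI allI)
 assume n: "n = 0"
 have "G 0 u : d 0 ` carrier (P (Suc 0))" if "u : carrier (S 0)" for u
  using that G0 module_hom_closed[OF G] by (auto simp: exact0)
 then show "ALL u:carrier (S 0). h (G 0 u) = \<zero>\<^bsub>K\<^esub>" using hd n by (metis imageE)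
next
 fix j assume n: "n = Suc j"
 obtain H where H: "H : module_hom A (S j) (P (Suc j))"
  and im: "!!u. u : carrier (S (Suc j)) ==> G (Suc j) u \<ominus>\<^bsub>P (Suc j)\<^esub> H (s j u) : d (Suc j) ` carrier (P (Suc (Suc j)))"
  using null_homotopy[OF S s ss l G G0 dG, of j] by blast
 interpret K: left_module A K by fact
 have "h (G n u) = h (H (s j u))" if u: "u : carrier (S n)" for u
 proof -
  have sc: "s j u : carrier (S j)" using u n by (auto intro: module_hom_closed[OF s])
  have c: "G n u : carrier (P n)" "H (s j u) : carrier (P n)"
   using module_hom_closed[OF G u] module_hom_closed[OF H sc] n by auto
  have "h (G n u) \<ominus>\<^bsub>K\<^esub> h (H (s j u)) = \<zero>\<^bsub>K\<^esub>"
   using im[of u] u n hd module_hom_diff_apply[OF P K h c] by auto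
  then show ?thesis using c module_hom_closed[OF h]
   using K.M.add.inv_solve_right'[of "\<zero>\<^bsub>K\<^esub>"] by (simp add: a_minus_def)
 qed
 moreover have "compose (carrier (S j)) h H : module_hom A (S j) K"
  by (rule module_hom_compose[OF S H]) (use h n in simp)
 ultimately show "EX b:module_hom A (S j) K. ALL u:carrier (S n). h (G n u) = b (s j u)"
  using n module_hom_closed[OF s] by (intro bexI[of _ "compose (carrier (S j)) h H"]) (auto simp: compose_eq)
qed

end

section \<open>Classes, Yoneda products and the criterion for finite generation\<close>

section \<open>The cohomology ring\<close>

lemma trivial_module_simps [simp]:
 "carrier (trivial_module \<epsilon>) = UNIV" "\<zero>\<^bsub>trivial_module \<epsilon>\<^esub> = 0"
 "x \<oplus>\<^bsub>trivial_module \<epsilon>\<^esub> y = x + y" "a \<odot>\<^bsub>trivial_module \<epsilon>\<^esub> x = \<epsilon> a * x"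
 by (simp_all add: trivial_module_def)

locale ext_ring =
 fixes A :: "('a, 'r) ring_scheme" and \<epsilon> :: "'a => 'k::field" and P :: "nat => ('a, 'm) module"
  and d :: "nat => 'm => 'm" and \<eta> :: "'m => 'k"
 assumes proj: "projective_resolution A (trivial_module \<epsilon>) P d \<eta>"
  and K: "left_module A (trivial_module \<epsilon>)"

sublocale ext_ring \<subseteq> resolution A "trivial_module \<epsilon>" P d \<eta>
 by (rule resolution.intro[OF projective_resolution_exact[OF proj] K])

context ext_ring
begin

abbreviation "Co n \<equiv> module_hom A (P n) (trivial_module \<epsilon>)"
abbreviation "Z \<equiv> cocycles A \<epsilon> P d"
abbreviation "B \<equiv> coboundaries A \<epsilon> P d"
abbreviation "cls \<equiv> ext_class A \<epsilon> P d"
abbreviation "E \<equiv> ext_group A \<epsilon> P d"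
abbreviation "HH \<equiv> cohomology_ring A \<epsilon> P d \<eta>"

lemma lifts: "left_module A Y ==> left_module A L ==> lifts_along A (P n) Y L"
 by (rule lifts_along_projective) (use proj in \<open>simp_all add: projective_resolution_def\<close>)

lemma coI:
 assumes "!!u v. u : carrier (P n) ==> v : carrier (P n) ==> f (u \<oplus>\<^bsub>P n\<^esub> v) = f u + f v"
  and "!!a u. a : carrier A ==> u : carrier (P n) ==> f (a \<odot>\<^bsub>P n\<^esub> u) = \<epsilon> a * f u"
 shows "restrict f (carrier (P n)) : Co n"
 by (rule module_hom_restrictI[OF P]) (use assms in auto)

lemma co_add: "f : Co n ==> u : carrier (P n) ==> v : carrier (P n) ==> f (u \<oplus>\<^bsub>P n\<^esub> v) = f u + f v"
 by (drule module_hom_add) auto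

lemma co_smult: "f : Co n ==> a : carrier A ==> u : carrier (P n) ==> f (a \<odot>\<^bsub>P n\<^esub> u) = \<epsilon> a * f u"
 by (drule module_hom_smult) auto

lemma co_zero: "f : Co n ==> f \<zero>\<^bsub>P n\<^esub> = 0"
 using module_hom_zero[OF P K] by auto

lemma co_lin:
 assumes "f : Co n" "g : Co n"
 shows "(\<lambda>u\<in>carrier (P n). c * f u + c' * g u) : Co n"
 by (rule coI) (use assms in \<open>auto simp: co_add co_smult algebra_simps\<close>)

lemma co_const0: "(\<lambda>u\<in>carrier (P n). 0) : Co n"
 by (rule coI) auto

lemma Z_Co: "f : Z n ==> f : Co n"
 and Z_d: "f : Z n ==> u : carrier (P (Suc n)) ==> f (d n u) = 0"
 by (simp_all add: cocycles_def)

lemma Z_lin: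
 assumes "f : Z n" "g : Z n"
 shows "(\<lambda>u\<in>carrier (P n). c * f u + c' * g u) : Z n"
 using co_lin[OF Z_Co Z_Co, OF assms] assms d_closed by (auto simp: cocycles_def)

lemma Z_const0: "(\<lambda>u\<in>carrier (P n). 0) : Z n"
 using co_const0 d_closed by (auto simp: cocycles_def)

lemma B_0: "b : B 0 \<longleftrightarrow> b = (\<lambda>u\<in>carrier (P 0). 0)"
 by (simp add: coboundaries_def)

lemma B_Suc: "b : B (Suc n) \<longleftrightarrow> (EX h:Co n. b = (\<lambda>u\<in>carrier (P (Suc n)). h (d n u)))"
 by (auto simp: coboundaries_def compose_def)

lemma B_SucI: "h : Co n ==> (\<lambda>u\<in>carrier (P (Suc n)). h (d n u)) : B (Suc n)"
 by (auto simp: B_Suc)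

lemma B_const0: "(\<lambda>u\<in>carrier (P n). 0) : B n"
proof (cases n)
 case (Suc m)
 show ?thesis unfolding Suc B_Suc
  by (rule bexI[OF _ co_const0]) (auto simp: d_closed)
qed (simp add: B_0)

lemma B_lin:
 assumes "f : B n" "g : B n"
 shows "(\<lambda>u\<in>carrier (P n). c * f u + c' * g u) : B n"
proof (cases n)
 case 0
 then show ?thesis using assms by (auto simp: B_0)
next
 case (Suc m)
 obtain h1 h2 where h: "h1 : Co m" "h2 : Co m"
  "f = (\<lambda>u\<in>carrier (P n). h1 (d m u))" "g = (\<lambda>u\<in>carrier (P n). h2 (d m u))"
  using assms unfolding Suc B_Suc by blast
 show ?thesis
  using B_SucI[OF co_lin[OF h(1,2), of c c']] d_closed unfolding Suc
  by (elim arg_cong[where f = "%x. x : B (Suc m)", THEN iffD1, rotated])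
   (auto simp: h(3,4) Suc)
qed

lemma B_Z: "b : B n ==> b : Z n"
proof (cases n)
 case 0
 then show "b : B n ==> b : Z n" using Z_const0 by (simp add: B_0)
next
 case (Suc m)
 assume "b : B n"
 then obtain h where h: "h : Co m" "b = (\<lambda>u\<in>carrier (P (Suc m)). h (d m u))"
  unfolding Suc B_Suc by blast
 have "b = compose (carrier (P (Suc m))) h (d m)" by (simp add: h compose_def)
 then have "b : Co n" using module_hom_compose[OF P d h(1)] Suc by simp
 then show "b : Z n" using h d_closed dd co_zero by (simp add: cocycles_def Suc)
qed

lemma cls_eq:
 assumes b: "b : B n" and f': "!!u. u : carrier (P n) ==> f' u = f u + b u"
 shows "cls n f' = cls n f"
proof
 have *: "cls n g' \<subseteq> cls n g" if "c : B n" "!!u. u : carrier (P n) ==> g' u = g u + c u" for c g g'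
 proof
  fix y assume "y : cls n g'"
  then obtain c' where c': "c' : B n" "y = (\<lambda>u\<in>carrier (P n). g' u + c' u)"
   by (auto simp: ext_class_def)
  have "(\<lambda>u\<in>carrier (P n). 1 * c u + 1 * c' u) : B n" by (rule B_lin[OF that(1) c'(1)])
  moreover have "y = (\<lambda>u\<in>carrier (P n). g u + (\<lambda>u\<in>carrier (P n). 1 * c u + 1 * c' u) u)"
   using c'(2) that(2) by (auto simp: add.assoc)
  ultimately show "y : cls n g" unfolding ext_class_def by blast
 qed
 show "cls n f' \<subseteq> cls n f" by (rule *[OF b f'])
 show "cls n f \<subseteq> cls n f'"
  by (rule *[OF B_lin[OF b b, of "-1" 0]]) (use f' in auto)
qed

lemma cls_cong: "(!!u. u : carrier (P n) ==> f' u = f u) ==> cls n f' = cls n f"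
 by (rule cls_eq[OF B_const0]) auto

lemma cls_mem: "y : cls n f ==> EX b:B n. y = (\<lambda>u\<in>carrier (P n). f u + b u)"
 by (auto simp: ext_class_def)

lemma cls_self: "f : Co n ==> f : cls n f"
proof -
 assume f: "f : Co n"
 have "f = (\<lambda>u\<in>carrier (P n). f u + (\<lambda>u\<in>carrier (P n). 0) u)"
  by (rule extensionalityI[OF module_hom_extensional[OF f]]) auto
 then show ?thesis unfolding ext_class_def using B_const0 by blast
qed

lemma cls_mem_Z: "f : Z n ==> y : cls n f ==> y : Z n"
 using Z_lin[of f n _ 1 1] B_Z by (fastforce dest!: cls_mem)

lemma E_carrier: "X : carrier (E n) \<longleftrightarrow> (EX f:Z n. X = cls n f)"
 by (auto simp: ext_group_def)

lemma E_zero: "\<zero>\<^bsub>E n\<^esub> = cls n (\<lambda>u\<in>carrier (P n). 0)"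
 by (simp add: ext_group_def)

text \<open>Operations on classes are defined as unions over all representatives; this collapses
  such a union once all its members are shown equal.\<close>

lemma UN_const: "I ~= {} ==> (!!i. i : I ==> X i = Y) ==> (\<Union>i\<in>I. X i) = Y"
 by auto

lemma E_add:
 assumes "f : Z n" "g : Z n"
 shows "cls n f \<oplus>\<^bsub>E n\<^esub> cls n g = cls n (\<lambda>u\<in>carrier (P n). f u + g u)"
proof -
 have *: "cls n (\<lambda>u\<in>carrier (P n). f' u + g' u) = cls n (\<lambda>u\<in>carrier (P n). f u + g u)"
  if "f' : cls n f" "g' : cls n g" for f' g'
 proof -
  obtain b c where bc: "b : B n" "c : B n" "f' = (\<lambda>u\<in>carrier (P n). f u + b u)" "g' = (\<lambda>u\<in>carrier (P n). g u + c u)"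
   using cls_mem[OF \<open>f' : cls n f\<close>] cls_mem[OF \<open>g' : cls n g\<close>] by blast
  show ?thesis by (rule cls_eq[OF B_lin[OF bc(1,2), of 1 1]]) (auto simp: bc(3,4))
 qed
 have ne: "cls n f ~= {}" "cls n g ~= {}"
  using cls_self[OF Z_Co, OF assms(1)] cls_self[OF Z_Co, OF assms(2)] by auto
 have "cls n f \<oplus>\<^bsub>E n\<^esub> cls n g = (\<Union>f'\<in>cls n f. \<Union>g'\<in>cls n g. cls n (\<lambda>u\<in>carrier (P n). f' u + g' u))"
  by (simp add: ext_group_def)
 also have "\<dots> = cls n (\<lambda>u\<in>carrier (P n). f u + g u)"
  by (rule UN_const[OF ne(1)], rule UN_const[OF ne(2)], rule *)
 finally show ?thesis .
qed

lemma E_smult: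
 assumes "f : Z n"
 shows "c \<odot>\<^bsub>E n\<^esub> cls n f = cls n (\<lambda>u\<in>carrier (P n). c * f u)"
proof -
 have *: "cls n (\<lambda>u\<in>carrier (P n). c * f' u) = cls n (\<lambda>u\<in>carrier (P n). c * f u)"
  if "f' : cls n f" for f'
 proof -
  obtain b where b: "b : B n" "f' = (\<lambda>u\<in>carrier (P n). f u + b u)"
   using cls_mem[OF \<open>f' : cls n f\<close>] by blast
  show ?thesis by (rule cls_eq[OF B_lin[OF b(1) b(1), of c 0]]) (auto simp: b(2) algebra_simps)
 qed
 have ne: "cls n f ~= {}" using cls_self[OF Z_Co, OF assms(1)] by auto
 have "c \<odot>\<^bsub>E n\<^esub> cls n f = (\<Union>f'\<in>cls n f. cls n (\<lambda>u\<in>carrier (P n). c * f' u))"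
  by (simp add: ext_group_def)
 also have "\<dots> = cls n (\<lambda>u\<in>carrier (P n). c * f u)"
  by (rule UN_const[OF ne], rule *)
 finally show ?thesis .
qed

lemma E_abelian_monoid: "abelian_monoid (E n)"
proof (rule abelian_monoidI)
 have Zs: "(\<lambda>u\<in>carrier (P n). f u + g u) : Z n" if "f : Z n" "g : Z n" for f g
  using Z_lin[OF that, of 1 1] by (simp cong: restrict_cong)
 fix x assume x: "x : carrier (E n)"
 then obtain f where f: "f : Z n" "x = cls n f" by (auto simp: E_carrier)
 show "\<zero>\<^bsub>E n\<^esub> \<oplus>\<^bsub>E n\<^esub> x = x" unfolding E_zero f(2) E_add[OF Z_const0 f(1)]
  by (rule cls_cong) auto
 fix y assume "y : carrier (E n)"
 then obtain g where g: "g : Z n" "y = cls n g" by (auto simp: E_carrier)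
 show "x \<oplus>\<^bsub>E n\<^esub> y : carrier (E n)" unfolding f(2) g(2) E_add[OF f(1) g(1)] E_carrier
  using Zs[OF f(1) g(1)] by blast
 show "x \<oplus>\<^bsub>E n\<^esub> y = y \<oplus>\<^bsub>E n\<^esub> x" unfolding f(2) g(2) E_add[OF f(1) g(1)] E_add[OF g(1) f(1)]
  by (rule cls_cong) (auto simp: add.commute)
 fix z assume "z : carrier (E n)"
 then obtain h where h: "h : Z n" "z = cls n h" by (auto simp: E_carrier)
 show "x \<oplus>\<^bsub>E n\<^esub> y \<oplus>\<^bsub>E n\<^esub> z = x \<oplus>\<^bsub>E n\<^esub> (y \<oplus>\<^bsub>E n\<^esub> z)"
  unfolding f(2) g(2) h(2) E_add[OF f(1) g(1)] E_add[OF g(1) h(1)]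
   E_add[OF Zs[OF f(1) g(1)] h(1)] E_add[OF f(1) Zs[OF g(1) h(1)]]
  by (rule cls_cong) (auto simp: add.assoc)
next
 show "\<zero>\<^bsub>E n\<^esub> : carrier (E n)" unfolding E_zero E_carrier using Z_const0 by blast
qed

end

text \<open>The difference of the two lifts is a chain map over zero, to which
  \<open>null_homotopic_cocycle\<close> applies.\<close>

lemma (in resolution) two_lifts_cocycle:
 fixes S :: "nat => ('a, 's) module"
 assumes S: "!!i. left_module A (S i)" and s: "!!i. s i : module_hom A (S (Suc i)) (S i)"
  and ss: "!!i u. u : carrier (S (Suc (Suc i))) ==> s i (s (Suc i) u) = \<zero>\<^bsub>S i\<^esub>"
  and l: "!!i. lifts_along A (S i) (P (Suc i)) (P i)"
  and F: "!!i. F i : module_hom A (S i) (P i)" and F': "!!i. F' i : module_hom A (S i) (P i)"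
  and F0: "!!u. u : carrier (S 0) ==> \<eta> (F 0 u) = \<eta> (F' 0 u)"
  and dF: "!!i u. u : carrier (S (Suc i)) ==> d i (F (Suc i) u) = F i (s i u)"
  and dF': "!!i u. u : carrier (S (Suc i)) ==> d i (F' (Suc i) u) = F' i (s i u)"
  and K: "left_module A K" and h: "h : module_hom A (P n) K"
  and hd: "!!u. u : carrier (P (Suc n)) ==> h (d n u) = \<zero>\<^bsub>K\<^esub>"
 shows "(n = 0 --> (ALL u:carrier (S 0). h (F 0 u) \<ominus>\<^bsub>K\<^esub> h (F' 0 u) = \<zero>\<^bsub>K\<^esub>)) &
  (ALL j. n = Suc j --> (EX b:module_hom A (S j) K. ALL u:carrier (S n). h (F n u) \<ominus>\<^bsub>K\<^esub> h (F' n u) = b (s j u)))"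
proof -
 interpret N: left_module A N by (rule N)
 define G where "G i = (\<lambda>u\<in>carrier (S i). F i u \<ominus>\<^bsub>P i\<^esub> F' i u)" for i
 have G: "G i : module_hom A (S i) (P i)" for i
  unfolding G_def by (rule module_hom_diff[OF S P F F'])
 have G0: "\<eta> (G 0 u) = \<zero>\<^bsub>N\<^esub>" if "u : carrier (S 0)" for u
 proof -
  have "\<eta> (G 0 u) = \<eta> (F 0 u) \<ominus>\<^bsub>N\<^esub> \<eta> (F' 0 u)"
   using that by (simp add: G_def module_hom_diff_apply[OF P N.left_module_axioms \<eta>] module_hom_closed[OF F] module_hom_closed[OF F'])
  then show ?thesis using F0[OF that] module_hom_closed[OF \<eta> module_hom_closed[OF F' that]]
   by (simp add: a_minus_def N.M.r_neg)
 qed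
 have dG: "d i (G (Suc i) u) = G i (s i u)" if "u : carrier (S (Suc i))" for i u
  using that module_hom_closed[OF s that]
  by (simp add: G_def module_hom_diff_apply[OF P P d] module_hom_closed[OF F] module_hom_closed[OF F'] dF dF')
 have hG: "h (G n u) = h (F n u) \<ominus>\<^bsub>K\<^esub> h (F' n u)" if "u : carrier (S n)" for u
  using that by (simp add: G_def module_hom_diff_apply[OF P K h] module_hom_closed[OF F] module_hom_closed[OF F'])
 show ?thesis
  using null_homotopic_cocycle[OF S s ss l G G0 dG K h hd] hG by auto
qed

context ext_ring
begin

lemma trivial_minus [simp]: "x \<ominus>\<^bsub>trivial_module \<epsilon>\<^esub> y = x - y"
proof -
 interpret K: left_module A "trivial_module \<epsilon>" by (rule K)
 have "\<ominus>\<^bsub>trivial_module \<epsilon>\<^esub> y = - y" using K.M.minus_equality[of "- y" y] by simp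
 then show ?thesis by (simp add: a_minus_def)
qed

text \<open>The target \<open>Y\<close> may be a complex other than \<open>P\<close>: later, chain
  maps from \<open>P\<close> into \<open>P\<close> itself and into the explicit resolution have to
  be compared.\<close>

lemma lifts_cls_eq:
 fixes Y :: "nat => ('a, 'y) module"
 assumes Y: "exact_resolution A (trivial_module \<epsilon>) Y t \<theta>"
  and F: "!!i. F i : module_hom A (P (m + i)) (Y i)" and F': "!!i. F' i : module_hom A (P (m + i)) (Y i)"
  and F0: "!!u. u : carrier (P m) ==> \<theta> (F 0 u) = \<theta> (F' 0 u)"
  and dF: "!!i u. u : carrier (P (Suc (m + i))) ==> t i (F (Suc i) u) = F i (d (m + i) u)"
  and dF': "!!i u. u : carrier (P (Suc (m + i))) ==> t i (F' (Suc i) u) = F' i (d (m + i) u)"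
  and h: "h : cocycles A \<epsilon> Y t n"
 shows "cls (m + n) (%u. h (F n u)) = cls (m + n) (%u. h (F' n u))"
proof -
 interpret Y: resolution A "trivial_module \<epsilon>" Y t \<theta> by (rule resolution.intro[OF Y K])
 have *: "(n = 0 --> (ALL u:carrier (P (m + 0)). h (F 0 u) \<ominus>\<^bsub>trivial_module \<epsilon>\<^esub> h (F' 0 u) = \<zero>\<^bsub>trivial_module \<epsilon>\<^esub>)) &
  (ALL j. n = Suc j --> (EX b:module_hom A (P (m + j)) (trivial_module \<epsilon>). ALL u:carrier (P (m + n)).
    h (F n u) \<ominus>\<^bsub>trivial_module \<epsilon>\<^esub> h (F' n u) = b (d (m + j) u)))"
  by (rule Y.two_lifts_cocycle[where S = "%i. P (m + i)" and s = "%i. d (m + i)"])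
   (use P d dd F F' F0 dF dF' K h lifts[OF Y.P Y.P] in \<open>auto simp: cocycles_def\<close>)
 show ?thesis
 proof (cases n)
  case 0
  then show ?thesis using * by (intro cls_cong) auto
 next
  case (Suc j)
  then obtain b where b: "b : Co (m + j)"
   "!!u. u : carrier (P (m + n)) ==> h (F n u) - h (F' n u) = b (d (m + j) u)"
   using * by auto
  have "h (F n u) = h (F' n u) + (\<lambda>u\<in>carrier (P (m + n)). b (d (m + j) u)) u"
   if "u : carrier (P (m + n))" for u
   using b(2)[OF that] that by (simp add: algebra_simps)
  then show ?thesis using B_SucI[OF b(1)] Suc by (intro cls_eq[where b = "\<lambda>u\<in>carrier (P (m + n)). b (d (m + j) u)"]) auto
 qed
qed

lemma chain_liftsD:
 assumes "F : chain_lifts A P d \<eta> m f"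
 shows "F i : module_hom A (P (m + i)) (P i)"
  and "u : carrier (P m) ==> \<eta> (F 0 u) = f u"
  and "u : carrier (P (Suc (m + i))) ==> d i (F (Suc i) u) = F i (d (m + i) u)"
 using assms by (auto simp: chain_lifts_def)

lemma chain_lifts_exist: "f : Z m ==> EX F. F : chain_lifts A P d \<eta> m f"
proof -
 assume f: "f : Z m"
 obtain F where "!!i. F i : module_hom A (P (m + i)) (P i)" "!!u. u : carrier (P (m + 0)) ==> \<eta> (F 0 u) = f u"
  "!!i u. u : carrier (P (m + Suc i)) ==> d i (F (Suc i) u) = F i (d (m + i) u)"
  by (rule chain_lift_exists[where S = "%i. P (m + i)" and s = "%i. d (m + i)" and f = f])
   (use P d dd f lifts[OF P P] lifts[OF P K] in \<open>auto simp: cocycles_def\<close>)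
 then show ?thesis by (intro exI[of _ F]) (simp add: chain_lifts_def)
qed

lemma product_cocycle:
 assumes h: "h : Z n" and F: "F : chain_lifts A P d \<eta> m f"
 shows "compose (carrier (P (m + n))) h (F n) : Z (m + n)"
proof -
 have "compose (carrier (P (m + n))) h (F n) (d (m + n) u) = 0" if u: "u : carrier (P (Suc (m + n)))" for u
  using Z_d[OF h] chain_liftsD(3)[OF F u, symmetric] chain_liftsD(1)[OF F, of "Suc n"] d_closed[OF u] u
  by (simp add: compose_eq module_hom_closed)
 then show ?thesis
  using module_hom_compose[OF P chain_liftsD(1)[OF F] Z_Co[OF h]] by (simp add: cocycles_def)
qed

text \<open>Three choices have to be shown harmless. Changing \<open>h\<close> by a coboundary
  changes the composite by a coboundary; changing \<open>f\<close> by a coboundary is absorbed by a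
  modified lift; and two lifts of the same cocycle give cohomologous composites.\<close>

lemma yoneda_eq:
 assumes h: "h : Z n" and f: "f : Z m" and F: "F : chain_lifts A P d \<eta> m f"
 shows "yoneda_product A \<epsilon> P d \<eta> n m (cls n h) (cls m f) = cls (m + n) (compose (carrier (P (m + n))) h (F n))"
proof -
 have eq: "cls (m + n) (compose (carrier (P (m + n))) h' (F' n)) = cls (m + n) (compose (carrier (P (m + n))) h (F n))"
  if h': "h' : cls n h" and f': "f' : cls m f" and F': "F' : chain_lifts A P d \<eta> m f'" for h' f' F'
 proof -
  obtain b where b: "b : B n" "h' = (\<lambda>u\<in>carrier (P n). h u + b u)" using cls_mem[OF h'] by blast
  obtain c where c: "c : B m" "f' = (\<lambda>u\<in>carrier (P m). f u + c u)" using cls_mem[OF f'] by blast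
  have F'c: "F' i u : carrier (P i)" if "u : carrier (P (m + i))" for i u
   by (rule module_hom_closed[OF chain_liftsD(1)[OF F'] that])
  have Fc: "F i u : carrier (P i)" if "u : carrier (P (m + i))" for i u
   by (rule module_hom_closed[OF chain_liftsD(1)[OF F] that])
  have "(\<lambda>u\<in>carrier (P (m + n)). b (F' n u)) : B (m + n)"
  proof (cases n)
   case 0
   then have "(\<lambda>u\<in>carrier (P (m + n)). b (F' n u)) = (\<lambda>u\<in>carrier (P (m + n)). 0)"
    using b(1) F'c[where i = 0] by (auto simp: B_0)
   then show ?thesis using B_const0 by simp
  next
   case (Suc j)
   then obtain \<beta> where be: "\<beta> : Co j" "b = (\<lambda>u\<in>carrier (P (Suc j)). \<beta> (d j u))"
    using b(1) by (auto simp: B_Suc)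
   have "compose (carrier (P (m + j))) \<beta> (F' j) : Co (m + j)"
    by (rule module_hom_compose[OF P chain_liftsD(1)[OF F'] be(1)])
   from B_SucI[OF this]
   have "(\<lambda>u\<in>carrier (P (m + n)). compose (carrier (P (m + j))) \<beta> (F' j) (d (m + j) u)) : B (m + n)"
    by (simp add: Suc)
   moreover have "(\<lambda>u\<in>carrier (P (m + n)). compose (carrier (P (m + j))) \<beta> (F' j) (d (m + j) u)) =
     (\<lambda>u\<in>carrier (P (m + n)). b (F' n u))"
    using F'c[where i = "Suc j"] d_closed
    by (intro restrict_ext) (simp add: Suc be(2) chain_liftsD(3)[OF F'] compose_eq)
   ultimately show ?thesis by simp
  qed
  then have 1: "cls (m + n) (%u. h' (F' n u)) = cls (m + n) (%u. h (F' n u))"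
   by (rule cls_eq) (simp add: b(2) F'c)
  have 2: "cls (m + n) (%u. h (F' n u)) = cls (m + n) (%u. h (F n u))"
  proof (cases m)
   case 0
   show ?thesis
    by (rule lifts_cls_eq[OF projective_resolution_exact[OF proj]])
     (use chain_liftsD[OF F] chain_liftsD[OF F'] c h 0 in \<open>auto simp: B_0\<close>)
  next
   case (Suc i)
   then obtain \<beta> where be: "\<beta> : Co i" "c = (\<lambda>u\<in>carrier (P (Suc i)). \<beta> (d i u))"
    using c(1) by (auto simp: B_Suc)
   obtain \<gamma> where ga: "\<gamma> : module_hom A (P i) (P 0)" "!!u. u : carrier (P i) ==> \<eta> (\<gamma> u) = \<beta> u"
    by (rule lifts_alongE[OF lifts[OF P K] \<eta> be(1)]) (use \<eta>_surj in auto)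
   have gd: "compose (carrier (P m)) \<gamma> (d i) : module_hom A (P m) (P 0)"
    using module_hom_compose[OF P d ga(1)] Suc by simp
   \<comment> \<open>If \<open>c\<close> is the coboundary of \<open>\<beta>\<close> and
     \<open>\<gamma>\<close> lifts \<open>\<beta>\<close> to \<open>P 0\<close>, then adding
     \<open>\<gamma> d\<close> in degree 0 turns a lift of \<open>f\<close> into a lift of
     \<open>f + c\<close>. The higher components can stay as they are because
     \<open>d d = 0\<close>.\<close>
   define F2 where "F2 i' = (if i' = 0 then (\<lambda>u\<in>carrier (P m). F 0 u \<oplus>\<^bsub>P 0\<^esub> compose (carrier (P m)) \<gamma> (d i) u) else F i')" for i'
   have F2: "F2 j : module_hom A (P (m + j)) (P j)" for j
    using chain_liftsD(1)[OF F, of j] chain_liftsD(1)[OF F, of 0] module_hom_sum[OF P P _ gd]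
    by (simp add: F2_def)
   have F20: "\<eta> (F2 0 u) = \<eta> (F' 0 u)" if u: "u : carrier (P m)" for u
    using u Suc d_closed ga Fc[where i = 0] be
    by (simp add: F2_def chain_liftsD(2)[OF F] chain_liftsD(2)[OF F'] co_add[OF \<eta>] c(2) compose_eq
      module_hom_closed[OF ga(1)])
   have dF2: "d j (F2 (Suc j) u) = F2 j (d (m + j) u)" if u: "u : carrier (P (Suc (m + j)))" for j u
   proof (cases j)
    case 0
    interpret P0: left_module A "P 0" by (rule P)
    show ?thesis using u Suc 0 dd[of u i] module_hom_zero[OF P P ga(1)] d_closed[of u "Suc i"] chain_liftsD(3)[OF F u]
      Fc[of "d m u" 0]
     by (simp add: F2_def compose_eq)
   next
    case (Suc j')
    then show ?thesis using chain_liftsD(3)[OF F u] by (simp add: F2_def)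
   qed
   have "cls (m + n) (%u. h (F2 n u)) = cls (m + n) (%u. h (F' n u))"
    by (rule lifts_cls_eq[OF projective_resolution_exact[OF proj] F2 chain_liftsD(1)[OF F'] F20 dF2 chain_liftsD(3)[OF F'] h])
   moreover have "cls (m + n) (%u. h (F2 n u)) = cls (m + n) (%u. h (F n u))"
   proof (cases n)
    case 0
    have "compose (carrier (P i)) h \<gamma> : Co i"
     using module_hom_compose[OF P ga(1), of h] Z_Co[OF h] 0 by simp
    from B_SucI[OF this] have "(\<lambda>u\<in>carrier (P m). h (\<gamma> (d i u))) : B m"
     using Suc d_closed by (simp add: compose_eq cong: restrict_cong)
    then show ?thesis using 0 Z_Co[OF h] Suc d_closed Fc[where i = 0]
     by (intro cls_eq[where b = "\<lambda>u\<in>carrier (P m). h (\<gamma> (d i u))"]) (auto simp: F2_def co_add compose_eq module_hom_closed[OF ga(1)])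
   next
    case (Suc j')
    then show ?thesis by (simp add: F2_def)
   qed
   ultimately show ?thesis by simp
  qed
  show ?thesis using 1 2 by (simp add: compose_def cls_cong[of _ "restrict _ _"])
 qed
 show ?thesis unfolding yoneda_product_def
  by (intro UN_const eq) (use cls_self[OF Z_Co[OF h]] cls_self[OF Z_Co[OF f]] chain_lifts_exist F cls_mem_Z[OF f] in blast)+
qed

lemma yoneda_closed:
 assumes "X : carrier (E n)" "Y : carrier (E m)"
 shows "yoneda_product A \<epsilon> P d \<eta> n m X Y : carrier (E (m + n))"
proof -
 obtain h f where hf: "h : Z n" "X = cls n h" "f : Z m" "Y = cls m f" using assms by (auto simp: E_carrier)
 obtain F where F: "F : chain_lifts A P d \<eta> m f" using chain_lifts_exist[OF hf(3)] by blast
 show ?thesis unfolding hf(2,4) yoneda_eq[OF hf(1,3) F] E_carrier using product_cocycle[OF hf(1) F] by blast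
qed

lemma yoneda_zero_left:
 assumes "Y : carrier (E m)"
 shows "yoneda_product A \<epsilon> P d \<eta> n m \<zero>\<^bsub>E n\<^esub> Y = \<zero>\<^bsub>E (m + n)\<^esub>"
proof -
 obtain f where f: "f : Z m" "Y = cls m f" using assms by (auto simp: E_carrier)
 obtain F where F: "F : chain_lifts A P d \<eta> m f" using chain_lifts_exist[OF f(1)] by blast
 show ?thesis unfolding f(2) E_zero yoneda_eq[OF Z_const0 f(1) F]
  by (rule cls_cong) (simp add: compose_eq module_hom_closed[OF chain_liftsD(1)[OF F]])
qed

lemma yoneda_zero_right:
 assumes "X : carrier (E n)"
 shows "yoneda_product A \<epsilon> P d \<eta> n m X \<zero>\<^bsub>E m\<^esub> = \<zero>\<^bsub>E (m + n)\<^esub>"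
proof -
 obtain h where h: "h : Z n" "X = cls n h" using assms by (auto simp: E_carrier)
 define F where "F i = (\<lambda>u\<in>carrier (P (m + i)). \<zero>\<^bsub>P i\<^esub>)" for i
 have Fh: "F i : module_hom A (P (m + i)) (P i)" for i
 proof -
  interpret Pi: left_module A "P i" by (rule P)
  show ?thesis unfolding F_def by (rule module_hom_restrictI[OF P]) (auto simp: Pi.smult_zero_right)
 qed
 have "F : chain_lifts A P d \<eta> m (\<lambda>u\<in>carrier (P m). 0)"
  unfolding chain_lifts_def
  using Fh d_closed co_zero[OF \<eta>] module_hom_zero[OF P P d] by (auto simp: F_def)
 from yoneda_eq[OF h(1) Z_const0 this] show ?thesis unfolding h(2) E_zero
  by (simp, intro cls_cong) (simp add: compose_eq F_def co_zero[OF Z_Co[OF h(1)]])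
qed

definition hcls :: "nat => ('m => 'k) => nat => ('m => 'k) set" where
 "hcls n f = (%m. if m = n then cls n f else \<zero>\<^bsub>E m\<^esub>)"

lemma HH_simps:
 "carrier HH = {U. (ALL n. U n : carrier (E n)) & finite {n. U n ~= \<zero>\<^bsub>E n\<^esub>}}"
 "U \<otimes>\<^bsub>HH\<^esub> V = (%n. \<Oplus>\<^bsub>E n\<^esub>i\<in>{..n}. yoneda_product A \<epsilon> P d \<eta> i (n - i) (U i) (V (n - i)))"
 "\<one>\<^bsub>HH\<^esub> = hcls 0 \<eta>"
 "U \<oplus>\<^bsub>HH\<^esub> V = (%n. U n \<oplus>\<^bsub>E n\<^esub> V n)"
 "c \<odot>\<^bsub>HH\<^esub> U = (%n. c \<odot>\<^bsub>E n\<^esub> U n)"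
 by (auto simp: cohomology_ring_def hcls_def Let_def)

lemma E_zero_closed: "\<zero>\<^bsub>E n\<^esub> : carrier (E n)"
 unfolding E_zero E_carrier using Z_const0 by blast

lemma E_add_closed: "X : carrier (E n) ==> Y : carrier (E n) ==> X \<oplus>\<^bsub>E n\<^esub> Y : carrier (E n)"
 by (rule abelian_monoid.a_closed[OF E_abelian_monoid])

lemma E_add_zero: "X : carrier (E n) ==> X \<oplus>\<^bsub>E n\<^esub> \<zero>\<^bsub>E n\<^esub> = X" "X : carrier (E n) ==> \<zero>\<^bsub>E n\<^esub> \<oplus>\<^bsub>E n\<^esub> X = X"
 by (simp_all add: abelian_monoid.l_zero[OF E_abelian_monoid] abelian_monoid.r_zero[OF E_abelian_monoid])

lemma E_smult_closed: "X : carrier (E n) ==> c \<odot>\<^bsub>E n\<^esub> X : carrier (E n)"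
proof -
 assume "X : carrier (E n)"
 then obtain f where f: "f : Z n" "X = cls n f" by (auto simp: E_carrier)
 have "(\<lambda>u\<in>carrier (P n). c * f u) : Z n" using Z_lin[OF f(1) f(1), of c 0] by (simp cong: restrict_cong)
 then show ?thesis unfolding f(2) E_smult[OF f(1)] E_carrier by blast
qed

lemma E_smult_zero: "c \<odot>\<^bsub>E n\<^esub> \<zero>\<^bsub>E n\<^esub> = \<zero>\<^bsub>E n\<^esub>"
 unfolding E_zero E_smult[OF Z_const0] by (rule cls_cong) simp

lemma hcls_closed: "f : Z n ==> hcls n f : carrier HH"
 using E_zero_closed by (auto simp: HH_simps(1) hcls_def E_carrier intro: finite_subset[of _ "{n}"])

lemma hcls_add: "f : Z n ==> g : Z n ==> hcls n f \<oplus>\<^bsub>HH\<^esub> hcls n g = hcls n (\<lambda>u\<in>carrier (P n). f u + g u)"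
 by (auto simp: HH_simps hcls_def E_add E_add_zero E_zero_closed fun_eq_iff)

lemma hcls_smult: "f : Z n ==> c \<odot>\<^bsub>HH\<^esub> hcls n f = hcls n (\<lambda>u\<in>carrier (P n). c * f u)"
 by (auto simp: HH_simps hcls_def E_smult E_smult_zero fun_eq_iff)

lemma hcls_cong: "(!!u. u : carrier (P n) ==> f u = g u) ==> hcls n f = hcls n g"
 unfolding hcls_def using cls_cong[of n f g] by (auto simp: fun_eq_iff)

lemma yoneda_closed': "X : carrier (E i) ==> Y : carrier (E (n - i)) ==> i \<le> n ==>
  yoneda_product A \<epsilon> P d \<eta> i (n - i) X Y : carrier (E n)"
 using yoneda_closed[of X i Y "n - i"] by simp

lemma yoneda_zero_left': "Y : carrier (E (n - i)) ==> i \<le> n ==>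
  yoneda_product A \<epsilon> P d \<eta> i (n - i) \<zero>\<^bsub>E i\<^esub> Y = \<zero>\<^bsub>E n\<^esub>"
 using yoneda_zero_left[of Y "n - i" i] by simp

lemma yoneda_zero_right': "X : carrier (E i) ==> i \<le> n ==>
  yoneda_product A \<epsilon> P d \<eta> i (n - i) X \<zero>\<^bsub>E (n - i)\<^esub> = \<zero>\<^bsub>E n\<^esub>"
 using yoneda_zero_right[of X i "n - i"] by simp

text \<open>Of the convolution sum only the term with index \<open>n\<close> survives, and in total
  degree \<open>m + n\<close> only; all others have a zero factor.\<close>

lemma hcls_mult:
 assumes h: "h : Z n" and f: "f : Z m" and F: "F : chain_lifts A P d \<eta> m f"
 shows "hcls n h \<otimes>\<^bsub>HH\<^esub> hcls m f = hcls (m + n) (%u. h (F n u))"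
proof
 fix k
 interpret Ek: abelian_monoid "E k" by (rule E_abelian_monoid)
 have c: "hcls n h i : carrier (E i)" "hcls m f i : carrier (E i)" for i
  using hcls_closed[OF h] hcls_closed[OF f] by (simp_all add: HH_simps)
 have t: "yoneda_product A \<epsilon> P d \<eta> i (k - i) (hcls n h i) (hcls m f (k - i)) =
   (if n = i then (if k = m + n then cls (m + n) (%u. h (F n u)) else \<zero>\<^bsub>E k\<^esub>) else \<zero>\<^bsub>E k\<^esub>)" if i: "i \<le> k" for i
 proof (cases "n = i & k = m + n")
  case True
  then have "k - i = m" using i by simp
  then show ?thesis using True yoneda_eq[OF h f F] by (simp add: hcls_def compose_def cls_cong[of _ "restrict _ _"])
 next
  case False
  then have "hcls n h i = \<zero>\<^bsub>E i\<^esub> \<or> hcls m f (k - i) = \<zero>\<^bsub>E (k - i)\<^esub>"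
   using i by (auto simp: hcls_def)
  then have "yoneda_product A \<epsilon> P d \<eta> i (k - i) (hcls n h i) (hcls m f (k - i)) = \<zero>\<^bsub>E k\<^esub>"
   using yoneda_zero_left'[OF c(2) i] yoneda_zero_right'[OF c(1) i] by auto
  then show ?thesis using False by auto
 qed
 have tc: "(if n = i then (if k = m + n then cls (m + n) (%u. h (F n u)) else \<zero>\<^bsub>E k\<^esub>) else \<zero>\<^bsub>E k\<^esub>) : carrier (E k)" if "i \<le> k" for i
  using yoneda_closed'[OF c(1)[of i] c(2) that] t[OF that] by simp
 have "(hcls n h \<otimes>\<^bsub>HH\<^esub> hcls m f) k = (\<Oplus>\<^bsub>E k\<^esub>i\<in>{..k}. (if n = i then (if k = m + n then cls (m + n) (%u. h (F n u)) else \<zero>\<^bsub>E k\<^esub>) else \<zero>\<^bsub>E k\<^esub>))"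
  unfolding HH_simps by (rule Ek.finsum_cong') (use t tc in auto)
 also have "\<dots> = hcls (m + n) (%u. h (F n u)) k"
 proof (cases "k = m + n")
  case True
  then show ?thesis using tc[of n] by (subst Ek.finsum_singleton) (auto simp: hcls_def)
 next
  case False
  then show ?thesis by (simp add: hcls_def if_distrib cong: if_cong)
 qed
 finally show "(hcls n h \<otimes>\<^bsub>HH\<^esub> hcls m f) k = hcls (m + n) (%u. h (F n u)) k" .
qed

lemma HH_add_closed: "U : carrier HH ==> V : carrier HH ==> U \<oplus>\<^bsub>HH\<^esub> V : carrier HH"
proof -
 assume UV: "U : carrier HH" "V : carrier HH"
 have "{n. U n \<oplus>\<^bsub>E n\<^esub> V n ~= \<zero>\<^bsub>E n\<^esub>} \<subseteq> {n. U n ~= \<zero>\<^bsub>E n\<^esub>} \<union> {n. V n ~= \<zero>\<^bsub>E n\<^esub>}"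
  by (auto simp: E_add_zero E_zero_closed)
 then show ?thesis using UV by (auto simp: HH_simps E_add_closed intro: finite_subset)
qed

lemma HH_smult_closed: "U : carrier HH ==> c \<odot>\<^bsub>HH\<^esub> U : carrier HH"
 by (auto simp: HH_simps E_smult_closed E_smult_zero elim!: finite_subset[rotated])

lemma HH_mult_closed: "U : carrier HH ==> V : carrier HH ==> U \<otimes>\<^bsub>HH\<^esub> V : carrier HH"
proof -
 assume UV: "U : carrier HH" "V : carrier HH"
 then have c: "U i : carrier (E i)" "V i : carrier (E i)" for i by (auto simp: HH_simps)
 have fin: "finite {n. U n ~= \<zero>\<^bsub>E n\<^esub>}" "finite {n. V n ~= \<zero>\<^bsub>E n\<^esub>}"
  using UV by (auto simp: HH_simps)
 obtain a where a: "!!n. U n ~= \<zero>\<^bsub>E n\<^esub> ==> n \<le> a" using fin(1) by (auto simp: finite_nat_set_iff_bounded_le)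
 obtain b where b: "!!n. V n ~= \<zero>\<^bsub>E n\<^esub> ==> n \<le> b" using fin(2) by (auto simp: finite_nat_set_iff_bounded_le)
 have cl: "(U \<otimes>\<^bsub>HH\<^esub> V) n : carrier (E n)" for n
  unfolding HH_simps by (rule abelian_monoid.finsum_closed[OF E_abelian_monoid]) (auto intro: yoneda_closed' c)
 have "(U \<otimes>\<^bsub>HH\<^esub> V) n = \<zero>\<^bsub>E n\<^esub>" if n: "n > a + b" for n
 proof -
  interpret En: abelian_monoid "E n" by (rule E_abelian_monoid)
  have "yoneda_product A \<epsilon> P d \<eta> i (n - i) (U i) (V (n - i)) = \<zero>\<^bsub>E n\<^esub>" if i: "i \<le> n" for i
  proof -
   have "U i = \<zero>\<^bsub>E i\<^esub> \<or> V (n - i) = \<zero>\<^bsub>E (n - i)\<^esub>" using a[of i] b[of "n - i"] n i by linarith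
   then show ?thesis using yoneda_zero_left'[OF c(2) i] yoneda_zero_right'[OF c(1) i] by auto
  qed
  then have "(U \<otimes>\<^bsub>HH\<^esub> V) n = (\<Oplus>\<^bsub>E n\<^esub>i\<in>{..n}. \<zero>\<^bsub>E n\<^esub>)"
   unfolding HH_simps by (intro En.finsum_cong') auto
  then show ?thesis by simp
 qed
 then have "{n. (U \<otimes>\<^bsub>HH\<^esub> V) n ~= \<zero>\<^bsub>E n\<^esub>} \<subseteq> {..a + b}" by (force simp: not_le[symmetric])
 then have "finite {n. (U \<otimes>\<^bsub>HH\<^esub> V) n ~= \<zero>\<^bsub>E n\<^esub>}" by (rule finite_subset) simp
 then show ?thesis using cl by (subst HH_simps(1)) blast
qed

lemma \<eta>_Z: "\<eta> : Z 0"
 using \<eta> \<eta>d by (simp add: cocycles_def)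

lemma generated_closed:
 assumes "S \<subseteq> carrier HH" "U : generated_subalgebra HH S"
 shows "U : carrier HH"
 using assms(2)
proof induction
 case one
 then show ?case using hcls_closed[OF \<eta>_Z] by (simp add: HH_simps(3))
qed (use assms(1) HH_add_closed HH_mult_closed HH_smult_closed in auto)

lemma generated_by_homogeneous:
 assumes U: "U : carrier HH" and hom: "!!n f. f : Z n ==> hcls n f : generated_subalgebra HH S"
 shows "U : generated_subalgebra HH S"
proof -
 have *: "(%n. if n : T then U n else \<zero>\<^bsub>E n\<^esub>) : generated_subalgebra HH S" if "finite T" for T
  using that
 proof (induction T)
  case empty
  have "hcls 0 (\<lambda>u\<in>carrier (P 0). 0) = (%n. \<zero>\<^bsub>E n\<^esub>)" by (intro ext) (simp add: hcls_def E_zero)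
  then show ?case using hom[OF Z_const0[of 0]] by simp
 next
  case (insert t T)
  obtain f where f: "f : Z t" "U t = cls t f" using U by (auto simp: HH_simps E_carrier)
  have "hcls t f \<oplus>\<^bsub>HH\<^esub> (%n. if n : T then U n else \<zero>\<^bsub>E n\<^esub>) = (%n. if n : insert t T then U n else \<zero>\<^bsub>E n\<^esub>)"
  proof
   fix n
   have "U n : carrier (E n)" for n using U by (simp add: HH_simps)
   then show "(hcls t f \<oplus>\<^bsub>HH\<^esub> (%n. if n : T then U n else \<zero>\<^bsub>E n\<^esub>)) n = (if n : insert t T then U n else \<zero>\<^bsub>E n\<^esub>)"
    using insert(2) by (simp add: HH_simps(4) hcls_def E_add_zero E_zero_closed flip: f(2))
  qed
  then show ?case using generated_subalgebra.add[OF hom[OF f(1)] insert.IH] by simp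
 qed
 have "U = (%n. if n : {n. U n ~= \<zero>\<^bsub>E n\<^esub>} then U n else \<zero>\<^bsub>E n\<^esub>)" by (intro ext) simp
 also have "\<dots> : generated_subalgebra HH S" by (rule *) (use U in \<open>simp add: HH_simps\<close>)
 finally show ?thesis .
qed

text \<open>That the sum is a cocycle is carried through the induction, because classes can be added
  only when their representatives are known to be cocycles.\<close>

lemma generated_sum:
 assumes I: "finite I" and g: "!!i. i : I ==> g i : Z n"
  and gen: "!!i. i : I ==> hcls n (g i) : generated_subalgebra HH S"
 shows "(\<lambda>u\<in>carrier (P n). \<Sum>i\<in>I. g i u) : Z n & hcls n (\<lambda>u\<in>carrier (P n). \<Sum>i\<in>I. g i u) : generated_subalgebra HH S"
 using I g gen
proof (induction I)
 case empty
 have "0 \<odot>\<^bsub>HH\<^esub> \<one>\<^bsub>HH\<^esub> : generated_subalgebra HH S" by (intro generated_subalgebra.smult generated_subalgebra.one)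
 moreover have "0 \<odot>\<^bsub>HH\<^esub> \<one>\<^bsub>HH\<^esub> = hcls n (\<lambda>u\<in>carrier (P n). 0)"
  unfolding HH_simps(3) hcls_smult[OF \<eta>_Z] by (intro ext) (simp add: hcls_def E_zero)
 ultimately have "hcls n (\<lambda>u\<in>carrier (P n). 0) : generated_subalgebra HH S" by simp
 then show ?case unfolding sum.empty using Z_const0 by blast
next
 case (insert i I)
 let ?s = "\<lambda>u\<in>carrier (P n). \<Sum>i\<in>I. g i u"
 have "?s : Z n & hcls n ?s : generated_subalgebra HH S"
  by (rule insert.IH) (use insert.prems in blast)+
 then have s: "?s : Z n" "hcls n ?s : generated_subalgebra HH S" by (rule conjunct1, rule conjunct2)
 have gi: "g i : Z n" "hcls n (g i) : generated_subalgebra HH S" using insert by auto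
 have "(\<lambda>u\<in>carrier (P n). 1 * g i u + 1 * ?s u) : Z n" by (rule Z_lin[OF gi(1) s(1)])
 moreover have "(\<lambda>u\<in>carrier (P n). 1 * g i u + 1 * ?s u) = (\<lambda>u\<in>carrier (P n). \<Sum>i\<in>insert i I. g i u)"
  using insert by (intro restrict_ext) simp
 ultimately have a: "(\<lambda>u\<in>carrier (P n). \<Sum>i\<in>insert i I. g i u) : Z n" by (simp only:)
 have b: "hcls n (g i) \<oplus>\<^bsub>HH\<^esub> hcls n ?s = hcls n (\<lambda>u\<in>carrier (P n). \<Sum>i\<in>insert i I. g i u)"
  unfolding hcls_add[OF gi(1) s(1)] by (rule hcls_cong) (use insert in simp)
 show ?case using generated_subalgebra.add[OF gi(2) s(2)] a unfolding b by blast
qed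

text \<open>\<open>F\<close> is an explicit resolution, \<open>P\<close> the given one. Generators
  are the classes of the 2-cocycles \<open>X i\<close> underlying the chain maps
  \<open>\<chi> i\<close>, together with finitely many cocycles that span the degrees below
  \<open>b\<close>. By \<open>step\<close>, a cocycle of degree at least \<open>b\<close> is a sum
  of composites of \<open>zs i\<close> with \<open>\<chi> i\<close>, and each composite represents
  the Yoneda product of the class of \<open>zs i\<close> with that of \<open>X i\<close>.\<close>

theorem fg_criterion:
 fixes F :: "nat => ('a, 'f) module"
 assumes F: "exact_resolution A (trivial_module \<epsilon>) F D \<theta>"
  and FP: "!!n. lifts_along A (F (Suc n)) (P (Suc n)) (P n)"
  and FK: "lifts_along A (F 0) (P 0) (trivial_module \<epsilon>)"
  and I: "finite I"
  and \<chi>: "!!i n. i : I ==> \<chi> i n : module_hom A (F (Suc (Suc n))) (F n)"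
  and D\<chi>: "!!i n u. i : I ==> u : carrier (F (Suc (Suc (Suc n)))) ==>
    D n (\<chi> i (Suc n) u) = \<chi> i n (D (Suc (Suc n)) u)"
  and fin: "!!n. n < b ==> EX T. finite T & T \<subseteq> cocycles A \<epsilon> F D n &
    (ALL z:cocycles A \<epsilon> F D n. EX c. ALL u:carrier (F n). z u = (\<Sum>t\<in>T. c t * t u))"
  and step: "!!n z. b \<le> Suc (Suc n) ==> z : cocycles A \<epsilon> F D (Suc (Suc n)) ==>
    EX zs. (ALL i:I. zs i : cocycles A \<epsilon> F D n) &
     (ALL u:carrier (F (Suc (Suc n))). z u = (\<Sum>i\<in>I. zs i (\<chi> i n u)))"
  and b: "2 \<le> b"
 shows "finitely_generated_algebra HH"
proof -
 interpret F: resolution A "trivial_module \<epsilon>" F D \<theta> by (rule resolution.intro[OF F K])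
 obtain \<phi> where \<phi>: "!!i. \<phi> i : module_hom A (P i) (F i)" "!!u. u : carrier (P 0) ==> \<theta> (\<phi> 0 u) = \<eta> u"
  "!!i u. u : carrier (P (Suc i)) ==> D i (\<phi> (Suc i) u) = \<phi> i (d i u)"
  by (rule F.chain_lift_exists[OF P d dd lifts[OF F.P K] lifts[OF F.P F.P] \<eta> \<eta>d]) (assumption | rule that)+
 obtain \<psi> where \<psi>: "!!i. \<psi> i : module_hom A (F i) (P i)" "!!u. u : carrier (F 0) ==> \<eta> (\<psi> 0 u) = \<theta> u"
  "!!i u. u : carrier (F (Suc i)) ==> d i (\<psi> (Suc i) u) = \<psi> i (D i u)"
  by (rule chain_lift_exists[OF F.P F.d F.dd FK FP F.\<eta> F.\<eta>d]) (assumption | rule that)+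
 note \<phi>c = module_hom_closed[OF \<phi>(1)] and \<psi>c = module_hom_closed[OF \<psi>(1)]
 have \<chi>c: "\<chi> i n u : carrier (F n)" if "i : I" "u : carrier (F (Suc (Suc n)))" for i n u
  by (rule module_hom_closed[OF \<chi> that(2)]) (rule that(1))
 have pull: "(\<lambda>u\<in>carrier (P n). z (\<phi> n u)) : Z n" if z: "z : cocycles A \<epsilon> F D n" for z n
 proof -
  have "compose (carrier (P n)) z (\<phi> n) : Co n"
   by (rule module_hom_compose[OF P \<phi>(1)]) (use z in \<open>simp add: cocycles_def\<close>)
  then show ?thesis using z \<phi>(3)[symmetric] \<phi>c d_closed by (simp add: cocycles_def compose_def)
 qed
 define X where "X i = (\<lambda>u\<in>carrier (P 2). \<theta> (\<chi> i 0 (\<phi> 2 u)))" for i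
 \<comment> \<open>The chain map \<open>\<chi> i\<close> carried over to \<open>P\<close> by the
   comparison maps. It lifts \<open>X i\<close> because \<open>\<psi>\<close> respects the
   augmentations.\<close>
 define G where "G i n = compose (carrier (P (Suc (Suc n)))) (\<psi> n) (compose (carrier (P (Suc (Suc n)))) (\<chi> i n) (\<phi> (Suc (Suc n))))" for i n
 have chi_phi: "compose (carrier (P (Suc (Suc n)))) (\<chi> i n) (\<phi> (Suc (Suc n))) : module_hom A (P (Suc (Suc n))) (F n)"
  if "i : I" for i n by (rule module_hom_compose[OF P \<phi>(1) \<chi>[OF that]])
 have Ghom: "G i n : module_hom A (P (Suc (Suc n))) (P n)" if "i : I" for i n
  unfolding G_def by (rule module_hom_compose[OF P chi_phi[OF that] \<psi>(1)])
 have XZ: "X i : Z 2" if i: "i : I" for i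
 proof -
  have "compose (carrier (P (Suc (Suc 0)))) \<theta> (compose (carrier (P (Suc (Suc 0)))) (\<chi> i 0) (\<phi> (Suc (Suc 0)))) : Co (Suc (Suc 0))"
   by (rule module_hom_compose[OF P chi_phi[OF i] F.\<eta>])
  moreover have "compose (carrier (P (Suc (Suc 0)))) \<theta> (compose (carrier (P (Suc (Suc 0)))) (\<chi> i 0) (\<phi> (Suc (Suc 0)))) = X i"
   unfolding X_def compose_def numeral_2_eq_2 by (intro restrict_ext) simp
  moreover have "X i (d 2 u) = 0" if u: "u : carrier (P (Suc 2))" for u
   using u d_closed[of u 2] \<phi>(3)[of u 2, symmetric] D\<chi>[OF i \<phi>c, of u 0, symmetric] F.\<eta>d[OF \<chi>c[OF i \<phi>c, of u]]
   by (simp add: X_def numeral_2_eq_2)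
  ultimately show ?thesis by (simp add: cocycles_def numeral_2_eq_2)
 qed
 have Glift: "G i : chain_lifts A P d \<eta> 2 (X i)" if i: "i : I" for i
  unfolding chain_lifts_def
 proof (intro CollectI conjI allI ballI)
  show "G i n : module_hom A (P (2 + n)) (P n)" for n using Ghom[OF i] by simp
  show "\<eta> (G i 0 u) = X i u" if "u : carrier (P 2)" for u
   using that \<chi>c[OF i \<phi>c, of u 0] by (simp add: G_def X_def numeral_2_eq_2 compose_eq \<psi>(2))
  show "d n (G i (Suc n) u) = G i n (d (2 + n) u)" if "u : carrier (P (2 + Suc n))" for n u
   using that \<chi>c[OF i \<phi>c, of u "Suc n"] d_closed[of u "2 + n"] \<phi>(3)[of u "Suc (Suc n)"]
   by (simp add: G_def compose_eq \<psi>(3) D\<chi>[OF i \<phi>c])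
 qed
 define Sp where "Sp n T \<longleftrightarrow> finite T & T \<subseteq> cocycles A \<epsilon> F D n &
    (ALL z:cocycles A \<epsilon> F D n. EX c. ALL u:carrier (F n). z u = (\<Sum>t\<in>T. c t * t u))" for n T
 have "EX T. Sp n T" if "n < b" for n
  unfolding Sp_def by (rule fin[OF that])
 then have "ALL n. EX T. n < b --> Sp n T" by blast
 then obtain T where Sp: "!!n. n < b ==> Sp n (T n)" by metis
 have T: "!!n. n < b ==> finite (T n)" "!!n. n < b ==> T n \<subseteq> cocycles A \<epsilon> F D n"
  "!!n z. n < b ==> z : cocycles A \<epsilon> F D n ==> EX c. ALL u:carrier (F n). z u = (\<Sum>t\<in>T n. c t * t u)"
  using Sp unfolding Sp_def by simp_all
 define S where "S = (%i. hcls 2 (X i)) ` I \<union> (\<Union>n\<in>{..<b}. (%t. hcls n (\<lambda>u\<in>carrier (P n). t (\<phi> n u))) ` T n)"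
 have finS: "finite S" unfolding S_def using I T(1) by auto
 have SH: "S \<subseteq> carrier HH" unfolding S_def using hcls_closed XZ pull T(2) by blast
 let ?gen = "generated_subalgebra HH S"
 have gen: "hcls n (\<lambda>u\<in>carrier (P n). z (\<phi> n u)) : ?gen" if "z : cocycles A \<epsilon> F D n" for n z
  using that
 proof (induction n arbitrary: z rule: less_induct)
  case (less n)
  show ?case
  proof (cases "n < b")
   case True
   obtain c where c: "!!u. u : carrier (F n) ==> z u = (\<Sum>t\<in>T n. c t * t u)"
    using T(3)[OF True less.prems] by blast
   let ?g = "%t. \<lambda>u\<in>carrier (P n). c t * (\<lambda>u\<in>carrier (P n). t (\<phi> n u)) u"
   have tZ: "(\<lambda>u\<in>carrier (P n). t (\<phi> n u)) : Z n" if "t : T n" for t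
    using T(2)[OF True] that pull by blast
   have "(\<lambda>u\<in>carrier (P n). \<Sum>t\<in>T n. ?g t u) : Z n & hcls n (\<lambda>u\<in>carrier (P n). \<Sum>t\<in>T n. ?g t u) : ?gen"
   proof (rule generated_sum[OF T(1)[OF True]])
    fix t assume t: "t : T n"
    show "?g t : Z n" using Z_lin[OF tZ[OF t] tZ[OF t], of "c t" 0] by (simp cong: restrict_cong)
    have "hcls n (\<lambda>u\<in>carrier (P n). t (\<phi> n u)) : S" unfolding S_def using t True by blast
    then show "hcls n (?g t) : ?gen"
     unfolding hcls_smult[OF tZ[OF t], symmetric] by (intro generated_subalgebra.smult generated_subalgebra.incl)
   qed
   moreover have "hcls n (\<lambda>u\<in>carrier (P n). \<Sum>t\<in>T n. ?g t u) = hcls n (\<lambda>u\<in>carrier (P n). z (\<phi> n u))"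
    by (rule hcls_cong) (simp add: c \<phi>c)
   ultimately show ?thesis by (simp only:)
  next
   case False
   then obtain m where m: "n = Suc (Suc m)" using b by (metis One_nat_def Suc_1 add_2_eq_Suc le_Suc_ex not_less order_trans)
   obtain zs where zs: "!!i. i : I ==> zs i : cocycles A \<epsilon> F D m"
    "!!u. u : carrier (F n) ==> z u = (\<Sum>i\<in>I. zs i (\<chi> i m u))"
    using step[of m z] False less.prems m by auto
   let ?g = "%i. \<lambda>u\<in>carrier (P n). zs i (\<chi> i m (\<phi> n u))"
   have "(\<lambda>u\<in>carrier (P n). \<Sum>i\<in>I. ?g i u) : Z n & hcls n (\<lambda>u\<in>carrier (P n). \<Sum>i\<in>I. ?g i u) : ?gen"
   proof (rule generated_sum[OF I])
    fix i assume i: "i : I"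
    have zsi: "zs i : module_hom A (F m) (trivial_module \<epsilon>)" "!!u. u : carrier (F (Suc m)) ==> zs i (D m u) = 0"
     using zs(1)[OF i] by (simp_all add: cocycles_def)
    have "compose (carrier (P n)) (zs i) (compose (carrier (P n)) (\<chi> i m) (\<phi> n)) : Co n"
     unfolding m by (rule module_hom_compose[OF P chi_phi[OF i] zsi(1)])
    moreover have "compose (carrier (P n)) (zs i) (compose (carrier (P n)) (\<chi> i m) (\<phi> n)) = ?g i"
     by (simp add: compose_def cong: restrict_cong)
    moreover have "?g i (d n u) = 0" if u: "u : carrier (P (Suc n))" for u
     using u d_closed[of u n] \<phi>(3)[of u n, symmetric] D\<chi>[OF i, of "\<phi> (Suc n) u" m, symmetric]
      \<chi>c[OF i, of "\<phi> (Suc n) u" "Suc m"] \<phi>c[of u "Suc n"]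
     by (simp add: m zsi(2))
    ultimately show "?g i : Z n" by (simp add: cocycles_def)
    have m1: "hcls m (\<lambda>u\<in>carrier (P m). zs i (\<phi> m u)) \<otimes>\<^bsub>HH\<^esub> hcls 2 (X i) : ?gen"
     by (rule generated_subalgebra.mult[OF less.IH[OF _ zs(1)[OF i]] generated_subalgebra.incl])
      (use i in \<open>auto simp: m S_def\<close>)
    have m2: "hcls m (\<lambda>u\<in>carrier (P m). zs i (\<phi> m u)) \<otimes>\<^bsub>HH\<^esub> hcls 2 (X i) =
      hcls (2 + m) (%u. (\<lambda>u\<in>carrier (P m). zs i (\<phi> m u)) (G i m u))"
     by (rule hcls_mult[OF pull[OF zs(1)[OF i]] XZ[OF i] Glift[OF i]])
    \<comment> \<open>\<open>\<phi> \<psi> \<chi> \<phi>\<close> and \<open>\<chi> \<phi>\<close>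
      are chain maps from \<open>P\<close> shifted by 2 into \<open>F\<close> with the same
      augmentation, so evaluating a cocycle of \<open>F\<close> on them gives one class.\<close>
    have m3: "cls (2 + m) (%u. zs i (compose (carrier (P (Suc (Suc m)))) (\<phi> m) (G i m) u)) =
      cls (2 + m) (%u. zs i (compose (carrier (P (Suc (Suc m)))) (\<chi> i m) (\<phi> (Suc (Suc m))) u))"
     by (rule lifts_cls_eq[OF F, where F = "%j. compose (carrier (P (Suc (Suc j)))) (\<phi> j) (G i j)"
        and F' = "%j. compose (carrier (P (Suc (Suc j)))) (\<chi> i j) (\<phi> (Suc (Suc j)))"])
      (use zs(1)[OF i] chi_phi[OF i] module_hom_compose[OF P Ghom[OF i] \<phi>(1)] \<phi>(2)
       module_hom_closed[OF Ghom[OF i]] chain_liftsD(2)[OF Glift[OF i]] chain_liftsD(3)[OF Glift[OF i]]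
       d_closed \<phi>(3) D\<chi>[OF i] \<phi>c in
       \<open>auto simp: compose_eq X_def numeral_2_eq_2\<close>)
    have e1: "cls (2 + m) (%u. (\<lambda>u\<in>carrier (P m). zs i (\<phi> m u)) (G i m u)) =
      cls (2 + m) (%u. zs i (compose (carrier (P (Suc (Suc m)))) (\<phi> m) (G i m) u))"
     by (rule cls_cong) (simp add: compose_eq module_hom_closed[OF Ghom[OF i]])
    have e2: "cls (2 + m) (%u. zs i (compose (carrier (P (Suc (Suc m)))) (\<chi> i m) (\<phi> (Suc (Suc m))) u)) =
      cls (2 + m) (?g i)"
     by (rule cls_cong) (simp add: compose_eq m)
    have "hcls (2 + m) (%u. (\<lambda>u\<in>carrier (P m). zs i (\<phi> m u)) (G i m u)) = hcls (2 + m) (?g i)"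
     unfolding hcls_def e1 m3 e2 ..
    moreover have "2 + m = n" by (simp add: m)
    ultimately show "hcls n (?g i) : ?gen" using m1 unfolding m2 by (simp only:)
   qed
   moreover have "hcls n (\<lambda>u\<in>carrier (P n). \<Sum>i\<in>I. ?g i u) = hcls n (\<lambda>u\<in>carrier (P n). z (\<phi> n u))"
    by (rule hcls_cong) (simp add: zs(2) \<phi>c)
   ultimately show ?thesis by (simp only:)
  qed
 qed
 \<comment> \<open>Every class of \<open>P\<close> comes from a cocycle of \<open>F\<close>:
   \<open>f\<close> is cohomologous to \<open>f \<psi> \<phi>\<close>, as
   \<open>\<psi> \<phi>\<close> covers the identity of k.\<close>
 have homog: "hcls n f : ?gen" if f: "f : Z n" for n f
 proof -
  have "compose (carrier (F n)) f (\<psi> n) (D n u) = 0" if u: "u : carrier (F (Suc n))" for u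
   using Z_d[OF f \<psi>c[OF u]] F.d_closed[OF u] \<psi>(3)[OF u] by (simp add: compose_eq)
  then have "compose (carrier (F n)) f (\<psi> n) : cocycles A \<epsilon> F D n"
   using module_hom_compose[OF F.P \<psi>(1) Z_Co[OF f]] by (simp add: cocycles_def)
  from gen[OF this] have g1: "hcls n (\<lambda>u\<in>carrier (P n). compose (carrier (F n)) f (\<psi> n) (\<phi> n u)) : ?gen" .
  have g2: "hcls n (\<lambda>u\<in>carrier (P n). compose (carrier (F n)) f (\<psi> n) (\<phi> n u)) =
    hcls n (%u. f (compose (carrier (P n)) (\<psi> n) (\<phi> n) u))"
   by (rule hcls_cong) (simp add: compose_eq \<phi>c)
  have g3: "cls (0 + n) (%u. f (compose (carrier (P n)) (\<psi> n) (\<phi> n) u)) = cls (0 + n) (%u. f ((\<lambda>u\<in>carrier (P n). u) u))"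
   by (rule lifts_cls_eq[OF projective_resolution_exact[OF proj],
      where F = "%j. compose (carrier (P j)) (\<psi> j) (\<phi> j)" and F' = "%j. \<lambda>u\<in>carrier (P j). u"])
    (use f module_hom_compose[OF P \<phi>(1) \<psi>(1)] module_hom_restrictI[OF P, of _ "%u. u"] \<phi>(2) \<psi>(2) \<phi>(3) \<psi>(3) \<phi>c d_closed
     in \<open>auto simp: compose_eq\<close>)
  have g4: "cls n (%u. f ((\<lambda>u\<in>carrier (P n). u) u)) = cls n f" by (rule cls_cong) simp
  have "cls n (%u. f (compose (carrier (P n)) (\<psi> n) (\<phi> n) u)) = cls n f"
   using g3 unfolding add_0 g4 .
  then have "hcls n (%u. f (compose (carrier (P n)) (\<psi> n) (\<phi> n) u)) = hcls n f"
   unfolding hcls_def by (simp only:)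
  then show ?thesis using g1 unfolding g2 by (simp only:)
 qed
 have "?gen = carrier HH"
  using generated_closed[OF SH] generated_by_homogeneous[OF _ homog] by blast
 then show ?thesis unfolding finitely_generated_algebra_def using finS SH by blast
qed

end

section \<open>Linear maps in coordinates, with control of supports\<close>

section \<open>Linear maps between spaces of finitely supported functions\<close>

abbreviation (input) "lookup \<equiv> Poly_Mapping.lookup"
abbreviation (input) "single \<equiv> Poly_Mapping.single"
abbreviation (input) "keys \<equiv> Poly_Mapping.keys"

definition scl :: "'k::field => ('b \<Rightarrow>\<^sub>0 'k) => ('b \<Rightarrow>\<^sub>0 'k)" where
 "scl c u = Poly_Mapping.map ((*) c) u"

lemma lookup_scl [simp]: "lookup (scl c u) b = c * lookup u b"
 by (simp add: scl_def map.rep_eq when_def)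

lemma scl_simps [simp]:
 "scl c 0 = 0" "scl 0 u = 0" "scl 1 u = u" "scl c (scl c' u) = scl (c * c') u"
 "scl c (u + v) = scl c u + scl c v" "scl c (u - v) = scl c u - scl c v" "scl c (- u) = - scl c u"
 "scl (- c) u = - scl c u"
 by (auto intro!: poly_mapping_eqI simp: lookup_add lookup_minus algebra_simps)

lemma scl_add_left: "scl (c + c') u = scl c u + scl c' u"
 by (auto intro!: poly_mapping_eqI simp: lookup_add algebra_simps)

lemma scl_single [simp]: "scl c (single b x) = single b (c * x)"
 by (auto intro!: poly_mapping_eqI simp: lookup_single when_def)

lemma scl_sum: "scl c (\<Sum>i\<in>I. f i) = (\<Sum>i\<in>I. scl c (f i))"
 by (induction I rule: infinite_finite_induct) auto

lemma keys_scl: "keys (scl c u) \<subseteq> keys u"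
 by (auto simp: in_keys_iff)

abbreviation bas :: "'b => ('b \<Rightarrow>\<^sub>0 'k::field)" where
 "bas b \<equiv> single b 1"

lemma sum_keys_superset:
 assumes "finite S" "keys u \<subseteq> S"
 shows "(\<Sum>b\<in>keys u. scl (lookup u b) (f b)) = (\<Sum>b\<in>S. scl (lookup u b) (f b))"
 by (rule sum.mono_neutral_left) (use assms in \<open>auto simp: in_keys_iff\<close>)

lemma decompose: "u = (\<Sum>b\<in>keys u. scl (lookup u b) (bas b))"
proof (rule poly_mapping_eqI)
 fix x
 have "lookup (\<Sum>b\<in>S. scl (lookup u b) (bas b)) x = (if x : S then lookup u x else 0)" if "finite S" for S
  using that by (induction S) (auto simp: lookup_add lookup_single when_def)
 then show "lookup u x = lookup (\<Sum>b\<in>keys u. scl (lookup u b) (bas b)) x"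
  by (simp add: in_keys_iff)
qed

definition linm :: "(('b \<Rightarrow>\<^sub>0 'k::field) => ('c \<Rightarrow>\<^sub>0 'k)) => bool" where
 "linm f \<longleftrightarrow> (ALL u v. f (u + v) = f u + f v) & (ALL c u. f (scl c u) = scl c (f u))"

lemma linm_add: "linm f ==> f (u + v) = f u + f v"
 and linm_scl: "linm f ==> f (scl c u) = scl c (f u)"
 by (simp_all add: linm_def)

lemma linm_0: "linm f ==> f 0 = 0"
 using linm_scl[of f 0 0] by simp

lemma linm_minus: "linm f ==> f (- u) = - f u"
 using linm_scl[of f "-1" u] by simp

lemma linm_diff: "linm f ==> f (u - v) = f u - f v"
 using linm_add[of f u "- v"] linm_minus[of f v] by simp

lemma linm_sum: "linm f ==> f (\<Sum>i\<in>I. g i) = (\<Sum>i\<in>I. f (g i))"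
 by (induction I rule: infinite_finite_induct) (auto simp: linm_0 linm_add)

lemma linm_decompose: "linm f ==> f u = (\<Sum>b\<in>keys u. scl (lookup u b) (f (bas b)))"
 by (subst decompose) (simp only: linm_sum linm_scl)

lemma linm_eqI:
 assumes "linm f" "linm g" "!!b. b : keys u ==> f (bas b) = g (bas b)"
 shows "f u = g u"
 unfolding linm_decompose[OF assms(1), of u] linm_decompose[OF assms(2), of u]
 by (rule sum.cong) (simp_all add: assms(3))

lemma linm_comp: "linm f ==> linm g ==> linm (%u. f (g u))"
 by (simp add: linm_def)

lemma linm_plus: "linm f ==> linm g ==> linm (%u. f u + g u)"
 by (simp add: linm_def algebra_simps)

lemma linm_sub: "linm f ==> linm g ==> linm (%u. f u - g u)"
 by (simp add: linm_def algebra_simps)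

lemma linm_scaled: "linm f ==> linm (%u. scl c (f u))"
 by (simp add: linm_def mult.commute)

lemma linm_id: "linm (%u. u)" and linm_zero: "linm (%u. 0)"
 by (simp_all add: linm_def)

definition linext :: "('b => ('c \<Rightarrow>\<^sub>0 'k::field)) => ('b \<Rightarrow>\<^sub>0 'k) => ('c \<Rightarrow>\<^sub>0 'k)" where
 "linext f u = (\<Sum>b\<in>keys u. scl (lookup u b) (f b))"

lemma linext_superset:
 "finite S ==> keys u \<subseteq> S ==> linext f u = (\<Sum>b\<in>S. scl (lookup u b) (f b))"
 unfolding linext_def by (rule sum_keys_superset)

lemma linext_linm: "linm (linext f)"
 unfolding linm_def
proof (intro conjI allI)
 fix u v :: "'a \<Rightarrow>\<^sub>0 'b" and c
 let ?S = "keys u \<union> keys v"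
 have "linext f (u + v) = (\<Sum>b\<in>?S. scl (lookup (u + v) b) (f b))"
  by (rule linext_superset) (use Poly_Mapping.keys_add[of u v] in auto)
 also have "\<dots> = (\<Sum>b\<in>?S. scl (lookup u b) (f b)) + (\<Sum>b\<in>?S. scl (lookup v b) (f b))"
  by (simp add: lookup_add scl_add_left sum.distrib)
 also have "\<dots> = linext f u + linext f v"
  by (simp add: linext_superset[of ?S])
 finally show "linext f (u + v) = linext f u + linext f v" .
 show "linext f (scl c u) = scl c (linext f u)"
  by (subst linext_superset[of "keys u"]) (auto simp: keys_scl linext_def scl_sum)
qed

lemma linext_single [simp]: "linext f (single b c) = scl c (f b)"
 by (subst linext_superset[of "{b}"]) auto

lemmas linext_rules [simp] = linm_add[OF linext_linm] linm_scl[OF linext_linm] linm_0[OF linext_linm]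
 linm_minus[OF linext_linm] linm_diff[OF linext_linm]

text \<open>Supports are given by predicates, so that bounds on exponents, cell degree and weight
  can be conjoined and pushed through a linear map by looking at basis vectors only
  (\<open>linm_Kset\<close>).\<close>

definition Kset :: "('b => bool) => ('b \<Rightarrow>\<^sub>0 'k::field) set" where
 "Kset Q = {u. ALL b:keys u. Q b}"

lemma Kset_0 [simp]: "0 : Kset Q"
 by (simp add: Kset_def)

lemma Kset_add: "u : Kset Q ==> v : Kset Q ==> u + v : Kset Q"
 using Poly_Mapping.keys_add[of u v] by (auto simp: Kset_def)

lemma Kset_scl: "u : Kset Q ==> scl c u : Kset Q"
 using keys_scl[of c u] by (auto simp: Kset_def)

lemma Kset_minus: "u : Kset Q ==> - u : Kset Q"
 using Kset_scl[of u Q "-1"] by simp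

lemma Kset_diff: "u : Kset Q ==> v : Kset Q ==> u - v : Kset Q"
 using Kset_add[OF _ Kset_minus] by fastforce

lemma Kset_sum: "(!!i. i : I ==> f i : Kset Q) ==> (\<Sum>i\<in>I. f i) : Kset Q"
 by (induction I rule: infinite_finite_induct) (auto simp: Kset_add)

lemma Kset_single: "Q b ==> single b c : Kset Q"
 by (simp add: Kset_def)

lemma Kset_bas [simp]: "bas b : (Kset Q :: ('b \<Rightarrow>\<^sub>0 'k::field) set) \<longleftrightarrow> Q b"
 by (simp add: Kset_def)

lemma Kset_mono: "u : Kset Q ==> (!!b. Q b ==> R b) ==> u : Kset R"
 by (auto simp: Kset_def)

lemma linm_Kset:
 assumes "linm f" "u : Kset Q" "!!b. Q b ==> f (bas b) : Kset R"
 shows "f u : Kset R"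
proof -
 have "(\<Sum>b\<in>keys u. scl (lookup u b) (f (bas b))) : Kset R"
  by (intro Kset_sum Kset_scl assms(3)) (use assms(2) in \<open>simp add: Kset_def\<close>)
 then show ?thesis using linm_decompose[OF assms(1), of u] by simp
qed

lemma linm_eq_Kset:
 assumes "linm f" "linm g" "u : Kset Q" "!!b. Q b ==> f (bas b) = g (bas b)"
 shows "f u = g u"
 by (rule linm_eqI) (use assms in \<open>auto simp: Kset_def\<close>)

section \<open>Periodic resolutions of truncated polynomial rings, their tensor product and its
  contraction\<close>

section \<open>The tensor product of three periodic complexes\<close>

datatype pbw_gen = PH | PX | PY

type_synonym mono = "pbw_gen => nat"

lemma all_pbw_gen: "(ALL i. Q i) \<longleftrightarrow> Q PH & Q PX & Q PY"
 by (metis pbw_gen.exhaust)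

lemma mono_eq_iff: "(m :: mono) = m' \<longleftrightarrow> m PH = m' PH & m PX = m' PX & m PY = m' PY"
 by (simp add: fun_eq_iff all_pbw_gen)

text \<open>\<open>N i\<close> is the exponent at which the generator \<open>i\<close> is truncated.
  With \<open>2 \<le> N i\<close> both steps 1 and \<open>N i - 1\<close> of the periodic complex
  are positive.\<close>

locale weights =
 fixes N w :: "pbw_gen => nat"
 assumes N: "2 \<le> N i" and w: "0 < w i"
begin

definition box :: "mono => bool" where "box m \<longleftrightarrow> (ALL i. m i < N i)"

definition deg :: "mono => nat" where "deg c = c PH + c PX + c PY"

definition mwt :: "mono => nat" where "mwt m = w PH * m PH + w PX * m PX + w PY * m PY"

text \<open>The internal degree of the generator in degree \<open>k\<close> of the periodic
  resolution of the trivial module over k[t]/(t^N): 0, 1, N, N + 1, 2 N, 2 N + 1, and so on. With it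
  all maps of the periodic complex become homogeneous.\<close>

definition cpos :: "pbw_gen => nat => nat" where "cpos i k = N i * (k div 2) + k mod 2"

definition cwt :: "mono => nat" where
 "cwt c = w PH * cpos PH (c PH) + w PX * cpos PX (c PX) + w PY * cpos PY (c PY)"

definition wt :: "mono \<times> mono => nat" where "wt b = mwt (fst b) + cwt (snd b)"

text \<open>The exponent of t in the periodic differential, which alternates between multiplication
  by t out of odd degrees and by t^(N-1) out of even ones.\<close>

definition stp :: "pbw_gen => nat => nat" where "stp i k = (if odd k then 1 else N i - 1)"

lemma stp_pos: "0 < stp i k" using N[of i] by (auto simp: stp_def)

lemma cpos_stp: "0 < k ==> cpos i (k - 1) + stp i k = cpos i k"
proof -
 assume k: "0 < k"
 show ?thesis
 proof (cases "odd k")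
  case True
  then obtain j where j: "k = 2 * j + 1" by (auto elim: oddE)
  then show ?thesis by (simp add: cpos_def stp_def)
 next
  case False
  then obtain j where j: "k = 2 * j" by (auto elim: evenE)
  then obtain j' where "j = Suc j'" using k by (cases j) auto
  then have "k - 1 = 2 * j' + 1" "k = 2 * (j' + 1)" using j by auto
  then show ?thesis using N[of i] unfolding cpos_def stp_def by (simp del: mult_Suc_right) simp
 qed
qed

text \<open>The Koszul sign: the parity of the total degree in the slots before
  \<open>i\<close>.\<close>

definition sgn_at :: "pbw_gen => mono => 'k::field" where
 "sgn_at i c = (case i of PH => 1 | PX => (-1) ^ c PH | PY => (-1) ^ (c PH + c PX))"

definition Dt :: "pbw_gen => mono \<times> mono => (mono \<times> mono \<Rightarrow>\<^sub>0 'k::field)" where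
 "Dt i b = (if 0 < snd b i & fst b i + stp i (snd b i) < N i
   then bas ((fst b)(i := fst b i + stp i (snd b i)), (snd b)(i := snd b i - 1)) else 0)"

definition D :: "mono \<times> mono => (mono \<times> mono \<Rightarrow>\<^sub>0 'k::field)" where
 "D b = Dt PH b + scl (sgn_at PX (snd b)) (Dt PX b) + scl (sgn_at PY (snd b)) (Dt PY b)"

text \<open>The contraction of one periodic complex. In even degree it divides by t; in odd degree
  it sends t^(N-1) to the next generator, whose differential that is, and everything else to
  0.\<close>

definition ht :: "pbw_gen => mono \<times> mono => (mono \<times> mono \<Rightarrow>\<^sub>0 'k::field)" where
 "ht i b = (if even (snd b i) & 0 < fst b i then bas ((fst b)(i := fst b i - 1), (snd b)(i := snd b i + 1))
   else if odd (snd b i) & fst b i = N i - 1 then bas ((fst b)(i := 0), (snd b)(i := snd b i + 1)) else 0)"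

definition nz :: "pbw_gen => mono \<times> mono => bool" where
 "nz i b \<longleftrightarrow> fst b i ~= 0 \<or> snd b i ~= 0"

text \<open>The first slot off its base point is contracted. The earlier slots then have degree 0,
  so the homotopy itself carries no Koszul sign.\<close>

definition hm :: "mono \<times> mono => (mono \<times> mono \<Rightarrow>\<^sub>0 'k::field)" where
 "hm b = (if nz PH b then ht PH b else if nz PX b then ht PX b else if nz PY b then ht PY b else 0)"

definition origin :: "mono \<times> mono" where "origin = ((%_. 0), (%_. 0))"

lemma origin_iff: "b = origin \<longleftrightarrow> \<not> nz PH b & \<not> nz PX b & \<not> nz PY b"
 by (cases b) (auto simp: origin_def nz_def mono_eq_iff)

text \<open>The cases are the parity of the degree and whether the exponent is extreme. In each of
  them exactly one of the two summands is nonzero, and it gives the basis vector back.\<close>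

lemma slot_homotopy:
 assumes "fst b i < N i" "nz i b"
 shows "linext (Dt i) (ht i b) + linext (ht i) (Dt i b) = bas b"
proof -
 obtain m c where b: "b = (m, c)" by (cases b)
 have "2 \<le> N i" by (rule N)
 consider "even (c i)" "m i = 0" "0 < c i" | "even (c i)" "0 < m i" | "odd (c i)" "m i = N i - 1" | "odd (c i)" "m i < N i - 1"
  using assms b unfolding nz_def by (cases "even (c i)"; cases "m i = 0"; cases "m i = N i - 1") auto
 then show ?thesis
  by cases (use assms \<open>2 \<le> N i\<close> in \<open>auto simp: b Dt_def ht_def stp_def fun_upd_idem\<close>)
qed

lemma ht_Dt_commute: "i ~= j ==> linext (Dt j) (ht i b) = linext (ht i) (Dt j b)"
 by (auto simp: Dt_def ht_def fun_upd_twist)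

lemma Dt_Dt: "linext (Dt i) (Dt i b) = 0"
 using N[of i] by (auto simp: Dt_def stp_def)

lemma Dt_Dt_commute: "i ~= j ==> linext (Dt j) (Dt i b) = linext (Dt i) (Dt j b)"
 by (auto simp: Dt_def fun_upd_twist)

lemma linext_D: "linext D u = linext (Dt PH) u + linext (%b. scl (sgn_at PX (snd b)) (Dt PX b)) u
  + linext (%b. scl (sgn_at PY (snd b)) (Dt PY b)) u"
 by (rule linm_eqI[where g = "%u. linext (Dt PH) u + linext (%b. scl (sgn_at PX (snd b)) (Dt PX b)) u
  + linext (%b. scl (sgn_at PY (snd b)) (Dt PY b)) u"])
  (auto intro!: linext_linm linm_plus simp: D_def)

lemma linext_signed:
 assumes "u : Kset (%b. sgn_at j (snd b) = s)"
 shows "linext (%b. scl (sgn_at j (snd b)) (f b)) u = scl s (linext f u)"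
 by (rule linm_eq_Kset[OF linext_linm linm_scaled[OF linext_linm] assms]) auto

lemma Dt_Kset:
 assumes "!!m c. b = (m, c) ==> 0 < c i ==> m i + stp i (c i) < N i ==> Q (m(i := m i + stp i (c i)), c(i := c i - 1))"
 shows "Dt i b : Kset Q"
 using assms by (cases b) (auto simp: Dt_def)

lemma ht_Kset:
 assumes "!!m c k. b = (m, c) ==> Q (m(i := k), c(i := c i + 1))"
 shows "ht i b : Kset Q"
 using assms by (cases b) (auto simp: ht_def)

lemma minus_one_pow_pred: "0 < k ==> (-1 :: 'k::field) ^ (k - Suc 0) = - ((-1) ^ k)"
 by (cases k) auto

lemma minus_one_pow_pred_add: "0 < k ==> (-1 :: 'k::field) ^ (k - Suc 0 + l) = - ((-1) ^ (k + l))"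
  "0 < k ==> (-1 :: 'k::field) ^ (l + (k - Suc 0)) = - ((-1) ^ (l + k))"
 by (cases k; simp)+

text \<open>Differentials in one slot square to zero and those in different slots commute; lowering
  an earlier slot flips the sign of a later one, so mixed terms cancel.\<close>

lemma D_D: "linext D (D b :: _ \<Rightarrow>\<^sub>0 'k::field) = 0"
proof -
 obtain m c where b: "b = (m, c)" by (cases b)
 have K: "Dt i b : Kset (%b. sgn_at j (snd b) = (if i = PH & j ~= PH \<or> i = PX & j = PY then - sgn_at j (snd b') else (sgn_at j (snd b') :: 'k)))"
  if "b' = b" for i j b' using that
  by (cases i; cases j) (auto intro!: Dt_Kset simp: b sgn_at_def minus_one_pow_pred minus_one_pow_pred_add)
 note S = linext_signed[OF K[OF refl]]
 have "linext D (D b) = linext D (Dt PH b) + scl (sgn_at PX (snd b)) (linext D (Dt PX b))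
   + scl (sgn_at PY (snd b)) (linext D (Dt PY b) :: _ \<Rightarrow>\<^sub>0 'k)"
  unfolding D_def[of b] by simp
 also have "\<dots> = 0" unfolding linext_D
  by (simp add: S Dt_Dt Dt_Dt_commute[of PX PH] Dt_Dt_commute[of PY PH] Dt_Dt_commute[of PY PX] algebra_simps)
 finally show ?thesis .
qed

lemma hm_eq: "linext hm u = linext (ht i) u" if "u : Kset (%b. nz i b & (ALL j. (j = PH & i ~= PH \<or> j = PX & i = PY) --> \<not> nz j b))"
 by (rule linm_eq_Kset[OF linext_linm linext_linm that]) (cases i; auto simp: hm_def)

text \<open>In the slot that is contracted this is \<open>slot_homotopy\<close>. For a later slot,
  \<open>ht\<close> raises the degree before it and so flips its sign, which cancels the two mixed
  terms; earlier slots are at their base point and contribute nothing.\<close>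

lemma contracting:
 assumes b: "box (fst b)" "b ~= origin"
 shows "linext D (hm b) + linext hm (D b) = (bas b :: _ \<Rightarrow>\<^sub>0 'k::field)"
proof -
 obtain m c where mc: "b = (m, c)" by (cases b)
 have m: "fst b i < N i" for i using b(1) by (simp add: box_def)
 consider (PH) "nz PH b" | (PX) "\<not> nz PH b" "nz PX b" | (PY) "\<not> nz PH b" "\<not> nz PX b" "nz PY b"
  using b(2) origin_iff by blast
 then show ?thesis
 proof cases
  case PH
  have hb: "hm b = (ht PH b :: _ \<Rightarrow>\<^sub>0 'k)" using PH by (simp add: hm_def)
  have K: "(Dt i b :: _ \<Rightarrow>\<^sub>0 'k) : Kset (%b. nz PH b & (ALL j. (j = PH & PH ~= PH \<or> j = PX & PH = PY) --> \<not> nz j b))" for i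
   using PH stp_pos by (cases i) (auto intro!: Dt_Kset simp: mc nz_def)
  have S: "(ht PH b :: _ \<Rightarrow>\<^sub>0 'k) : Kset (%b'. sgn_at j (snd b') = - sgn_at j (snd b))" if "j ~= PH" for j
   using that by (cases j) (auto intro!: ht_Kset simp: mc sgn_at_def)
  have "linext hm (D b) = (linext (ht PH) (D b) :: _ \<Rightarrow>\<^sub>0 'k)"
   unfolding D_def by (intro hm_eq Kset_add Kset_scl K)
  then show ?thesis unfolding hb linext_D
   using slot_homotopy[OF m PH, where 'a = 'k]
   by (simp add: linext_signed[OF S] D_def ht_Dt_commute algebra_simps)
 next
  case PX
  have hb: "hm b = (ht PX b :: _ \<Rightarrow>\<^sub>0 'k)" using PX by (simp add: hm_def)
  have Z: "Dt PH b = (0 :: _ \<Rightarrow>\<^sub>0 'k)" "linext (Dt PH) (ht PX b) = (0 :: _ \<Rightarrow>\<^sub>0 'k)"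
   using PX by (auto simp: Dt_def ht_def nz_def mc)
  have s1: "sgn_at PX (snd b) = (1 :: 'k)" using PX by (simp add: sgn_at_def nz_def)
  have K: "(Dt i b :: _ \<Rightarrow>\<^sub>0 'k) : Kset (%b. nz PX b & (ALL j. (j = PH & PX ~= PH \<or> j = PX & PX = PY) --> \<not> nz j b))" if "i ~= PH" for i
   using PX stp_pos that by (cases i) (auto intro!: Dt_Kset simp: mc nz_def)
  have S: "(ht PX b :: _ \<Rightarrow>\<^sub>0 'k) : Kset (%b'. sgn_at PY (snd b') = - sgn_at PY (snd b))"
    "(ht PX b :: _ \<Rightarrow>\<^sub>0 'k) : Kset (%b'. sgn_at PX (snd b') = 1)"
   using PX by (auto intro!: ht_Kset simp: mc sgn_at_def nz_def)
  have "linext hm (D b) = (linext (ht PX) (D b) :: _ \<Rightarrow>\<^sub>0 'k)"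
   unfolding D_def Z(1) by (intro hm_eq Kset_add Kset_scl K Kset_0) simp_all
  then show ?thesis unfolding hb linext_D
   using slot_homotopy[OF m PX(2), where 'a = 'k]
   by (simp add: linext_signed[OF S(1)] linext_signed[OF S(2)] D_def ht_Dt_commute Z s1 algebra_simps)
 next
  case PY
  have hb: "hm b = (ht PY b :: _ \<Rightarrow>\<^sub>0 'k)" using PY by (simp add: hm_def)
  have Z: "Dt i b = (0 :: _ \<Rightarrow>\<^sub>0 'k)" "linext (Dt i) (ht PY b) = (0 :: _ \<Rightarrow>\<^sub>0 'k)" if "i ~= PY" for i
   using PY that by (cases i; auto simp: Dt_def ht_def nz_def mc)+
  have s1: "sgn_at PY (snd b) = (1 :: 'k)" using PY by (simp add: sgn_at_def nz_def)
  have K: "(Dt PY b :: _ \<Rightarrow>\<^sub>0 'k) : Kset (%b. nz PY b & (ALL j. (j = PH & PY ~= PH \<or> j = PX & PY = PY) --> \<not> nz j b))"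
   using PY stp_pos by (auto intro!: Dt_Kset simp: mc nz_def)
  have S: "(ht PY b :: _ \<Rightarrow>\<^sub>0 'k) : Kset (%b'. sgn_at PY (snd b') = 1)"
    "(ht PY b :: _ \<Rightarrow>\<^sub>0 'k) : Kset (%b'. sgn_at PX (snd b') = 1)"
   using PY by (auto intro!: ht_Kset simp: mc sgn_at_def nz_def)
  have "linext hm (D b) = (linext (ht PY) (D b) :: _ \<Rightarrow>\<^sub>0 'k)"
   unfolding D_def Z(1)[of PH, simplified] Z(1)[of PX, simplified] by (intro hm_eq Kset_add Kset_scl K Kset_0)
  then show ?thesis unfolding hb linext_D
   using slot_homotopy[OF m PY(3), where 'a = 'k]
   by (simp add: linext_signed[OF S(1)] linext_signed[OF S(2)] D_def Z s1 algebra_simps)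
 qed
qed

end

section \<open>Filtration by weight, filtered exactness and the leading part of the shift\<close>

section \<open>The deformed resolution\<close>

context weights
begin

text \<open>The parameter \<open>s\<close> is for maps that lower weights by \<open>s\<close>: their
  error terms, measured against the weight \<open>k\<close> of the argument, must lie strictly below
  \<open>k - s\<close>.\<close>

definition lowby :: "nat => nat => (mono \<times> mono \<Rightarrow>\<^sub>0 'k::field) set" where
 "lowby s k = Kset (%b. wt b + s < k)"

definition Wb :: "(mono \<times> mono \<Rightarrow>\<^sub>0 'k::field) set" where
 "Wb = Kset (%b. box (fst b))"

definition Fr :: "nat => (mono \<times> mono \<Rightarrow>\<^sub>0 'k::field) set" where
 "Fr n = Kset (%b. box (fst b) & deg (snd b) = n)"

lemma Fr_Wb: "u : Fr n ==> u : Wb"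
 unfolding Fr_def Wb_def by (erule Kset_mono) simp

lemma Fr_bas: "bas (m, c) : (Fr n :: (mono \<times> mono \<Rightarrow>\<^sub>0 'k::field) set) \<longleftrightarrow> box m & deg c = n"
 by (simp add: Fr_def)

lemma box_zero [simp]: "box (%_. 0)"
 by (simp add: box_def) (metis N le_zero_eq not_gr_zero zero_neq_numeral)

lemma deg_dec: "0 < c i ==> deg (c(i := c i - 1)) = deg c - 1" "deg (c(i := Suc (c i))) = Suc (deg c)"
 "2 \<le> c i ==> deg (c(i := c i - 2)) = deg c - 2"
 by (cases i; simp add: deg_def)+

lemma cpos_Suc: "even k ==> cpos i (Suc k) = cpos i k + 1" "odd k ==> cpos i (Suc k) = cpos i k + (N i - 1)"
 using cpos_stp[of "Suc k" i] by (simp_all add: stp_def)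

lemma cpos_2: "2 \<le> k ==> cpos i k = cpos i (k - 2) + N i"
proof -
 assume "2 \<le> k"
 then obtain j where "k = j + 2" by (metis add.commute le_Suc_ex)
 then show ?thesis by (simp add: cpos_def)
qed

lemma wt_slot: "wt (m, c) = w i * (m i + cpos i (c i)) + (wt (m(i := 0), c(i := 0)))"
 by (cases i) (simp_all add: wt_def mwt_def cwt_def cpos_def algebra_simps)

lemma Dt_wt: "Dt i b : Kset (%b'. wt b' = wt b)"
proof (rule Dt_Kset)
 fix m c assume b: "b = (m, c)" and c: "0 < c i"
 show "wt (m(i := m i + stp i (c i)), c(i := c i - 1)) = wt b"
  unfolding b using cpos_stp[OF c, of i] by (subst (1 2) wt_slot[where i = i]) (simp add: algebra_simps)
qed

lemma Dt_Fr: "box (fst b) ==> Dt i b : Kset (%b'. box (fst b') & deg (snd b') = deg (snd b) - 1)"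
 by (rule Dt_Kset) (auto simp: box_def deg_dec[unfolded One_nat_def])

lemma D_wt: "D b : Kset (%b'. wt b' = wt b)"
 unfolding D_def by (intro Kset_add Kset_scl Dt_wt)

lemma D_Fr: "box (fst b) ==> D b : Kset (%b'. box (fst b') & deg (snd b') = deg (snd b) - 1)"
 unfolding D_def by (intro Kset_add Kset_scl Dt_Fr)

lemma ht_wt: "ht i b : Kset (%b'. wt b' = wt b)"
proof -
 obtain m c where b: "b = (m, c)" by (cases b)
 have 1: "wt (m(i := m i - 1), c(i := Suc (c i))) = wt b" if "even (c i)" "0 < m i"
  unfolding b using that by (subst (1 2) wt_slot[where i = i]) (simp add: cpos_Suc)
 have 2: "wt (m(i := 0), c(i := Suc (c i))) = wt b" if "odd (c i)" "m i = N i - 1"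
  unfolding b using that by (subst (1 2) wt_slot[where i = i]) (simp add: cpos_Suc algebra_simps)
 show ?thesis using 1 2 by (auto simp: ht_def b)
qed

lemma ht_Fr: "box (fst b) ==> ht i b : Kset (%b'. box (fst b') & deg (snd b') = Suc (deg (snd b)))"
 using N[of i] by (auto simp: ht_def box_def deg_dec intro: less_imp_diff_less)

lemma hm_wt: "hm b : Kset (%b'. wt b' = wt b)"
 unfolding hm_def by (auto intro: ht_wt)

lemma hm_Fr: "box (fst b) ==> hm b : Kset (%b'. box (fst b') & deg (snd b') = Suc (deg (snd b)))"
 unfolding hm_def by (auto intro: ht_Fr)

lemma linm_lowby:
 assumes "linm f" "u : Kset Q" "u : lowby s k" "!!b. Q b ==> f (bas b) : Kset (%b'. wt b' + t \<le> wt b + s')" "s' \<le> s"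
 shows "f u : lowby t k"
proof -
 have "u : Kset (%b. Q b & wt b + s < k)" using assms(2,3) by (auto simp: lowby_def Kset_def)
 then show ?thesis unfolding lowby_def
 proof (rule linm_Kset[OF assms(1)])
  fix b assume b: "Q b & wt b + s < k"
  show "f (bas b) : Kset (%b. wt b + t < k)"
   by (rule Kset_mono[OF assms(4)]) (use b assms(5) in auto)
 qed
qed

lemma linm_lowby_strict:
 assumes "linm f" "u : Kset (%b. Q b & wt b \<le> k)" "!!b. Q b ==> f (bas b) : lowby t (wt b)"
 shows "f u : lowby t k"
 unfolding lowby_def
proof (rule linm_Kset[OF assms(1,2)])
 fix b assume b: "Q b & wt b \<le> k"
 show "f (bas b) : Kset (%b. wt b + t < k)"
  by (rule Kset_mono[OF assms(3)[unfolded lowby_def]]) (use b in auto)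
qed

text \<open>A perturbation argument by induction on the weight bound. Subtract
  \<open>d1 (hm z)\<close> from \<open>z\<close>: since \<open>d0 z = 0\<close>, the vector
  \<open>D z\<close> has smaller weight than allowed for \<open>z\<close>, and the contraction of
  \<open>D\<close> then shows that the difference has smaller weight too. The origin has to be
  excluded because the contraction fails exactly there. That the preimage obeys the same bound as
  \<open>z\<close> is what later keeps leading terms intact.\<close>

lemma exact_step:
 fixes d0 d1 :: "(mono \<times> mono \<Rightarrow>\<^sub>0 'k::field) => (mono \<times> mono \<Rightarrow>\<^sub>0 'k)"
 assumes d0: "linm d0" and d1: "linm d1"
  and l0: "!!b. box (fst b) ==> deg (snd b) = n ==> d0 (bas b) - D b : lowby 0 (wt b)"
  and l1: "!!b. box (fst b) ==> deg (snd b) = Suc n ==> d1 (bas b) - D b : lowby 0 (wt b)"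
  and d1F: "!!v. v : Fr (Suc n) ==> d1 v : Fr n" and d01: "!!v. v : Fr (Suc n) ==> d0 (d1 v) = 0"
  and orig: "!!v. v : Fr (Suc n) ==> lookup (d1 v) origin = 0"
 shows "z : Fr n ==> lookup z origin = 0 ==> d0 z = 0 ==> z : lowby 0 k ==>
  EX v. v : Fr (Suc n) & v : lowby 0 k & d1 v = z"
proof (induction k arbitrary: z)
 case 0
 then have "keys z = {}" by (intro equals0I) (auto simp: lowby_def Kset_def)
 then have "z = 0" by simp
 then show ?case using linm_0[OF d1] by (intro exI[of _ 0]) (simp add: Fr_def lowby_def)
next
 case (Suc k)
 let ?hz = "linext hm z"
 have hzF: "?hz : Fr (Suc n)"
  unfolding Fr_def by (rule linm_Kset[OF linext_linm Suc.prems(1)[unfolded Fr_def]])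
   (use hm_Fr in \<open>auto intro: Kset_mono\<close>)
 have hzl: "?hz : lowby 0 (Suc k)"
  by (rule linm_lowby[OF linext_linm Suc.prems(1)[unfolded Fr_def] Suc.prems(4), where s' = 0])
   (simp_all add: Kset_mono[OF hm_wt])
 have E: "d1 ?hz - linext D ?hz : lowby 0 k"
  by (rule linm_lowby_strict[OF linm_sub[OF d1 linext_linm], where Q = "%b. box (fst b) & deg (snd b) = Suc n"])
   (use hzF hzl l1 in \<open>auto simp: Fr_def lowby_def Kset_def\<close>)
 have E0: "d0 z - linext D z : lowby 0 k"
  by (rule linm_lowby_strict[OF linm_sub[OF d0 linext_linm], where Q = "%b. box (fst b) & deg (snd b) = n"])
   (use Suc.prems l0 in \<open>auto simp: Fr_def lowby_def Kset_def\<close>)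
 have Dz: "linext D z : lowby 0 k" using Kset_minus[OF E0[unfolded lowby_def]] Suc.prems(3) by (simp add: lowby_def)
 have "linext hm (linext D z) : lowby 0 k"
  by (rule linm_lowby[OF linext_linm _ Dz, where s' = 0 and Q = "%_. True"])
   (simp_all add: Kset_mono[OF hm_wt], simp add: Kset_def)
 moreover have "linext D ?hz + linext hm (linext D z) = z"
 proof -
  have "linext D (linext hm z) + linext hm (linext D z) = (%u. u) z"
  proof (rule linm_eq_Kset[OF linm_plus[OF linm_comp[OF linext_linm linext_linm] linm_comp[OF linext_linm linext_linm]] linm_id])
   show "z : Kset (%b. box (fst b) & b ~= origin)"
    using Suc.prems(1,2) by (auto simp: Fr_def Kset_def in_keys_iff)
  qed (use contracting in auto)
  then show ?thesis by simp
 qed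
 moreover have "z - d1 ?hz = (z - linext D ?hz) - (d1 ?hz - linext D ?hz)" by simp
 ultimately have z'l: "z - d1 ?hz : lowby 0 k"
  using E Kset_diff[of "linext hm (linext D z)" "%b. wt b + 0 < k" "d1 ?hz - linext D ?hz"]
  unfolding lowby_def by (metis add_diff_cancel_left')
 have "z - d1 ?hz : Fr n" using Kset_diff Suc.prems(1) d1F[OF hzF] unfolding Fr_def by blast
 moreover have "d0 (z - d1 ?hz) = 0" using Suc.prems(3) d01[OF hzF] by (simp add: linm_diff[OF d0])
 moreover have "lookup (z - d1 ?hz) origin = 0" using Suc.prems(2) orig[OF hzF] by (simp add: lookup_minus)
 ultimately obtain v where v: "v : Fr (Suc n)" "v : lowby 0 k" "d1 v = z - d1 ?hz"
  using Suc.IH[OF _ _ _ z'l] by blast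
 have "v + ?hz : Fr (Suc n)" using Kset_add v(1) hzF unfolding Fr_def by blast
 moreover have "v + ?hz : lowby 0 (Suc k)" using v(2) hzl unfolding lowby_def by (intro Kset_add) (auto elim: Kset_mono)
 moreover have "d1 (v + ?hz) = z" using v(3) by (simp add: linm_add[OF d1])
 ultimately show ?case by blast
qed

definition cyc :: "mono => pbw_gen => mono" where "cyc c i = c(i := c i + 2)"

text \<open>The periodicity map of slot \<open>i\<close>, that is, the shifting chain map of the
  undeformed tensor product.\<close>

definition Sh :: "pbw_gen => mono \<times> mono => (mono \<times> mono \<Rightarrow>\<^sub>0 'k::field)" where
 "Sh i b = (if 2 \<le> snd b i then bas (fst b, (snd b)(i := snd b i - 2)) else 0)"

lemma Sh_wt: "Sh i b : Kset (%b'. wt b' + w i * N i = wt b)"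
proof -
 obtain m c where b: "b = (m, c)" by (cases b)
 have "wt (m, c(i := c i - 2)) + w i * N i = wt (m, c)" if "2 \<le> c i"
  using cpos_2[OF that, of i] by (subst (1 2) wt_slot[where i = i]) (simp add: algebra_simps)
 then show ?thesis by (simp add: Sh_def b)
qed

lemma Sh_Fr: "box (fst b) ==> Sh i b : Kset (%b'. box (fst b') & deg (snd b') = deg (snd b) - 2)"
 by (simp add: Sh_def deg_dec)

lemma stp_lt: "stp i k < N i"
 using N[of i] by (auto simp: stp_def)

text \<open>A shift by 2 preserves parities, hence steps and Koszul signs. Where the degree in slot
  \<open>i\<close> is below 3 the terms that could disagree are zero on both sides. Free generators
  are enough, as the chain maps below are determined by their values there.\<close>

lemma Sh_D_commute: "linext (Sh i) (D ((%_. 0), c)) = (linext D (Sh i ((%_. 0), c)) :: _ \<Rightarrow>\<^sub>0 'k::field)"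
proof -
 let ?b = "((%_. 0) :: mono, c)"
 have t: "linext (Sh i) (Dt j ?b) = (if 2 \<le> c i then Dt j ((%_. 0), c(i := c i - 2)) else (0 :: _ \<Rightarrow>\<^sub>0 'k))" for j
 proof (cases "i = j")
  case True
  consider "c j = 0" | "c j = 1" | "c j = 2" | k where "c j = k + 3"
  proof -
   have "c j = 0 \<or> c j = 1 \<or> c j = 2 \<or> c j = (c j - 3) + 3" by arith
   then show ?thesis using that by metis
  qed
  then show ?thesis using True
   by cases (simp_all add: Sh_def Dt_def stp_lt stp_def)
 next
  case False
  then show ?thesis by (auto simp: Sh_def Dt_def fun_upd_twist)
 qed
 have s: "sgn_at j (c(i := c i - 2)) = (sgn_at j c :: 'k)" if "2 \<le> c i" for j
 proof -
  define k where "k = c i - 2"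
  then have k: "c i = k + 2" using that by simp
  show ?thesis by (cases i; cases j) (use k in \<open>auto simp: sgn_at_def power_add\<close>)
 qed
 show ?thesis
  by (cases "2 \<le> c i") (simp_all add: D_def t s, simp_all add: Sh_def D_def s)
qed

end

text \<open>\<open>mu\<close> gives the structure constants of an algebra on the ordered monomials
  with bounded exponents. By \<open>mu_lead\<close> the associated graded algebra is the tensor
  product of truncated polynomial rings; by \<open>mu_eps\<close> the coefficient of the unit
  monomial is multiplicative, so it is the augmentation.\<close>

locale pbw = weights N w for N w :: "pbw_gen => nat" +
 fixes mu :: "mono => mono => (mono \<Rightarrow>\<^sub>0 'k::field)"
 assumes mu_supp: "box m ==> box m' ==> mu m m' : Kset box"
  and mu_unit_left: "box m ==> mu (%_. 0) m = bas m"
  and mu_unit_right: "box m ==> mu m (%_. 0) = bas m"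
  and mu_assoc: "box m1 ==> box m2 ==> box m3 ==>
   linext (%m. mu m m3) (mu m1 m2) = linext (mu m1) (mu m2 m3)"
  and mu_lead: "box m ==> box m' ==>
   mu m m' - (if box (%i. m i + m' i) then bas (%i. m i + m' i) else 0) : Kset (%n. mwt n < mwt m + mwt m')"
  and mu_eps: "box m ==> box m' ==> lookup (mu m m') (%_. 0) = (if m = (%_. 0) & m' = (%_. 0) then 1 else 0)"
begin

definition emb :: "mono => (mono \<Rightarrow>\<^sub>0 'k) => (mono \<times> mono \<Rightarrow>\<^sub>0 'k)" where
 "emb c = linext (%m. bas (m, c))"

definition act :: "mono => (mono \<times> mono \<Rightarrow>\<^sub>0 'k) => (mono \<times> mono \<Rightarrow>\<^sub>0 'k)" where
 "act m = linext (%b. emb (snd b) (mu m (fst b)))"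

text \<open>The module homomorphism with values \<open>\<xi> c\<close> on the free generators. That
  it commutes with the action is \<open>mext_act\<close>, where associativity of \<open>mu\<close>
  enters.\<close>

definition mext :: "(mono => (mono \<times> mono \<Rightarrow>\<^sub>0 'k)) => (mono \<times> mono \<Rightarrow>\<^sub>0 'k) => (mono \<times> mono \<Rightarrow>\<^sub>0 'k)" where
 "mext \<xi> = linext (%b. act (fst b) (\<xi> (snd b)))"

lemma emb_linm: "linm (emb c)" and act_linm: "linm (act m)" and mext_linm: "linm (mext \<xi>)"
 by (simp_all add: emb_def act_def mext_def linext_linm)

lemma emb_bas [simp]: "emb c (bas m) = bas (m, c)"
 by (simp add: emb_def)

lemma act_bas: "act m (bas (m', c)) = emb c (mu m m')"
 by (simp add: act_def)

lemma mext_bas: "mext \<xi> (bas (m, c)) = act m (\<xi> c)"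
 by (simp add: mext_def)

lemma emb_Kset: "u : Kset Q ==> (!!m. Q m ==> R (m, c)) ==> emb c u : Kset R"
 by (rule linm_Kset[OF emb_linm, where Q = Q]) auto

lemma lookup_emb: "lookup (emb c u) (m, c') = (if c' = c then lookup u m else 0)"
proof -
 have "emb c u = (\<Sum>m\<in>keys u. single (m, c) (lookup u m))"
  by (simp add: emb_def linext_def)
 moreover have "lookup (\<Sum>m\<in>S. single (m, c) (lookup u m)) (m, c') =
   (if c' = c & m : S then lookup u m else 0)" if "finite S" for S
  using that by (induction S) (auto simp: lookup_add lookup_single when_def)
 ultimately show ?thesis by (auto simp: in_keys_iff)
qed

lemma act_emb: "act m (emb c u) = emb c (linext (mu m) u)"
 by (rule linm_eqI[OF linm_comp[OF act_linm emb_linm] linm_comp[OF emb_linm linext_linm]]) (simp add: act_bas)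

lemma act_act:
 assumes "box m" "box m'" "v : Wb"
 shows "act m (act m' v) = linext (%n. act n v) (mu m m')"
proof -
 have lin: "linm (%v. linext (%n. act n v) (mu m m'))"
  unfolding linm_def linext_def
  by (auto simp: linm_add[OF act_linm] linm_scl[OF act_linm] sum.distrib scl_sum mult.commute)
 show ?thesis
 proof (rule linm_eq_Kset[OF linm_comp[OF act_linm act_linm] lin assms(3)[unfolded Wb_def]])
  fix b :: "mono \<times> mono" assume b: "box (fst b)"
  obtain n c where bc: "b = (n, c)" by (cases b)
  have "act m (act m' (bas b)) = emb c (linext (mu m) (mu m' n))"
   by (simp add: bc act_bas act_emb)
  also have "\<dots> = emb c (linext (%n'. mu n' n) (mu m m'))"
   using mu_assoc[OF assms(1,2), of n] b bc by simp
  also have "\<dots> = linext (%n'. act n' (bas b)) (mu m m')"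
   by (rule linm_eqI[OF linm_comp[OF emb_linm linext_linm] linext_linm]) (simp add: bc act_bas)
  finally show "act m (act m' (bas b)) = linext (%n. act n (bas b)) (mu m m')" .
 qed
qed

lemma act_unit: "v : Wb ==> act (%_. 0) v = v"
 by (rule linm_eq_Kset[OF act_linm linm_id, unfolded Wb_def[symmetric], of v "%b. box (fst b)"])
  (auto simp: act_bas mu_unit_left Wb_def)

lemma act_gen: "box m ==> act m (bas ((%_. 0), c)) = bas (m, c)"
 by (simp add: act_bas mu_unit_right)

lemma act_Fr: "box m ==> v : Fr n ==> act m v : Fr n"
 unfolding Fr_def by (rule linm_Kset[OF act_linm, where Q = "%b. box (fst b) & deg (snd b) = n"]) (auto simp: act_bas intro!: emb_Kset[OF mu_supp])

lemma act_Wb: "box m ==> v : Wb ==> act m v : Wb"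
 unfolding Wb_def by (rule linm_Kset[OF act_linm, where Q = "%b. box (fst b)"]) (auto simp: act_bas intro!: emb_Kset[OF mu_supp])

lemma mext_gen: "\<xi> c : Wb ==> mext \<xi> (bas ((%_. 0), c)) = \<xi> c"
 by (simp add: mext_bas act_unit)

lemma mext_act:
 assumes "!!c. \<xi> c : Wb" "box m" "v : Wb"
 shows "mext \<xi> (act m v) = act m (mext \<xi> v)"
proof (rule linm_eq_Kset[OF linm_comp[OF mext_linm act_linm] linm_comp[OF act_linm mext_linm] assms(3)[unfolded Wb_def]])
 fix b :: "mono \<times> mono" assume b: "box (fst b)"
 obtain n c where bc: "b = (n, c)" by (cases b)
 have "mext \<xi> (act m (bas b)) = mext \<xi> (emb c (mu m n))" by (simp add: bc act_bas)
 also have "\<dots> = linext (%n'. act n' (\<xi> c)) (mu m n)"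
  by (rule linm_eqI[OF linm_comp[OF mext_linm emb_linm] linext_linm]) (simp add: mext_bas)
 also have "\<dots> = act m (act n (\<xi> c))" using act_act[OF assms(2) _ assms(1)] b bc by simp
 finally show "mext \<xi> (act m (bas b)) = act m (mext \<xi> (bas b))" by (simp add: bc mext_bas)
qed

lemma mext_Wb: "(!!c. \<xi> c : Wb) ==> v : Wb ==> mext \<xi> v : Wb"
 by (subst Wb_def, rule linm_Kset[OF mext_linm, of v "%b. box (fst b)"])
  (auto simp: Wb_def mext_def intro: act_Wb[unfolded Wb_def])

lemma mext_Fr: "(!!c. deg c = n ==> \<xi> c : Fr k) ==> v : Fr n ==> mext \<xi> v : Fr k"
 by (subst Fr_def, rule linm_Kset[OF mext_linm, of v "%b. box (fst b) & deg (snd b) = n"])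
  (auto simp: Fr_def mext_def intro: act_Fr[unfolded Fr_def])

text \<open>Linear maps commuting with the action that agree on the free generators agree.\<close>

lemma act_determined:
 assumes "linm f" "linm g"
  and "!!m v. box m ==> v : Wb ==> f (act m v) = act m (f v)" "!!m v. box m ==> v : Wb ==> g (act m v) = act m (g v)"
  and "!!c. deg c = n ==> f (bas ((%_. 0), c)) = g (bas ((%_. 0), c))" and "v : Fr n"
 shows "f v = g v"
proof (rule linm_eq_Kset[OF assms(1,2) assms(6)[unfolded Fr_def]])
 fix b assume b: "box (fst b) & deg (snd b) = n"
 obtain m c where bc: "b = (m, c)" by (cases b)
 have W: "bas ((%_. 0), c) : (Wb :: (_ \<Rightarrow>\<^sub>0 'k) set)" by (simp add: Wb_def)
 have m: "box m" and gb: "bas b = act m (bas ((%_. 0), c))" using b bc act_gen[of m c] by auto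
 have "f (bas b) = act m (f (bas ((%_. 0), c)))" unfolding gb by (rule assms(3)[OF m W])
 also have "\<dots> = act m (g (bas ((%_. 0), c)))" using b bc assms(5) by simp
 also have "\<dots> = g (bas b)" unfolding gb by (rule assms(4)[OF m W, symmetric])
 finally show "f (bas b) = g (bas b)" .
qed

lemma mext_mext_eq:
 assumes "!!c. \<xi>1 c : Wb" "!!c. \<xi>2 c : Wb" "!!c. \<xi>3 c : Wb" "!!c. \<xi>4 c : Wb"
  and "!!c. deg c = n ==> mext \<xi>1 (\<xi>2 c) = mext \<xi>3 (\<xi>4 c)" "v : Fr n"
 shows "mext \<xi>1 (mext \<xi>2 v) = mext \<xi>3 (mext \<xi>4 v)"
 by (rule act_determined[OF linm_comp[OF mext_linm mext_linm] linm_comp[OF mext_linm mext_linm] _ _ _ assms(6)])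
  (simp_all add: mext_act mext_Wb assms mext_gen)

lemma mext_mext_zero:
 assumes "!!c. \<xi>1 c : Wb" "!!c. \<xi>2 c : Wb"
  and "!!c. deg c = n ==> mext \<xi>1 (\<xi>2 c) = 0" "v : Fr n"
 shows "mext \<xi>1 (mext \<xi>2 v) = 0"
 by (rule act_determined[OF linm_comp[OF mext_linm mext_linm] linm_zero _ _ _ assms(4)])
  (simp_all add: mext_act mext_Wb assms mext_gen linm_0[OF act_linm])

lemma act_le:
 assumes "box m" "box m'"
 shows "act m (bas (m', c)) : Kset (%b. wt b \<le> mwt m + wt (m', c))"
proof -
 have "(if box (%i. m i + m' i) then bas (%i. m i + m' i) else 0) : (Kset (%n. mwt n \<le> mwt m + mwt m') :: (_ \<Rightarrow>\<^sub>0 'k) set)"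
  by (simp add: mwt_def algebra_simps)
 from Kset_add[OF Kset_mono[OF mu_lead[OF assms]] this] have "mu m m' : Kset (%n. mwt n \<le> mwt m + mwt m')"
  by auto
 then show ?thesis unfolding act_bas by (rule emb_Kset) (simp add: wt_def)
qed

text \<open>The action of a monomial on the associated graded module: exponents add, and an overflow
  gives zero.\<close>

definition tr :: "mono => (mono \<times> mono \<Rightarrow>\<^sub>0 'k) => (mono \<times> mono \<Rightarrow>\<^sub>0 'k)" where
 "tr m = linext (%b. if box (%i. m i + fst b i) then bas (%i. m i + fst b i, snd b) else 0)"

lemma act_lead:
 assumes "box m" "box m'"
 shows "act m (bas (m', c)) - tr m (bas (m', c)) : lowby 0 (mwt m + wt (m', c))"
proof -
 have "emb c (mu m m' - (if box (%i. m i + m' i) then bas (%i. m i + m' i) else 0)) : lowby 0 (mwt m + wt (m', c))"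
  unfolding lowby_def by (rule emb_Kset[OF mu_lead[OF assms]]) (simp add: wt_def)
 then show ?thesis by (auto simp: act_bas tr_def linm_diff[OF emb_linm] linm_0[OF emb_linm] split: if_splits)
qed

text \<open>If \<open>\<sigma>\<close> is compatible with the graded action, a leading term on the
  free generators spreads to all basis vectors: the tail of \<open>\<xi> c\<close> stays low under
  \<open>act m\<close>, and \<open>act m\<close> differs from \<open>tr m\<close> by lower terms. It
  is used for \<open>\<sigma> = D\<close> and \<open>\<sigma> = Sh i\<close>.\<close>

lemma mext_lead:
 assumes \<xi>: "\<xi> c : Wb" "\<xi> c - \<sigma> ((%_. 0), c) : lowby s (wt ((%_. 0), c))"
  and \<sigma>: "\<sigma> ((%_. 0), c) : Kset (%b. box (fst b) & wt b + s \<le> wt ((%_. 0), c))"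
  and tr: "tr m (\<sigma> ((%_. 0), c)) = \<sigma> (m, c)" and m: "box m"
 shows "mext \<xi> (bas (m, c)) - \<sigma> (m, c) : lowby s (wt (m, c))"
proof -
 let ?s0 = "\<sigma> ((%_. 0), c)"
 have wtm: "wt (m, c) = mwt m + wt ((%_. 0), c)" by (simp add: wt_def mwt_def)
 have sW: "?s0 : Wb" using \<sigma> unfolding Wb_def by (rule Kset_mono) simp
 have "act m (\<xi> c - ?s0) : lowby s (wt (m, c))"
 proof -
  have "\<xi> c - ?s0 : Kset (%b. box (fst b) & wt b + s < wt ((%_. 0), c))"
   using Kset_diff[OF \<xi>(1)[unfolded Wb_def] sW[unfolded Wb_def]] \<xi>(2) by (auto simp: lowby_def Kset_def)
  then show ?thesis unfolding lowby_def
  proof (rule linm_Kset[OF act_linm])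
   fix b assume b: "box (fst b) & wt b + s < wt ((%_. 0), c)"
   show "act m (bas b) : Kset (%b. wt b + s < wt (m, c))"
    using act_le[OF m, of "fst b" "snd b"] b wtm by (auto elim!: Kset_mono)
  qed
 qed
 moreover have "act m ?s0 - tr m ?s0 : lowby s (wt (m, c))"
  unfolding lowby_def
 proof (rule linm_Kset[OF linm_sub[OF act_linm] \<sigma>])
  show "linm (tr m)" unfolding tr_def by (rule linext_linm)
  fix b assume b: "box (fst b) & wt b + s \<le> wt ((%_. 0), c)"
  show "act m (bas b) - tr m (bas b) : Kset (%b. wt b + s < wt (m, c))"
   using act_lead[OF m, of "fst b" "snd b"] b wtm by (auto simp: lowby_def elim!: Kset_mono)
 qed
 moreover have "mext \<xi> (bas (m, c)) - \<sigma> (m, c) = act m (\<xi> c - ?s0) + (act m ?s0 - tr m ?s0)"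
  by (simp add: mext_bas tr linm_diff[OF act_linm])
 ultimately show ?thesis using Kset_add unfolding lowby_def by metis
qed

lemma tr_D: "box m ==> tr m (D ((%_. 0), c)) = D (m, c)"
proof -
 assume m: "box m"
 have "tr m (Dt i ((%_. 0), c)) = Dt i (m, c)" for i
 proof -
  have *: "(%j. m j + ((%_. 0)(i := k)) j) = m(i := m i + k)" for k by auto
  have bx: "box (m(i := m i + k)) \<longleftrightarrow> m i + k < N i" for k using m by (auto simp: box_def)
  have d0: "Dt i ((%_. 0), c) = (if 0 < c i then bas ((%_. 0)(i := stp i (c i)), c(i := c i - 1)) else (0 :: _ \<Rightarrow>\<^sub>0 'k))"
   by (simp add: Dt_def stp_lt)
  have t: "tr m (bas (m', c')) = (if box (%i. m i + m' i) then bas (%i. m i + m' i, c') else 0)" for m' c'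
   by (simp add: tr_def)
  show ?thesis
  proof (cases "0 < c i")
   case True
   have "tr m (Dt i ((%_. 0), c)) = (if m i + stp i (c i) < N i then bas (m(i := m i + stp i (c i)), c(i := c i - 1)) else 0)"
    unfolding d0 using True by (simp only: t * bx if_True)
   then show ?thesis using True by (simp add: Dt_def)
  next
   case False
   then show ?thesis unfolding d0 by (simp add: Dt_def tr_def)
  qed
 qed
 then show ?thesis by (simp add: D_def tr_def)
qed

lemma tr_Sh: "box m ==> tr m (Sh i ((%_. 0), c)) = Sh i (m, c)"
 by (simp add: Sh_def tr_def)

lemma D_mext_lead:
 assumes "dl c : Wb" "dl c - D ((%_. 0), c) : lowby 0 (wt ((%_. 0), c))" "box m"
 shows "mext dl (bas (m, c)) - D (m, c) : lowby 0 (wt (m, c))"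
proof (rule mext_lead[where \<sigma> = D and \<xi> = dl and c = c and s = 0 and m = m])
 show "dl c : Wb" "dl c - D ((%_. 0), c) : lowby 0 (wt ((%_. 0), c))" "box m" by fact+
 show "tr m (D ((%_. 0), c)) = D (m, c)" by (rule tr_D[OF assms(3)])
 show "D ((%_. 0), c) : Kset (%b. box (fst b) & wt b + 0 \<le> wt ((%_. 0), c))"
  using D_wt[of "((%_. 0), c)"] D_Fr[of "((%_. 0), c)"] by (auto simp: Kset_def)
qed

lemma Sh_mext_lead:
 assumes "\<xi> c : Wb" "\<xi> c - Sh i ((%_. 0), c) : lowby (w i * N i) (wt ((%_. 0), c))" "box m"
 shows "mext \<xi> (bas (m, c)) - Sh i (m, c) : lowby (w i * N i) (wt (m, c))"
proof (rule mext_lead[where \<sigma> = "Sh i" and \<xi> = \<xi> and c = c and s = "w i * N i" and m = m])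
 show "\<xi> c : Wb" "\<xi> c - Sh i ((%_. 0), c) : lowby (w i * N i) (wt ((%_. 0), c))" "box m" by fact+
 show "tr m (Sh i ((%_. 0), c)) = Sh i (m, c)" by (rule tr_Sh[OF assms(3)])
 show "Sh i ((%_. 0), c) : Kset (%b. box (fst b) & wt b + w i * N i \<le> wt ((%_. 0), c))"
  using Sh_wt[of i "((%_. 0), c)"] Sh_Fr[of "((%_. 0), c)" i] by (auto simp: Kset_def)
qed

lemma act_origin: "box m ==> v : Wb ==> lookup (act m v) origin = (if m = (%_. 0) then lookup v origin else 0)"
proof -
 assume m: "box m" and v: "v : Wb"
 have t: "lookup (act m (bas b)) origin = (if m = (%_. 0) & b = origin then 1 else 0)" if "box (fst b)" for b
  using mu_eps[OF m that] by (cases b) (auto simp: act_bas lookup_emb origin_def)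
 have "lookup (act m v) origin = (\<Sum>b\<in>keys v. lookup v b * (if m = (%_. 0) & b = origin then 1 else 0))"
  by (subst linm_decompose[OF act_linm]) (use v in \<open>auto simp: lookup_sum t Wb_def Kset_def intro!: sum.cong\<close>)
 also have "\<dots> = (if m = (%_. 0) then lookup v origin else 0)"
  by (auto simp: in_keys_iff if_distrib cong: if_cong)
 finally show ?thesis .
qed

lemma mext_origin:
 assumes "!!c. deg c = n ==> \<xi> c : Wb" "!!c. deg c = n ==> lookup (\<xi> c) origin = 0" "v : Fr n"
 shows "lookup (mext \<xi> v) origin = 0"
proof -
 have "mext \<xi> v : Kset (%b. b ~= origin)"
 proof (rule linm_Kset[OF mext_linm assms(3)[unfolded Fr_def]])
  fix b assume b: "box (fst b) & deg (snd b) = n"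
  then have "lookup (act (fst b) (\<xi> (snd b))) origin = 0"
   using act_origin[of "fst b" "\<xi> (snd b)"] assms by simp
  then show "mext \<xi> (bas b) : Kset (%b. b ~= origin)"
   by (cases b) (auto simp: mext_bas Kset_def in_keys_iff)
 qed
 then show ?thesis by (auto simp: Kset_def in_keys_iff)
qed

end

lemma Kset_lookup: "u : Kset Q ==> \<not> Q b ==> lookup u b = 0"
proof -
 assume "u : Kset Q" "\<not> Q b"
 then have "b \<notin> keys u" unfolding Kset_def by blast
 then show ?thesis by (simp add: in_keys_iff)
qed

lemma Kset_conj: "u : Kset Q ==> u : Kset R ==> u : Kset (%b. Q b & R b)"
 by (simp add: Kset_def)

lemma (in weights) Fr_diff: "u : Fr n ==> v : Fr n ==> u - v : Fr n"
 unfolding Fr_def by (rule Kset_diff)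

lemma (in weights) wt_pos: "0 < deg c ==> 0 < wt ((%_. 0), c)"
proof -
 assume "0 < deg c"
 then obtain i where i: "0 < c i" by (auto simp: deg_def)
 have "0 < cpos i (c i)" using cpos_stp[OF i, of i] stp_pos[of i "c i"] by simp
 then show ?thesis using w[of i] by (subst wt_slot[where i = i]) simp
qed

lemma (in weights) wt_origin: "wt origin = 0"
 by (simp add: wt_def mwt_def cwt_def cpos_def origin_def)

lemma (in weights) lookup_D_origin: "0 < deg c ==> lookup (D ((%_. 0), c)) origin = 0"
 using wt_pos[of c] wt_origin by (intro Kset_lookup[OF D_wt]) simp

lemma (in weights) lookup_Fr_origin: "v : Fr (Suc n) ==> lookup v origin = 0"
 unfolding Fr_def by (erule Kset_lookup) (simp add: origin_def deg_def)

context pbw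
begin

lemma mext_cong:
 assumes "!!c. deg c = n ==> \<xi> c = \<xi>' c" "u : Fr n"
 shows "mext \<xi> u = mext \<xi>' u"
 by (rule linm_eq_Kset[OF mext_linm mext_linm assms(2)[unfolded Fr_def]])
  (use assms(1) in \<open>auto simp: mext_def\<close>)

lemma mext_exact:
 assumes a: "!!c. a c : Wb" "!!c. deg c = n ==> a c - D ((%_. 0), c) : lowby 0 (wt ((%_. 0), c))"
  and b: "!!c. b c : Wb" "!!c. deg c = Suc n ==> b c - D ((%_. 0), c) : lowby 0 (wt ((%_. 0), c))"
  "!!c. deg c = Suc n ==> b c : Fr n" "!!c. deg c = Suc n ==> lookup (b c) origin = 0"
  and ab: "!!c. deg c = Suc n ==> mext a (b c) = 0"
  and z: "z : Fr n" "lookup z origin = 0" "mext a z = 0" "z : lowby 0 k"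
 shows "EX v. v : Fr (Suc n) & v : lowby 0 k & mext b v = z"
proof (rule exact_step[OF mext_linm mext_linm _ _ _ _ _ z])
 fix x :: "mono \<times> mono" assume "box (fst x)" "deg (snd x) = n"
 then show "mext a (bas x) - D x : lowby 0 (wt x)"
  using D_mext_lead[where dl = a and c = "snd x" and m = "fst x", OF a(1) a(2)] by simp
next
 fix x :: "mono \<times> mono" assume "box (fst x)" "deg (snd x) = Suc n"
 then show "mext b (bas x) - D x : lowby 0 (wt x)"
  using D_mext_lead[where dl = b and c = "snd x" and m = "fst x", OF b(1) b(2)] by simp
next
 fix v assume v: "v : (Fr (Suc n) :: (_ \<Rightarrow>\<^sub>0 'k) set)"
 show "mext b v : Fr n" by (rule mext_Fr[OF b(3) v])
 show "mext a (mext b v) = 0" by (rule mext_mext_zero[OF a(1) b(1) ab v])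
 show "lookup (mext b v) origin = 0" by (rule mext_origin[OF b(1) b(4) v])
qed

text \<open>Degree 1 needs no correction: the cell of a generator is sent to that generator.\<close>

definition d1 :: "mono => (mono \<times> mono \<Rightarrow>\<^sub>0 'k)" where
 "d1 c = (if deg c = 1 then D ((%_. 0), c) else 0)"

lemma D0_Fr: "D ((%_. 0), c) : Fr (deg c - 1)"
 using D_Fr[of "((%_. 0), c)"] by (simp add: Fr_def)

lemma D_deg0: "deg c = 0 ==> D (m, c) = 0"
 by (simp add: D_def Dt_def deg_def)

text \<open>Starting from a prescribed second differential, the differentials are corrected one degree at a
 time: the standard value is a cycle up to terms of lower weight, which can be lifted.\<close>

lemma resolution_exists:
 assumes dl2: "!!c. deg c = 2 ==> dl2 c : Fr 1"
   "!!c. deg c = 2 ==> dl2 c - D ((%_. 0), c) : lowby 0 (wt ((%_. 0), c))"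
   "!!c. deg c = 2 ==> mext d1 (dl2 c) = 0"
 shows "\<exists>dl. (ALL c. dl c : Fr (deg c - 1)) & (ALL c. deg c = 0 --> dl c = 0) &
  (ALL c. dl c - D ((%_. 0), c) : lowby 0 (wt ((%_. 0), c))) & (ALL c. mext dl (dl c) = 0) &
  (ALL c. lookup (dl c) origin = 0) & (ALL c. deg c = 2 --> dl c = dl2 c)"
proof -
 define ld where "ld n dl \<longleftrightarrow> (ALL c. if deg c = Suc n then dl c : Fr n & dl c - D ((%_. 0), c) : lowby 0 (wt ((%_. 0), c)) else dl c = 0)"
  for n and dl :: "mono => (mono \<times> mono \<Rightarrow>\<^sub>0 'k)"
 \<comment> \<open>Exactness at boundaries with a weight bound: a boundary of low weight bounds a
   chain that is equally low. The bound is the point, since corrections must not disturb leading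
   terms.\<close>
 define ex where "ex n dl \<longleftrightarrow> (ALL z j. z : mext dl ` Fr n --> z : lowby 0 j --> (EX v. v : Fr n & v : lowby 0 j & mext dl v = z))"
  for n and dl :: "mono => (mono \<times> mono \<Rightarrow>\<^sub>0 'k)"
 have ldW: "dl c : Wb" if "ld n dl" for n dl c
  using that[unfolded ld_def, rule_format, of c] Fr_Wb by (auto simp: Wb_def split: if_splits)
 have step: "ex (Suc (Suc n)) b" if a: "ld n a" and b: "ld (Suc n) b" and ab: "!!c. mext a (b c) = 0" for n a b
  unfolding ex_def
 proof (intro allI impI)
  fix z j assume z: "z : mext b ` Fr (Suc (Suc n))" and zl: "z : lowby 0 j"
  have bF: "b c : Fr (Suc n)" if "deg c = Suc (Suc n)" for c using b that unfolding ld_def by metis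
  obtain v where v: "v : Fr (Suc (Suc n))" "z = mext b v" using z by blast
  have zF: "z : Fr (Suc n)" unfolding v(2) by (rule mext_Fr[OF bF v(1)])
  show "EX v. v : Fr (Suc (Suc n)) & v : lowby 0 j & mext b v = z"
  proof (rule mext_exact[OF ldW[OF a] _ ldW[OF b] _ bF lookup_Fr_origin[OF bF] ab zF lookup_Fr_origin[OF zF] _ zl])
   show "a c - D ((%_. 0), c) : lowby 0 (wt ((%_. 0), c))" if "deg c = Suc n" for c
    using a that unfolding ld_def by metis
   show "b c - D ((%_. 0), c) : lowby 0 (wt ((%_. 0), c))" if "deg c = Suc (Suc n)" for c
    using b that unfolding ld_def by metis
   show "mext a z = 0" unfolding v(2) by (rule mext_mext_zero[OF ldW[OF a] ldW[OF b] ab v(1)])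
  qed
 qed
 have "D ((%_. 0), c) : (Fr 0 :: (_ \<Rightarrow>\<^sub>0 'k) set)" if "deg c = Suc 0" for c
  using D0_Fr[of c] that by simp
 then have ld1: "ld 0 d1" by (auto simp: ld_def d1_def lowby_def)
 define dl2' where "dl2' c = (if deg c = 2 then dl2 c else 0)" for c
 have ld2: "ld (Suc 0) dl2'" using dl2 by (auto simp: ld_def dl2'_def numeral_2_eq_2)
 have "EX g. ALL n. (ld (Suc n) (g n) & ex (Suc (Suc n)) (g n) & (n = 0 --> g n = dl2')) & (ALL c. mext (g n) (g (Suc n) c) = 0)"
 proof (rule dependent_nat_choice)
  have "mext d1 (dl2' c) = 0" for c using dl2(3) by (simp add: dl2'_def linm_0[OF mext_linm])
  then show "EX x. ld (Suc 0) x & ex (Suc (Suc 0)) x & (0 = (0::nat) --> x = dl2')"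
   using step[OF ld1 ld2] ld2 by blast
 next
  fix a n assume a: "ld (Suc n) a & ex (Suc (Suc n)) a & (n = 0 --> a = dl2')"
  \<comment> \<open>\<open>mext a (D c)\<close> is a boundary by its form, and it has low weight
    because \<open>D D = 0\<close>. So it also bounds a low chain \<open>v\<close>, and
    \<open>D c - v\<close> is a cycle with leading term \<open>D c\<close>, fit to be the
    differential of the cell \<open>c\<close>.\<close>
  have "EX v. v : Fr (Suc (Suc n)) & v : lowby 0 (wt ((%_. 0), c)) & mext a v = mext a (D ((%_. 0), c))"
   if c: "deg c = Suc (Suc (Suc n))" for c
  proof -
   have DF: "D ((%_. 0), c) : (Fr (Suc (Suc n)) :: (_ \<Rightarrow>\<^sub>0 'k) set)" using D0_Fr[of c] c by simp
   have "(mext a (D ((%_. 0), c)) - linext D (D ((%_. 0), c))) : lowby 0 (wt ((%_. 0), c))"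
   proof (rule linm_lowby_strict[OF linm_sub[OF mext_linm linext_linm], where Q = "%b. box (fst b) & deg (snd b) = Suc (Suc n)"])
    show "(D ((%_. 0), c) :: _ \<Rightarrow>\<^sub>0 'k) : Kset (%b. (box (fst b) & deg (snd b) = Suc (Suc n)) & wt b \<le> wt ((%_. 0), c))"
     using Kset_conj[OF DF[unfolded Fr_def] D_wt] by (rule Kset_mono) simp
    fix b :: "mono \<times> mono" assume b: "box (fst b) & deg (snd b) = Suc (Suc n)"
    have l: "a (snd b) - D ((%_. 0), snd b) : lowby 0 (wt ((%_. 0), snd b))"
     using a b unfolding ld_def by metis
    show "mext a (bas b) - linext D (bas b) : lowby 0 (wt b)"
     using D_mext_lead[where dl = a and c = "snd b" and m = "fst b", OF ldW[OF a[THEN conjunct1]] l] b by simp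
   qed
   then have "mext a (D ((%_. 0), c)) : lowby 0 (wt ((%_. 0), c))" by (simp add: D_D)
   then show ?thesis using a DF unfolding ex_def by blast
  qed
  then obtain v where v: "!!c. deg c = Suc (Suc (Suc n)) ==> v c : Fr (Suc (Suc n)) & v c : lowby 0 (wt ((%_. 0), c)) & mext a (v c) = mext a (D ((%_. 0), c))"
   by metis
  define b where "b c = (if deg c = Suc (Suc (Suc n)) then D ((%_. 0), c) - v c else 0)" for c
  have "ld (Suc (Suc n)) b" unfolding ld_def
  proof (intro allI)
   fix c
   show "if deg c = Suc (Suc (Suc n)) then b c : Fr (Suc (Suc n)) & b c - D ((%_. 0), c) : lowby 0 (wt ((%_. 0), c)) else b c = 0"
    using v[of c] D0_Fr[of c] Kset_diff[of "D ((%_. 0), c)" _ "v c"] Kset_minus[of "v c"]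
    by (auto simp: b_def Fr_def lowby_def)
  qed
  moreover have ab: "!!c. mext a (b c) = 0" using v by (simp add: b_def linm_diff[OF mext_linm] linm_0[OF mext_linm])
  ultimately show "EX y. (ld (Suc (Suc n)) y & ex (Suc (Suc (Suc n))) y & (Suc n = 0 --> y = dl2')) & (ALL c. mext a (y c) = 0)"
   using step[of "Suc n" a b] a by blast
 qed
 then obtain g where g: "!!n. ld (Suc n) (g n)" "g 0 = dl2'" "!!n c. mext (g n) (g (Suc n) c) = 0" by blast
 define dl where "dl c = (if deg c = 0 then 0 else if deg c = 1 then D ((%_. 0), c) else g (deg c - 2) c)" for c
 have del: "dl c = g n c" if "deg c = Suc (Suc n)" for n c using that by (simp add: dl_def)
 have gp: "g n c : Fr (Suc n)" "g n c - D ((%_. 0), c) : lowby 0 (wt ((%_. 0), c))" if "deg c = Suc (Suc n)" for n c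
  using g(1)[of n] that unfolding ld_def by metis+
 have 1: "dl c : Fr (deg c - 1)" and 2: "dl c - D ((%_. 0), c) : lowby 0 (wt ((%_. 0), c))"
  and 3: "mext dl (dl c) = 0" and 4: "lookup (dl c) origin = 0" for c
 proof -
  consider "deg c = 0" | "deg c = 1" | "deg c = 2" | n where "deg c = Suc (Suc (Suc n))"
   by (metis One_nat_def Suc_1 not0_implies_Suc)
  then have "dl c : Fr (deg c - 1) & dl c - D ((%_. 0), c) : lowby 0 (wt ((%_. 0), c)) & mext dl (dl c) = 0 & lookup (dl c) origin = 0"
  proof cases
   case 1
   then show ?thesis by (simp add: dl_def D_deg0 Fr_def lowby_def linm_0[OF mext_linm])
  next
   case 2
   have DF: "D ((%_. 0), c) : (Fr 0 :: (_ \<Rightarrow>\<^sub>0 'k) set)" using D0_Fr[of c] 2 by simp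
   have "mext dl (D ((%_. 0), c)) = mext (%_. 0) (D ((%_. 0), c))" by (rule mext_cong[OF _ DF]) (simp add: dl_def)
   also have "\<dots> = 0" by (simp add: mext_def linext_def linm_0[OF act_linm])
   finally show ?thesis using 2 DF lookup_D_origin[of c] by (simp add: dl_def lowby_def)
  next
   case 3
   then have d: "dl c = dl2 c" using g(2) by (simp add: dl_def dl2'_def)
   have "mext dl (dl2 c) = mext d1 (dl2 c)" by (rule mext_cong[OF _ dl2(1)[OF 3]]) (simp add: dl_def d1_def)
   then show ?thesis using 3 dl2[OF 3] d lookup_Fr_origin[of "dl2 c" 0] by simp
  next
   case (4 n)
   have "mext dl (g (Suc n) c) = mext (g n) (g (Suc n) c)" by (rule mext_cong[OF _ gp(1)[OF 4]]) (rule del)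
   then show ?thesis using 4 del[OF 4] gp[OF 4] g(3) lookup_Fr_origin[OF gp(1)[OF 4]] by simp
  qed
  then show "dl c : Fr (deg c - 1)" "dl c - D ((%_. 0), c) : lowby 0 (wt ((%_. 0), c))" "mext dl (dl c) = 0" "lookup (dl c) origin = 0"
   by auto
 qed
 have 5: "dl c = dl2 c" if "deg c = 2" for c using that g(2) by (simp add: dl_def dl2'_def)
 show ?thesis using 1 2 3 4 5 by (intro exI[of _ dl]) (simp add: dl_def)
qed

text \<open>The homomorphism to the trivial module given by a cochain. Its values lie in the
  one-dimensional space \<open>unit \<Rightarrow>\<^sub>0 'k\<close>, so that the lemmas about
  linear maps apply; \<open>ev\<close> extracts the scalar.\<close>

definition evl :: "(mono => 'k) => (mono \<times> mono \<Rightarrow>\<^sub>0 'k) => (unit \<Rightarrow>\<^sub>0 'k)" where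
 "evl a = linext (%b. if fst b = (%_. 0) then single () (a (snd b)) else 0)"

definition ev :: "(mono => 'k) => (mono \<times> mono \<Rightarrow>\<^sub>0 'k) => 'k" where
 "ev a u = lookup (evl a u) ()"

lemma evl_linm: "linm (evl a)"
 by (simp add: evl_def linext_linm)

lemma evl_ev: "evl a u = single () (ev a u)"
 by (rule poly_mapping_eqI) (simp add: ev_def lookup_single)

lemma ev_add: "ev a (u + v) = ev a u + ev a v" and ev_scl: "ev a (scl c u) = c * ev a u" and ev_0: "ev a 0 = 0"
 by (simp_all add: ev_def linm_add[OF evl_linm] linm_scl[OF evl_linm] linm_0[OF evl_linm] lookup_add)

lemma ev_bas: "ev a (bas (m, c)) = (if m = (%_. 0) then a c else 0)"
 by (simp add: ev_def evl_def)

lemma evl_bas: "evl a (bas (m, c)) = (if m = (%_. 0) then single () (a c) else 0)"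
 by (simp add: evl_def)

lemma evl_eqI:
 assumes "linm f" "u : Kset Q" "!!b. Q b ==> f (bas b) = evl a (bas b)"
 shows "f u = evl a u"
 by (rule linm_eq_Kset[OF assms(1) evl_linm assms(2,3)])

lemma evl_emb: "evl a (emb c x) = single () (a c * lookup x (%_. 0))"
proof -
 have "evl a (emb c x) = (\<Sum>m\<in>keys x. scl (lookup x m) (if m = (%_. 0) then single () (a c) else 0))"
  by (subst linm_decompose[OF linm_comp[OF evl_linm emb_linm]]) (simp add: evl_def cong: if_cong)
 also have "\<dots> = single () (a c * lookup x (%_. 0))"
  by (auto simp: if_distrib in_keys_iff mult.commute cong: if_cong)
 finally show ?thesis .
qed

lemma evl_act:
 assumes "box m" "v : Wb"
 shows "evl a (act m v) = (if m = (%_. 0) then evl a v else 0)"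
proof (rule linm_eq_Kset[OF linm_comp[OF evl_linm act_linm] _ assms(2)[unfolded Wb_def]])
 show "linm (%v. if m = (%_. 0) then evl a v else 0)"
  by (cases "m = (%_. 0)") (simp_all add: evl_linm linm_zero)
 fix b :: "mono \<times> mono" assume "box (fst b)"
 then show "evl a (act m (bas b)) = (if m = (%_. 0) then evl a (bas b) else 0)"
  by (cases b) (auto simp: act_bas evl_emb mu_eps[OF assms(1)], auto simp: evl_def)
qed

text \<open>The trivial module sees only the coefficient of the unit monomial. Pulling a cochain
  back along an extension therefore amounts to evaluating it on the values at the free
  generators.\<close>

lemma evl_mext:
 assumes "!!c. \<xi> c : Wb" "u : Wb"
 shows "evl a (mext \<xi> u) = evl (%c. ev a (\<xi> c)) u"
proof (rule evl_eqI[OF linm_comp[OF evl_linm mext_linm] assms(2)[unfolded Wb_def]])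
 fix b :: "mono \<times> mono" assume b: "box (fst b)"
 obtain m c where bc: "b = (m, c)" by (cases b)
 have "evl a (mext \<xi> (bas b)) = (if m = (%_. 0) then evl a (\<xi> c) else 0)"
  using b by (simp add: bc mext_bas evl_act assms(1))
 then show "evl a (mext \<xi> (bas b)) = evl (%c. ev a (\<xi> c)) (bas b)"
  by (simp add: bc evl_bas evl_ev[of a "\<xi> c"])
qed

lemma ev_mext: "(!!c. \<xi> c : Wb) ==> u : Wb ==> ev a (mext \<xi> u) = ev (%c. ev a (\<xi> c)) u"
 using evl_mext by (simp add: ev_def)

lemma ev_cong: "u : Fr n ==> (!!c. deg c = n ==> a c = a' c) ==> ev a u = ev a' u"
 unfolding ev_def by (rule arg_cong[where f = "%x. lookup x ()"], rule evl_eqI[OF evl_linm, where Q = "%b. box (fst b) & deg (snd b) = n"])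
  (auto simp: Fr_def evl_def)

lemma ev_zero: "ev (%_. 0) u = 0"
 by (simp add: ev_def evl_def linext_def if_distrib[of "scl _"] cong: if_cong)

lemma ev_zero_on: "u : Fr n ==> (!!c. deg c = n ==> a c = 0) ==> ev a u = 0"
 using ev_cong[of u n a "%_. 0"] ev_zero by simp

lemma ev_lin_left: "ev (%c. a c + t * a' c) u = ev a u + t * ev a' u"
proof -
 have "evl (%c. a c + t * a' c) u = evl a u + scl t (evl a' u)"
  by (rule linm_eqI[OF evl_linm linm_plus[OF evl_linm linm_scaled[OF evl_linm]]]) (auto simp: evl_def single_add)
 then show ?thesis by (simp add: ev_def lookup_add)
qed

lemma lookup_ev: "lookup u ((%_. 0), c0) = ev (%c. if c = c0 then 1 else 0) u"
proof -
 have "ev (%c. if c = c0 then 1 else 0) u = (\<Sum>b\<in>keys u. lookup u b * (if b = ((%_. 0), c0) then 1 else 0))"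
  by (auto simp: ev_def evl_def linext_def lookup_sum intro!: sum.cong)
 also have "\<dots> = lookup u ((%_. 0), c0)" by (simp add: in_keys_iff if_distrib cong: if_cong)
 finally show ?thesis by (rule sym)
qed

end

text \<open>\<open>dl_cocycle\<close> is the vanishing of the obstruction: the 2-cochain dual to the
  cell with entry 2 in slot \<open>i\<close> is zero on all 2-cycles, in particular on the
  boundaries of 3-chains, so it is a cocycle.\<close>

locale pbw_res = pbw N w mu for N w and mu :: "mono => mono => (mono \<Rightarrow>\<^sub>0 'k::field)" +
 fixes dl :: "mono => (mono \<times> mono \<Rightarrow>\<^sub>0 'k)"
 assumes dl_Fr: "dl c : Fr (deg c - 1)" and dl_0: "deg c = 0 ==> dl c = 0"
  and dl_lead: "dl c - D ((%_. 0), c) : lowby 0 (wt ((%_. 0), c))"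
  and dldl: "mext dl (dl c) = 0" and dl_origin: "lookup (dl c) origin = 0"
  and dl_cocycle: "u : Fr 2 ==> mext dl u = 0 ==> lookup u ((%_. 0), cyc (%_. 0) i) = 0"
begin

lemma dl_Wb: "dl c : Wb" by (rule Fr_Wb[OF dl_Fr])

lemma d_Fr: "u : Fr (Suc n) ==> mext dl u : Fr n"
 by (erule mext_Fr[rotated]) (metis dl_Fr diff_Suc_1)

lemma d_Fr0: "u : Fr 0 ==> mext dl u = 0"
 using mext_cong[of 0 dl "%_. 0" u] dl_0 by (simp add: mext_def linext_def linm_0[OF act_linm])

lemma dd: "u : Fr n ==> mext dl (mext dl u) = 0"
 by (rule mext_mext_zero[OF dl_Wb dl_Wb dldl])

lemma d_origin: "u : Fr n ==> lookup (mext dl u) origin = 0"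
 by (rule mext_origin[OF dl_Wb dl_origin])

lemma exact:
 assumes "z : Fr n" "lookup z origin = 0" "mext dl z = 0" "z : lowby 0 k"
 shows "EX v. v : Fr (Suc n) & v : lowby 0 k & mext dl v = z"
 by (rule mext_exact[OF dl_Wb dl_lead dl_Wb dl_lead _ dl_origin dldl assms]) (metis dl_Fr diff_Suc_1)

text \<open>Truncated subtraction does no harm: for \<open>k \<le> s\<close> both sides consist of
  the zero vector.\<close>

lemma lowby_shift: "lowby s k = lowby 0 (k - s)"
 by (auto simp: lowby_def Kset_def)

text \<open>The shift \<open>Sh i\<close> is corrected in each degree by a lift of
  \<open>d Sh - \<xi> d\<close>. This difference is low because \<open>Sh i\<close> commutes with
  \<open>D\<close>. It can be lifted if it is a cycle without origin coordinate; the latter is a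
  condition in target degree 0 only, where it follows from \<open>dl_cocycle\<close>.\<close>

lemma chi_exists:
 "\<exists>\<xi>. (ALL c. deg c < 2 --> \<xi> c = 0) & (ALL c. \<xi> c : Fr (deg c - 2)) &
  (ALL c. 2 \<le> deg c --> \<xi> c - Sh i ((%_. 0), c) : lowby (w i * N i) (wt ((%_. 0), c))) &
  (ALL c. 3 \<le> deg c --> mext dl (\<xi> c) = mext \<xi> (dl c))"
proof -
 let ?s = "w i * N i"
 define ld where "ld n \<xi> \<longleftrightarrow> (ALL c. if deg c = Suc (Suc n) then \<xi> c : Fr n & \<xi> c - Sh i ((%_. 0), c) : lowby ?s (wt ((%_. 0), c)) else \<xi> c = 0)"
  for n and \<xi> :: "mono => (mono \<times> mono \<Rightarrow>\<^sub>0 'k)"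
 \<comment> \<open>The invariant that permits the next lift: \<open>\<xi>\<close> maps boundaries to
   cycles whose origin coordinate is zero.\<close>
 define cy where "cy n \<xi> \<longleftrightarrow> (ALL u:Fr (Suc (Suc (Suc n))). mext dl (mext \<xi> (mext dl u)) = 0 & lookup (mext \<xi> (mext dl u)) origin = 0)"
  for n and \<xi> :: "mono => (mono \<times> mono \<Rightarrow>\<^sub>0 'k)"
 have ldW: "\<xi> c : Wb" if "ld n \<xi>" for n \<xi> c
  using that[unfolded ld_def, rule_format, of c] Fr_Wb by (auto simp: Wb_def split: if_splits)
 have ldF: "\<xi> c : Fr n" if "ld n \<xi>" "deg c = Suc (Suc n)" for n \<xi> c
  using that unfolding ld_def by metis
 \<comment> \<open>In degree 2 the leading term itself is taken: the cell with 2 in slot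
   \<open>i\<close> goes to the generator of degree 0, all other cells to 0.\<close>
 define x0 :: "mono => (mono \<times> mono \<Rightarrow>\<^sub>0 'k)" where "x0 c = (if c = cyc (%_. 0) i then bas origin else 0)" for c
 have base: "ld 0 x0 & cy 0 x0"
 proof
  show l: "ld 0 x0" unfolding ld_def
  proof (intro allI)
   fix c
   have dc: "deg (cyc (%_. 0) i) = Suc (Suc 0)" by (cases i) (simp_all add: cyc_def deg_def)
   show "if deg c = Suc (Suc 0) then x0 c : Fr 0 & x0 c - Sh i ((%_. 0), c) : lowby ?s (wt ((%_. 0), c)) else x0 c = 0"
   proof (cases "c = cyc (%_. 0) i")
    case True
    have "(cyc (%_. 0) i)(i := cyc (%_. 0) i i - 2) = (%_. 0)" by (auto simp: cyc_def)
    then have "Sh i ((%_. 0), c) = (bas origin :: _ \<Rightarrow>\<^sub>0 'k)"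
     unfolding True by (simp add: Sh_def origin_def) (simp add: cyc_def)
    then show ?thesis using True dc by (simp add: x0_def lowby_def Fr_def origin_def deg_def)
   next
    case False
    have "Sh i ((%_. 0), c) = (0 :: _ \<Rightarrow>\<^sub>0 'k)" if "deg c = Suc (Suc 0)"
    proof -
     have "\<not> 2 \<le> c i" using that False by (cases i) (auto simp: deg_def cyc_def mono_eq_iff)
     then show ?thesis by (simp add: Sh_def)
    qed
    then show ?thesis using False by (simp add: x0_def lowby_def Fr_def)
   qed
  qed
  show "cy 0 x0" unfolding cy_def
  proof (intro ballI conjI)
   fix u assume "u : (Fr (Suc (Suc (Suc 0))) :: (_ \<Rightarrow>\<^sub>0 'k) set)"
   then have du: "mext dl u : Fr (Suc (Suc 0))" and ddu: "mext dl (mext dl u) = 0" by (auto intro: d_Fr dd)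
   show "mext dl (mext x0 (mext dl u)) = 0" by (rule d_Fr0[OF mext_Fr[OF ldF[OF l] du]])
   have "lookup (mext x0 (mext dl u)) origin = ev (%c. if c = (%_. 0) then 1 else 0) (mext x0 (mext dl u))"
    unfolding origin_def by (rule lookup_ev)
   also have "\<dots> = ev (%c. ev (%c. if c = (%_. 0) then 1 else 0) (x0 c)) (mext dl u)"
    by (rule ev_mext[OF ldW[OF l] Fr_Wb[OF du]])
   also have "\<dots> = lookup (mext dl u) ((%_. 0), cyc (%_. 0) i)"
    unfolding lookup_ev by (rule ev_cong[OF du]) (simp add: x0_def origin_def ev_bas ev_0)
   also have "\<dots> = 0" by (rule dl_cocycle) (use du ddu in \<open>simp_all add: numeral_2_eq_2\<close>)
   finally show "lookup (mext x0 (mext dl u)) origin = 0" .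
  qed
 qed
 have "EX g. ALL n. (ld n (g n) & cy n (g n)) & (ALL c. deg c = Suc (Suc (Suc n)) --> mext dl (g (Suc n) c) = mext (g n) (dl c))"
 proof (rule dependent_nat_choice)
  show "EX x. ld 0 x & cy 0 x" using base by blast
 next
  fix a n assume a: "ld n a & cy n a"
  then have ald: "ld n a" and acy: "cy n a" by auto
  have "EX v. v : Fr (Suc n) & v : lowby ?s (wt ((%_. 0), c)) & mext dl v = mext dl (Sh i ((%_. 0), c)) - mext a (dl c)"
   if c: "deg c = Suc (Suc (Suc n))" for c
  proof -
   let ?k = "wt ((%_. 0), c)"
   let ?b = "bas ((%_. 0), c) :: _ \<Rightarrow>\<^sub>0 'k"
   let ?S = "Sh i ((%_. 0), c)"
   have bF: "?b : Fr (Suc (Suc (Suc n)))" using c by (simp add: Fr_bas)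
   have db: "mext dl ?b = dl c" by (rule mext_gen[OF dl_Wb])
   have SF: "?S : Fr (Suc n)" using Sh_Fr[of "((%_. 0), c)" i] c by (simp add: Fr_def)
   have dlF: "dl c : Fr (Suc (Suc n))" using dl_Fr[of c] c by simp
   let ?z = "mext dl ?S - mext a (dl c)"
   have zF: "?z : Fr n" by (rule Fr_diff[OF d_Fr[OF SF] mext_Fr[OF ldF[OF ald] dlF]])
   have dz: "mext dl ?z = 0" using acy bF db dd[OF SF] unfolding cy_def by (auto simp: linm_diff[OF mext_linm])
   have oz: "lookup ?z origin = 0" using acy bF db d_origin[OF SF] unfolding cy_def by (auto simp: lookup_minus)
   have 1: "mext dl ?S - linext D ?S : lowby ?s ?k"
   proof -
    have "?S : Kset (%b. box (fst b) & wt b + ?s = ?k)"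
     using Kset_conj[OF SF[unfolded Fr_def] Sh_wt] by (rule Kset_mono) simp
    then show ?thesis unfolding lowby_def
    proof (rule linm_Kset[OF linm_sub[OF mext_linm linext_linm]])
     fix b :: "mono \<times> mono" assume b: "box (fst b) & wt b + ?s = ?k"
     show "mext dl (bas b) - linext D (bas b) : Kset (%b. wt b + ?s < ?k)"
      by (rule Kset_mono[of _ "%b'. wt b' + 0 < wt b"])
       (use D_mext_lead[where dl = dl and m = "fst b" and c = "snd b", OF dl_Wb dl_lead] b in \<open>auto simp: lowby_def\<close>)
    qed
   qed
   have al: "mext a (bas b) - Sh i b : lowby ?s (wt b)" if "box (fst b)" "deg (snd b) = Suc (Suc n)" for b
   proof -
    have "a (snd b) - Sh i ((%_. 0), snd b) : lowby ?s (wt ((%_. 0), snd b))"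
     using ald that unfolding ld_def by metis
    from Sh_mext_lead[where \<xi> = a and c = "snd b" and i = i and m = "fst b", OF ldW[OF ald] this that(1)]
    show ?thesis by simp
   qed
   have 2: "mext a (dl c) - linext (Sh i) (dl c) : lowby ?s ?k"
   proof (rule linm_lowby_strict[OF linm_sub[OF mext_linm linext_linm], where Q = "%b. box (fst b) & deg (snd b) = Suc (Suc n)"])
    have "dl c - D ((%_. 0), c) + D ((%_. 0), c) : Kset (%b. wt b \<le> ?k)"
     by (rule Kset_add) (use dl_lead[of c] D_wt[of "((%_. 0), c)"] in \<open>auto simp: lowby_def elim!: Kset_mono\<close>)
    then show "dl c : Kset (%b. (box (fst b) & deg (snd b) = Suc (Suc n)) & wt b \<le> ?k)"
     using Kset_conj[OF dlF[unfolded Fr_def]] by simp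
    fix b :: "mono \<times> mono" assume "box (fst b) & deg (snd b) = Suc (Suc n)"
    then show "mext a (bas b) - linext (Sh i) (bas b) : lowby ?s (wt b)" using al by simp
   qed
   have 3: "linext (Sh i) (dl c) - linext (Sh i) (D ((%_. 0), c)) : lowby ?s ?k"
   proof -
    have "linext (Sh i) (dl c - D ((%_. 0), c)) : lowby ?s ?k"
     by (rule linm_lowby[OF linext_linm _ dl_lead, where Q = "%_. True" and s' = 0])
      (simp add: Kset_def, simp add: Kset_mono[OF Sh_wt], simp)
    then show ?thesis by simp
   qed
   have "?z = (mext dl ?S - linext D ?S) - (mext a (dl c) - linext (Sh i) (dl c))
     - (linext (Sh i) (dl c) - linext (Sh i) (D ((%_. 0), c)))"
    by (simp add: Sh_D_commute)
   also have "\<dots> : lowby ?s ?k"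
    using Kset_diff[OF Kset_diff[OF 1[unfolded lowby_def] 2[unfolded lowby_def]] 3[unfolded lowby_def]]
    unfolding lowby_def .
   finally have "?z : lowby 0 (?k - ?s)" by (simp add: lowby_shift[symmetric])
   from exact[OF zF oz dz this] show ?thesis by (simp add: lowby_shift[symmetric])
  qed
  then obtain v where v: "!!c. deg c = Suc (Suc (Suc n)) ==> v c : Fr (Suc n) & v c : lowby ?s (wt ((%_. 0), c)) &
    mext dl (v c) = mext dl (Sh i ((%_. 0), c)) - mext a (dl c)"
   by metis
  define b where "b c = (if deg c = Suc (Suc (Suc n)) then Sh i ((%_. 0), c) - v c else 0)" for c
  have bld: "ld (Suc n) b" unfolding ld_def
  proof (intro allI)
   fix c
   show "if deg c = Suc (Suc (Suc n)) then b c : Fr (Suc n) & b c - Sh i ((%_. 0), c) : lowby ?s (wt ((%_. 0), c)) else b c = 0"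
    using v[of c] Sh_Fr[of "((%_. 0), c)" i] Kset_diff[of "Sh i ((%_. 0), c)" _ "v c"] Kset_minus[of "v c"]
    by (auto simp: b_def Fr_def lowby_def)
  qed
  have bd: "mext dl (b c) = mext a (dl c)" if "deg c = Suc (Suc (Suc n))" for c
   using v[OF that] that by (simp add: b_def linm_diff[OF mext_linm])
  have "cy (Suc n) b" unfolding cy_def
  proof (intro ballI conjI)
   fix u assume "u : (Fr (Suc (Suc (Suc (Suc n)))) :: (_ \<Rightarrow>\<^sub>0 'k) set)"
   then have du: "mext dl u : Fr (Suc (Suc (Suc n)))" and ddu: "mext dl (mext dl u) = 0" by (auto intro: d_Fr dd)
   have "mext dl (mext b (mext dl u)) = mext a (mext dl (mext dl u))"
    by (rule mext_mext_eq[OF dl_Wb ldW[OF bld] ldW[OF ald] dl_Wb bd du])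
   then show "mext dl (mext b (mext dl u)) = 0" by (simp add: ddu linm_0[OF mext_linm])
   show "lookup (mext b (mext dl u)) origin = 0"
    by (rule lookup_Fr_origin[OF mext_Fr[OF ldF[OF bld] du]])
  qed
  then show "EX y. (ld (Suc n) y & cy (Suc n) y) & (ALL c. deg c = Suc (Suc (Suc n)) --> mext dl (y c) = mext a (dl c))"
   using bld bd by blast
 qed
 then obtain g where g: "!!n. ld n (g n)" "!!n c. deg c = Suc (Suc (Suc n)) ==> mext dl (g (Suc n) c) = mext (g n) (dl c)" by blast
 define \<xi> where "\<xi> c = (if deg c < 2 then 0 else g (deg c - 2) c)" for c
 have xg: "\<xi> c = g n c" if "deg c = Suc (Suc n)" for n c using that by (simp add: \<xi>_def)
 show ?thesis
 proof (intro exI[of _ \<xi>] conjI allI impI)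
  fix c
  show "deg c < 2 ==> \<xi> c = 0" by (simp add: \<xi>_def)
  show "\<xi> c : Fr (deg c - 2)"
  proof (cases "deg c < 2")
   case False
   then have "deg c = Suc (Suc (deg c - 2))" by simp
   then show ?thesis using xg ldF[OF g(1)] by metis
  qed (simp add: \<xi>_def Fr_def)
  show "\<xi> c - Sh i ((%_. 0), c) : lowby ?s (wt ((%_. 0), c))" if "2 \<le> deg c"
  proof -
   from that have "deg c = Suc (Suc (deg c - 2))" by simp
   then show ?thesis using xg g(1)[of "deg c - 2"] unfolding ld_def by metis
  qed
  show "mext dl (\<xi> c) = mext \<xi> (dl c)" if "3 \<le> deg c"
  proof -
   define n where "n = deg c - 3"
   have c: "deg c = Suc (Suc (Suc n))" using that by (simp add: n_def)
   have "mext \<xi> (dl c) = mext (g n) (dl c)"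
    by (rule mext_cong[of "Suc (Suc n)"]) (use dl_Fr[of c] c xg in auto)
   then show ?thesis using xg[OF c] g(2)[OF c] by simp
  qed
 qed
qed

end

section \<open>Leading cells, elimination and Dickson's lemma with parities\<close>

section \<open>Leading terms of cocycles\<close>

context weights
begin

text \<open>Weight decides first; the lexicographic part only makes the order total. The leading
  cell of a cochain is the smallest cell of its support, dually to chains, whose leading terms have
  the largest weight: lower terms of a chain map reappear, after pulling back, at heavier
  cells.\<close>

definition klt :: "mono => mono => bool" where
 "klt c c' \<longleftrightarrow> cwt c < cwt c' \<or> cwt c = cwt c' &
   (c PH < c' PH \<or> c PH = c' PH & (c PX < c' PX \<or> c PX = c' PX & c PY < c' PY))"

lemma klt_trans: "klt a b ==> klt b c ==> klt a c"
 unfolding klt_def by linarith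

lemma klt_irrefl: "\<not> klt a a"
 by (simp add: klt_def)

lemma klt_total: "a ~= b ==> klt a b \<or> klt b a"
 unfolding klt_def mono_eq_iff by linarith

lemma cwt_cyc: "cwt (cyc c i) = cwt c + w i * N i"
 using cpos_2[of "c i + 2" i] by (cases i) (simp_all add: cwt_def cyc_def algebra_simps)

lemma klt_cyc: "klt c c' ==> klt (cyc c i) (cyc c' i)"
 unfolding klt_def cwt_cyc by (cases i) (auto simp: cyc_def)

lemma deg_cyc: "deg (cyc c i) = deg c + 2"
 by (cases i) (simp_all add: cyc_def deg_def)

definition isl :: "(mono => 'k::field) => mono => bool" where
 "isl a c \<longleftrightarrow> a c ~= 0 & (ALL c'. a c' ~= 0 --> c' = c \<or> klt c c')"

lemma finite_deg: "finite {c. deg c = n}"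
proof (rule finite_surj)
 show "finite ({..n} \<times> {..n} \<times> {..n})" by simp
 show "{c. deg c = n} \<subseteq> (%(x, y, z) i. case i of PH => x | PX => y | PY => z) ` ({..n} \<times> {..n} \<times> {..n})"
 proof
  fix c assume "c : {c. deg c = n}"
  then have "(c PH, c PX, c PY) : {..n} \<times> {..n} \<times> {..n}" by (auto simp: deg_def)
  moreover have "c = (%(x, y, z) i. case i of PH => x | PX => y | PY => z) (c PH, c PX, c PY)"
   by (simp add: mono_eq_iff)
  ultimately show "c : (%(x, y, z) i. case i of PH => x | PX => y | PY => z) ` ({..n} \<times> {..n} \<times> {..n})"
   by (rule rev_image_eqI)
 qed
qed

lemma isl_exists:
 assumes "!!c. deg c ~= n ==> a c = 0" "a c0 ~= 0"
 shows "EX c. isl a c & deg c = n"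
proof -
 have "finite {c. a c ~= 0}" by (rule finite_subset[OF _ finite_deg[of n]]) (use assms in auto)
 moreover have "EX m:S. ALL c:S. c = m \<or> klt m c" if "finite S" "S ~= {}" for S
  using that
 proof (induction S rule: finite_ne_induct)
  case (insert x F)
  then obtain m where m: "m : F" "!!c. c : F ==> c = m \<or> klt m c" by blast
  show ?case
  proof (cases "klt x m")
   case True
   then show ?thesis using m klt_trans by (intro bexI[of _ x]) auto
  next
   case False
   then show ?thesis using m klt_total[of x m] by (intro bexI[of _ m]) auto
  qed
 qed auto
 ultimately obtain m where "m : {c. a c ~= 0}" "ALL c:{c. a c ~= 0}. c = m \<or> klt m c" using assms(2) by blast
 then show ?thesis using assms(1) unfolding isl_def by blast
qed

text \<open>Gaussian elimination. Subtracting a multiple of an element of \<open>S\<close> with the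
  same leading cell pushes the leading cell of \<open>a\<close> up. The measure counts the cells of
  degree \<open>n\<close> lying at or above some cell of the support, so it drops.\<close>

lemma lead_span:
 fixes V S :: "(mono => 'k::field) set"
 assumes V: "!!a c. a : V ==> deg c ~= n ==> a c = 0"
  and Vlin: "!!a b t. a : V ==> b : V ==> (%c. a c + t * b c) : V"
  and SV: "S \<subseteq> V" and S0: "(%_. 0) : S" and Slin: "!!a b t. a : S ==> b : S ==> (%c. a c + t * b c) : S"
  and lead: "!!a c. a : V ==> isl a c ==> EX b:S. isl b c"
 shows "V \<subseteq> S"
proof
 fix a assume "a : V"
 then show "a : S"
 proof (induction "card {c. deg c = n & (EX c'. a c' ~= 0 & (c' = c \<or> klt c' c))}" arbitrary: a rule: less_induct)
  case less
  show ?case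
  proof (cases "EX c. a c ~= 0")
   case False
   then have "a = (%_. 0)" by auto
   then show ?thesis using S0 by simp
  next
   case True
   then obtain c where c: "isl a c" "deg c = n" using isl_exists[of n a] V[OF less.prems] by blast
   then obtain b where b: "b : S" "isl b c" using lead less.prems by blast
   define t where "t = - (a c / b c)"
   let ?a = "%x. a x + t * b x"
   have bc: "b c ~= 0" using b by (simp add: isl_def)
   have aV: "?a : V" using Vlin[OF less.prems] b SV by blast
   have az: "?a c = 0" using bc by (simp add: t_def)
   have al: "klt c x" if "?a x ~= 0" for x
   proof -
    have "a x ~= 0 \<or> b x ~= 0" "x ~= c" using that az by auto
    then show ?thesis using c(1) b(2) by (auto simp: isl_def)
   qed
   let ?T = "%a. {c. deg c = n & (EX c'. a c' ~= 0 & (c' = c \<or> klt c' c))}"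
   have "?T ?a \<subset> ?T a"
   proof
    show "?T ?a \<subseteq> ?T a"
    proof
     fix x assume "x : ?T ?a"
     then obtain c' where "?a c' ~= 0" "c' = x \<or> klt c' x" "deg x = n" by blast
     then have "klt c x" using al klt_trans by blast
     then show "x : ?T a" using c \<open>deg x = n\<close> unfolding isl_def by blast
    qed
    have "c \<notin> ?T ?a" using al klt_trans klt_irrefl by blast
    moreover have "c : ?T a" using c unfolding isl_def by blast
    ultimately show "?T ?a ~= ?T a" by blast
   qed
   then have "card (?T ?a) < card (?T a)"
    by (rule psubset_card_mono[rotated]) (rule finite_subset[OF _ finite_deg[of n]], blast)
   then have "?a : S" by (rule less.hyps[OF _ aV])
   from Slin[OF this b(1), of "- t"] show ?thesis by (simp add: fun_eq_iff)
  qed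
 qed
qed

end

text \<open>Some subsequence is monotone. If it does not increase, it attains its minimum and is
  constant from there on, so a tail of it is still nondecreasing.\<close>

lemma nat_mono_subseq: "\<exists>g :: nat => nat. strict_mono g & mono (%n. (s :: nat => nat) (g n))"
proof -
 obtain g :: "nat => nat" where g: "strict_mono g" "monoseq (%n. s (g n))" using seq_monosub[of s] by blast
 show ?thesis
 proof (cases "ALL m. \<forall>n\<ge>m. s (g m) \<le> s (g n)")
  case True
  then show ?thesis using g(1) by (intro exI[of _ g]) (auto simp: mono_def)
 next
  case False
  then have dec: "!!m n. m \<le> n ==> s (g n) \<le> s (g m)" using g(2) by (auto simp: monoseq_def)
  define v where "v = (LEAST v. v : range (%n. s (g n)))"
  have "v : range (%n. s (g n))" unfolding v_def by (rule LeastI[of _ "s (g 0)"]) simp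
  then obtain k where k: "v = s (g k)" by blast
  have min: "v \<le> s (g n)" for n unfolding v_def by (rule Least_le) simp
  have "s (g (n + k)) = v" for n using dec[of k "n + k"] min[of "n + k"] k by simp
  then show ?thesis using g(1)
   by (intro exI[of _ "%n. g (n + k)"]) (auto simp: mono_def strict_mono_def)
 qed
qed

lemma common_mono_subseq: "\<exists>g :: nat => nat. strict_mono g & (ALL s:set ss. mono (%n. (s :: nat => nat) (g n)))"
proof (induction ss)
 case Nil
 show ?case by (intro exI[of _ "%n. n"]) (simp add: strict_mono_def)
next
 case (Cons s ss)
 then obtain g :: "nat => nat" where g: "strict_mono g" "ALL s:set ss. mono (%n. s (g n))" by blast
 obtain h :: "nat => nat" where h: "strict_mono h" "mono (%n. s (g (h n)))" using nat_mono_subseq[of "%n. s (g n)"] by blast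
 have "mono h" by (rule strict_mono_mono[OF h(1)])
 then have "ALL s:set (s # ss). mono (%n. s (g (h n)))" using g(2) h(2) by (auto simp: mono_def)
 moreover have "strict_mono (%n. g (h n))" using g(1) h(1) by (simp add: strict_mono_def)
 ultimately show ?case by blast
qed

text \<open>Pass to a subsequence along which the three exponents and their three parities are
  nondecreasing. The parities sum to at most 3, so among its first five terms two consecutive ones
  have equal sums, hence equal parities; these two are comparable with even differences.\<close>

lemma dickson:
 assumes "infinite (B :: mono set)"
 shows "EX c:B. EX c':B. c ~= c' & (ALL i. c i \<le> c' i & even (c' i - c i))"
proof -
 obtain f :: "nat => mono" where f: "inj f" "range f \<subseteq> B" using infinite_countable_subset[OF assms] by blast
 obtain g :: "nat => nat" where g: "strict_mono g" "ALL s:set [%n. f n PH, %n. f n PX, %n. f n PY, %n. f n PH mod 2, %n. f n PX mod 2, %n. f n PY mod 2].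
   mono (%n. (s :: nat => nat) (g n))" using common_mono_subseq by blast
 then have m: "mono (%n. f (g n) i)" and p: "mono (%n. f (g n) i mod 2)" for i by (cases i; simp)+
 define r where "r n = f (g n) PH mod 2 + f (g n) PX mod 2 + f (g n) PY mod 2" for n
 have rm: "r n \<le> r (Suc n)" for n using p[THEN monoD, of n "Suc n"] unfolding r_def by (intro add_mono) auto
 have "r 4 \<le> 3" unfolding r_def
  using mod_less_divisor[of 2 "f (g 4) PH"] mod_less_divisor[of 2 "f (g 4) PX"] mod_less_divisor[of 2 "f (g 4) PY"] by linarith
 then have "EX n. r (Suc n) = r n"
  using rm[of 0] rm[of 1] rm[of 2] rm[of 3] by (simp add: eval_nat_numeral) (metis (no_types, lifting) le_antisym not_less_eq_eq order_trans le_SucE le_0_eq le_zero_eq)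
 then obtain n where n: "r (Suc n) = r n" by blast
 have 1: "f (g (Suc n)) i mod 2 = f (g n) i mod 2" for i
  using n p[THEN monoD, of n "Suc n" PH] p[THEN monoD, of n "Suc n" PX] p[THEN monoD, of n "Suc n" PY]
  unfolding r_def by (cases i; simp)
 have 2: "f (g n) i \<le> f (g (Suc n)) i" for i using m[THEN monoD, of n "Suc n"] by simp
 have 3: "even (b - a)" if "b mod 2 = a mod 2" "a \<le> b" for a b :: nat
  using that by presburger
 have 4: "f (g n) ~= f (g (Suc n))"
  using f(1) g(1) by (metis injD lessI less_irrefl strict_monoD)
 have 5: "f (g k) : B" for k using f(2) by blast
 show ?thesis
  by (rule bexI[OF _ 5[of n]], rule bexI[OF _ 5[of "Suc n"]]) (intro conjI allI 4 2 3[OF 1 2])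
qed

locale pbw_chi = pbw_res N w mu dl for N w and mu :: "mono => mono => (mono \<Rightarrow>\<^sub>0 'k::field)" and dl +
 fixes \<xi> :: "pbw_gen => mono => (mono \<times> mono \<Rightarrow>\<^sub>0 'k)"
 assumes \<xi>_0: "deg c < 2 ==> \<xi> i c = 0" and \<xi>_Fr: "\<xi> i c : Fr (deg c - 2)"
  and \<xi>_lead: "2 \<le> deg c ==> \<xi> i c - Sh i ((%_. 0), c) : lowby (w i * N i) (wt ((%_. 0), c))"
  and dl\<xi>: "3 \<le> deg c ==> mext dl (\<xi> i c) = mext (\<xi> i) (dl c)"
begin

lemma \<xi>_Wb: "\<xi> i c : Wb" by (rule Fr_Wb[OF \<xi>_Fr])

definition Zc :: "nat => (mono => 'k) set" where
 "Zc n = {a. (ALL c. deg c ~= n --> a c = 0) & (ALL c. deg c = Suc n --> ev a (dl c) = 0)}"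

text \<open>On cochains, the multiplication by the class of degree 2 that belongs to slot
  \<open>i\<close>.\<close>

definition pbk :: "pbw_gen => (mono => 'k) => mono => 'k" where
 "pbk i a c = ev a (\<xi> i c)"

lemma Zc_off: "a : Zc n ==> deg c ~= n ==> a c = 0"
 by (simp add: Zc_def)

lemma Zc_lin: "a : Zc n ==> b : Zc n ==> (%c. a c + t * b c) : Zc n"
 by (simp add: Zc_def ev_lin_left)

lemma Zc_0: "(%_. 0) : Zc n"
 by (simp add: Zc_def ev_zero)

lemma pbk_off: "(!!c. deg c ~= n ==> a c = 0) ==> deg c ~= Suc (Suc n) ==> pbk i a c = 0"
proof (cases "deg c < 2")
 case True
 then show ?thesis by (simp add: pbk_def \<xi>_0 ev_0)
next
 case False
 assume "!!c. deg c ~= n ==> a c = 0" "deg c ~= Suc (Suc n)"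
 with False show ?thesis unfolding pbk_def by (intro ev_zero_on[OF \<xi>_Fr]) auto
qed

lemma pbk_Zc: "a : Zc n ==> pbk i a : Zc (Suc (Suc n))"
proof -
 assume a: "a : Zc n"
 have "ev (pbk i a) (dl c) = 0" if c: "deg c = Suc (Suc (Suc n))" for c
 proof -
  have "ev (pbk i a) (dl c) = ev a (mext (\<xi> i) (dl c))"
   unfolding pbk_def[abs_def] by (rule ev_mext[OF \<xi>_Wb dl_Wb, symmetric])
  also have "\<dots> = ev a (mext dl (\<xi> i c))" using c by (simp add: dl\<xi>)
  also have "\<dots> = ev (%c. ev a (dl c)) (\<xi> i c)" by (rule ev_mext[OF dl_Wb \<xi>_Wb])
  also have "\<dots> = 0" by (rule ev_zero_on[of _ "Suc n"]) (use \<xi>_Fr[of i c] c a in \<open>simp_all add: Zc_def\<close>)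
  finally show ?thesis .
 qed
 then show ?thesis using pbk_off[of n a] Zc_off[OF a] by (simp add: Zc_def)
qed

text \<open>A deviation from the plain shift stems from the tail of \<open>\<xi> i c'\<close>, whose
  cells are lighter than \<open>cwt c' - w i * N i\<close>. If
  \<open>cwt c' \<le> cwt c + w i * N i\<close>, they are lighter than the leading cell of
  \<open>a\<close>, and \<open>a\<close> vanishes on them.\<close>

lemma pbk_value:
 assumes "isl a c" "2 \<le> deg c'" "pbk i a c' ~= (if 2 \<le> c' i then a (c'(i := c' i - 2)) else 0)"
 shows "cwt c + w i * N i < cwt c'"
proof (rule ccontr)
 assume n: "\<not> cwt c + w i * N i < cwt c'"
 have "ev a (\<xi> i c' - Sh i ((%_. 0), c')) = 0"
 proof -
  have "evl a (\<xi> i c' - Sh i ((%_. 0), c')) = evl (%_. 0) (\<xi> i c' - Sh i ((%_. 0), c'))"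
  proof (rule evl_eqI[OF evl_linm \<xi>_lead[OF assms(2), unfolded lowby_def]])
   fix b assume b: "wt b + w i * N i < wt ((%_. 0), c')"
   obtain m c'' where bb: "b = (m, c'')" by (cases b)
   have "a c'' = 0" if "m = (%_. 0)"
   proof (rule ccontr)
    assume "a c'' ~= 0"
    then have "cwt c \<le> cwt c''" using assms(1) by (auto simp: isl_def klt_def)
    then show False using b n that by (simp add: bb wt_def mwt_def)
   qed
   then show "evl a (bas b) = evl (%_. 0) (bas b)" by (simp add: bb evl_bas)
  qed
  then show ?thesis using ev_zero by (simp add: ev_def)
 qed
 moreover have "ev a (\<xi> i c') = ev a (\<xi> i c' - Sh i ((%_. 0), c')) + ev a (Sh i ((%_. 0), c'))"
  by (simp flip: ev_add)
 ultimately show False using assms(3) by (simp add: pbk_def Sh_def ev_bas ev_0 split: if_splits)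
qed

text \<open>By \<open>pbk_value\<close>, deviations from the plain shift occur only at cells heavier
  than \<open>cyc c i\<close>; elsewhere the support is the shifted one, and shifting preserves the
  order.\<close>

lemma pbk_lead:
 assumes l: "isl a c"
 shows "isl (pbk i a) (cyc c i)"
 unfolding isl_def
proof (intro conjI allI impI)
 have cc: "(cyc c i)(i := cyc c i i - 2) = c" "2 \<le> cyc c i i" by (auto simp: cyc_def)
 have "pbk i a (cyc c i) = (if 2 \<le> cyc c i i then a ((cyc c i)(i := cyc c i i - 2)) else 0)"
  using pbk_value[OF l, of "cyc c i" i] by (rule_tac ccontr) (simp add: deg_cyc cwt_cyc)
 then show "pbk i a (cyc c i) ~= 0" using cc l by (simp add: isl_def)
 fix c' assume nz: "pbk i a c' ~= 0"
 have d: "2 \<le> deg c'"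
 proof (rule ccontr)
  assume "\<not> 2 \<le> deg c'"
  then show False using nz \<xi>_0[of c' i] by (simp add: pbk_def ev_0)
 qed
 show "c' = cyc c i \<or> klt (cyc c i) c'"
 proof (cases "pbk i a c' = (if 2 \<le> c' i then a (c'(i := c' i - 2)) else 0)")
  case True
  then have 2: "2 \<le> c' i" "a (c'(i := c' i - 2)) ~= 0" using nz by (auto split: if_splits)
  have c': "cyc (c'(i := c' i - 2)) i = c'" using 2(1) by (simp add: cyc_def fun_upd_idem_iff)
  have "c'(i := c' i - 2) = c \<or> klt c (c'(i := c' i - 2))" using l 2(2) by (auto simp: isl_def)
  then show ?thesis using klt_cyc[of c "c'(i := c' i - 2)" i] c' by auto
 next
  case False
  from pbk_value[OF l d False] show ?thesis by (simp add: klt_def cwt_cyc)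
 qed
qed

definition Lead :: "mono set" where "Lead = {c. EX a:Zc (deg c). isl a c}"

lemma isl_deg: "a : Zc n ==> isl a c ==> deg c = n"
 using Zc_off by (auto simp: isl_def)

lemma Lead_cyc: "c : Lead ==> cyc c i : Lead"
 unfolding Lead_def using pbk_Zc pbk_lead by (fastforce simp: deg_cyc)

text \<open>Leading cells are closed under shifts by 2. Those that are not themselves shifts of
  leading cells form a finite set: of two comparable ones with even differences, the larger would be
  a shift of a leading cell. Any bound above their degrees serves.\<close>

lemma Lead_bound: "EX b. ALL c:Lead. b \<le> deg c --> (EX i. EX c':Lead. c = cyc c' i)"
proof -
 define B where "B = {c : Lead. \<not> (EX i. EX c':Lead. c = cyc c' i)}"
 have up: "(%i. c i + 2 * k i) : Lead" if "c : Lead" for c k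
 proof -
  have H: "(%j. c j + (if j = i then 2 * n else 0)) : Lead" if "c : Lead" for c i n
  proof (induction n)
   case 0
   have "(%j. c j + (if j = i then 2 * 0 else 0)) = c" by auto
   then show ?case using that by simp
  next
   case (Suc n)
   then have "cyc (%j. c j + (if j = i then 2 * n else 0)) i : Lead" by (intro Lead_cyc) simp
   moreover have "cyc (%j. c j + (if j = i then 2 * n else 0)) i = (%j. c j + (if j = i then 2 * Suc n else 0))"
    by (auto simp: cyc_def)
   ultimately show ?case by simp
  qed
  from H[OF H[OF H[OF that, of PH "k PH"], of PX "k PX"], of PY "k PY"]
  show ?thesis
   by (rule back_subst[where P = "%c. c : Lead"]) (simp add: mono_eq_iff)
 qed
 have "finite B"
 proof (rule ccontr)
  assume "infinite B"
  then obtain c c' where c: "c : B" "c' : B" "c ~= c'" "!!i. c i \<le> c' i" "!!i. even (c' i - c i)"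
   using dickson by metis
  define k where "k i = (c' i - c i) div 2" for i
  have k: "c' i = c i + 2 * k i" for i using c(4,5)[of i] by (simp add: k_def)
  obtain i where i: "0 < k i" using c(3) k by (metis add.right_neutral ext gr0I mult_0_right)
  have "(%j. c j + 2 * (k(i := k i - 1)) j) : Lead" using up c(1) by (simp add: B_def)
  moreover have "c' = cyc (%j. c j + 2 * (k(i := k i - 1)) j) i"
   using i k by (auto simp: cyc_def fun_eq_iff)
  ultimately show False using c(2) by (auto simp: B_def)
 qed
 then have "finite (deg ` B)" by simp
 then obtain b where b: "!!c. c : B ==> deg c < b" by (auto simp: finite_nat_set_iff_bounded)
 have "EX i. EX c':Lead. c = cyc c' i" if "c : Lead" "b \<le> deg c" for c
  using b[of c] that by (auto simp: B_def)
 then show ?thesis by blast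
qed

text \<open>In large degree a leading cell is \<open>cyc c' i\<close> with \<open>c'\<close> leading
  for some cocycle; pulling that cocycle back along \<open>\<xi> i\<close> produces the required
  leading cell. \<open>lead_span\<close> turns this into equality of spaces.\<close>

lemma cocycles_fg:
 "EX b. ALL n a. b \<le> Suc (Suc n) --> a : Zc (Suc (Suc n)) -->
   (EX as. (ALL i. as i : Zc n) & (ALL c. a c = pbk PH (as PH) c + pbk PX (as PX) c + pbk PY (as PY) c))"
proof -
 obtain b where b: "!!c. c : Lead ==> b \<le> deg c ==> EX i. EX c':Lead. c = cyc c' i"
  using Lead_bound by blast
 show ?thesis
 proof (intro exI[of _ b] allI impI)
  fix n a assume n: "b \<le> Suc (Suc n)" and a: "a : Zc (Suc (Suc n))"
  define S where "S = {a. EX as. (ALL i. as i : Zc n) & a = (%c. pbk PH (as PH) c + pbk PX (as PX) c + pbk PY (as PY) c)}"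
  have pl: "pbk i (%c. a c + t * b c) x = pbk i a x + t * pbk i b x" for i a b t x
   by (simp add: pbk_def ev_lin_left)
  have p0: "pbk i (%_. 0) x = 0" for i x by (simp add: pbk_def ev_zero)
  have "Zc (Suc (Suc n)) \<subseteq> S"
  proof (rule lead_span[where V = "Zc (Suc (Suc n))" and n = "Suc (Suc n)" and S = S])
   show "a c = 0" if "a : Zc (Suc (Suc n))" "deg c ~= Suc (Suc n)" for a c using Zc_off that by blast
   show "(%c. a c + t * b c) : Zc (Suc (Suc n))" if "a : Zc (Suc (Suc n))" "b : Zc (Suc (Suc n))" for a b t
    using Zc_lin that by blast
  next
   show "S \<subseteq> Zc (Suc (Suc n))"
   proof
    fix a assume "a : S"
    then obtain as where as: "!!i. as i : Zc n" "a = (%c. pbk PH (as PH) c + pbk PX (as PX) c + pbk PY (as PY) c)"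
     by (auto simp: S_def)
    from Zc_lin[OF Zc_lin[OF pbk_Zc[OF as(1)] pbk_Zc[OF as(1)], of PH PH 1 PX PX] pbk_Zc[OF as(1)], of 1 PY PY]
    show "a : Zc (Suc (Suc n))" by (simp add: as(2))
   qed
   show "(%_. 0) : S" unfolding S_def using Zc_0 p0 by (intro CollectI exI[of _ "%_ _. 0"]) simp
   fix a' b' t assume "a' : S" "b' : S"
   then obtain as bs where "!!i. as i : Zc n" "!!i. bs i : Zc n"
    "a' = (%c. pbk PH (as PH) c + pbk PX (as PX) c + pbk PY (as PY) c)"
    "b' = (%c. pbk PH (bs PH) c + pbk PX (bs PX) c + pbk PY (bs PY) c)"
    by (auto simp: S_def)
   then show "(%c. a' c + t * b' c) : S" unfolding S_def
    by (intro CollectI exI[of _ "%i c. as i c + t * bs i c"]) (auto simp: pl Zc_lin algebra_simps)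
  next
   fix a' c assume a': "a' : Zc (Suc (Suc n))" and l: "isl a' c"
   have dc: "deg c = Suc (Suc n)" by (rule isl_deg[OF a' l])
   then have "c : Lead" using a' l by (auto simp: Lead_def)
   then obtain i c' where c': "c' : Lead" "c = cyc c' i" using b n dc by metis
   then obtain a'' where a'': "a'' : Zc n" "isl a'' c'" using dc by (auto simp: Lead_def deg_cyc)
   have "pbk i a'' : S" unfolding S_def
    by (intro CollectI exI[of _ "%j. if j = i then a'' else (%_. 0)"]) (cases i; simp add: a'' Zc_0 p0)
   moreover have "isl (pbk i a'') c" unfolding c'(2) by (rule pbk_lead[OF a''(2)])
   ultimately show "EX b:S. isl b c" by blast
  qed
  then show "EX as. (ALL i. as i : Zc n) & (ALL c. a c = pbk PH (as PH) c + pbk PX (as PX) c + pbk PY (as PY) c)"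
   using a by (auto simp: S_def)
 qed
qed

text \<open>One cocycle for each leading cell suffices by elimination, and a degree has finitely
  many cells.\<close>

lemma Zc_finite_span: "EX T. finite T & T \<subseteq> Zc n & (ALL a:Zc n. EX t. a = (%c. \<Sum>b\<in>T. t b * b c))"
proof -
 have "ALL c. EX a. c : Lead --> a : Zc (deg c) & isl a c" by (auto simp: Lead_def)
 then obtain f where f: "!!c. c : Lead ==> f c : Zc (deg c) & isl (f c) c" by metis
 define T where "T = f ` {c : Lead. deg c = n}"
 have fin: "finite T" unfolding T_def by (intro finite_imageI finite_subset[OF _ finite_deg[of n]]) auto
 have TZ: "T \<subseteq> Zc n" unfolding T_def using f by auto
 define S where "S = {a. EX t. a = (%c. \<Sum>b\<in>T. t b * b c)}"
 have Zsum: "(%c. \<Sum>b\<in>T'. t b * b c) : Zc n" if "finite T'" "T' \<subseteq> Zc n" for T' t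
  using that
 proof (induction T')
  case empty
  then show ?case by (simp add: Zc_0)
 next
  case (insert b T')
  from Zc_lin[of "%c. \<Sum>b\<in>T'. t b * b c" n b "t b"] insert show ?case by (simp add: add.commute)
 qed
 have "Zc n \<subseteq> S"
 proof (rule lead_span[where V = "Zc n" and n = n and S = S])
  show "a c = 0" if "a : Zc n" "deg c ~= n" for a c using Zc_off that by blast
  show "(%c. a c + t * b c) : Zc n" if "a : Zc n" "b : Zc n" for a b t
   using Zc_lin that by blast
 next
  show "S \<subseteq> Zc n" unfolding S_def using Zsum[OF fin TZ] by auto
  show "(%_. 0) : S" unfolding S_def by (intro CollectI exI[of _ "%_. 0"]) simp
  fix a b t assume "a : S" "b : S"
  then obtain s s' where "a = (%c. \<Sum>b\<in>T. s b * b c)" "b = (%c. \<Sum>b\<in>T. s' b * b c)" by (auto simp: S_def)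
  then show "(%c. a c + t * b c) : S" unfolding S_def
   by (intro CollectI exI[of _ "%b. s b + t * s' b"]) (simp add: algebra_simps sum.distrib sum_distrib_left)
 next
  fix a c assume a: "a : Zc n" and l: "isl a c"
  have dc: "deg c = n" by (rule isl_deg[OF a l])
  then have c: "c : Lead" using a l by (auto simp: Lead_def)
  have "f c : S" unfolding S_def
  proof (intro CollectI exI[of _ "%b. if b = f c then 1 else 0"] ext)
   have "f c : T" unfolding T_def using c dc by blast
   then show "f c x = (\<Sum>b\<in>T. (if b = f c then 1 else 0) * b x)" for x
    using fin by (simp add: if_distrib[of "%x. x * _"] cong: if_cong)
  qed
  then show "EX b:S. isl b c" using f[OF c] by blast
 qed
 then show ?thesis using fin TZ by (intro exI[of _ T]) (auto simp: S_def)
qed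

end

section \<open>The resolution as modules over the abstract algebra\<close>

section \<open>Finite generation from a PBW basis\<close>

lemma Kset_induct [consumes 1, case_names zero single add]:
 assumes u: "u : Kset Q" and 0: "P 0" and s: "!!b t. Q b ==> P (single b t)"
  and a: "!!u v. u : Kset Q ==> v : Kset Q ==> P u ==> P v ==> P (u + v)"
 shows "P u"
proof -
 have "P (\<Sum>b\<in>S. scl (lookup u b) (bas b)) & (\<Sum>b\<in>S. scl (lookup u b) (bas b)) : Kset Q"
  if "finite S" "!!b. b : S ==> Q b" for S
  using that
 proof (induction S)
  case (insert b S)
  have Qb: "Q b" using insert by simp
  have "P (\<Sum>b\<in>S. scl (lookup u b) (bas b))" "(\<Sum>b\<in>S. scl (lookup u b) (bas b)) : Kset Q"
   using insert by auto
  then show ?case using insert.hyps a[OF Kset_single[of Q b "lookup u b", OF Qb] _ s[OF Qb]] Kset_add[OF Kset_single[of Q b "lookup u b", OF Qb]]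
   by simp
 qed (simp add: 0)
 note * = this
 show ?thesis
  by (subst decompose, rule *[THEN conjunct1]) (use u in \<open>auto simp: Kset_def\<close>)
qed

text \<open>This ties an abstract ring to the structure constants \<open>mu\<close> by a coordinate
  map \<open>kp\<close>. All constructions so far live in coordinates, while the theorem speaks
  about modules over the ring itself.\<close>

locale pbw_coords = pbw N w mu for N w and mu :: "mono => mono => (mono \<Rightarrow>\<^sub>0 'k::field)" +
 fixes A :: "('a, 'r) ring_scheme" and \<epsilon> :: "'a => 'k" and kp :: "'a => (mono \<Rightarrow>\<^sub>0 'k)"
 assumes A: "ring A" and kp_bij: "bij_betw kp (carrier A) (Kset box)"
  and kp_add: "a : carrier A ==> b : carrier A ==> kp (a \<oplus>\<^bsub>A\<^esub> b) = kp a + kp b"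
  and kp_mult: "a : carrier A ==> b : carrier A ==> kp (a \<otimes>\<^bsub>A\<^esub> b) = linext (%m. linext (mu m) (kp b)) (kp a)"
  and kp_one: "kp \<one>\<^bsub>A\<^esub> = bas (%_. 0)"
  and \<epsilon>_coord: "a : carrier A ==> \<epsilon> a = lookup (kp a) (%_. 0)"
begin

lemma kp_box: "a : carrier A ==> kp a : Kset box"
 using kp_bij by (auto simp: bij_betw_def)

lemma kp_inj: "a : carrier A ==> b : carrier A ==> kp a = kp b ==> a = b"
 using kp_bij by (auto simp: bij_betw_def inj_on_def)

definition kpi :: "(mono \<Rightarrow>\<^sub>0 'k) => 'a" where "kpi = the_inv_into (carrier A) kp"

lemma kpi: "u : Kset box ==> kpi u : carrier A" "u : Kset box ==> kp (kpi u) = u"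
 using kp_bij the_inv_into_into[of kp "carrier A" u "carrier A"] f_the_inv_into_f[of kp "carrier A" u]
 by (auto simp: bij_betw_def kpi_def)

lemma kp_zero: "kp \<zero>\<^bsub>A\<^esub> = 0"
proof -
 interpret ring A by (rule A)
 show ?thesis using kp_add[of "\<zero>\<^bsub>A\<^esub>" "\<zero>\<^bsub>A\<^esub>"] by simp
qed

lemma kpi_zero: "kpi 0 = \<zero>\<^bsub>A\<^esub>" and kpi_one: "kpi (bas (%_. 0)) = \<one>\<^bsub>A\<^esub>"
proof -
 interpret ring A by (rule A)
 show "kpi 0 = \<zero>\<^bsub>A\<^esub>" by (rule kp_inj) (simp_all add: kpi kp_zero)
 show "kpi (bas (%_. 0)) = \<one>\<^bsub>A\<^esub>" by (rule kp_inj) (simp_all add: kpi kp_one)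
qed

lemma trivial_left_module: "left_module A (trivial_module \<epsilon>)"
proof -
 interpret ring A by (rule A)
 have e: "\<epsilon> (a \<otimes>\<^bsub>A\<^esub> b) = \<epsilon> a * \<epsilon> b" if a: "a : carrier A" and b: "b : carrier A" for a b
 proof -
  have 1: "lookup (linext (mu m) v) (%_. 0) = (if m = (%_. 0) then lookup v (%_. 0) else 0)"
   if m: "box m" and v: "v : Kset box" for m v
   using v by (induction v rule: Kset_induct) (auto simp: mu_eps[OF m] lookup_add lookup_single when_def)
  have 2: "lookup (linext (%m. linext (mu m) v) u) (%_. 0) = lookup u (%_. 0) * lookup v (%_. 0)"
   if u: "u : Kset box" and v: "v : Kset box" for u v
   using u by (induction u rule: Kset_induct) (auto simp: 1[OF _ v] lookup_add lookup_single when_def algebra_simps)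
  show ?thesis using a b by (simp add: \<epsilon>_coord kp_mult 2 kp_box)
 qed
 have e_add: "\<epsilon> (a \<oplus>\<^bsub>A\<^esub> b) = \<epsilon> a + \<epsilon> b" if "a : carrier A" "b : carrier A" for a b
  using that by (simp add: \<epsilon>_coord kp_add lookup_add)
 have e_one: "\<epsilon> \<one>\<^bsub>A\<^esub> = 1" by (simp add: \<epsilon>_coord kp_one)
 show ?thesis
  by (intro left_module.intro left_module_axioms.intro abelian_groupI A)
   (auto simp: e e_add e_one algebra_simps intro: exI[of _ "- x" for x])
qed

definition smul :: "'a => (mono \<times> mono \<Rightarrow>\<^sub>0 'k) => (mono \<times> mono \<Rightarrow>\<^sub>0 'k)" where
 "smul a y = linext (%m. act m y) (kp a)"

lemma linm_act_arg: "linm (%y. linext (%m. act m y) x)"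
 unfolding linm_def linext_def
 by (auto simp: linm_add[OF act_linm] linm_scl[OF act_linm] sum.distrib scl_sum mult.commute)

lemma smul_linm: "linm (smul a)"
 unfolding smul_def[abs_def] by (rule linm_act_arg)

lemma smul_Fr: "a : carrier A ==> y : Fr n ==> smul a y : Fr n"
 unfolding smul_def by (subst Fr_def, rule linm_Kset[OF linext_linm kp_box])
  (use act_Fr in \<open>auto simp: Fr_def\<close>)

lemma smul_smul:
 assumes a: "a : carrier A" and b: "b : carrier A" and y: "y : Wb"
 shows "smul (a \<otimes>\<^bsub>A\<^esub> b) y = smul a (smul b y)"
proof -
 have "linext (%n. act n y) (linext (%m. linext (mu m) (kp b)) u) = linext (%m. act m (linext (%n. act n y) (kp b))) u"
  if u: "u : Kset box" for u
 proof (rule linm_eq_Kset[OF linm_comp[OF linext_linm linext_linm] linext_linm u])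
  fix m assume m: "box m"
  have "linext (%n. act n y) (linext (mu m) (kp b)) = act m (linext (%n. act n y) (kp b))"
   by (rule linm_eq_Kset[OF linm_comp[OF linext_linm linext_linm] linm_comp[OF act_linm linext_linm] kp_box[OF b]])
    (simp add: act_act[OF m _ y])
  then show "linext (%n. act n y) (linext (%m. linext (mu m) (kp b)) (bas m)) = linext (%m. act m (linext (%n. act n y) (kp b))) (bas m)"
   by simp
 qed
 from this[OF kp_box[OF a]] show ?thesis by (simp add: smul_def kp_mult[OF a b])
qed

definition FM :: "nat => ('a, mono \<times> mono \<Rightarrow>\<^sub>0 'k) module" where
 "FM n = \<lparr>carrier = Fr n, mult = undefined, one = undefined, zero = 0, add = (+), smult = smul\<rparr>"

lemma FM_simps [simp]: "carrier (FM n) = Fr n" "\<zero>\<^bsub>FM n\<^esub> = 0" "u \<oplus>\<^bsub>FM n\<^esub> v = u + v" "a \<odot>\<^bsub>FM n\<^esub> u = smul a u"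
 by (simp_all add: FM_def)

lemma Fr_add: "u : Fr n ==> v : Fr n ==> u + v : Fr n" and Fr_minus: "u : Fr n ==> - u : Fr n"
 and Fr_0: "0 : Fr n" and Fr_scl: "u : Fr n ==> scl t u : Fr n"
 by (simp_all add: Fr_def Kset_add Kset_minus Kset_scl)

lemma FM_left_module: "left_module A (FM n)"
proof (intro left_module.intro left_module_axioms.intro abelian_groupI A)
 fix u v x assume u: "u : carrier (FM n)" and v: "v : carrier (FM n)" and x: "x : carrier (FM n)"
 show "u \<oplus>\<^bsub>FM n\<^esub> v : carrier (FM n)" using u v by (simp add: Fr_add)
 show "u \<oplus>\<^bsub>FM n\<^esub> v \<oplus>\<^bsub>FM n\<^esub> x = u \<oplus>\<^bsub>FM n\<^esub> (v \<oplus>\<^bsub>FM n\<^esub> x)" by (simp add: add.assoc)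
 show "u \<oplus>\<^bsub>FM n\<^esub> v = v \<oplus>\<^bsub>FM n\<^esub> u" by (simp add: add.commute)
 show "\<zero>\<^bsub>FM n\<^esub> \<oplus>\<^bsub>FM n\<^esub> u = u" by simp
 show "EX y:carrier (FM n). y \<oplus>\<^bsub>FM n\<^esub> u = \<zero>\<^bsub>FM n\<^esub>" using u by (intro bexI[of _ "- u"]) (simp_all add: Fr_minus)
 show "\<one>\<^bsub>A\<^esub> \<odot>\<^bsub>FM n\<^esub> u = u" using u act_unit[OF Fr_Wb, of u n] by (simp add: smul_def kp_one)
 fix a b assume a: "a : carrier A" and b: "b : carrier A"
 show "a \<odot>\<^bsub>FM n\<^esub> u : carrier (FM n)" using a u by (simp add: smul_Fr)
 show "(a \<oplus>\<^bsub>A\<^esub> b) \<odot>\<^bsub>FM n\<^esub> u = a \<odot>\<^bsub>FM n\<^esub> u \<oplus>\<^bsub>FM n\<^esub> b \<odot>\<^bsub>FM n\<^esub> u"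
  using a b by (simp add: smul_def kp_add)
 show "a \<odot>\<^bsub>FM n\<^esub> (u \<oplus>\<^bsub>FM n\<^esub> v) = a \<odot>\<^bsub>FM n\<^esub> u \<oplus>\<^bsub>FM n\<^esub> a \<odot>\<^bsub>FM n\<^esub> v"
  by (simp add: linm_add[OF smul_linm])
 show "a \<otimes>\<^bsub>A\<^esub> b \<odot>\<^bsub>FM n\<^esub> u = a \<odot>\<^bsub>FM n\<^esub> (b \<odot>\<^bsub>FM n\<^esub> u)"
  using smul_smul[OF a b Fr_Wb, of u n] u by simp
qed (simp_all add: Fr_0)

lemma single_smul:
 assumes "box m"
 shows "single (m, c) t = smul (kpi (single m t)) (bas ((%_. 0), c))"
 using assms by (simp add: smul_def kpi Kset_single act_gen)

lemma Fr_induct [consumes 1, case_names zero gen add]: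
 assumes u: "u : Fr n" and 0: "P 0" and g: "!!a c. a : carrier A ==> deg c = n ==> P (smul a (bas ((%_. 0), c)))"
  and a: "!!u v. u : Fr n ==> v : Fr n ==> P u ==> P v ==> P (u + v)"
 shows "P u"
 using u unfolding Fr_def
proof (induction rule: Kset_induct)
 case (single b t)
 then show ?case using single_smul[of "fst b" "snd b" t] g[OF kpi(1)[OF Kset_single]] by simp
qed (use 0 a in \<open>auto simp: Fr_def\<close>)

lemma bas_Fr: "deg c = n ==> bas ((%_. 0), c) : Fr n"
 by (simp add: Fr_bas)

lemma hom_determined:
 assumes M: "left_module A M" and f: "f : module_hom A (FM n) M" and g: "g : module_hom A (FM n) M"
  and fg: "!!c. deg c = n ==> f (bas ((%_. 0), c)) = g (bas ((%_. 0), c))" and u: "u : Fr n"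
 shows "f u = g u"
 using u
proof (induction rule: Fr_induct)
 case zero
 then show ?case using module_hom_zero[OF FM_left_module M f] module_hom_zero[OF FM_left_module M g] by simp
next
 case (gen a c)
 then show ?case using module_hom_smult[OF f gen(1), of "bas ((%_. 0), c)"] module_hom_smult[OF g gen(1), of "bas ((%_. 0), c)"]
  by (simp add: bas_Fr fg)
next
 case (add u v)
 then show ?case using module_hom_add[OF f, of u v] module_hom_add[OF g, of u v] by simp
qed

definition comp :: "mono => (mono \<times> mono \<Rightarrow>\<^sub>0 'k) => (mono \<Rightarrow>\<^sub>0 'k)" where
 "comp c = linext (%b. if snd b = c then bas (fst b) else 0)"

lemma comp_linm: "linm (comp c)" by (simp add: comp_def linext_linm)

lemma comp_box: "y : Fr n ==> comp c y : Kset box"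
 unfolding Fr_def by (rule linm_Kset[OF comp_linm, where Q = "%b. box (fst b) & deg (snd b) = n"]) (auto simp: comp_def)

lemma comp_off: "y : Fr n ==> deg c ~= n ==> comp c y = 0"
 by (rule linm_eq_Kset[OF comp_linm linm_zero, of y "%b. box (fst b) & deg (snd b) = n"]) (auto simp: Fr_def comp_def)

lemma comp_emb: "comp c (emb c' x) = (if c' = c then x else 0)"
 by (rule linm_eqI[OF linm_comp[OF comp_linm emb_linm], of "%x. if c' = c then x else 0"])
  (auto simp: linm_def comp_def)

lemma comp_act: "comp c (act m y) = linext (mu m) (comp c y)"
 by (rule linm_eqI[OF linm_comp[OF comp_linm act_linm] linm_comp[OF linext_linm comp_linm]])
  (auto simp: act_def comp_emb, auto simp: comp_def)

lemma comp_smul: "comp c (smul a y) = linext (%m. linext (mu m) (comp c y)) (kp a)"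
 unfolding smul_def
 by (rule linm_eqI[OF linm_comp[OF comp_linm linext_linm] linext_linm]) (simp add: comp_act)

text \<open>\<open>FM n\<close> is free on the cells of degree \<open>n\<close>. The component maps
  identify it with \<open>free_module\<close>, and the section and retraction obtained in this way
  transfer the lifting property.\<close>

lemma FM_lifts:
 assumes Y: "left_module A Y" and Z: "left_module A Z"
 shows "lifts_along A (FM n) Y Z"
proof -
 interpret A: ring A by (rule A)
 let ?X = "{c. deg c = n}"
 let ?L = "free_module A ?X"
 let ?r = "restrict (free_ev A (FM n) (%c. bas ((%_. 0), c))) (carrier ?L)"
 let ?s = "\<lambda>y\<in>carrier (FM n). %c. kpi (comp c y)"
 have r: "?r : module_hom A ?L (FM n)"
  by (rule free_ev_hom[OF A FM_left_module]) (simp add: bas_Fr)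
 have i_add: "kpi (u + v) = kpi u \<oplus>\<^bsub>A\<^esub> kpi v" if "u : Kset box" "v : Kset box" for u v
  by (rule kp_inj) (use that in \<open>simp_all add: kpi Kset_add kp_add\<close>)
 have i_smul: "kpi (linext (%m. linext (mu m) u) (kp a)) = a \<otimes>\<^bsub>A\<^esub> kpi u" if u: "u : Kset box" and a: "a : carrier A" for u a
 proof -
  have "kp (a \<otimes>\<^bsub>A\<^esub> kpi u) = linext (%m. linext (mu m) u) (kp a)" using u a by (simp add: kp_mult kpi)
  then show ?thesis using kp_box[of "a \<otimes>\<^bsub>A\<^esub> kpi u"] u a by (intro kp_inj) (auto simp: kpi)
 qed
 have s: "?s : module_hom A (FM n) ?L"
 proof (rule module_hom_restrictI[OF FM_left_module])
  fix u assume u: "u : carrier (FM n)"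
  have "{x. kpi (comp x u) ~= \<zero>\<^bsub>A\<^esub>} \<subseteq> ?X"
  proof (intro subsetI CollectI, rule ccontr)
   fix x assume "x : {x. kpi (comp x u) ~= \<zero>\<^bsub>A\<^esub>}" "deg x ~= n"
   then show False using comp_off[of u n x] u by (simp add: kpi_zero)
  qed
  then show "(%c. kpi (comp c u)) : carrier ?L"
   using u finite_subset[OF _ finite_deg[of n]] by (auto simp: free_module_def kpi comp_box)
  show "(%c. kpi (comp c (u \<oplus>\<^bsub>FM n\<^esub> v))) = (%c. kpi (comp c u)) \<oplus>\<^bsub>?L\<^esub> (%c. kpi (comp c v))"
   if "v : carrier (FM n)" for v
   using u that by (auto simp: free_module_def linm_add[OF comp_linm] i_add comp_box)
  show "(%c. kpi (comp c (a \<odot>\<^bsub>FM n\<^esub> u))) = a \<odot>\<^bsub>?L\<^esub> (%c. kpi (comp c u))" if "a : carrier A" for a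
   using u that by (auto simp: free_module_def comp_smul i_smul comp_box)
 qed
 have rs: "?r (?s y) = y" if y: "y : carrier (FM n)" for y
 proof -
  have id: "(\<lambda>y\<in>carrier (FM n). y) : module_hom A (FM n) (FM n)"
   by (rule module_hom_restrictI[OF FM_left_module]) auto
  have "compose (carrier (FM n)) ?r ?s y = (\<lambda>y\<in>carrier (FM n). y) y"
  proof (rule hom_determined[OF FM_left_module module_hom_compose[OF FM_left_module s r] id])
   fix c assume c: "deg c = n"
   have "(%c'. kpi (comp c' (bas ((%_. 0), c)))) = free_unit A c"
    by (auto simp: comp_def free_unit_def kpi_one kpi_zero)
   then show "compose (carrier (FM n)) ?r ?s (bas ((%_. 0), c)) = (\<lambda>y\<in>carrier (FM n). y) (bas ((%_. 0), c))"
    using free_ev_unit[OF A FM_left_module[of n], of ?X "%c. bas ((%_. 0), c)" c] c free_unit_closed[OF A, of c ?X]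
    by (simp add: compose_eq bas_Fr)
  qed (use y in simp)
  then show ?thesis using y by (simp add: compose_eq)
 qed
 show ?thesis
 proof (rule lifts_along_retract[where L = ?L and r = ?r and s = ?s])
  show "lifts_along A ?L Y Z" by (rule lifts_along_free[OF A Y Z])
  show "left_module A ?L" by (rule free_module_left_module[OF A])
 qed (use FM_left_module r s rs in blast)+
qed

end

locale pbw_fg = pbw_coords N w mu A \<epsilon> kp + pbw_chi N w mu dl \<xi>
 for N w and mu :: "mono => mono => (mono \<Rightarrow>\<^sub>0 'k::field)" and A :: "('a, 'r) ring_scheme" and \<epsilon> kp dl \<xi>
begin

lemma mext_smul:
 assumes "!!c. \<xi>' c : Wb" "a : carrier A" "u : Wb"
 shows "mext \<xi>' (smul a u) = smul a (mext \<xi>' u)"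
proof -
 have "mext \<xi>' (linext (%m. act m u) x) = linext (%m. act m (mext \<xi>' u)) x" if "x : Kset box" for x
  by (rule linm_eq_Kset[OF linm_comp[OF mext_linm linext_linm] linext_linm that]) (simp add: mext_act assms)
 then show ?thesis using kp_box[OF assms(2)] by (simp add: smul_def)
qed

lemma mext_hom:
 assumes "!!c. \<xi>' c : Wb" "!!u. u : Fr n ==> mext \<xi>' u : Fr k"
 shows "restrict (mext \<xi>') (Fr n) : module_hom A (FM n) (FM k)"
 using module_hom_restrictI[OF FM_left_module, of n "mext \<xi>'" "FM k"] assms
 by (simp add: linm_add[OF mext_linm] mext_smul[OF assms(1) _ Fr_Wb])

lemma ev_smul:
 assumes "s : carrier A" "u : Wb"
 shows "ev a (smul s u) = \<epsilon> s * ev a u"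
proof -
 have "evl a (linext (%m. act m u) x) = scl (lookup x (%_. 0)) (evl a u)" if "x : Kset box" for x
  using that by (induction rule: Kset_induct)
   (auto simp: linm_0[OF evl_linm] linm_scl[OF evl_linm] linm_add[OF evl_linm] evl_act[OF _ assms(2)] lookup_add
    lookup_single when_def scl_add_left)
 then show ?thesis using kp_box[OF assms(1)] by (simp add: smul_def ev_def \<epsilon>_coord[OF assms(1)])
qed

lemma ev_hom: "restrict (ev a) (Fr n) : module_hom A (FM n) (trivial_module \<epsilon>)"
 using module_hom_restrictI[OF FM_left_module, of n "ev a" "trivial_module \<epsilon>"]
 by (simp add: ev_add ev_smul[OF _ Fr_Wb])

definition DM :: "nat => (mono \<times> mono \<Rightarrow>\<^sub>0 'k) => (mono \<times> mono \<Rightarrow>\<^sub>0 'k)" where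
 "DM n = restrict (mext dl) (Fr (Suc n))"

definition \<theta>M :: "(mono \<times> mono \<Rightarrow>\<^sub>0 'k) => 'k" where
 "\<theta>M = restrict (ev (%c. if c = (%_. 0) then 1 else 0)) (Fr 0)"

lemma \<theta>M_lookup: "u : Fr 0 ==> \<theta>M u = lookup u origin"
 by (simp add: \<theta>M_def origin_def lookup_ev)

lemma lowby_all: "EX k. u : lowby 0 k"
proof -
 have "finite (wt ` keys u)" by simp
 then obtain k where "!!x. x : wt ` keys u ==> x < k" by (auto simp: finite_nat_set_iff_bounded)
 then show ?thesis by (auto simp: lowby_def Kset_def)
qed

lemma exact': "z : Fr n ==> lookup z origin = 0 ==> mext dl z = 0 ==> EX v:Fr (Suc n). mext dl v = z"
 using exact lowby_all by blast

lemma FM_exact: "exact_resolution A (trivial_module \<epsilon>) FM DM \<theta>M"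
 unfolding exact_resolution_def
proof (intro conjI allI)
 show "left_module A (FM n)" for n by (rule FM_left_module)
 show "DM n : module_hom A (FM (Suc n)) (FM n)" for n
  unfolding DM_def by (rule mext_hom[OF dl_Wb d_Fr])
 show "\<theta>M : module_hom A (FM 0) (trivial_module \<epsilon>)" unfolding \<theta>M_def by (rule ev_hom)
 show "\<theta>M ` carrier (FM 0) = carrier (trivial_module \<epsilon>)"
 proof -
  have "t : \<theta>M ` Fr 0" for t
  proof (rule image_eqI)
   show "single origin t : Fr 0" by (simp add: Fr_def Kset_single origin_def deg_def)
   then show "t = \<theta>M (single origin t)" by (simp add: \<theta>M_lookup)
  qed
  then show ?thesis by auto
 qed
 show "DM 0 ` carrier (FM 1) = {u : carrier (FM 0). \<theta>M u = \<zero>\<^bsub>trivial_module \<epsilon>\<^esub>}"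
 proof
  show "DM 0 ` carrier (FM 1) \<subseteq> {u : carrier (FM 0). \<theta>M u = \<zero>\<^bsub>trivial_module \<epsilon>\<^esub>}"
   using d_Fr[of _ 0] d_origin by (auto simp: DM_def \<theta>M_lookup)
  show "{u : carrier (FM 0). \<theta>M u = \<zero>\<^bsub>trivial_module \<epsilon>\<^esub>} \<subseteq> DM 0 ` carrier (FM 1)"
  proof
   fix u assume "u : {u : carrier (FM 0). \<theta>M u = \<zero>\<^bsub>trivial_module \<epsilon>\<^esub>}"
   then have u: "u : Fr 0" "lookup u origin = 0" by (auto simp: \<theta>M_lookup)
   then obtain v where "v : Fr (Suc 0)" "mext dl v = u" using exact' d_Fr0 by blast
   then show "u : DM 0 ` carrier (FM 1)" by (intro image_eqI[of _ _ v]) (auto simp: DM_def)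
  qed
 qed
 fix n
 show "DM (Suc n) ` carrier (FM (Suc (Suc n))) = {u : carrier (FM (Suc n)). DM n u = \<zero>\<^bsub>FM n\<^esub>}"
 proof
  show "DM (Suc n) ` carrier (FM (Suc (Suc n))) \<subseteq> {u : carrier (FM (Suc n)). DM n u = \<zero>\<^bsub>FM n\<^esub>}"
   using d_Fr[of _ "Suc n"] dd by (auto simp: DM_def)
  show "{u : carrier (FM (Suc n)). DM n u = \<zero>\<^bsub>FM n\<^esub>} \<subseteq> DM (Suc n) ` carrier (FM (Suc (Suc n)))"
  proof
   fix u assume "u : {u : carrier (FM (Suc n)). DM n u = \<zero>\<^bsub>FM n\<^esub>}"
   then have u: "u : Fr (Suc n)" "mext dl u = 0" by (auto simp: DM_def)
   then obtain v where "v : Fr (Suc (Suc n))" "mext dl v = u" using exact' lookup_Fr_origin by blast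
   then show "u : DM (Suc n) ` carrier (FM (Suc (Suc n)))" by (intro image_eqI[of _ _ v]) (auto simp: DM_def)
  qed
 qed
qed

lemma ev_Zc_cocycle:
 assumes a: "a : Zc n"
 shows "restrict (ev a) (Fr n) : cocycles A \<epsilon> FM DM n"
proof -
 have "ev a (mext dl u) = 0" if u: "u : Fr (Suc n)" for u
 proof -
  have "ev a (mext dl u) = ev (%c. ev a (dl c)) u" by (rule ev_mext[OF dl_Wb Fr_Wb[OF u]])
  also have "\<dots> = 0" by (rule ev_zero_on[OF u]) (use a in \<open>simp add: Zc_def\<close>)
  finally show ?thesis .
 qed
 then show ?thesis using ev_hom d_Fr by (auto simp: cocycles_def DM_def)
qed

lemma cocycle_ev:
 assumes z: "z : cocycles A \<epsilon> FM DM n"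
 shows "EX a:Zc n. ALL u:Fr n. z u = ev a u"
proof -
 define a where "a c = (if deg c = n then z (bas ((%_. 0), c)) else 0)" for c
 have zh: "z : module_hom A (FM n) (trivial_module \<epsilon>)" and zd: "!!u. u : Fr (Suc n) ==> z (mext dl u) = 0"
  using z by (auto simp: cocycles_def DM_def)
 have za: "z u = ev a u" if u: "u : Fr n" for u
 proof -
  have "z u = restrict (ev a) (Fr n) u"
   by (rule hom_determined[OF trivial_left_module zh ev_hom _ u]) (simp add: Fr_bas ev_bas a_def)
  then show ?thesis using u by simp
 qed
 moreover have "a : Zc n"
 proof -
  have "ev a (dl c) = 0" if c: "deg c = Suc n" for c
  proof -
   have "dl c : Fr n" using dl_Fr[of c] c by simp
   then have "ev a (dl c) = z (dl c)" by (simp add: za)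
   also have "\<dots> = z (mext dl (bas ((%_. 0), c)))" by (simp add: mext_gen[of dl, OF dl_Wb])
   also have "\<dots> = 0" by (rule zd[OF bas_Fr[OF c]])
   finally show ?thesis .
  qed
  then show ?thesis by (simp add: Zc_def a_def)
 qed
 ultimately show ?thesis by blast
qed

theorem fg:
 fixes P :: "nat => ('a, 'm) module"
 assumes P: "projective_resolution A (trivial_module \<epsilon>) P d \<eta>"
 shows "finitely_generated_algebra (cohomology_ring A \<epsilon> P d \<eta>)"
proof -
 interpret ext_ring A \<epsilon> P d \<eta> by (rule ext_ring.intro[OF P trivial_left_module])
 have pP: "left_module A (P n)" for n by (rule P)
 have U: "(UNIV :: pbw_gen set) = {PH, PX, PY}" using pbw_gen.exhaust by blast
 obtain b where b: "!!n a. b \<le> Suc (Suc n) ==> a : Zc (Suc (Suc n)) ==>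
   EX as. (ALL i. as i : Zc n) & (ALL c. a c = pbk PH (as PH) c + pbk PX (as PX) c + pbk PY (as PY) c)"
  using cocycles_fg by blast
 show ?thesis
 proof (rule fg_criterion[OF FM_exact FM_lifts[OF pP pP] FM_lifts[OF pP trivial_left_module],
   where I = UNIV and \<chi> = "%i n. restrict (mext (\<xi> i)) (Fr (Suc (Suc n)))" and b = "max 2 b"])
  show "finite (UNIV :: pbw_gen set)" by (simp add: U)
  have xF: "mext (\<xi> i) u : Fr n" if "u : Fr (Suc (Suc n))" for i u n
   by (rule mext_Fr[OF _ that]) (metis \<xi>_Fr diff_Suc_1 diff_Suc_Suc numeral_2_eq_2 minus_nat.diff_0)
  show "restrict (mext (\<xi> i)) (Fr (Suc (Suc n))) : module_hom A (FM (Suc (Suc n))) (FM n)" for i n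
   by (rule mext_hom[OF \<xi>_Wb xF])
  show "DM n (restrict (mext (\<xi> i)) (Fr (Suc (Suc (Suc n)))) u) = restrict (mext (\<xi> i)) (Fr (Suc (Suc n))) (DM (Suc (Suc n)) u)"
   if "u : carrier (FM (Suc (Suc (Suc n))))" for i n u
  proof -
   have u: "u : Fr (Suc (Suc (Suc n)))" using that by simp
   have "mext dl (mext (\<xi> i) u) = mext (\<xi> i) (mext dl u)"
    by (rule mext_mext_eq[OF dl_Wb \<xi>_Wb \<xi>_Wb dl_Wb _ u]) (simp add: dl\<xi>)
   then show ?thesis using u xF[OF u, of i] d_Fr[OF u] by (simp add: DM_def)
  qed
  show "2 \<le> max 2 b" by simp
  show "EX T. finite T & T \<subseteq> cocycles A \<epsilon> FM DM n &
    (ALL z:cocycles A \<epsilon> FM DM n. EX c. ALL u:carrier (FM n). z u = (\<Sum>t\<in>T. c t * t u))" for n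
  proof -
   obtain T where T: "finite T" "T \<subseteq> Zc n" "!!a. a : Zc n ==> EX t. a = (%c. \<Sum>b\<in>T. t b * b c)"
    using Zc_finite_span[of n] by blast
   let ?f = "%a. restrict (ev a) (Fr n)"
   \<comment> \<open>The criterion wants functions on the module, not cochains on cells. Different
     cochains of degree \<open>n\<close> differ on a generator, so the sum over \<open>T\<close> can
     be reindexed by the functions.\<close>
   have inj: "inj_on ?f T"
   proof (rule inj_onI)
    fix a b assume ab: "a : T" "b : T" "?f a = ?f b"
    show "a = b"
    proof
     fix c
     show "a c = b c"
     proof (cases "deg c = n")
      case True
      then show ?thesis using fun_cong[OF ab(3), of "bas ((%_. 0), c)"] by (simp add: bas_Fr ev_bas)
     next
      case False
      then show ?thesis using Zc_off ab T(2) by (metis subsetD)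
     qed
    qed
   qed
   have evsum: "ev (%c. \<Sum>b\<in>S. t b * b c) u = (\<Sum>b\<in>S. t b * ev b u)" if "finite S" for S t u
    using that
   proof (induction S)
    case empty
    then show ?case by (simp add: ev_zero)
   next
    case (insert x S)
    then show ?case using ev_lin_left[of "%c. \<Sum>b\<in>S. t b * b c" "t x" x u] by (simp add: add.commute)
   qed
   have "EX c. ALL u:Fr n. z u = (\<Sum>t\<in>?f ` T. c t * t u)" if z: "z : cocycles A \<epsilon> FM DM n" for z
   proof -
    obtain a where a: "a : Zc n" "!!u. u : Fr n ==> z u = ev a u" using cocycle_ev[OF z] by blast
    obtain t where t: "a = (%c. \<Sum>b\<in>T. t b * b c)" using T(3)[OF a(1)] by blast
    have "z u = (\<Sum>s\<in>?f ` T. t (the_inv_into T ?f s) * s u)" if u: "u : Fr n" for u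
     using u by (simp add: a(2) sum.reindex[OF inj] the_inv_into_f_f[OF inj]) (simp add: t evsum[OF T(1)])
    then show ?thesis by (intro exI[of _ "%s. t (the_inv_into T ?f s)"]) simp
   qed
   then show ?thesis using T ev_Zc_cocycle by (intro exI[of _ "?f ` T"]) auto
  qed
  show "EX zs. (ALL i:UNIV. zs i : cocycles A \<epsilon> FM DM n) &
     (ALL u:carrier (FM (Suc (Suc n))). z u = (\<Sum>i\<in>UNIV. zs i (restrict (mext (\<xi> i)) (Fr (Suc (Suc n))) u)))"
   if bn: "max 2 b \<le> Suc (Suc n)" and zn: "z : cocycles A \<epsilon> FM DM (Suc (Suc n))" for n z
  proof -
   obtain a where a: "a : Zc (Suc (Suc n))" "!!u. u : Fr (Suc (Suc n)) ==> z u = ev a u" using cocycle_ev[OF zn] by blast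
   obtain as where as: "!!i. as i : Zc n" "!!c. a c = pbk PH (as PH) c + pbk PX (as PX) c + pbk PY (as PY) c"
    using b[OF _ a(1)] bn by auto
   have a': "a = (%c. (pbk PH (as PH) c + 1 * pbk PX (as PX) c) + 1 * pbk PY (as PY) c)" by (simp add: as(2) fun_eq_iff)
   have pe: "ev (pbk i (as i)) u = ev (as i) (mext (\<xi> i) u)" if "u : Fr (Suc (Suc n))" for i u
    unfolding pbk_def[abs_def] by (rule ev_mext[OF \<xi>_Wb Fr_Wb[OF that], symmetric])
   have "z u = (\<Sum>i\<in>UNIV. ev (as i) (mext (\<xi> i) u))" if u: "u : Fr (Suc (Suc n))" for u
    unfolding a(2)[OF u] by (subst a', subst ev_lin_left, subst ev_lin_left) (simp add: U pe[OF u] add.assoc)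
   then show ?thesis using xF ev_Zc_cocycle[OF as(1)]
    by (intro exI[of _ "%i. restrict (ev (as i)) (Fr n)"]) simp
  qed
 qed
qed

end

section \<open>Straightening words into ordered monomials\<close>

section \<open>Straightening in algebras with commutation relations\<close>

locale kalg = ring R for R :: "('k::field, 'a) module" (structure) +
 assumes sm_closed: "a : carrier R ==> c \<odot>\<^bsub>R\<^esub> a : carrier R"
  and sm_add_right: "a : carrier R ==> b : carrier R ==> c \<odot>\<^bsub>R\<^esub> (a \<oplus> b) = c \<odot>\<^bsub>R\<^esub> a \<oplus> c \<odot>\<^bsub>R\<^esub> b"
  and sm_add_left: "a : carrier R ==> (c + c') \<odot>\<^bsub>R\<^esub> a = c \<odot>\<^bsub>R\<^esub> a \<oplus> c' \<odot>\<^bsub>R\<^esub> a"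
  and sm_assoc: "a : carrier R ==> (c * c') \<odot>\<^bsub>R\<^esub> a = c \<odot>\<^bsub>R\<^esub> (c' \<odot>\<^bsub>R\<^esub> a)"
  and sm_one: "a : carrier R ==> 1 \<odot>\<^bsub>R\<^esub> a = a"
  and sm_mult_left: "a : carrier R ==> b : carrier R ==> (c \<odot>\<^bsub>R\<^esub> a) \<otimes> b = c \<odot>\<^bsub>R\<^esub> (a \<otimes> b)"
  and sm_mult_right: "a : carrier R ==> b : carrier R ==> a \<otimes> (c \<odot>\<^bsub>R\<^esub> b) = c \<odot>\<^bsub>R\<^esub> (a \<otimes> b)"
begin

lemma sm_zero_left: "a : carrier R ==> 0 \<odot>\<^bsub>R\<^esub> a = \<zero>"
 using sm_add_left[of a 0 0] sm_closed[of a 0] by (simp add: add.l_cancel_one')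

lemma sm_zero_right: "c \<odot>\<^bsub>R\<^esub> \<zero> = \<zero>"
 using sm_add_right[of \<zero> \<zero> c] sm_closed[of \<zero> c] by (simp add: add.l_cancel_one')

lemma sm_minus: "a : carrier R ==> (- 1) \<odot>\<^bsub>R\<^esub> a = \<ominus> a"
 using sm_add_left[of a "- 1" 1] sm_closed[of a "-1"] by (simp add: sm_one sm_zero_left minus_equality)

definition lev :: "('b => 'a) => ('b \<Rightarrow>\<^sub>0 'k) => 'a" where
 "lev f u = (\<Oplus>b\<in>keys u. lookup u b \<odot>\<^bsub>R\<^esub> f b)"

lemma lev_superset:
 assumes f: "!!b. f b : carrier R" and S: "finite S" "keys u \<subseteq> S"
 shows "lev f u = (\<Oplus>b\<in>S. lookup u b \<odot>\<^bsub>R\<^esub> f b)"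
 unfolding lev_def
 by (rule add.finprod_mono_neutral_cong_left) (use S f sm_closed in \<open>auto simp: in_keys_iff sm_zero_left\<close>)

lemma lev_closed: "(!!b. f b : carrier R) ==> lev f u : carrier R"
 unfolding lev_def by (rule finsum_closed) (auto intro: sm_closed)

lemma lev_add: "(!!b. f b : carrier R) ==> lev f (u + v) = lev f u \<oplus> lev f v"
proof -
 assume f: "!!b. f b : carrier R"
 let ?S = "keys u \<union> keys v"
 have "lev f (u + v) = (\<Oplus>b\<in>?S. lookup (u + v) b \<odot>\<^bsub>R\<^esub> f b)"
  by (rule lev_superset[OF f]) (use Poly_Mapping.keys_add[of u v] in auto)
 also have "\<dots> = (\<Oplus>b\<in>?S. lookup u b \<odot>\<^bsub>R\<^esub> f b \<oplus> lookup v b \<odot>\<^bsub>R\<^esub> f b)"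
  by (rule finsum_cong') (auto simp: lookup_add sm_add_left f sm_closed)
 also have "\<dots> = lev f u \<oplus> lev f v"
  by (subst finsum_addf) (auto simp: f sm_closed lev_superset[OF f, of ?S])
 finally show ?thesis .
qed

lemma lev_single: "(!!b. f b : carrier R) ==> lev f (single b c) = c \<odot>\<^bsub>R\<^esub> f b"
 by (subst lev_superset[of f "{b}"]) (auto simp: sm_closed)

lemma lev_scl: "(!!b. f b : carrier R) ==> lev f (scl c u) = c \<odot>\<^bsub>R\<^esub> lev f u"
proof -
 assume f: "!!b. f b : carrier R"
 have "u : Kset (%_. True)" by (simp add: Kset_def)
 then show ?thesis
  by (induction rule: Kset_induct)
   (auto simp: lev_single[OF f] lev_add[OF f] lev_closed[OF f] sm_assoc f sm_add_right, auto simp: lev_def sm_zero_right)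
qed

lemma lev_zero: "lev f 0 = \<zero>"
 by (simp add: lev_def)

lemma lev_minus: "(!!b. f b : carrier R) ==> lev f (- u) = \<ominus> lev f u"
 using lev_scl[of f "-1" u] lev_closed[of f u] by (simp add: sm_minus)

lemma lev_mult_left: "(!!b. f b : carrier R) ==> x : carrier R ==> x \<otimes> lev f u = lev (%b. x \<otimes> f b) u"
proof -
 assume f: "!!b. f b : carrier R" and x: "x : carrier R"
 then have f': "!!b. x \<otimes> f b : carrier R" by simp
 have "u : Kset (%_. True)" by (simp add: Kset_def)
 then show ?thesis
  by (induction rule: Kset_induct)
   (auto simp: lev_single[OF f] lev_single[OF f'] lev_add[OF f] lev_add[OF f'] lev_closed[OF f] f x sm_mult_right r_distr lev_zero)
qed

lemma lev_mult_right: "(!!b. f b : carrier R) ==> x : carrier R ==> lev f u \<otimes> x = lev (%b. f b \<otimes> x) u"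
proof -
 assume f: "!!b. f b : carrier R" and x: "x : carrier R"
 then have f': "!!b. f b \<otimes> x : carrier R" by simp
 have "u : Kset (%_. True)" by (simp add: Kset_def)
 then show ?thesis
  by (induction rule: Kset_induct)
   (auto simp: lev_single[OF f] lev_single[OF f'] lev_add[OF f] lev_add[OF f'] lev_closed[OF f] f x sm_mult_left l_distr lev_zero)
qed

inductive_set lspan :: "'a set => 'a set" for S where
 zero: "\<zero> : lspan S"
| base: "x : S ==> x : lspan S"
| add: "x : lspan S ==> y : lspan S ==> x \<oplus> y : lspan S"
| smult: "x : lspan S ==> c \<odot>\<^bsub>R\<^esub> x : lspan S"

lemma lspan_closed: "S \<subseteq> carrier R ==> x : lspan S ==> x : carrier R"
 by (erule lspan.induct) (auto simp: sm_closed)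

lemma lspan_minus: "S \<subseteq> carrier R ==> x : lspan S ==> \<ominus> x : lspan S"
 using lspan.smult[of x S "-1"] lspan_closed[of S x] by (simp add: sm_minus)

lemma lspan_subset:
 assumes "x : lspan S" "S \<subseteq> lspan T"
 shows "x : lspan T"
 using assms(1) by induction (use assms(2) in \<open>auto intro: lspan.intros\<close>)

lemma lspan_mono: "x : lspan S ==> S \<subseteq> T ==> x : lspan T"
 by (rule lspan_subset) (auto intro: lspan.base)

lemma lspan_mult:
 assumes S: "S \<subseteq> carrier R" and p: "p : carrier R" and q: "q : carrier R"
  and T: "!!x. x : S ==> p \<otimes> x \<otimes> q : lspan T" and x: "x : lspan S"
 shows "p \<otimes> x \<otimes> q : lspan T"
 using x
proof induction
 case (add x y)
 then show ?case using lspan_closed[OF S] p q by (simp add: r_distr l_distr lspan.add)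
next
 case (smult x c)
 then show ?case using lspan_closed[OF S] p q by (simp add: sm_mult_left sm_mult_right lspan.smult)
qed (use p q T in \<open>auto intro: lspan.zero\<close>)

lemma lspan_lev:
 assumes f: "!!b. f b : carrier R" and x: "x : lspan (f ` {b. Q b})"
 shows "EX u:Kset Q. x = lev f u"
 using x
proof induction
 case zero
 then show ?case by (intro bexI[of _ 0]) (simp_all add: lev_zero)
next
 case (base x)
 then obtain b where "Q b" "x = f b" by auto
 then show ?case using f by (intro bexI[of _ "bas b"]) (simp_all add: lev_single[OF f] sm_one)
next
 case (add x y)
 then obtain u v where "u : Kset Q" "x = lev f u" "v : Kset Q" "y = lev f v" by blast
 then show ?case by (intro bexI[of _ "u + v"]) (simp_all add: lev_add[OF f] Kset_add)
next
 case (smult x c)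
 then obtain u where "u : Kset Q" "x = lev f u" by blast
 then show ?case by (intro bexI[of _ "scl c u"]) (simp_all add: lev_scl[OF f] Kset_scl)
qed

end

locale kalg_gens = kalg R + weights N w for R :: "('k::field, 'a) module" (structure) and N w +
 fixes e :: "pbw_gen => 'a"
 assumes e: "e i : carrier R"
begin

primrec wd :: "pbw_gen list => 'a" where
 "wd [] = \<one>"
| "wd (i # v) = e i \<otimes> wd v"

lemma wd_closed: "wd v : carrier R"
 by (induction v) (auto simp: e)

lemma wd_append: "wd (u @ v) = wd u \<otimes> wd v"
 by (induction u) (auto simp: e wd_closed m_assoc)

definition wgt :: "pbw_gen list => nat" where "wgt v = sum_list (map w v)"

definition cnt :: "pbw_gen list => mono" where "cnt v i = count_list v i"

definition nf :: "mono => pbw_gen list" where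
 "nf m = replicate (m PH) PH @ replicate (m PX) PX @ replicate (m PY) PY"

definition mon :: "mono => 'a" where "mon m = wd (nf m)"

lemma mon_closed: "mon m : carrier R"
 by (simp add: mon_def wd_closed)

lemma wgt_append: "wgt (u @ v) = wgt u + wgt v"
 by (simp add: wgt_def)

lemma wgt_mset: "mset u = mset v ==> wgt u = wgt v"
proof -
 have "wgt v = sum_mset (image_mset w (mset v))" for v by (induction v) (simp_all add: wgt_def)
 then show "mset u = mset v ==> wgt u = wgt v" by simp
qed

lemma cnt_append: "cnt (u @ v) = (%i. cnt u i + cnt v i)"
 by (simp add: cnt_def fun_eq_iff)

lemma count_replicate: "count_list (replicate n x) y = (if x = y then n else 0)"
 by (induction n) auto

lemma cnt_nf: "cnt (nf m) = m"
 by (simp add: cnt_def nf_def mono_eq_iff count_replicate)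

lemma wgt_mwt: "wgt v = mwt (cnt v)"
proof (induction v)
 case (Cons i v)
 then show ?case by (cases i) (simp_all add: wgt_def mwt_def cnt_def)
qed (simp add: wgt_def mwt_def cnt_def)

definition low_words :: "nat => 'a set" where "low_words n = lspan (wd ` {v. wgt v < n})"

definition low_mons :: "nat => 'a set" where "low_mons n = lspan (mon ` {m. box m & mwt m < n})"

lemma low_mons_mono: "x : low_mons n ==> n \<le> n' ==> x : low_mons n'"
 unfolding low_mons_def by (erule lspan_mono) auto

end

text \<open>The conditions concern generators only: swapping two of them, and the truncation power
  of one, cost words of smaller weight. Everything about longer words is deduced.\<close>

locale straightening = kalg_gens R N w e for R :: "('k::field, 'a) module" (structure) and N w e +
 assumes swap: "e j \<otimes> e i \<ominus> e i \<otimes> e j : low_words (w i + w j)"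
  and power: "wd (replicate (N i) i) : low_words (N i * w i)"
begin

text \<open>Modulo words of lower weight, words may be sorted and overflowing powers vanish.\<close>

lemma straighten:
 "wd v \<ominus> (if box (cnt v) then mon (cnt v) else \<zero>) : low_mons (wgt v)"
proof (induction "wgt v" arbitrary: v rule: less_induct)
 case less
 let ?n = "wgt v"
 \<comment> \<open>Words of low weight placed between \<open>p'\<close> and \<open>q'\<close> have
   weight below \<open>?n\<close>, so the induction hypothesis rewrites them as low
   monomials.\<close>
 have lowlow: "p \<otimes> x \<otimes> q : low_mons ?n"
  if "x : low_words k" "p = wd p'" "q = wd q'" "wgt p' + k + wgt q' = ?n" for p q x k p' q'
  unfolding low_mons_def
 proof (rule lspan_mult[OF _ _ _ _ that(1)[unfolded low_words_def]])
  fix y assume "y : wd ` {v. wgt v < k}"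
  then obtain v' where v': "y = wd v'" "wgt v' < k" by auto
  let ?v = "p' @ v' @ q'"
  have lt: "wgt ?v < ?n" using v' that(4) by (simp add: wgt_append)
  have "wd ?v \<ominus> (if box (cnt ?v) then mon (cnt ?v) else \<zero>) : low_mons ?n"
   using less[OF lt] lt by (auto intro: low_mons_mono)
  moreover have "(if box (cnt ?v) then mon (cnt ?v) else \<zero>) : low_mons ?n"
   using lt unfolding low_mons_def wgt_mwt by (auto intro: lspan.base lspan.zero)
  ultimately have "(wd ?v \<ominus> (if box (cnt ?v) then mon (cnt ?v) else \<zero>)) \<oplus> (if box (cnt ?v) then mon (cnt ?v) else \<zero>) : low_mons ?n"
   unfolding low_mons_def by (rule lspan.add)
  moreover have "(wd ?v \<ominus> (if box (cnt ?v) then mon (cnt ?v) else \<zero>)) \<oplus> (if box (cnt ?v) then mon (cnt ?v) else \<zero>) = wd ?v"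
   by (simp add: a_minus_def a_assoc l_neg wd_closed mon_closed)
  ultimately show "p \<otimes> y \<otimes> q : lspan (mon ` {m. box m & mwt m < ?n})"
   unfolding low_mons_def[symmetric] by (simp add: that v' wd_append wd_closed m_assoc)
 qed (auto simp: that wd_closed)
 define eqv where "eqv x y \<longleftrightarrow> x : carrier R & y : carrier R & x \<ominus> y : low_mons ?n" for x y
 have eqv_refl: "eqv x x" if "x : carrier R" for x
  using that by (simp add: eqv_def a_minus_def r_neg low_mons_def lspan.zero)
 have eqv_trans: "eqv x z" if "eqv x y" "eqv y z" for x y z
 proof -
  have c: "x : carrier R" "y : carrier R" "z : carrier R" using that by (auto simp: eqv_def)
  have "(x \<ominus> y) \<oplus> (y \<ominus> z) : low_mons ?n" using that unfolding eqv_def low_mons_def by (auto intro: lspan.add)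
  moreover have "(x \<ominus> y) \<oplus> (y \<ominus> z) = x \<ominus> z"
  proof -
   have "(x \<oplus> \<ominus> y) \<oplus> (y \<oplus> \<ominus> z) = x \<oplus> (\<ominus> y \<oplus> y) \<oplus> \<ominus> z" using c by (simp only: a_assoc a_inv_closed a_closed)
   then show ?thesis using c by (simp add: a_minus_def l_neg)
  qed
  ultimately show ?thesis using c by (simp add: eqv_def)
 qed
 have swp: "eqv (wd (p @ j # i # q)) (wd (p @ i # j # q))" if "wgt (p @ i # j # q) = ?n" for p q i j
 proof -
  have "wd p \<otimes> (e j \<otimes> e i \<ominus> e i \<otimes> e j) \<otimes> wd q : low_mons ?n"
   by (rule lowlow[OF swap refl refl]) (use that in \<open>simp add: wgt_def\<close>)
  moreover have "wd p \<otimes> (e j \<otimes> e i \<ominus> e i \<otimes> e j) \<otimes> wd q = wd (p @ j # i # q) \<ominus> wd (p @ i # j # q)"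
   by (simp add: wd_append a_minus_def r_distr l_distr r_minus l_minus m_assoc e wd_closed)
  ultimately show ?thesis by (simp add: eqv_def wd_closed)
 qed
 have move: "eqv (wd (p @ i # a @ q)) (wd (p @ a @ i # q))" if "wgt (p @ i # a @ q) = ?n" for p q i a
  using that
 proof (induction a arbitrary: p)
  case Nil
  then show ?case by (simp add: eqv_refl wd_closed)
 next
  case (Cons j a)
  have "eqv (wd (p @ i # j # a @ q)) (wd (p @ j # i # a @ q))"
   by (rule swp) (use Cons.prems in \<open>simp add: wgt_def\<close>)
  moreover have "eqv (wd ((p @ [j]) @ i # a @ q)) (wd ((p @ [j]) @ a @ i # q))"
   by (rule Cons.IH) (use Cons.prems in \<open>simp add: wgt_def\<close>)
  ultimately show ?case using eqv_trans by simp
 qed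
 have perm: "eqv (wd (p @ u)) (wd (p @ u'))" if "mset u = mset u'" "wgt (p @ u) = ?n" for p u u'
  using that
 proof (induction u arbitrary: p u')
  case Nil
  then show ?case by (simp add: eqv_refl wd_closed)
 next
  case (Cons i u)
  then have "i : set u'" by (metis list.set_intros(1) mset_eq_setD)
  then obtain a b where u': "u' = a @ i # b" by (meson split_list)
  have "eqv (wd ((p @ [i]) @ u)) (wd ((p @ [i]) @ a @ b))"
   by (rule Cons.IH) (use Cons.prems u' in simp_all)
  moreover have "eqv (wd (p @ i # a @ b)) (wd (p @ a @ i # b))"
  proof (rule move)
   have "wgt (i # u) = wgt u'" by (rule wgt_mset) (rule Cons.prems)
   then show "wgt (p @ i # a @ b) = ?n" using Cons.prems(2) u' by (simp add: wgt_def)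
  qed
  ultimately show ?case using eqv_trans u' by simp
 qed
 show ?case
 proof (cases "box (cnt v)")
  case True
  have "mset v = mset (nf (cnt v))"
  proof (rule multiset_eqI)
   fix x show "count (mset v) x = count (mset (nf (cnt v))) x"
    using cnt_nf[of "cnt v"] by (simp add: cnt_def fun_eq_iff count_mset)
  qed
  then show ?thesis using perm[of v "nf (cnt v)" "[]"] True by (simp add: eqv_def mon_def)
 next
  case False
  then obtain i where i: "N i \<le> cnt v i" by (auto simp: box_def not_less)
  \<comment> \<open>The letters that remain when \<open>N i\<close> copies of \<open>i\<close> are
    taken out. Since words may be permuted modulo low terms, these copies can be moved to the front,
    where the power relation applies.\<close>
  define t where "t = concat (map (%j. replicate (if j = i then cnt v j - N i else cnt v j) j) [PH, PX, PY])"
  let ?u = "replicate (N i) i @ t"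
  have mvu: "mset v = mset ?u"
  proof (rule multiset_eqI)
   fix x show "count (mset v) x = count (mset ?u) x"
    using i by (cases x; cases i) (simp_all add: t_def cnt_def count_mset count_replicate)
  qed
  have wu: "wgt ?u = ?n" by (rule wgt_mset[OF mvu[symmetric]])
  have 1: "eqv (wd v) (wd ?u)" using perm[OF mvu, of "[]"] unfolding append_Nil by blast
  have "\<one> \<otimes> wd (replicate (N i) i) \<otimes> wd t : low_mons ?n"
  proof (rule lowlow[OF power])
   show "\<one> = wd []" by simp
   show "wgt [] + N i * w i + wgt t = ?n"
    using wu unfolding wgt_append by (simp add: wgt_def sum_list_replicate)
  qed (rule refl)
  then have 2: "wd ?u : low_mons ?n" unfolding wd_append by (simp add: wd_closed)
  have "(wd v \<ominus> wd ?u) \<oplus> wd ?u : low_mons ?n" using 1 2 unfolding eqv_def low_mons_def by (auto intro: lspan.add)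
  moreover have "(wd v \<ominus> wd ?u) \<oplus> wd ?u = wd v" by (simp only: a_minus_def a_assoc l_neg wd_closed a_inv_closed r_zero)
  ultimately show ?thesis using False by (simp add: a_minus_def wd_closed)
 qed
qed

lemma low_words_low_mons: "x : low_words n ==> x : low_mons n"
 unfolding low_words_def low_mons_def
proof (erule lspan_subset, safe)
 fix v assume v: "wgt v < n"
 have "wd v \<ominus> (if box (cnt v) then mon (cnt v) else \<zero>) : low_mons n"
  using low_mons_mono[OF straighten] v by simp
 moreover have "(if box (cnt v) then mon (cnt v) else \<zero>) : low_mons n"
  using v unfolding low_mons_def wgt_mwt by (auto intro: lspan.base lspan.zero)
 ultimately have "(wd v \<ominus> (if box (cnt v) then mon (cnt v) else \<zero>)) \<oplus> (if box (cnt v) then mon (cnt v) else \<zero>) : low_mons n"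
  unfolding low_mons_def by (rule lspan.add)
 moreover have "(wd v \<ominus> (if box (cnt v) then mon (cnt v) else \<zero>)) \<oplus> (if box (cnt v) then mon (cnt v) else \<zero>) = wd v"
  by (simp add: a_minus_def a_assoc l_neg wd_closed mon_closed)
 ultimately show "wd v : lspan (mon ` {m. box m & mwt m < n})" unfolding low_mons_def by simp
qed

end

locale pbw_basis = straightening R N w e for R :: "('k::field, 'a) module" (structure) and N w e +
 fixes \<epsilon> :: "'a => 'k"
 assumes generated: "a : carrier R ==> a : lspan (range wd)"
  and independent: "u : Kset box ==> lev mon u = \<zero> ==> u = 0"
  and \<epsilon>_add: "a : carrier R ==> b : carrier R ==> \<epsilon> (a \<oplus> b) = \<epsilon> a + \<epsilon> b"
  and \<epsilon>_mult: "a : carrier R ==> b : carrier R ==> \<epsilon> (a \<otimes> b) = \<epsilon> a * \<epsilon> b"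
  and \<epsilon>_smult: "a : carrier R ==> \<epsilon> (c \<odot>\<^bsub>R\<^esub> a) = c * \<epsilon> a"
  and \<epsilon>_one: "\<epsilon> \<one> = 1" and \<epsilon>_e: "\<epsilon> (e i) = 0"
begin

lemmas lm = lev_add[of mon, OF mon_closed] lev_scl[of mon, OF mon_closed] lev_single[of mon, OF mon_closed]
 lev_closed[of mon, OF mon_closed] lev_minus[of mon, OF mon_closed]

lemma lev_inj: "u : Kset box ==> v : Kset box ==> lev mon u = lev mon v ==> u = v"
proof -
 assume u: "u : Kset box" "v : Kset box" "lev mon u = lev mon v"
 have "lev mon (u + - v) = \<zero>" using u(3) by (simp only: lm r_neg)
 then show ?thesis using independent[of "u + - v"] u Kset_diff[of u box v] by simp
qed

lemma lev_surj: "a : carrier R ==> EX u:Kset box. a = lev mon u"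
proof (rule lspan_lev[OF mon_closed])
 assume a: "a : carrier R"
 show "a : lspan (mon ` {m. box m})"
 proof (rule lspan_subset[OF generated[OF a]], safe)
  fix v
  have "wd v : low_words (Suc (wgt v))" unfolding low_words_def by (rule lspan.base) auto
  then have "wd v : low_mons (Suc (wgt v))" by (rule low_words_low_mons)
  then show "wd v : lspan (mon ` {m. box m})"
   unfolding low_mons_def by (rule lspan_mono) auto
 qed
qed

definition kp :: "'a => (mono \<Rightarrow>\<^sub>0 'k)" where "kp a = (THE u. u : Kset box & lev mon u = a)"

lemma kp_lev: "u : Kset box ==> kp (lev mon u) = u"
 unfolding kp_def by (rule the_equality) (auto intro: lev_inj)

lemma kp: "a : carrier R ==> kp a : Kset box" "a : carrier R ==> lev mon (kp a) = a"
 using lev_surj[of a] kp_lev by auto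

lemma kp_add: "a : carrier R ==> b : carrier R ==> kp (a \<oplus> b) = kp a + kp b"
 using kp_lev[OF Kset_add[OF kp(1) kp(1)], of a b] by (simp add: lm kp)

lemma kp_smult: "a : carrier R ==> kp (c \<odot>\<^bsub>R\<^esub> a) = scl c (kp a)"
 using kp_lev[OF Kset_scl[OF kp(1)], of a c] by (simp add: lm kp)

lemma kp_mon: "box m ==> kp (mon m) = bas m"
 using kp_lev[of "bas m"] by (simp add: lm sm_one mon_closed)

lemma kp_zero: "kp \<zero> = 0"
 using kp_lev[of 0] by (simp add: lev_zero)

lemma kp_minus: "a : carrier R ==> kp (\<ominus> a) = - kp a"
 using kp_smult[of a "-1"] by (simp add: sm_minus)

lemma kp_of_lev: "(!!b. f b : carrier R) ==> kp (lev f u) = linext (%b. kp (f b)) u"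
proof -
 assume f: "!!b. f b : carrier R"
 have "u : Kset (%_. True)" by (simp add: Kset_def)
 then show ?thesis
  by (induction rule: Kset_induct)
   (auto simp: lev_single[OF f] lev_add[OF f] lev_closed[OF f] kp_add kp_smult f lev_zero kp_zero)
qed

definition mu :: "mono => mono => (mono \<Rightarrow>\<^sub>0 'k)" where "mu m m' = kp (mon m \<otimes> mon m')"

lemma mon_zero: "mon (%_. 0) = \<one>"
 by (simp add: mon_def nf_def)

lemma kp_mult_right: "a : carrier R ==> b : carrier R ==> kp (a \<otimes> b) = linext (%m. kp (a \<otimes> mon m)) (kp b)"
proof -
 assume ab: "a : carrier R" "b : carrier R"
 have "kp (a \<otimes> b) = kp (a \<otimes> lev mon (kp b))" using ab by (simp add: kp)
 also have "\<dots> = linext (%m. kp (a \<otimes> mon m)) (kp b)"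
  using ab by (subst lev_mult_left[OF mon_closed]) (simp_all add: kp_of_lev mon_closed)
 finally show ?thesis .
qed

lemma kp_mult_left: "a : carrier R ==> b : carrier R ==> kp (a \<otimes> b) = linext (%m. kp (mon m \<otimes> b)) (kp a)"
proof -
 assume ab: "a : carrier R" "b : carrier R"
 have "kp (a \<otimes> b) = kp (lev mon (kp a) \<otimes> b)" using ab by (simp add: kp)
 also have "\<dots> = linext (%m. kp (mon m \<otimes> b)) (kp a)"
  using ab by (subst lev_mult_right[OF mon_closed]) (simp_all add: kp_of_lev mon_closed)
 finally show ?thesis .
qed

lemma kp_mult: "a : carrier R ==> b : carrier R ==> kp (a \<otimes> b) = linext (%m. linext (mu m) (kp b)) (kp a)"
proof -
 assume a: "a : carrier R" and b: "b : carrier R"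
 have "kp (mon m \<otimes> b) = linext (mu m) (kp b)" for m
  unfolding mu_def[abs_def] by (rule kp_mult_right[OF mon_closed b])
 then show ?thesis using kp_mult_left[OF a b] by simp
qed

lemma \<epsilon>_zero: "\<epsilon> \<zero> = 0"
 using \<epsilon>_smult[of \<zero> 0] by (simp add: sm_zero_left)

lemma \<epsilon>_wd: "\<epsilon> (wd v) = (if v = [] then 1 else 0)"
 by (cases v) (simp_all add: \<epsilon>_one \<epsilon>_mult \<epsilon>_e e wd_closed)

lemma \<epsilon>_mon: "\<epsilon> (mon m) = (if m = (%_. 0) then 1 else 0)"
 by (auto simp: mon_def \<epsilon>_wd nf_def mono_eq_iff)

lemma \<epsilon>_coord: "a : carrier R ==> \<epsilon> a = lookup (kp a) (%_. 0)"
proof -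
 have "\<epsilon> (lev mon u) = lookup u (%_. 0)" if "u : Kset box" for u
  using that by (induction rule: Kset_induct)
   (auto simp: lm lev_zero \<epsilon>_zero \<epsilon>_add \<epsilon>_smult \<epsilon>_mon mon_closed lookup_add lookup_single when_def)
 then show "a : carrier R ==> ?thesis" using kp[of a] by metis
qed

lemma low_mons_kp: "x : low_mons n ==> kp x : Kset (%m. box m & mwt m < n)"
proof -
 assume "x : low_mons n"
 then obtain u where u: "u : Kset (%m. box m & mwt m < n)" "x = lev mon u"
  unfolding low_mons_def using lspan_lev[where f = mon, OF mon_closed] by blast
 then have "kp x = u" using kp_lev[OF Kset_mono[OF u(1)]] by simp
 then show ?thesis using u by simp
qed

text \<open>Associativity of \<open>mu\<close> is that of the algebra read in coordinates,
  \<open>mu_lead\<close> is straightening of two concatenated normal forms, and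
  \<open>mu_eps\<close> holds because the augmentation is multiplicative and kills the
  generators.\<close>

sublocale pbw N w mu
proof
 show "mu m m' : Kset box" for m m' by (simp add: mu_def kp mon_closed)
 show "mu (%_. 0) m = bas m" "mu m (%_. 0) = bas m" if "box m" for m
  using that by (simp_all add: mu_def mon_zero mon_closed kp_mon)
 show "linext (%m. mu m m3) (mu m1 m2) = linext (mu m1) (mu m2 m3)" for m1 m2 m3
 proof -
  have "linext (%m. mu m m3) (mu m1 m2) = kp ((mon m1 \<otimes> mon m2) \<otimes> mon m3)"
   unfolding mu_def[abs_def] by (rule kp_mult_left[symmetric]) (simp_all add: mon_closed)
  also have "\<dots> = kp (mon m1 \<otimes> (mon m2 \<otimes> mon m3))" by (simp add: m_assoc mon_closed)
  also have "\<dots> = linext (mu m1) (mu m2 m3)"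
   unfolding mu_def[abs_def] by (rule kp_mult_right) (simp_all add: mon_closed)
  finally show ?thesis .
 qed
 show "mu m m' - (if box (%i. m i + m' i) then bas (%i. m i + m' i) else 0) : Kset (%n. mwt n < mwt m + mwt m')"
  for m m'
 proof -
  have c: "cnt (nf m @ nf m') = (%i. m i + m' i)" by (simp add: cnt_append cnt_nf)
  have wg: "wgt (nf m @ nf m') = mwt m + mwt m'" by (simp add: wgt_mwt c, simp add: mwt_def algebra_simps)
  from low_mons_kp[OF straighten[of "nf m @ nf m'", unfolded c wg]]
  have "kp (mon m \<otimes> mon m' \<ominus> (if box (%i. m i + m' i) then mon (%i. m i + m' i) else \<zero>)) : Kset (%n. mwt n < mwt m + mwt m')"
   by (auto simp: wd_append mon_def elim!: Kset_mono)
  then show ?thesis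
   by (auto simp: mu_def a_minus_def kp_add kp_minus kp_mon kp_zero mon_closed split: if_splits)
 qed
 show "lookup (mu m m') (%_. 0) = (if m = (%_. 0) & m' = (%_. 0) then 1 else 0)" for m m'
 proof -
  have "lookup (mu m m') (%_. 0) = \<epsilon> (mon m \<otimes> mon m')" by (simp add: mu_def \<epsilon>_coord mon_closed)
  then show ?thesis by (simp add: \<epsilon>_mult \<epsilon>_mon mon_closed)
 qed
qed

sublocale pbw_coords N w mu R \<epsilon> kp
proof
 show "bij_betw kp (carrier R) (Kset box)"
  unfolding bij_betw_def
 proof
  show "inj_on kp (carrier R)" by (rule inj_onI) (metis kp(2))
  show "kp ` carrier R = Kset box"
  proof (intro equalityI subsetI)
   show "u : Kset box" if "u : kp ` carrier R" for u using that kp(1) by blast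
   show "u : kp ` carrier R" if "u : Kset box" for u
    using kp_lev[OF that] lm(4)[of u] by (metis imageI)
  qed
 qed
 show "kp \<one> = bas (%_. 0)" using kp_mon[of "%_. 0"] by (simp add: mon_zero)
qed (use kp_add kp_mult \<epsilon>_coord in auto)

end

section \<open>One family of relations covering the bosonization and the liftings\<close>

section \<open>Algebras of Jordan type\<close>

text \<open>What matters is that the weights increase from h to x to y: the commutator of x and h
  contains h^2, that of y and h contains x h, and that of y and x contains x^2.\<close>

definition jw :: "pbw_gen => nat" where "jw i = (case i of PH => 1 | PX => 2 | PY => 3)"

lemma jw_simps [simp]: "jw PH = 1" "jw PX = 2" "jw PY = 3"
 by (simp_all add: jw_def)

text \<open>\<open>PH\<close> stands for g - 1. The liftings have \<open>s = 1\<close>,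
  \<open>\<alpha> = - 1\<close>, \<open>\<beta> = \<mu> + ce\<close> and
  \<open>\<gamma> = ce\<close>; the bosonization has \<open>s = - 1\<close>,
  \<open>\<alpha> = 1 / 2\<close> and zero for the other parameters. The polynomial
  \<open>pc i\<close> has no constant term, so one factor \<open>e i\<close> can be split off from
  the power relation.\<close>

locale jordan_type = kalg_gens R N jw e for R :: "('k::field, 'a) module" (structure) and N e +
 fixes ce s \<mu> \<alpha> \<beta> \<gamma> \<tau> :: 'k and pc :: "pbw_gen => nat \<Rightarrow>\<^sub>0 'k" and \<epsilon> :: "'a => 'k"
 assumes rel_xh: "e PX \<otimes> e PH = e PH \<otimes> e PX \<oplus> ce \<odot>\<^bsub>R\<^esub> (e PH \<oplus> e PH \<otimes> e PH)"
  and rel_yh: "e PY \<otimes> e PH = e PH \<otimes> e PY \<oplus> s \<odot>\<^bsub>R\<^esub> (e PX \<oplus> e PX \<otimes> e PH) \<oplus> (- \<mu>) \<odot>\<^bsub>R\<^esub> (e PH \<oplus> e PH \<otimes> e PH)"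
  and rel_yx: "e PY \<otimes> e PX = e PX \<otimes> e PY \<oplus> \<alpha> \<odot>\<^bsub>R\<^esub> (e PX \<otimes> e PX) \<oplus> \<beta> \<odot>\<^bsub>R\<^esub> e PX \<oplus> \<gamma> \<odot>\<^bsub>R\<^esub> e PY
    \<oplus> \<tau> \<odot>\<^bsub>R\<^esub> (e PH \<oplus> (- 1) \<odot>\<^bsub>R\<^esub> (e PH \<otimes> e PH))"
  and pc: "pc i : Kset (%k. 0 < k & k < N i)"
  and rel_pow: "wd (replicate (N i) i) = lev (%k. wd (replicate k i)) (pc i)"
  and generated: "a : carrier R ==> a : lspan (range wd)"
  and independent: "u : Kset box ==> lev mon u = \<zero> ==> u = 0"
  and \<epsilon>_add: "a : carrier R ==> b : carrier R ==> \<epsilon> (a \<oplus> b) = \<epsilon> a + \<epsilon> b"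
  and \<epsilon>_mult: "a : carrier R ==> b : carrier R ==> \<epsilon> (a \<otimes> b) = \<epsilon> a * \<epsilon> b"
  and \<epsilon>_smult: "a : carrier R ==> \<epsilon> (c \<odot>\<^bsub>R\<^esub> a) = c * \<epsilon> a"
  and \<epsilon>_one: "\<epsilon> \<one> = 1" and \<epsilon>_e: "\<epsilon> (e i) = 0"
begin

lemma add_minus_cancel: "a : carrier R ==> b : carrier R ==> a \<oplus> b \<ominus> a = b"
 by (simp add: a_minus_def a_comm[of a b] a_assoc r_neg)

lemma low_words_wd: "wgt v < n ==> wd v : low_words n"
 unfolding low_words_def by (rule lspan.base) auto

lemma low_words_minus: "x : low_words n ==> \<ominus> x : low_words n"
 unfolding low_words_def by (rule lspan_minus) (auto simp: wd_closed)

lemma wd_small: "wd [i] = e i" "wd [i, j] = e i \<otimes> e j"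
 by (simp_all add: e)

lemma swap_ordered:
 "e PX \<otimes> e PH \<ominus> e PH \<otimes> e PX : low_words 3"
 "e PY \<otimes> e PH \<ominus> e PH \<otimes> e PY : low_words 4"
 "e PY \<otimes> e PX \<ominus> e PX \<otimes> e PY : low_words 5"
proof -
 have m: "e i \<otimes> e j : carrier R" "e i : carrier R" for i j by (simp_all add: e)
 note sm_closed[simp] m[simp]
 have g: "wgt [PH] = 1" "wgt [PX] = 2" "wgt [PY] = 3" "wgt [PH, PH] = 2" "wgt [PX, PH] = 3" "wgt [PX, PX] = 4"
  by (simp_all add: wgt_def)
 note W = low_words_wd[of "[PH]"] low_words_wd[of "[PX]"] low_words_wd[of "[PY]"] low_words_wd[of "[PH, PH]"]
  low_words_wd[of "[PX, PH]"] low_words_wd[of "[PX, PX]"]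
 note W' = W[unfolded wd_small g low_words_def]
 have 1: "ce \<odot>\<^bsub>R\<^esub> (e PH \<oplus> e PH \<otimes> e PH) : low_words 3"
  unfolding low_words_def by (intro lspan.add lspan.smult W') simp_all
 show "e PX \<otimes> e PH \<ominus> e PH \<otimes> e PX : low_words 3"
  unfolding rel_xh by (subst add_minus_cancel) (simp_all add: 1)
 have 2: "s \<odot>\<^bsub>R\<^esub> (e PX \<oplus> e PX \<otimes> e PH) \<oplus> (- \<mu>) \<odot>\<^bsub>R\<^esub> (e PH \<oplus> e PH \<otimes> e PH) : low_words 4"
  unfolding low_words_def by (intro lspan.add lspan.smult W') simp_all
 show "e PY \<otimes> e PH \<ominus> e PH \<otimes> e PY : low_words 4"
  unfolding rel_yh by (subst a_assoc, simp_all, subst add_minus_cancel) (simp_all add: 2)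
 have 3: "\<alpha> \<odot>\<^bsub>R\<^esub> (e PX \<otimes> e PX) \<oplus> (\<beta> \<odot>\<^bsub>R\<^esub> e PX \<oplus> (\<gamma> \<odot>\<^bsub>R\<^esub> e PY
    \<oplus> \<tau> \<odot>\<^bsub>R\<^esub> (e PH \<oplus> (- 1) \<odot>\<^bsub>R\<^esub> (e PH \<otimes> e PH)))) : low_words 5"
  unfolding low_words_def by (intro lspan.add lspan.smult W') simp_all
 have "e PY \<otimes> e PX = e PX \<otimes> e PY \<oplus> (\<alpha> \<odot>\<^bsub>R\<^esub> (e PX \<otimes> e PX) \<oplus> (\<beta> \<odot>\<^bsub>R\<^esub> e PX \<oplus> (\<gamma> \<odot>\<^bsub>R\<^esub> e PY
    \<oplus> \<tau> \<odot>\<^bsub>R\<^esub> (e PH \<oplus> (- 1) \<odot>\<^bsub>R\<^esub> (e PH \<otimes> e PH)))))"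
  unfolding rel_yx by (simp add: a_assoc)
 then show "e PY \<otimes> e PX \<ominus> e PX \<otimes> e PY : low_words 5"
  by (simp only:) (subst add_minus_cancel, simp_all add: 3)
qed

sublocale straightening R N jw e
proof
 have m: "e i \<otimes> e j : carrier R" for i j by (simp add: e)
 have z: "\<zero> : low_words n" for n unfolding low_words_def by (rule lspan.zero)
 have rev: "e i \<otimes> e j \<ominus> e j \<otimes> e i : low_words n" if "e j \<otimes> e i \<ominus> e i \<otimes> e j : low_words n" for i j n
  using low_words_minus[OF that] m by (simp add: a_minus_def minus_add a_comm)
 show "e j \<otimes> e i \<ominus> e i \<otimes> e j : low_words (jw i + jw j)" for i j
  using swap_ordered swap_ordered[THEN rev] z m
  by (cases i; cases j) (simp_all add: numeral_eq_Suc a_minus_def r_neg)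
 show "wd (replicate (N i) i) : low_words (N i * jw i)" for i
 proof -
  have "lev (%k. wd (replicate k i)) u : low_words (N i * jw i)" if "u : Kset (%k. 0 < k & k < N i)" for u
   using that
  proof (induction rule: Kset_induct)
   case (single k t)
   have "wgt (replicate k i) < N i * jw i" using single w[of i] by (simp add: wgt_def sum_list_replicate)
   then show ?case using low_words_wd[of "replicate k i"] lspan.smult[of "wd (replicate k i)"]
    by (simp add: lev_single[OF wd_closed] low_words_def)
  qed (auto simp: lev_zero lev_add[OF wd_closed] low_words_def intro: lspan.add lspan.zero)
  then show ?thesis unfolding rel_pow using pc by blast
 qed
qed

sublocale pbw_basis R N jw e \<epsilon>
 by standard (use generated independent \<epsilon>_add \<epsilon>_mult \<epsilon>_smult \<epsilon>_one \<epsilon>_e in auto)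

definition pm :: "pbw_gen => nat => mono" where "pm i k = (%_. 0)(i := k)"

abbreviation "um i \<equiv> pm i (Suc 0)"

text \<open>The power relation of \<open>e i\<close> with one right factor \<open>e i\<close>
  removed, so that \<open>upol i\<close> times \<open>e i\<close> is zero in the algebra.\<close>

definition upol :: "pbw_gen => mono \<Rightarrow>\<^sub>0 'k" where
 "upol i = bas (pm i (N i - 1)) - linext (%k. bas (pm i (k - 1))) (pc i)"

definition cell :: "nat => nat => nat => mono" where
 "cell a b c = (%i. case i of PH => a | PX => b | PY => c)"

text \<open>The second differential: each relation is written as a left linear combination of the generators.\<close>

definition dl2 :: "mono => (mono \<times> mono \<Rightarrow>\<^sub>0 'k)" where
 "dl2 c = (if c = cell 2 0 0 then emb (um PH) (upol PH) else if c = cell 0 2 0 then emb (um PX) (upol PX)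
   else if c = cell 0 0 2 then emb (um PY) (upol PY)
   else if c = cell (Suc 0) (Suc 0) 0 then emb (um PX) (bas (um PH)) +
    emb (um PH) (single (%_. 0) ce + single (um PH) ce - bas (um PX))
   else if c = cell (Suc 0) 0 (Suc 0) then emb (um PY) (bas (um PH)) + emb (um PX) (single (%_. 0) s) +
    emb (um PH) (single (um PX) s - single (%_. 0) \<mu> - single (um PH) \<mu> - bas (um PY))
   else if c = cell 0 (Suc 0) (Suc 0) then emb (um PY) (bas (um PX) + single (%_. 0) \<gamma>) +
    emb (um PX) (single (um PX) \<alpha> + single (%_. 0) \<beta> - bas (um PY)) +
    emb (um PH) (single (%_. 0) \<tau> - single (um PH) \<tau>)
   else 0)"

lemma cell_eq [simp]: "cell a b c = cell a' b' c' \<longleftrightarrow> a = a' & b = b' & c = c'"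
 by (auto simp: cell_def mono_eq_iff)

lemma cell_cases:
 assumes "deg c = 2"
 obtains "c = cell 2 0 0" | "c = cell 0 2 0" | "c = cell 0 0 2" | "c = cell (Suc 0) (Suc 0) 0" | "c = cell (Suc 0) 0 (Suc 0)" | "c = cell 0 (Suc 0) (Suc 0)"
proof -
 have "c PH + c PX + c PY = 2" using assms by (simp add: deg_def)
 then have "(c PH, c PX, c PY) : {(2, 0, 0), (0, 2, 0), (0, 0, 2), (1, 1, 0), (1, 0, 1), (0, 1, 1)}"
  by (auto simp: numeral_2_eq_2 add_is_1)
 then show ?thesis using that by (auto simp: cell_def mono_eq_iff)
qed

lemma pm_simps: "pm PH k = cell k 0 0" "pm PX k = cell 0 k 0" "pm PY k = cell 0 0 k" "(%_. 0) = cell 0 0 0"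
 by (auto simp: pm_def cell_def mono_eq_iff)

lemma box_pm: "k < N i ==> box (pm i k)"
proof -
 assume "k < N i"
 moreover have "0 < N j" for j using N[of j] by simp
 ultimately show ?thesis by (simp add: box_def pm_def)
qed

lemma N1: "1 < N i" using N[of i] by simp

lemma box_um: "box (um i)" using N1[of i] by (simp add: box_pm)

lemma mwt_pm: "mwt (pm i k) = jw i * k"
 by (cases i) (simp_all add: mwt_def pm_def)

lemma cwt_um: "cwt (um i) = jw i"
 by (cases i) (simp_all add: cwt_def pm_def cpos_def)

lemma deg_pm: "deg (pm i k) = k"
 by (cases i) (simp_all add: deg_def pm_def)

lemma upol_rest: "linext (%k. bas (pm i (k - 1))) (pc i) : Kset (%m. box m & mwt m + jw i < jw i * N i)"
proof (rule linm_Kset[OF linext_linm pc])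
 fix k assume k: "0 < k & k < N i"
 then have "jw i * k < jw i * N i" using w[of i] by simp
 moreover have "jw i * (k - 1) + jw i = jw i * k" using k by (cases k) simp_all
 ultimately show "linext (%k. bas (pm i (k - 1))) (bas k) : Kset (%m. box m & mwt m + jw i < jw i * N i)"
  using k by (simp add: mwt_pm box_pm less_imp_diff_less)
qed

lemma upol_box: "upol i : Kset box"
 unfolding upol_def by (intro Kset_diff) (use upol_rest[of i] box_pm[of "N i - 1" i] N1[of i] in \<open>auto elim: Kset_mono\<close>)

lemma emb_Fr: "u : Kset box ==> emb (um j) u : Fr (Suc 0)"
 unfolding Fr_def by (erule emb_Kset) (simp add: deg_pm)

lemma Fr_add': "u : Fr n ==> v : Fr n ==> u + v : Fr n"
 unfolding Fr_def by (rule Kset_add)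

lemma D_cells:
 "D ((%_. 0), cell 2 0 0) = (bas (pm PH (N PH - 1), um PH) :: _ \<Rightarrow>\<^sub>0 'k)"
 "D ((%_. 0), cell 0 2 0) = (bas (pm PX (N PX - 1), um PX) :: _ \<Rightarrow>\<^sub>0 'k)"
 "D ((%_. 0), cell 0 0 2) = (bas (pm PY (N PY - 1), um PY) :: _ \<Rightarrow>\<^sub>0 'k)"
 "D ((%_. 0), cell (Suc 0) (Suc 0) 0) = (bas (um PH, um PX) - bas (um PX, um PH) :: _ \<Rightarrow>\<^sub>0 'k)"
 "D ((%_. 0), cell (Suc 0) 0 (Suc 0)) = (bas (um PH, um PY) - bas (um PY, um PH) :: _ \<Rightarrow>\<^sub>0 'k)"
 "D ((%_. 0), cell 0 (Suc 0) (Suc 0)) = (bas (um PX, um PY) - bas (um PY, um PX) :: _ \<Rightarrow>\<^sub>0 'k)"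
proof -
 have u: "(cell a b c)(PH := k) = cell k b c" "(cell a b c)(PX := k) = cell a k c" "(cell a b c)(PY := k) = cell a b k" for a b c k
  by (auto simp: cell_def mono_eq_iff)
 have v: "cell a b c PH = a" "cell a b c PX = b" "cell a b c PY = c" for a b c by (simp_all add: cell_def)
 have neg: "single b (- 1) = - (bas b :: mono \<times> mono \<Rightarrow>\<^sub>0 'k)" for b
  by (simp add: single_uminus)
 have lt: "N i - Suc 0 < N i" "Suc 0 < N i" for i using N1[of i] by auto
 show "D ((%_. 0), cell 2 0 0) = (bas (pm PH (N PH - 1), um PH) :: _ \<Rightarrow>\<^sub>0 'k)"
  "D ((%_. 0), cell 0 2 0) = (bas (pm PX (N PX - 1), um PX) :: _ \<Rightarrow>\<^sub>0 'k)"
  "D ((%_. 0), cell 0 0 2) = (bas (pm PY (N PY - 1), um PY) :: _ \<Rightarrow>\<^sub>0 'k)"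
  "D ((%_. 0), cell (Suc 0) (Suc 0) 0) = (bas (um PH, um PX) - bas (um PX, um PH) :: _ \<Rightarrow>\<^sub>0 'k)"
  "D ((%_. 0), cell (Suc 0) 0 (Suc 0)) = (bas (um PH, um PY) - bas (um PY, um PH) :: _ \<Rightarrow>\<^sub>0 'k)"
  "D ((%_. 0), cell 0 (Suc 0) (Suc 0)) = (bas (um PX, um PY) - bas (um PY, um PX) :: _ \<Rightarrow>\<^sub>0 'k)"
  unfolding pm_simps by (simp_all add: D_def Dt_def u v stp_def lt sgn_at_def neg)
qed

lemma wt_cells: "wt ((%_. 0), cell 2 0 0) = jw PH * N PH" "wt ((%_. 0), cell 0 2 0) = jw PX * N PX" "wt ((%_. 0), cell 0 0 2) = jw PY * N PY"
 "wt ((%_. 0), cell (Suc 0) (Suc 0) 0) = 3" "wt ((%_. 0), cell (Suc 0) 0 (Suc 0)) = 4" "wt ((%_. 0), cell 0 (Suc 0) (Suc 0)) = 5"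
 by (simp_all add: wt_def mwt_def cwt_def cpos_def cell_def)

lemma emb_lowby: "u : Kset (%m. mwt m + jw j < k) ==> emb (um j) u : lowby 0 k"
 unfolding lowby_def by (erule emb_Kset) (simp add: wt_def cwt_um)

lemma lowby_add: "u : lowby t k ==> v : lowby t k ==> u + v : lowby t k"
 unfolding lowby_def by (rule Kset_add)

lemma dl2_cells:
 "dl2 (cell 2 0 0) = emb (um PH) (upol PH)" "dl2 (cell 0 2 0) = emb (um PX) (upol PX)"
 "dl2 (cell 0 0 2) = emb (um PY) (upol PY)"
 "dl2 (cell (Suc 0) (Suc 0) 0) = emb (um PX) (bas (um PH)) +
    emb (um PH) (single (%_. 0) ce + single (um PH) ce - bas (um PX))"
 "dl2 (cell (Suc 0) 0 (Suc 0)) = emb (um PY) (bas (um PH)) + emb (um PX) (single (%_. 0) s) +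
    emb (um PH) (single (um PX) s - single (%_. 0) \<mu> - single (um PH) \<mu> - bas (um PY))"
 "dl2 (cell 0 (Suc 0) (Suc 0)) = emb (um PY) (bas (um PX) + single (%_. 0) \<gamma>) +
    emb (um PX) (single (um PX) \<alpha> + single (%_. 0) \<beta> - bas (um PY)) +
    emb (um PH) (single (%_. 0) \<tau> - single (um PH) \<tau>)"
 by (simp_all add: dl2_def)

lemma dl2_Fr: "deg c = 2 ==> dl2 c : Fr (Suc 0)"
proof -
 assume "deg c = 2"
 have B: "single (%_. 0) t : Kset box" "single (um i) t : Kset box" for t :: 'k and i
  by (simp_all add: Kset_single box_um)
 from \<open>deg c = 2\<close> show ?thesis
  by (cases rule: cell_cases; simp only: dl2_cells; intro Fr_add' emb_Fr upol_box Kset_add Kset_diff B)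
qed

lemma dl2_lead: "deg c = 2 ==> dl2 c - D ((%_. 0), c) : lowby 0 (wt ((%_. 0), c))"
proof -
 assume "deg c = 2"
 have U: "emb (um i) (upol i) - bas (pm i (N i - 1), um i) : lowby 0 (jw i * N i)" for i
 proof -
  have "emb (um i) (upol i) - bas (pm i (N i - 1), um i) = emb (um i) (- linext (%k. bas (pm i (k - 1))) (pc i))"
   by (simp add: upol_def linm_diff[OF emb_linm] linm_minus[OF emb_linm])
  also have "\<dots> : lowby 0 (jw i * N i)"
   by (intro emb_lowby Kset_minus Kset_mono[OF upol_rest]) simp
  finally show ?thesis .
 qed
 have z: "mwt (%_. 0) = 0" by (simp add: mwt_def)
 note E = linm_diff[OF emb_linm] linm_add[OF emb_linm]
 from \<open>deg c = 2\<close> show ?thesis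
 proof (cases rule: cell_cases)
  case 4
  have "dl2 c - D ((%_. 0), c) = emb (um PH) (single (%_. 0) ce + single (um PH) ce)"
   unfolding 4 by (simp add: dl2_cells D_cells E)
  also have "\<dots> : lowby 0 (wt ((%_. 0), c))" unfolding 4 wt_cells
   by (intro emb_lowby Kset_add Kset_single) (simp_all add: z mwt_pm)
  finally show ?thesis .
 next
  case 5
  have "dl2 c - D ((%_. 0), c) = emb (um PX) (single (%_. 0) s) +
    emb (um PH) (single (um PX) s - single (%_. 0) \<mu> - single (um PH) \<mu>)"
   unfolding 5 by (simp add: dl2_cells D_cells E)
  also have "\<dots> : lowby 0 (wt ((%_. 0), c))" unfolding 5 wt_cells
   by (intro lowby_add emb_lowby Kset_add Kset_diff Kset_single) (simp_all add: z mwt_pm)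
  finally show ?thesis .
 next
  case 6
  have "dl2 c - D ((%_. 0), c) = emb (um PY) (single (%_. 0) \<gamma>) +
    emb (um PX) (single (um PX) \<alpha> + single (%_. 0) \<beta>) +
    emb (um PH) (single (%_. 0) \<tau> - single (um PH) \<tau>)"
   unfolding 6 by (simp add: dl2_cells D_cells E)
  also have "\<dots> : lowby 0 (wt ((%_. 0), c))" unfolding 6 wt_cells
   by (intro lowby_add emb_lowby Kset_add Kset_diff Kset_single) (simp_all add: z mwt_pm)
  finally show ?thesis .
 qed (use U in \<open>simp_all add: dl2_cells D_cells wt_cells del: jw_simps\<close>)
qed

lemma mon_pm: "mon (pm i k) = wd (replicate k i)"
 by (cases i) (simp_all add: mon_def nf_def pm_def)

lemma mon_um: "mon (um i) = e i"
 by (simp add: mon_pm e)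

lemma d1_um: "d1 (um j) = bas (um j, (%_. 0))"
proof -
 have "D ((%_. 0), um j) = (bas (um j, (%_. 0)) :: _ \<Rightarrow>\<^sub>0 'k)"
  by (cases j) (use N1 in \<open>simp_all add: D_def Dt_def pm_def stp_def sgn_at_def fun_upd_idem\<close>)
 then show ?thesis by (simp add: d1_def deg_pm)
qed

lemma mext_d1_emb: "u : Kset box ==> mext d1 (emb (um j) u) = emb (%_. 0) (kp (lev mon u \<otimes> e j))"
proof (induction rule: Kset_induct)
 case (single m t)
 have "mext d1 (emb (um j) (scl t (bas m))) = scl t (emb (%_. 0) (mu m (um j)))"
  by (simp only: linm_scl[OF emb_linm] linm_scl[OF mext_linm] emb_bas mext_bas d1_um act_bas)
 also have "\<dots> = emb (%_. 0) (kp (lev mon (scl t (bas m)) \<otimes> e j))"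
  by (simp add: lm sm_mult_left kp_smult mon_closed e linm_scl[OF emb_linm] mu_def mon_um)
 finally show ?case by simp
qed (simp_all add: linm_0[OF emb_linm] linm_0[OF mext_linm] lev_zero e kp_zero linm_add[OF emb_linm] linm_add[OF mext_linm]
  lm l_distr kp_add)

lemma kp_pow: "kp (wd (replicate (N i) i)) = linext (%k. kp (wd (replicate k i))) (pc i)"
 unfolding rel_pow by (rule kp_of_lev[OF wd_closed])

lemma kp_rels:
 "kp (e PX \<otimes> e PH) = kp (e PH \<otimes> e PX) + scl ce (kp (e PH) + kp (e PH \<otimes> e PH))"
 "kp (e PY \<otimes> e PH) = kp (e PH \<otimes> e PY) + scl s (kp (e PX) + kp (e PX \<otimes> e PH)) - scl \<mu> (kp (e PH) + kp (e PH \<otimes> e PH))"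
 "kp (e PY \<otimes> e PX) = kp (e PX \<otimes> e PY) + scl \<alpha> (kp (e PX \<otimes> e PX)) + scl \<beta> (kp (e PX)) + scl \<gamma> (kp (e PY))
   + scl \<tau> (kp (e PH) - kp (e PH \<otimes> e PH))"
 unfolding rel_yx rel_yh by (subst rel_xh, simp add: kp_add kp_smult e sm_closed)
  (simp_all add: kp_add kp_smult e sm_closed)

lemma T_simps:
 "kp (lev mon (single m t) \<otimes> e j) = scl t (kp (mon m \<otimes> e j))"
 "kp (lev mon (u + v) \<otimes> e j) = kp (lev mon u \<otimes> e j) + kp (lev mon v \<otimes> e j)"
 "kp (lev mon (u - v) \<otimes> e j) = kp (lev mon u \<otimes> e j) - kp (lev mon v \<otimes> e j)"
proof -
 show 1: "kp (lev mon (u + v) \<otimes> e j) = kp (lev mon u \<otimes> e j) + kp (lev mon v \<otimes> e j)" for u v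
  by (simp add: lm l_distr kp_add e)
 show "kp (lev mon (single m t) \<otimes> e j) = scl t (kp (mon m \<otimes> e j))"
  by (simp add: lm sm_mult_left kp_smult mon_closed e)
 show "kp (lev mon (u - v) \<otimes> e j) = kp (lev mon u \<otimes> e j) - kp (lev mon v \<otimes> e j)"
  using 1[of "u - v" v] by simp
qed

text \<open>\<open>d1\<close> evaluates a left linear combination of cells as the corresponding
  combination of generators in the algebra; on \<open>dl2 c\<close> the result is one of the
  defining relations.\<close>

lemma d1_dl2: "deg c = 2 ==> mext d1 (dl2 c) = 0"
proof -
 assume "deg c = 2"
 have U: "mext d1 (emb (um i) (upol i)) = 0" for i
 proof -
  have rep: "wd (replicate k i) \<otimes> e i = wd (replicate (Suc k) i)" for k
   using wd_append[of "replicate k i" "[i]"] by (simp add: replicate_append_same e flip: wd_append)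
  have r: "kp (lev mon (linext (%k. bas (pm i (k - 1))) u) \<otimes> e i) = linext (%k. kp (wd (replicate k i))) u"
   if "u : Kset (%k. 0 < k & k < N i)" for u
   using that
  proof (induction rule: Kset_induct)
   case (single k t)
   then obtain k' where "k = Suc k'" by (cases k) auto
   then show ?case by (simp add: T_simps mon_pm rep del: replicate_Suc)
  qed (simp_all add: lev_zero e kp_zero T_simps)
  have n: "Suc (N i - 1) = N i" using N1[of i] by simp
  have "kp (lev mon (upol i) \<otimes> e i) = 0"
   unfolding upol_def T_simps(3) r[OF pc] by (simp only: T_simps(1) mon_pm rep n kp_pow scl_simps diff_self)
  then show ?thesis by (simp add: mext_d1_emb[OF upol_box] linm_0[OF emb_linm])
 qed
 have b: "u : Kset box ==> mext d1 (emb (um j) u) = emb (%_. 0) (kp (lev mon u \<otimes> e j))" for u j by (rule mext_d1_emb)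
 have B: "single (%_. 0) t : Kset box" "single (um i) t : Kset box" for t :: 'k and i
  by (simp_all add: Kset_single box_um)
 note E = linm_add[OF emb_linm, symmetric] linm_add[OF mext_linm]
 from \<open>deg c = 2\<close> show ?thesis
 proof (cases rule: cell_cases)
  case 4
  show ?thesis unfolding 4 dl2_cells
   by (simp add: E b Kset_add Kset_diff B box_um linm_0[OF emb_linm] T_simps mon_um mon_zero e kp_rels del: emb_bas)
 next
  case 5
  show ?thesis unfolding 5 dl2_cells
   by (simp add: E b Kset_add Kset_diff B box_um linm_0[OF emb_linm] T_simps mon_um mon_zero e kp_rels del: emb_bas)
 next
  case 6
  show ?thesis unfolding 6 dl2_cells
   by (simp add: E b Kset_add Kset_diff B box_um linm_0[OF emb_linm] T_simps mon_um mon_zero e kp_rels del: emb_bas)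
 qed (use U in \<open>simp_all add: dl2_cells\<close>)
qed

end

text \<open>For each \<open>i\<close> the vectors \<open>v i j\<close> are the images of the 1-cells
  \<open>j\<close> under a homomorphism from degree 1 of the resolution into a representation. The
  equations say that it sends the second differential of the cell with 2 in slot \<open>i\<close> to
  \<open>z i\<close> and that of every other 2-cell to 0.\<close>

locale jordan_type_rep = jordan_type R N e ce s \<mu> \<alpha> \<beta> \<gamma> \<tau> pc \<epsilon>
 for R :: "('k::field, 'a) module" (structure) and N e ce s \<mu> \<alpha> \<beta> \<gamma> \<tau> pc \<epsilon> +
 fixes \<pi> :: "'a => ('b \<Rightarrow>\<^sub>0 'k) => ('b \<Rightarrow>\<^sub>0 'k)" and v :: "pbw_gen => pbw_gen => ('b \<Rightarrow>\<^sub>0 'k)" and z :: "pbw_gen => ('b \<Rightarrow>\<^sub>0 'k)"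
 assumes \<pi>_linm: "a : carrier R ==> linm (\<pi> a)"
  and \<pi>_add: "a : carrier R ==> b : carrier R ==> \<pi> (a \<oplus> b) x = \<pi> a x + \<pi> b x"
  and \<pi>_mult: "a : carrier R ==> b : carrier R ==> \<pi> (a \<otimes> b) x = \<pi> a (\<pi> b x)"
  and \<pi>_smult: "a : carrier R ==> \<pi> (c \<odot>\<^bsub>R\<^esub> a) x = scl c (\<pi> a x)"
  and \<pi>_one: "\<pi> \<one> (v i j) = v i j"
  and v_xh: "\<pi> (e PH) (v i PX) - \<pi> (e PX) (v i PH) + scl ce (v i PH + \<pi> (e PH) (v i PH)) = 0"
  and v_yh: "\<pi> (e PH) (v i PY) - \<pi> (e PY) (v i PH) + scl s (v i PX + \<pi> (e PX) (v i PH)) - scl \<mu> (v i PH + \<pi> (e PH) (v i PH)) = 0"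
  and v_yx: "\<pi> (e PX) (v i PY) - \<pi> (e PY) (v i PX) + scl \<alpha> (\<pi> (e PX) (v i PX)) + scl \<beta> (v i PX) + scl \<gamma> (v i PY)
    + scl \<tau> (v i PH - \<pi> (e PH) (v i PH)) = 0"
  and v_pow: "(\<pi> (e j) ^^ (N j - 1)) (v i j) - linext (%k. (\<pi> (e j) ^^ (k - 1)) (v i j)) (pc j) = (if i = j then z i else 0)"
  and z_killed: "\<pi> (e j) (z i) = 0" and z_nz: "z i ~= 0"
begin

definition vv :: "pbw_gen => mono => ('b \<Rightarrow>\<^sub>0 'k)" where
 "vv i c = (if c = um PH then v i PH else if c = um PX then v i PX else if c = um PY then v i PY else 0)"

definition \<Psi> :: "pbw_gen => (mono \<times> mono \<Rightarrow>\<^sub>0 'k) => ('b \<Rightarrow>\<^sub>0 'k)" where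
 "\<Psi> i = linext (%b. \<pi> (mon (fst b)) (vv i (snd b)))"

lemma \<Psi>_linm: "linm (\<Psi> i)" by (simp add: \<Psi>_def linext_linm)

lemma \<pi>_zero: "\<pi> \<zero> x = 0"
 using \<pi>_smult[of \<zero> 0 x] by (simp add: sm_zero_left)

lemma \<pi>_lev: "(!!b. f b : carrier R) ==> \<pi> (lev f u) x = linext (%b. \<pi> (f b) x) u"
proof -
 assume f: "!!b. f b : carrier R"
 have "u : Kset (%_. True)" by (simp add: Kset_def)
 then show ?thesis
  by (induction rule: Kset_induct) (simp_all add: lev_zero \<pi>_zero lev_single[OF f] \<pi>_smult f lev_add[OF f] \<pi>_add lev_closed[OF f])
qed

lemma \<Psi>_emb: "\<Psi> i (emb c u) = \<pi> (lev mon u) (vv i c)"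
 unfolding \<pi>_lev[OF mon_closed]
 by (rule linm_eqI[OF linm_comp[OF \<Psi>_linm emb_linm] linext_linm]) (simp add: \<Psi>_def)

lemma \<Psi>_act:
 assumes m: "box m" and u: "u : Wb"
 shows "\<Psi> i (act m u) = \<pi> (mon m) (\<Psi> i u)"
proof (rule linm_eq_Kset[OF linm_comp[OF \<Psi>_linm act_linm] linm_comp[OF \<pi>_linm[OF mon_closed] \<Psi>_linm] u[unfolded Wb_def]])
 fix b :: "mono \<times> mono"
 obtain n c where b: "b = (n, c)" by (cases b)
 have "\<Psi> i (act m (bas b)) = \<pi> (mon m \<otimes> mon n) (vv i c)"
  by (simp add: b act_bas \<Psi>_emb mu_def kp(2) mon_closed)
 then show "\<Psi> i (act m (bas b)) = \<pi> (mon m) (\<Psi> i (bas b))"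
  by (simp add: b \<pi>_mult mon_closed \<Psi>_def)
qed

lemma vv_um: "vv i (um j) = v i j"
 by (cases j) (simp_all add: vv_def pm_simps)

lemma \<pi>_replicate: "\<pi> (wd (replicate k j)) (v i j') = (\<pi> (e j) ^^ k) (v i j')"
 by (induction k) (simp_all add: \<pi>_one \<pi>_mult e wd_closed)

lemma P_simps:
 "\<pi> (lev mon (single m t)) x = scl t (\<pi> (mon m) x)"
 "\<pi> (lev mon (u1 + u2)) x = \<pi> (lev mon u1) x + \<pi> (lev mon u2) x"
 "\<pi> (lev mon (u1 - u2)) x = \<pi> (lev mon u1) x - \<pi> (lev mon u2) x"
 by (simp_all add: \<pi>_lev[OF mon_closed])

lemma \<Psi>_upol: "\<Psi> i (emb (um j) (upol j)) = (if i = j then z i else 0)"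
proof -
  have "\<pi> (lev mon (linext (%k. bas (pm j (k - 1))) u)) (v i j) = linext (%k. (\<pi> (e j) ^^ (k - 1)) (v i j)) u" for u
   unfolding \<pi>_lev[OF mon_closed]
   by (rule linm_eqI[OF linm_comp[OF linext_linm linext_linm] linext_linm]) (simp add: mon_pm \<pi>_replicate)
  note r = this[of "pc j"]
  show ?thesis using v_pow[where i = i and j = j]
   by (simp only: \<Psi>_emb vv_um upol_def P_simps r mon_pm \<pi>_replicate scl_simps)
qed

lemma \<Psi>_dl2: "deg c = 2 ==> \<Psi> i (dl2 c) = (if c = cyc (%_. 0) i then z i else 0)"
proof -
 assume "deg c = 2"
 have cy: "cyc (%_. 0) PH = cell 2 0 0" "cyc (%_. 0) PX = cell 0 2 0" "cyc (%_. 0) PY = cell 0 0 2"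
  by (auto simp: cyc_def cell_def mono_eq_iff)
 from \<open>deg c = 2\<close> show ?thesis
 proof (cases rule: cell_cases)
  case 4
  have "\<Psi> i (dl2 c) = \<pi> (e PH) (v i PX) - \<pi> (e PX) (v i PH) + scl ce (v i PH + \<pi> (e PH) (v i PH))"
   unfolding 4 dl2_cells
   by (simp add: linm_add[OF \<Psi>_linm] \<Psi>_emb vv_um P_simps mon_um mon_zero \<pi>_one del: emb_bas)
  also have "\<dots> = 0" by (rule v_xh)
  finally show ?thesis unfolding 4 by (cases i) (simp_all add: cy)
 next
  case 5
  have "\<Psi> i (dl2 c) = \<pi> (e PH) (v i PY) - \<pi> (e PY) (v i PH) + scl s (v i PX + \<pi> (e PX) (v i PH)) - scl \<mu> (v i PH + \<pi> (e PH) (v i PH))"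
   unfolding 5 dl2_cells
   by (simp add: linm_add[OF \<Psi>_linm] \<Psi>_emb vv_um P_simps mon_um mon_zero \<pi>_one del: emb_bas)
  also have "\<dots> = 0" by (rule v_yh)
  finally show ?thesis unfolding 5 by (cases i) (simp_all add: cy)
 next
  case 6
  have "\<Psi> i (dl2 c) = \<pi> (e PX) (v i PY) - \<pi> (e PY) (v i PX) + scl \<alpha> (\<pi> (e PX) (v i PX)) + scl \<beta> (v i PX) + scl \<gamma> (v i PY) + scl \<tau> (v i PH - \<pi> (e PH) (v i PH))"
   unfolding 6 dl2_cells
   by (simp add: linm_add[OF \<Psi>_linm] \<Psi>_emb vv_um P_simps mon_um mon_zero \<pi>_one del: emb_bas)
  also have "\<dots> = 0" by (rule v_yx)
  finally show ?thesis unfolding 6 by (cases i) (simp_all add: cy)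
 next
  case 1
  show ?thesis unfolding 1 dl2_cells by (cases i) (simp_all add: \<Psi>_upol cy)
 next
  case 2
  show ?thesis unfolding 2 dl2_cells by (cases i) (simp_all add: \<Psi>_upol cy)
 next
  case 3
  show ?thesis unfolding 3 dl2_cells by (cases i) (simp_all add: \<Psi>_upol cy)
 qed
qed

lemma \<pi>_wd_z: "x ~= [] ==> \<pi> (wd x) (z i) = 0"
proof (induction x)
 case (Cons j x)
 then show ?case
 proof (cases "x = []")
  case True
  then show ?thesis by (simp add: e z_killed)
 next
  case False
  then show ?thesis using Cons by (simp add: \<pi>_mult e wd_closed linm_0[OF \<pi>_linm])
 qed
qed simp

text \<open>The unit is known to act trivially on the vectors \<open>v i j\<close>. It then does so
  on \<open>z i\<close>, which is an algebra element applied to \<open>v i i\<close>.\<close>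

lemma z_scaled: "\<pi> \<one> (z i) = z i"
proof -
 let ?a = "lev mon (upol i)"
 have z: "z i = \<pi> ?a (v i i)" using \<Psi>_upol[of i i] by (simp add: \<Psi>_emb vv_um)
 have "\<pi> \<one> (\<pi> ?a (v i i)) = \<pi> (\<one> \<otimes> ?a) (v i i)" by (rule \<pi>_mult[symmetric]) (simp_all add: lm)
 then show ?thesis by (simp add: z lm)
qed

text \<open>Apply \<open>\<Psi> i\<close> to \<open>mext dl2 u = 0\<close>. Nontrivial monomials
  kill \<open>z i\<close>, so what remains is \<open>z i\<close> times the coefficient of
  \<open>u\<close> at the unit monomial of the cell, and \<open>z i\<close> is not zero.\<close>

lemma dl2_cocycle:
 assumes u: "u : Fr 2" and d: "mext dl2 u = 0"
 shows "lookup u ((%_. 0), cyc (%_. 0) i) = 0"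
proof -
 have W: "dl2 c : Wb" for c
 proof (cases "deg c = 2")
  case True
  show ?thesis by (rule Fr_Wb[OF dl2_Fr[OF True]])
 next
  case False
  then have "dl2 c = 0" by (auto simp: dl2_def deg_def cell_def)
  then show ?thesis by (simp add: Wb_def)
 qed
 have "\<Psi> i (mext dl2 u) = linext (%b. if b = ((%_. 0), cyc (%_. 0) i) then z i else 0) u"
 proof (rule linm_eq_Kset[OF linm_comp[OF \<Psi>_linm mext_linm] linext_linm u[unfolded Fr_def]])
  fix b :: "mono \<times> mono" assume b: "box (fst b) & deg (snd b) = 2"
  obtain m c where bc: "b = (m, c)" by (cases b)
  have "\<Psi> i (mext dl2 (bas b)) = \<pi> (mon m) (if c = cyc (%_. 0) i then z i else 0)"
   using b by (simp add: bc mext_bas \<Psi>_act W \<Psi>_dl2)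
  also have "\<dots> = (if b = ((%_. 0), cyc (%_. 0) i) then z i else 0)"
  proof (cases "m = (%_. 0)")
   case True
   then show ?thesis by (simp add: bc mon_zero z_scaled linm_0[OF \<pi>_linm])
  next
   case False
   then have "nf m ~= []" using cnt_nf[of m] by (auto simp: cnt_def fun_eq_iff)
   then show ?thesis using False by (simp add: bc mon_def \<pi>_wd_z linm_0[OF \<pi>_linm] wd_closed)
  qed
  finally show "\<Psi> i (mext dl2 (bas b)) = linext (%b. if b = ((%_. 0), cyc (%_. 0) i) then z i else 0) (bas b)" by simp
 qed
 also have "\<dots> = scl (lookup u ((%_. 0), cyc (%_. 0) i)) (z i)"
  by (auto simp: linext_def if_distrib in_keys_iff cong: if_cong)
 finally have "scl (lookup u ((%_. 0), cyc (%_. 0) i)) (z i) = 0"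
  by (simp add: d linm_0[OF \<Psi>_linm])
 moreover obtain b where "lookup (z i) b ~= 0" using z_nz[of i] by (metis lookup_zero poly_mapping_eqI)
 ultimately show ?thesis by (metis lookup_scl lookup_zero mult_eq_0_iff)
qed

theorem fg:
 fixes P :: "nat => ('a, 'm) module"
 assumes P: "projective_resolution R (trivial_module \<epsilon>) P d \<eta>"
 shows "finitely_generated_algebra (cohomology_ring R \<epsilon> P d \<eta>)"
proof -
 obtain dl where dl: "!!c. dl c : Fr (deg c - 1)" "!!c. deg c = 0 ==> dl c = 0"
  "!!c. dl c - D ((%_. 0), c) : lowby 0 (wt ((%_. 0), c))" "!!c. mext dl (dl c) = 0"
  "!!c. lookup (dl c) origin = 0" "!!c. deg c = 2 ==> dl c = dl2 c"
  using resolution_exists[OF dl2_Fr[folded One_nat_def] dl2_lead d1_dl2] by blast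
 interpret pbw_res N jw mu dl
 proof
  show "lookup u ((%_. 0), cyc (%_. 0) i) = 0" if "u : Fr 2" "mext dl u = 0" for u i
   using dl2_cocycle[OF that(1)] mext_cong[of 2 dl dl2 u, OF dl(6) that(1)] that(2) by simp
 qed (use dl in auto)
 have "ALL i. \<exists>\<xi>. (ALL c. deg c < 2 --> \<xi> c = 0) & (ALL c. \<xi> c : Fr (deg c - 2)) &
  (ALL c. 2 \<le> deg c --> \<xi> c - Sh i ((%_. 0), c) : lowby (jw i * N i) (wt ((%_. 0), c))) &
  (ALL c. 3 \<le> deg c --> mext dl (\<xi> c) = mext \<xi> (dl c))"
  using chi_exists by blast
 then obtain \<xi> where \<xi>: "ALL i. (ALL c. deg c < 2 --> \<xi> i c = 0) & (ALL c. \<xi> i c : Fr (deg c - 2)) &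
  (ALL c. 2 \<le> deg c --> \<xi> i c - Sh i ((%_. 0), c) : lowby (jw i * N i) (wt ((%_. 0), c))) &
  (ALL c. 3 \<le> deg c --> mext dl (\<xi> i c) = mext (\<xi> i) (dl c))"
  by (rule choice[THEN exE])
 interpret pbw_chi N jw mu dl \<xi>
  by standard (use \<xi> in auto)
 interpret pbw_fg N jw mu R \<epsilon> kp dl \<xi> ..
 show ?thesis by (rule fg[OF P])
qed

end

section \<open>Presented algebras: representations, augmentations and induction\<close>

section \<open>Algebras given by generators and relations\<close>

lemma free_ring_ring: "ring (free_ring :: ('x, 'k::ring_1) free_algebra ring)"
proof (rule ringI)
 show "abelian_group (free_ring :: ('x, 'k) free_algebra ring)"
  by (rule abelian_groupI) (auto simp: free_ring_def algebra_simps intro: exI[of _ "- x" for x])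
 show "monoid (free_ring :: ('x, 'k) free_algebra ring)"
  by (rule monoidI) (auto simp: free_ring_def algebra_simps)
qed (auto simp: free_ring_def algebra_simps)

lemma free_ring_simps [simp]:
 "carrier free_ring = UNIV" "f \<otimes>\<^bsub>free_ring\<^esub> g = f * g" "f \<oplus>\<^bsub>free_ring\<^esub> g = f + g"
 "\<one>\<^bsub>free_ring\<^esub> = 1" "\<zero>\<^bsub>free_ring\<^esub> = 0"
 by (simp_all add: free_ring_def)

lemma free_ring_minus [simp]: "\<ominus>\<^bsub>free_ring\<^esub> f = - f"
proof -
 interpret ring "free_ring :: ('x, 'k::ring_1) free_algebra ring" by (rule free_ring_ring)
 show ?thesis using minus_equality[of "- f" f] by simp
qed

lemma ideal_Idl: "ideal (Idl\<^bsub>free_ring\<^esub> S) (free_ring :: ('x, 'k::ring_1) free_algebra ring)"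
 by (rule ring.genideal_ideal[OF free_ring_ring]) simp

abbreviation (input) "PA \<equiv> presented_algebra"

lemma presented_eqI:
 assumes "f - g : Idl\<^bsub>free_ring\<^esub> S"
 shows "presented_class S f = presented_class S g"
proof -
 interpret ideal "Idl\<^bsub>free_ring\<^esub> S" free_ring by (rule ideal_Idl)
 have "f : Idl\<^bsub>free_ring\<^esub> S +>\<^bsub>free_ring\<^esub> g"
  using assms by (auto simp: a_r_coset_def' intro!: bexI[of _ "f - g"])
 then show ?thesis unfolding presented_class_def by (intro a_repr_independence[symmetric] is_additive_subgroup a_subgroup) simp_all
qed

lemma presented_alg_simps:
 fixes S :: "('x, 'k::ring_1) free_algebra set"
 shows presented_carrier: "carrier (presented_algebra S) = range (presented_class S)"
  and presented_mult: "presented_class S f \<otimes>\<^bsub>PA S\<^esub> presented_class S g = presented_class S (f * g)"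
  and presented_add: "presented_class S f \<oplus>\<^bsub>PA S\<^esub> presented_class S g = presented_class S (f + g)"
  and presented_one: "\<one>\<^bsub>PA S\<^esub> = presented_class S 1"
  and presented_zero: "\<zero>\<^bsub>PA S\<^esub> = presented_class S 0"
  and presented_smult: "c \<odot>\<^bsub>PA S\<^esub> presented_class S f = presented_class S (scalar c * f)"
proof -
 interpret ideal "Idl\<^bsub>free_ring\<^esub> S" free_ring by (rule ideal_Idl)
 note P = presented_algebra_def Let_def FactRing_def presented_class_def
 show "carrier (presented_algebra S) = range (presented_class S)"
  by (auto simp: P A_RCOSETS_def RCOSETS_def a_r_coset_def)
 show m: "presented_class S f \<otimes>\<^bsub>PA S\<^esub> presented_class S g = presented_class S (f * g)" for f g
  using rcoset_mult_add[of f g] by (simp add: P)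
 show "presented_class S f \<oplus>\<^bsub>PA S\<^esub> presented_class S g = presented_class S (f + g)"
  using a_rcos_sum[of f g] by (simp add: P)
 show "\<one>\<^bsub>PA S\<^esub> = presented_class S 1" by (simp add: P)
 show "\<zero>\<^bsub>PA S\<^esub> = presented_class S 0"
  using a_coset_add_zero[of "Idl\<^bsub>free_ring\<^esub> S"] by (simp add: P)
 show "c \<odot>\<^bsub>PA S\<^esub> presented_class S f = presented_class S (scalar c * f)"
  using m[of "scalar c" f] by (simp add: presented_algebra_def Let_def)
qed

lemma presented_ring: "ring (presented_algebra S)"
proof -
 note P = presented_carrier presented_mult presented_add presented_one presented_zero
 show ?thesis
 proof (rule ringI)
  show "abelian_group (presented_algebra S)"
  proof (rule abelian_groupI)
   fix a assume "a : carrier (presented_algebra S)"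
   then obtain f where "a = presented_class S f" by (auto simp: P)
   then show "EX b:carrier (presented_algebra S). b \<oplus>\<^bsub>PA S\<^esub> a = \<zero>\<^bsub>PA S\<^esub>"
    by (intro bexI[of _ "presented_class S (- f)"]) (simp_all add: P)
  qed (auto simp: P algebra_simps)
  show "monoid (presented_algebra S)" by (rule monoidI) (auto simp: P algebra_simps)
 qed (auto simp: P algebra_simps)
qed

lemma presented_rel: "r : S ==> presented_class S r = \<zero>\<^bsub>PA S\<^esub>"
 unfolding presented_zero
 by (rule presented_eqI) (use ring.genideal_self[OF free_ring_ring, of S] in auto)

lemma presented_rel_eq: "f - g : S ==> presented_class S f = presented_class S g"
 by (rule presented_eqI) (use ring.genideal_self[OF free_ring_ring, of S] in auto)

lemma scalar_mult: "scalar c * f = scl c f"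
proof -
 have "f : Kset (%_. True)" by (simp add: Kset_def)
 then show ?thesis by (induction rule: Kset_induct) (simp_all add: scalar_def mult_single distrib_left)
qed

lemma mult_scl: "f * scl c g = scl c (f * g :: ('x, 'k::field) free_algebra)"
proof -
 have 1: "single w t * scl c g = scl c (single w t * g)" for w t
 proof -
  have "g : Kset (%_. True)" by (simp add: Kset_def)
  then show ?thesis by (induction rule: Kset_induct) (simp_all add: mult_single distrib_left ac_simps)
 qed
 have "f : Kset (%_. True)" by (simp add: Kset_def)
 then show ?thesis by (induction rule: Kset_induct) (simp_all add: 1 distrib_right)
qed

lemma scl_mult: "scl c f * g = scl c (f * g :: ('x, 'k::field) free_algebra)"
 by (simp flip: scalar_mult add: mult.assoc)

lemma presented_scl: "c \<odot>\<^bsub>PA S\<^esub> presented_class S f = presented_class S (scl c f)"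
 by (simp add: presented_smult scalar_mult)

lemma presented_kalg: "kalg (presented_algebra S)"
proof (intro kalg.intro kalg_axioms.intro presented_ring)
 have c: "EX f. a = presented_class S f" if "a : carrier (presented_algebra S)" for a
  using that by (auto simp: presented_carrier)
 note P = presented_carrier presented_mult presented_add presented_scl
 fix a b :: "('a, 'b) free_algebra set" and c d :: 'b
 assume "a : carrier (presented_algebra S)"
 then obtain f where a: "a = presented_class S f" using c by blast
 show "c \<odot>\<^bsub>PA S\<^esub> a : carrier (presented_algebra S)" by (simp add: a P)
 show "(c + d) \<odot>\<^bsub>PA S\<^esub> a = c \<odot>\<^bsub>PA S\<^esub> a \<oplus>\<^bsub>PA S\<^esub> d \<odot>\<^bsub>PA S\<^esub> a"
  by (simp add: a P scl_add_left)
 show "(c * d) \<odot>\<^bsub>PA S\<^esub> a = c \<odot>\<^bsub>PA S\<^esub> (d \<odot>\<^bsub>PA S\<^esub> a)"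
  by (simp add: a P)
 show "1 \<odot>\<^bsub>PA S\<^esub> a = a" by (simp add: a P)
 assume "b : carrier (presented_algebra S)"
 then obtain g where b: "b = presented_class S g" using c by blast
 show "c \<odot>\<^bsub>PA S\<^esub> (a \<oplus>\<^bsub>PA S\<^esub> b) =
   c \<odot>\<^bsub>PA S\<^esub> a \<oplus>\<^bsub>PA S\<^esub> c \<odot>\<^bsub>PA S\<^esub> b"
  by (simp add: a b P)
 show "(c \<odot>\<^bsub>PA S\<^esub> a) \<otimes>\<^bsub>PA S\<^esub> b = c \<odot>\<^bsub>PA S\<^esub> (a \<otimes>\<^bsub>PA S\<^esub> b)"
  by (simp add: a b P scl_mult)
 show "a \<otimes>\<^bsub>PA S\<^esub> (c \<odot>\<^bsub>PA S\<^esub> b) = c \<odot>\<^bsub>PA S\<^esub> (a \<otimes>\<^bsub>PA S\<^esub> b)"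
  by (simp add: a b P mult_scl)
qed

text \<open>The free algebra acts through arbitrary operators \<open>T x\<close>, and a quotient by relations that act
 as zero acts as well.\<close>

definition frep :: "('x => ('b \<Rightarrow>\<^sub>0 'k) => ('b \<Rightarrow>\<^sub>0 'k)) => ('x, 'k::field) free_algebra => ('b \<Rightarrow>\<^sub>0 'k) => ('b \<Rightarrow>\<^sub>0 'k)" where
 "frep T f u = linext (%w. foldr T (letters w) u) f"

text \<open>A class is a coset, and any representative will do: once the relations act as zero,
  \<open>frep_class\<close> shows that all elements of the coset act alike.\<close>

definition prep :: "('x => ('b \<Rightarrow>\<^sub>0 'k) => ('b \<Rightarrow>\<^sub>0 'k)) => ('x, 'k::field) free_algebra set => ('b \<Rightarrow>\<^sub>0 'k) => ('b \<Rightarrow>\<^sub>0 'k)" where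
 "prep T a u = frep T (SOME f. f : a) u"

lemma frep_add: "frep T (f + g) u = frep T f u + frep T g u"
 and frep_diff: "frep T (f - g) u = frep T f u - frep T g u"
 and frep_minus: "frep T (- f) u = - frep T f u"
 and frep_scl: "frep T (scl c f) u = scl c (frep T f u)"
 and frep_0: "frep T 0 u = 0"
 and frep_1: "frep T 1 u = u"
 and frep_gen: "frep T (gen x) u = T x u"
 by (simp_all add: frep_def gen_def zero_free_word_def flip: single_one)

context
 fixes T :: "'x => ('b \<Rightarrow>\<^sub>0 'k::field) => ('b \<Rightarrow>\<^sub>0 'k)"
 assumes T: "linm (T x)"
begin

lemma frep_linm: "linm (frep T f)"
proof -
 have f: "linm (foldr T w)" for w by (induction w) (auto simp: linm_id o_def id_def intro: linm_comp[OF T])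
 have "f : Kset (%_. True)" by (simp add: Kset_def)
 then show ?thesis
  unfolding frep_def[abs_def]
 proof (induction rule: Kset_induct)
  case (single w t)
  show ?case using linm_scaled[OF f] by simp
 qed (auto simp: linm_zero intro: linm_plus)
qed

lemma frep_mult: "frep T (f * g) u = frep T f (frep T g u)"
proof -
 have f: "linm (foldr T w)" for w by (induction w) (auto simp: linm_id o_def id_def intro: linm_comp[OF T])
 have 1: "frep T (single w t * g) u = frep T (single w t) (frep T g u)" for w t
 proof -
  have "g : Kset (%_. True)" by (simp add: Kset_def)
  then show ?thesis
   by (induction rule: Kset_induct)
    (simp_all add: mult_single distrib_left frep_add linm_add[OF frep_linm] linm_0[OF frep_linm] frep_0,
     simp add: frep_def plus_free_word_def linm_scl[OF f])
 qed
 have "f : Kset (%_. True)" by (simp add: Kset_def)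
 then show ?thesis by (induction rule: Kset_induct) (simp_all add: 1 distrib_right frep_add frep_0)
qed

lemma frep_power: "frep T (f ^ n) u = (frep T f ^^ n) u"
 by (induction n) (simp_all add: frep_1 frep_mult)

text \<open>The elements acting as zero form a two-sided ideal; it contains the relations, hence the
  ideal they generate.\<close>

lemma frep_Idl:
 assumes S: "!!r u. r : S ==> frep T r u = 0" and f: "f : Idl\<^bsub>free_ring\<^esub> S"
 shows "frep T f u = 0"
proof -
 have "ideal {f. ALL u. frep T f u = 0} (free_ring :: ('x, 'k) free_algebra ring)"
 proof (rule idealI[OF free_ring_ring])
  show "subgroup {f. ALL u. frep T f u = 0} (add_monoid (free_ring :: ('x, 'k) free_algebra ring))"
  proof
   fix f :: "('x, 'k) free_algebra"
   assume "f : {f. ALL u. frep T f u = 0}"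
   then show "inv\<^bsub>add_monoid free_ring\<^esub> f : {f. ALL u. frep T f u = 0}"
    unfolding a_inv_def[symmetric] free_ring_minus by (simp add: frep_minus)
  qed (auto simp: frep_add frep_0)
 qed (auto simp: frep_mult linm_0[OF frep_linm])
 then have "Idl\<^bsub>free_ring\<^esub> S \<subseteq> {f. ALL u. frep T f u = 0}"
  by (rule ring.genideal_minimal[OF free_ring_ring]) (use S in auto)
 then show ?thesis using f by blast
qed

lemma frep_class:
 assumes S: "!!r u. r : S ==> frep T r u = 0" and g: "g : presented_class S f"
 shows "frep T g u = frep T f u"
 using g frep_Idl[OF S] by (auto simp: presented_class_def a_r_coset_def' frep_add)

lemma prep_class:
 assumes S: "!!r u. r : S ==> frep T r u = 0"
 shows "prep T (presented_class S f) u = frep T f u"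
proof -
 interpret ideal "Idl\<^bsub>free_ring\<^esub> S" free_ring by (rule ideal_Idl)
 have "f : presented_class S f" unfolding presented_class_def by (rule a_rcos_self) simp
 then show ?thesis unfolding prep_def using frep_class[OF S someI[of "%g. g : presented_class S f"]] by blast
qed

end

text \<open>Evaluation at scalars is the representation in which each generator acts by a scalar.
  Its laws, and those of augmentations, are therefore read off from \<open>frep\<close>.\<close>

lemma frep_eval: "frep (%x. scl (v x)) (f :: ('x, 'k::field) free_algebra) u = scl (eval_free v f) u"
proof -
 have w: "foldr (%x. scl (v x)) w u = scl (prod_list (map v w)) u" for w
  by (induction w) simp_all
 have s: "(\<Sum>i\<in>I. scl (c i) u) = scl (\<Sum>i\<in>I. c i) u" for I and c :: "'x free_word => 'k"
  by (induction I rule: infinite_finite_induct) (simp_all add: scl_add_left)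
 show ?thesis by (simp add: frep_def linext_def eval_free_def w s)
qed

lemma eval_free_simps:
 fixes v :: "'x => 'k::field"
 shows
 "eval_free v (f + g) = eval_free v f + eval_free v g" "eval_free v (f - g) = eval_free v f - eval_free v g"
 "eval_free v (- f) = - eval_free v f"
 "eval_free v (f * g) = eval_free v f * eval_free v g" "eval_free v (f ^ n) = eval_free v f ^ n"
 "eval_free v 1 = 1" "eval_free v 0 = 0" "eval_free v (scalar c) = c" "eval_free v (scl c f) = c * eval_free v f" "eval_free v (gen x) = v x"
proof -
 have E: "eval_free v f = lookup (frep (%x. scl (v x)) f (bas ())) ()" for f
  by (simp add: frep_eval)
 have L: "linm (%u. scl (v x) u)" for x by (rule linm_scaled[OF linm_id])
 show "eval_free v (f + g) = eval_free v f + eval_free v g" "eval_free v (f - g) = eval_free v f - eval_free v g"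
  "eval_free v (- f) = - eval_free v f" "eval_free v 0 = 0"
  by (simp_all add: E frep_add frep_diff frep_minus frep_0 lookup_add lookup_minus)
 show m: "eval_free v (f * g) = eval_free v f * eval_free v g" for f g
  by (simp add: E frep_mult[OF L]) (simp add: frep_eval)
 show 1: "eval_free v 1 = 1" by (simp add: E frep_1)
 show "eval_free v (f ^ n) = eval_free v f ^ n" by (induction n) (simp_all add: m 1)
 show "eval_free v (scl c f) = c * eval_free v f" by (simp add: E frep_scl)
 show "eval_free v (scalar c) = c" using scalar_mult[of c "1 :: ('x, 'k) free_algebra"] by (simp add: E frep_scl frep_1)
 show "eval_free v (gen x) = v x" by (simp add: E frep_gen)
qed

lemma presented_aug_class:
 fixes v :: "'x => 'k::field"
 assumes "!!r. r : S ==> eval_free v r = 0"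
 shows "presented_aug v (presented_class S f) = eval_free v f"
proof -
 have L: "linm (%u :: unit \<Rightarrow>\<^sub>0 'k. scl (v x) u)" for x by (rule linm_scaled[OF linm_id])
 have e: "eval_free v g = eval_free v f" if "g : presented_class S f" for g
 proof -
  have "frep (%x. scl (v x)) g (bas ()) = frep (%x. scl (v x)) f (bas ())"
   by (rule frep_class[OF L _ that]) (simp add: frep_eval assms)
  then show ?thesis by (metis frep_eval lookup_scl lookup_single_eq mult.right_neutral)
 qed
 interpret ideal "Idl\<^bsub>free_ring\<^esub> S" free_ring by (rule ideal_Idl)
 have "f : presented_class S f" unfolding presented_class_def by (rule a_rcos_self) simp
 moreover have "eval_free v ` presented_class S f = (%_. eval_free v f) ` presented_class S f"
  by (rule image_cong[OF refl]) (rule e)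
 ultimately have "eval_free v ` presented_class S f = {eval_free v f}"
  using image_constant[of f "presented_class S f" "eval_free v f"] by simp
 then show ?thesis by (simp add: presented_aug_def)
qed

text \<open>Words are built from the left, so it is enough to treat multiplication by one generator
  on the left and linear combinations.\<close>

lemma presented_induct [case_names one gen add scl]:
 assumes one: "Q (presented_class S 1)"
  and gen: "!!x f. Q (presented_class S f) ==> Q (presented_class S (gen x * f))"
  and add: "!!f g. Q (presented_class S f) ==> Q (presented_class S g) ==> Q (presented_class S (f + g))"
  and scl: "!!c f. Q (presented_class S f) ==> Q (presented_class S (scl c f))"
 shows "Q (presented_class S (f :: ('x, 'k::field) free_algebra))"
proof -
 have w: "Q (presented_class S (bas (Word l)))" for l
 proof (induction l)
  case Nil
  then show ?case using one by (simp flip: single_one add: zero_free_word_def)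
 next
  case (Cons x l)
  have "gen x * bas (Word l) = (bas (Word (x # l)) :: ('x, 'k) free_algebra)"
   by (simp add: gen_def mult_single plus_free_word_def)
  then show ?case using gen[OF Cons, of x] by simp
 qed
 have "f : Kset (%_. True)" by (simp add: Kset_def)
 then show ?thesis
 proof (induction rule: Kset_induct)
  case zero
  then show ?case using scl[OF one, of 0] by simp
 next
  case (single b t)
  then show ?case using scl[OF w[of "letters b"], of t] by simp
 qed (rule add)
qed

section \<open>Computation in the generic lifting with symbolic parameters\<close>

section \<open>Symbolic vectors over a field of characteristic three\<close>

text \<open>An entry \<open>(b, (i, j, l), c)\<close> stands for \<open>c e\<^sup>i \<mu>\<^sup>j \<tau>\<^sup>l\<close> times the basis vector \<open>b\<close>.  Since
 \<open>e\<^sup>2 = e\<close>, the exponent of \<open>e\<close> is a truth value.\<close>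

datatype f3 = F0 | F1 | F2

fun f3_add :: "f3 => f3 => f3" where
 "f3_add F0 x = x" | "f3_add x F0 = x" | "f3_add F1 F1 = F2" | "f3_add F1 F2 = F0" | "f3_add F2 F1 = F0" | "f3_add F2 F2 = F1"

fun f3_mult :: "f3 => f3 => f3" where
 "f3_mult F0 x = F0" | "f3_mult F1 x = x" | "f3_mult F2 F0 = F0" | "f3_mult F2 F1 = F2" | "f3_mult F2 F2 = F1"

type_synonym idx = "f3 \<times> f3 \<times> f3"
type_synonym coef = "bool \<times> nat \<times> nat"
type_synonym svec = "(idx \<times> coef \<times> f3) list"

abbreviation "mO \<equiv> (False, 0, 0) :: coef"
abbreviation "mE \<equiv> (True, 0, 0) :: coef"
abbreviation "mM \<equiv> (False, 1, 0) :: coef"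
abbreviation "mT \<equiv> (False, 0, 1) :: coef"

text \<open>Equal terms are merged and vanishing ones dropped, so that cancellation identical in the
  parameters leaves the empty list; the checks below are stated in this form.\<close>

fun ins :: "idx => coef => f3 => svec => svec" where
 "ins b m c [] = (if c = F0 then [] else [(b, m, c)])"
| "ins b m c ((b', m', c') # l) = (if b = b' & m = m' then (let s = f3_add c c' in if s = F0 then l else (b, m, s) # l)
   else (b', m', c') # ins b m c l)"

fun mmul :: "coef => coef => coef" where
 "mmul (i, j, l) (i', j', l') = (i \<or> i', j + j', l + l')"

fun sadd :: "coef => f3 => svec => svec => svec" where
 "sadd m c [] v = v"
| "sadd m c ((b', m', c') # l) v = sadd m c l (ins b' (mmul m m') (f3_mult c c') v)"

fun sapp :: "(idx => svec) => svec => svec" where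
 "sapp f [] = []"
| "sapp f ((b, m, c) # l) = sadd m c (f b) (sapp f l)"

fun htab :: "idx => svec" where
 "htab (F0, b, c) = [((F1, b, c), (False, 0, 0), F1)]"
| "htab (F1, b, c) = [((F2, b, c), (False, 0, 0), F1)]"
| "htab (F2, b, c) = []"

text \<open>Raising the exponent of x in front of a power of y; the case \<open>F2\<close> is the
  relation \<open>x ^ 3 = e x\<close>. The extra terms of \<open>xtab\<close> come from moving x
  past powers of g - 1.\<close>

definition xred :: "f3 => f3 => f3 => svec" where
 "xred a b c = (case b of F0 => [((a, F1, c), (False, 0, 0), F1)] | F1 => [((a, F2, c), (False, 0, 0), F1)]
   | F2 => [((a, F1, c), (True, 0, 0), F1)])"

fun xtab :: "idx => svec" where
 "xtab (F0, b, c) = xred F0 b c"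
| "xtab (F1, b, c) = ((F1, b, c), (True, 0, 0), F1) # ((F2, b, c), (True, 0, 0), F1) # xred F1 b c"
| "xtab (F2, b, c) = ((F2, b, c), (True, 0, 0), F2) # xred F2 b c"

text \<open>The tables describe left multiplication by \<open>g - 1\<close>, \<open>x\<close> and \<open>y\<close> on the basis
 \<open>(g - 1)\<^sup>a x\<^sup>b y\<^sup>c\<close> of the lifting.\<close>

fun ytab :: "idx => svec" where
 "ytab (F0,F0,F0) = [((F0,F0,F1),mO,F1)]"
|  "ytab (F0,F0,F1) = [((F0,F0,F2),mO,F1)]"
|  "ytab (F0,F0,F2) = [((F0,F0,F1),mT,F1), ((F0,F0,F1),(False,Suc 1,0),F1), ((F0,F0,F1),(True,1,0),F2), ((F0,F0,F2),mE,F2)]"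
|  "ytab (F0,F1,F0) = [((F0,F0,F1),mE,F1), ((F0,F1,F0),mM,F1), ((F0,F1,F0),mE,F1), ((F0,F1,F1),mO,F1), ((F0,F2,F0),mO,F2), ((F1,F0,F0),mT,F1), ((F2,F0,F0),mT,F2)]"
|  "ytab (F0,F1,F1) = [((F0,F0,F2),mE,F1), ((F0,F1,F1),mM,F1), ((F0,F1,F1),mE,F1), ((F0,F1,F2),mO,F1), ((F0,F2,F1),mO,F2), ((F1,F0,F1),mT,F1), ((F2,F0,F1),mT,F2)]"
|  "ytab (F0,F1,F2) = [((F0,F0,F1),(True,0,1),F1), ((F0,F0,F1),(True,1,0),F2), ((F0,F0,F1),(True,Suc 1,0),F1), ((F0,F0,F2),mE,F2), ((F0,F1,F1),mT,F1), ((F0,F1,F1),(False,Suc 1,0),F1), ((F0,F1,F1),(True,1,0),F2), ((F0,F1,F2),mM,F1), ((F0,F2,F2),mO,F2), ((F1,F0,F2),mT,F1), ((F2,F0,F2),mT,F2)]"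
|  "ytab (F0,F2,F0) = [((F0,F0,F1),mE,F1), ((F0,F1,F0),mE,F2), ((F0,F1,F0),(True,1,0),F1), ((F0,F1,F1),mE,F2), ((F0,F2,F0),mM,F2), ((F0,F2,F0),mE,F1), ((F0,F2,F1),mO,F1), ((F1,F0,F0),(True,0,1),F2), ((F1,F1,F0),mT,F2), ((F2,F0,F0),(True,0,1),F1), ((F2,F1,F0),mT,F1)]"
|  "ytab (F0,F2,F1) = [((F0,F0,F2),mE,F1), ((F0,F1,F1),mE,F2), ((F0,F1,F1),(True,1,0),F1), ((F0,F1,F2),mE,F2), ((F0,F2,F1),mM,F2), ((F0,F2,F1),mE,F1), ((F0,F2,F2),mO,F1), ((F1,F0,F1),(True,0,1),F2), ((F1,F1,F1),mT,F2), ((F2,F0,F1),(True,0,1),F1), ((F2,F1,F1),mT,F1)]"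
|  "ytab (F0,F2,F2) = [((F0,F0,F1),(True,0,1),F1), ((F0,F0,F1),(True,1,0),F2), ((F0,F0,F1),(True,Suc 1,0),F1), ((F0,F0,F2),mE,F2), ((F0,F1,F1),(True,0,1),F2), ((F0,F1,F1),(True,1,0),F1), ((F0,F1,F1),(True,Suc 1,0),F2), ((F0,F1,F2),(True,1,0),F1), ((F0,F2,F1),mT,F1), ((F0,F2,F1),(False,Suc 1,0),F1), ((F0,F2,F1),(True,1,0),F2), ((F0,F2,F2),mM,F2), ((F1,F0,F2),(True,0,1),F2), ((F1,F1,F2),mT,F2), ((F2,F0,F2),(True,0,1),F1), ((F2,F1,F2),mT,F1)]"
|  "ytab (F1,F0,F0) = [((F0,F1,F0),mO,F1), ((F1,F0,F0),mM,F2), ((F1,F0,F0),mE,F1), ((F1,F0,F1),mO,F1), ((F1,F1,F0),mO,F1), ((F2,F0,F0),mM,F2), ((F2,F0,F0),mE,F1)]"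
|  "ytab (F1,F0,F1) = [((F0,F1,F1),mO,F1), ((F1,F0,F1),mM,F2), ((F1,F0,F1),mE,F1), ((F1,F0,F2),mO,F1), ((F1,F1,F1),mO,F1), ((F2,F0,F1),mM,F2), ((F2,F0,F1),mE,F1)]"
|  "ytab (F1,F0,F2) = [((F0,F1,F2),mO,F1), ((F1,F0,F1),mT,F1), ((F1,F0,F1),(False,Suc 1,0),F1), ((F1,F0,F1),(True,1,0),F2), ((F1,F0,F2),mM,F2), ((F1,F1,F2),mO,F1), ((F2,F0,F2),mM,F2), ((F2,F0,F2),mE,F1)]"
|  "ytab (F1,F1,F0) = [((F0,F2,F0),mO,F1), ((F1,F0,F1),mE,F1), ((F1,F1,F0),mE,F2), ((F1,F1,F1),mO,F1), ((F2,F0,F0),mT,F1), ((F2,F1,F0),mM,F2), ((F2,F1,F0),mE,F1)]"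
|  "ytab (F1,F1,F1) = [((F0,F2,F1),mO,F1), ((F1,F0,F2),mE,F1), ((F1,F1,F1),mE,F2), ((F1,F1,F2),mO,F1), ((F2,F0,F1),mT,F1), ((F2,F1,F1),mM,F2), ((F2,F1,F1),mE,F1)]"
|  "ytab (F1,F1,F2) = [((F0,F2,F2),mO,F1), ((F1,F0,F1),(True,0,1),F1), ((F1,F0,F1),(True,1,0),F2), ((F1,F0,F1),(True,Suc 1,0),F1), ((F1,F0,F2),mE,F2), ((F1,F1,F1),mT,F1), ((F1,F1,F1),(False,Suc 1,0),F1), ((F1,F1,F1),(True,1,0),F2), ((F1,F1,F2),mE,F1), ((F2,F0,F2),mT,F1), ((F2,F1,F2),mM,F2), ((F2,F1,F2),mE,F1)]"
|  "ytab (F1,F2,F0) = [((F0,F1,F0),mE,F1), ((F1,F0,F1),mE,F1), ((F1,F1,F0),(True,1,0),F1), ((F1,F1,F1),mE,F2), ((F1,F2,F0),mM,F1), ((F1,F2,F0),mE,F2), ((F1,F2,F1),mO,F1), ((F2,F0,F0),(True,0,1),F2), ((F2,F1,F0),mT,F2), ((F2,F2,F0),mM,F2), ((F2,F2,F0),mE,F1)]"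
|  "ytab (F1,F2,F1) = [((F0,F1,F1),mE,F1), ((F1,F0,F2),mE,F1), ((F1,F1,F1),(True,1,0),F1), ((F1,F1,F2),mE,F2), ((F1,F2,F1),mM,F1), ((F1,F2,F1),mE,F2), ((F1,F2,F2),mO,F1), ((F2,F0,F1),(True,0,1),F2), ((F2,F1,F1),mT,F2), ((F2,F2,F1),mM,F2), ((F2,F2,F1),mE,F1)]"
|  "ytab (F1,F2,F2) = [((F0,F1,F2),mE,F1), ((F1,F0,F1),(True,0,1),F1), ((F1,F0,F1),(True,1,0),F2), ((F1,F0,F1),(True,Suc 1,0),F1), ((F1,F0,F2),mE,F2), ((F1,F1,F1),(True,0,1),F2), ((F1,F1,F1),(True,1,0),F1), ((F1,F1,F1),(True,Suc 1,0),F2), ((F1,F1,F2),mE,F1), ((F1,F1,F2),(True,1,0),F1), ((F1,F2,F1),mT,F1), ((F1,F2,F1),(False,Suc 1,0),F1), ((F1,F2,F1),(True,1,0),F2), ((F1,F2,F2),mM,F1), ((F1,F2,F2),mE,F1), ((F2,F0,F2),(True,0,1),F2), ((F2,F1,F2),mT,F2), ((F2,F2,F2),mM,F2), ((F2,F2,F2),mE,F1)]"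
|  "ytab (F2,F0,F0) = [((F1,F0,F0),mE,F1), ((F1,F1,F0),mO,F2), ((F2,F0,F0),mM,F1), ((F2,F0,F0),mE,F1), ((F2,F0,F1),mO,F1), ((F2,F1,F0),mO,F2)]"
|  "ytab (F2,F0,F1) = [((F1,F0,F1),mE,F1), ((F1,F1,F1),mO,F2), ((F2,F0,F1),mM,F1), ((F2,F0,F1),mE,F1), ((F2,F0,F2),mO,F1), ((F2,F1,F1),mO,F2)]"
|  "ytab (F2,F0,F2) = [((F1,F0,F2),mE,F1), ((F1,F1,F2),mO,F2), ((F2,F0,F1),mT,F1), ((F2,F0,F1),(False,Suc 1,0),F1), ((F2,F0,F1),(True,1,0),F2), ((F2,F0,F2),mM,F1), ((F2,F1,F2),mO,F2)]"
|  "ytab (F2,F1,F0) = [((F1,F1,F0),mE,F1), ((F1,F2,F0),mO,F2), ((F2,F0,F1),mE,F1), ((F2,F1,F0),mM,F2), ((F2,F1,F0),mE,F2), ((F2,F1,F1),mO,F1), ((F2,F2,F0),mO,F1)]"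
|  "ytab (F2,F1,F1) = [((F1,F1,F1),mE,F1), ((F1,F2,F1),mO,F2), ((F2,F0,F2),mE,F1), ((F2,F1,F1),mM,F2), ((F2,F1,F1),mE,F2), ((F2,F1,F2),mO,F1), ((F2,F2,F1),mO,F1)]"
|  "ytab (F2,F1,F2) = [((F1,F1,F2),mE,F1), ((F1,F2,F2),mO,F2), ((F2,F0,F1),(True,0,1),F1), ((F2,F0,F1),(True,1,0),F2), ((F2,F0,F1),(True,Suc 1,0),F1), ((F2,F0,F2),mE,F2), ((F2,F1,F1),mT,F1), ((F2,F1,F1),(False,Suc 1,0),F1), ((F2,F1,F1),(True,1,0),F2), ((F2,F1,F2),mM,F2), ((F2,F1,F2),mE,F1), ((F2,F2,F2),mO,F1)]"
|  "ytab (F2,F2,F0) = [((F1,F1,F0),mE,F2), ((F1,F2,F0),mE,F1), ((F2,F0,F1),mE,F1), ((F2,F1,F0),mE,F1), ((F2,F1,F0),(True,1,0),F1), ((F2,F1,F1),mE,F2), ((F2,F2,F0),mE,F2), ((F2,F2,F1),mO,F1)]"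
|  "ytab (F2,F2,F1) = [((F1,F1,F1),mE,F2), ((F1,F2,F1),mE,F1), ((F2,F0,F2),mE,F1), ((F2,F1,F1),mE,F1), ((F2,F1,F1),(True,1,0),F1), ((F2,F1,F2),mE,F2), ((F2,F2,F1),mE,F2), ((F2,F2,F2),mO,F1)]"
|  "ytab (F2,F2,F2) = [((F1,F1,F2),mE,F2), ((F1,F2,F2),mE,F1), ((F2,F0,F1),(True,0,1),F1), ((F2,F0,F1),(True,1,0),F2), ((F2,F0,F1),(True,Suc 1,0),F1), ((F2,F0,F2),mE,F2), ((F2,F1,F1),(True,0,1),F2), ((F2,F1,F1),(True,1,0),F1), ((F2,F1,F1),(True,Suc 1,0),F2), ((F2,F1,F2),mE,F2), ((F2,F1,F2),(True,1,0),F1), ((F2,F2,F1),mT,F1), ((F2,F2,F1),(False,Suc 1,0),F1), ((F2,F2,F1),(True,1,0),F2), ((F2,F2,F2),mE,F1)]"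

text \<open>The vectors for \<open>i\<close> solve the equations dual to the relations; they were found by linear algebra
 over the polynomial ring in \<open>e, \<mu>, \<tau>\<close>.  The vector \<open>lint\<close> spans the left integrals.\<close>

fun lvec :: "pbw_gen => pbw_gen => svec" where
 "lvec PH PH = [((F0,F1,F0),(True,0,1),F1), ((F0,F1,F0),(True,1,0),F2), ((F0,F1,F0),(True,Suc 1,0),F1), ((F0,F1,F1),mE,F2), ((F0,F1,F2),mE,F2), ((F0,F2,F0),mT,F1), ((F0,F2,F0),(False,Suc 1,0),F1), ((F0,F2,F0),(True,1,0),F2), ((F0,F2,F1),mE,F2), ((F0,F2,F2),mO,F2), ((F1,F0,F0),(True,0,1),F2), ((F1,F0,F0),(True,1,1),F2), ((F1,F0,F1),(True,0,1),F1), ((F1,F1,F0),(False,1,1),F1), ((F1,F1,F0),(True,1,0),F2), ((F1,F1,F0),(True,Suc 1,0),F1), ((F1,F1,F1),mT,F2), ((F1,F1,F1),mE,F2), ((F1,F1,F2),mE,F2), ((F1,F2,F0),(False,Suc 1,0),F1), ((F1,F2,F0),(True,1,0),F2), ((F1,F2,F1),mE,F2), ((F1,F2,F2),mO,F2), ((F2,F0,F0),(False,0,Suc 1),F1), ((F2,F0,F0),(True,0,1),F2), ((F2,F2,F0),mT,F1)]"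
|  "lvec PH PX = [((F0,F1,F0),(True,0,1),F1), ((F0,F1,F0),(True,1,1),F2), ((F0,F1,F1),(True,0,1),F1), ((F0,F2,F0),(False,1,1),F1), ((F0,F2,F0),(True,0,1),F2), ((F0,F2,F1),mT,F2), ((F1,F0,F0),(True,0,1),F2), ((F1,F0,F0),(True,0,Suc 1),F1), ((F1,F1,F0),(False,0,Suc 1),F1), ((F1,F2,F0),(True,0,1),F1), ((F2,F0,F0),(True,0,1),F1), ((F2,F0,F0),(True,0,Suc 1),F2), ((F2,F0,F0),(True,1,1),F1), ((F2,F1,F0),(False,0,Suc 1),F2), ((F2,F1,F0),(True,0,1),F2), ((F2,F1,F0),(True,1,1),F1), ((F2,F1,F1),(True,0,1),F2), ((F2,F2,F0),(False,1,1),F1), ((F2,F2,F1),mT,F1)]"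
|  "lvec PH PY = []"
|  "lvec PX PH = [((F1,F0,F0),mE,F2), ((F1,F1,F0),mO,F1), ((F2,F0,F0),mM,F2), ((F2,F0,F0),mE,F2), ((F2,F0,F1),mO,F2), ((F2,F1,F0),mO,F1)]"
|  "lvec PX PX = [((F0,F1,F0),mE,F2), ((F0,F2,F0),mO,F1), ((F1,F0,F0),mE,F2), ((F1,F0,F0),(True,1,0),F2), ((F1,F0,F1),mE,F2), ((F1,F1,F0),mM,F2), ((F1,F1,F1),mO,F2), ((F1,F2,F0),mO,F1), ((F2,F0,F0),mT,F1), ((F2,F0,F0),(False,Suc 1,0),F1), ((F2,F0,F0),mE,F1), ((F2,F0,F0),(True,1,0),F2), ((F2,F0,F1),mE,F1), ((F2,F0,F2),mO,F2), ((F2,F1,F0),mM,F2), ((F2,F1,F0),mE,F2)]"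
|  "lvec PX PY = []"
|  "lvec PY PH = []"
|  "lvec PY PX = []"
|  "lvec PY PY = [((F2,F0,F0),mE,F1), ((F2,F2,F0),mO,F2)]"

definition lint :: svec where
 "lint = [((F2,F1,F0),(True,0,1),F1), ((F2,F1,F0),(True,1,0),F2), ((F2,F1,F0),(True,Suc 1,0),F1), ((F2,F1,F1),mE,F2), ((F2,F1,F2),mE,F2), ((F2,F2,F0),mT,F1), ((F2,F2,F0),(False,Suc 1,0),F1), ((F2,F2,F0),(True,1,0),F2), ((F2,F2,F1),mE,F2), ((F2,F2,F2),mO,F2)]"

abbreviation "sH \<equiv> sapp htab"
abbreviation "sX \<equiv> sapp xtab"
abbreviation "sY \<equiv> sapp ytab"
abbreviation "sone b \<equiv> [(b, (False, 0, 0), F1)] :: svec"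

text \<open>The power relations of g - 1, x and y with one factor removed, as operators: this is
  \<open>upol\<close> for the liftings. One more application of the generator gives the full
  relation.\<close>

fun spoly :: "pbw_gen => svec => svec" where
 "spoly PH u = sH (sH u)"
| "spoly PX u = sadd mE F2 u (sX (sX u))"
| "spoly PY u = (let v = sY u in
   sadd (False, Suc 1, 0) F2 u (sadd mT F2 u (sadd (True, 1, 0) F1 u (sadd mE F1 v (sY v)))))"

text \<open>\<open>sxh\<close>, \<open>syh\<close> and \<open>syx\<close> are the commutation
  relations in g - 1, x, y as operators; that they vanish on the basis shows that the tables define
  a module over the lifting.\<close>

definition sxh :: "svec => svec" where
 "sxh u = (let h = sH u in sadd mO F1 (sX h) (sadd mO F2 (sH (sX u)) (sadd mE F2 h (sadd mE F2 (sH h) []))))"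

definition syh :: "svec => svec" where
 "syh u = (let h = sH u in sadd mO F1 (sY h) (sadd mO F2 (sH (sY u)) (sadd mO F2 (sX u) (sadd mO F2 (sX h)
   (sadd mM F1 h (sadd mM F1 (sH h) []))))))"

definition syx :: "svec => svec" where
 "syx u = (let x = sX u; y = sY u; h = sH u in sadd mO F1 (sY x) (sadd mO F2 (sX y) (sadd mO F1 (sX x)
   (sadd mM F2 x (sadd mE F2 x (sadd mE F2 y (sadd mT F2 h (sadd mT F1 (sH h) []))))))))"

text \<open>\<open>vxh\<close>, \<open>vyh\<close> and \<open>vyx\<close> use only the left
  coefficients of these relations and apply them to the images of the three 1-cells: they are the
  left sides of the conditions on the test vectors.\<close>

definition vxh :: "svec => svec => svec" where
 "vxh vh vx = sadd mO F1 (sH vx) (sadd mO F2 (sX vh) (sadd mE F1 vh (sadd mE F1 (sH vh) [])))"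

definition vyh :: "svec => svec => svec => svec" where
 "vyh vh vx vy = sadd mO F1 (sH vy) (sadd mO F2 (sY vh) (sadd mO F1 vx (sadd mO F1 (sX vh) (sadd mM F2 vh (sadd mM F2 (sH vh) [])))))"

definition vyx :: "svec => svec => svec => svec" where
 "vyx vh vx vy = sadd mO F1 (sX vy) (sadd mO F2 (sY vx) (sadd mO F2 (sX vx) (sadd mM F1 vx (sadd mE F1 vx (sadd mE F1 vy
   (sadd mT F1 vh (sadd mT F2 (sH vh) [])))))))"

definition all3 :: "(f3 => bool) => bool" where "all3 P \<longleftrightarrow> P F0 & P F1 & P F2"

definition allb :: "(idx => bool) => bool" where "allb P \<longleftrightarrow> all3 (%a. all3 (%b. all3 (%c. P (a, b, c))))"

definition allg :: "(pbw_gen => bool) => bool" where "allg P \<longleftrightarrow> P PH & P PX & P PY"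

text \<open>The parameters stay symbolic in this and the following evaluations, so a single
  computation covers every lifting.\<close>

lemma check_h: "allb (%b. sH (spoly PH (sone b)) = [])" by code_simp

lemma check_x: "allb (%b. sX (spoly PX (sone b)) = [])" by code_simp

lemma check_xh: "allb (%b. sxh (sone b) = [])" by code_simp

lemma check_yh: "allb (%b. syh (sone b) = [])" by code_simp

lemma check_yx: "allb (%b. syx (sone b) = [])" by code_simp

lemma check_vec: "allg (%i. vxh (lvec i PH) (lvec i PX) = [] & vyh (lvec i PH) (lvec i PX) (lvec i PY) = [] &
  vyx (lvec i PH) (lvec i PX) (lvec i PY) = [])" by code_simp

lemma check_pow: "allg (%i. allg (%j. sadd mO F2 (spoly j (lvec i j)) (if i = j then lint else []) = []))" by code_simp

lemma check_int: "sH lint = [] & sX lint = [] & sY lint = []" by code_simp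

lemma check_y0: "all3 (%a. all3 (%b. sY (spoly PY (sone (a, b, F0))) = []))" by code_simp

lemma check_y1: "all3 (%a. all3 (%b. sY (spoly PY (sone (a, b, F1))) = []))" by code_simp

lemma check_y2: "all3 (%a. all3 (%b. sY (spoly PY (sone (a, b, F2))) = []))" by code_simp

lemma all3_D: "all3 P ==> P a"
 by (cases a) (simp_all add: all3_def)

lemma allb_D: "allb P ==> P b"
 unfolding allb_def by (cases b) (auto dest!: all3_D)

lemma allg_D: "allg P ==> P i"
 by (cases i) (simp_all add: allg_def)

lemma (in kalg) rep_lev:
 assumes add: "!!a b. a : carrier R ==> b : carrier R ==> \<pi> (a \<oplus> b) = \<pi> a + \<pi> b"
  and smult: "!!c a. a : carrier R ==> \<pi> (c \<odot>\<^bsub>R\<^esub> a) = scl c (\<pi> a)"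
  and f: "!!b. f b : carrier R"
 shows "\<pi> (lev f u) = linext (%b. \<pi> (f b)) u"
proof -
 have z: "\<pi> \<zero> = 0" using smult[of \<zero> 0] by (simp add: sm_zero_left)
 have "u : Kset (%_. True)" by (simp add: Kset_def)
 then show ?thesis
  by (induction rule: Kset_induct) (simp_all add: lev_zero z lev_single[OF f] smult f lev_add[OF f] add lev_closed[OF f])
qed

lemma prep_facts:
 fixes T :: "'x => ('b \<Rightarrow>\<^sub>0 'k::field) => ('b \<Rightarrow>\<^sub>0 'k)"
 assumes T: "!!x. linm (T x)" and S: "!!r u. r : S ==> frep T r u = 0"
 defines "R \<equiv> presented_algebra S"
 shows "a : carrier R ==> linm (prep T a)"
  and "a : carrier R ==> b : carrier R ==> prep T (a \<oplus>\<^bsub>R\<^esub> b) u = prep T a u + prep T b u"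
  and "a : carrier R ==> b : carrier R ==> prep T (a \<otimes>\<^bsub>R\<^esub> b) u = prep T a (prep T b u)"
  and "a : carrier R ==> prep T (c \<odot>\<^bsub>R\<^esub> a) u = scl c (prep T a u)"
  and "prep T \<one>\<^bsub>R\<^esub> u = u"
proof -
 note P = presented_carrier presented_add presented_mult presented_scl presented_one
 have c: "!!f u. prep T (presented_class S f) u = frep T f u" by (rule prep_class[OF T S])
 have c': "!!f. prep T (presented_class S f) = frep T f" by (rule ext) (rule c)
 show "a : carrier R ==> linm (prep T a)"
  by (auto simp: R_def P c' frep_linm[OF T])
 show "a : carrier R ==> b : carrier R ==> prep T (a \<oplus>\<^bsub>R\<^esub> b) u = prep T a u + prep T b u"
  by (auto simp: R_def P c frep_add)
 show "a : carrier R ==> b : carrier R ==> prep T (a \<otimes>\<^bsub>R\<^esub> b) u = prep T a (prep T b u)"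
  by (auto simp: R_def P c frep_mult[OF T])
 show "a : carrier R ==> prep T (c \<odot>\<^bsub>R\<^esub> a) u = scl c (prep T a u)"
  by (auto simp: R_def P c frep_scl)
 show "prep T \<one>\<^bsub>R\<^esub> u = u" by (simp add: R_def P c frep_1)
qed

lemma presented_aug_facts:
 fixes v :: "'x => 'k::field"
 assumes S: "!!r. r : S ==> eval_free v r = 0"
 defines "R \<equiv> presented_algebra S"
 shows "a : carrier R ==> b : carrier R ==> presented_aug v (a \<oplus>\<^bsub>R\<^esub> b) = presented_aug v a + presented_aug v b"
  and "a : carrier R ==> b : carrier R ==> presented_aug v (a \<otimes>\<^bsub>R\<^esub> b) = presented_aug v a * presented_aug v b"
  and "a : carrier R ==> presented_aug v (c \<odot>\<^bsub>R\<^esub> a) = c * presented_aug v a"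
  and "presented_aug v \<one>\<^bsub>R\<^esub> = 1"
proof -
 note P = presented_carrier presented_add presented_mult presented_scl presented_one presented_aug_class[OF S] eval_free_simps
 show "a : carrier R ==> b : carrier R ==> presented_aug v (a \<oplus>\<^bsub>R\<^esub> b) = presented_aug v a + presented_aug v b"
  "a : carrier R ==> b : carrier R ==> presented_aug v (a \<otimes>\<^bsub>R\<^esub> b) = presented_aug v a * presented_aug v b"
  "a : carrier R ==> presented_aug v (c \<odot>\<^bsub>R\<^esub> a) = c * presented_aug v a"
  "presented_aug v \<one>\<^bsub>R\<^esub> = 1"
  by (auto simp: R_def P)
qed

section \<open>The liftings in characteristic three\<close>

section \<open>The liftings\<close>

text \<open>The condition that the first parameter is 0 or 1 enters as idempotence, which is what a
  truth value as exponent in \<open>coef\<close> expresses.\<close>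

locale lifting_params =
 fixes ce \<mu> \<tau> :: "'k::field"
 assumes ce: "ce * ce = ce" and three: "(3 :: 'k) = 0"
begin

definition fv :: "f3 => 'k" where "fv c = (case c of F0 => 0 | F1 => 1 | F2 => - 1)"

definition cv :: "coef => 'k" where "cv m = (case m of (i, j, l) => (if i then ce else 1) * \<mu> ^ j * \<tau> ^ l)"

fun sv :: "svec => (idx \<Rightarrow>\<^sub>0 'k)" where
 "sv [] = 0"
| "sv ((b, m, c) # l) = single b (cv m * fv c) + sv l"

lemma fv_simps [simp]: "fv F0 = 0" "fv F1 = 1" "fv F2 = - 1"
 by (simp_all add: fv_def)

lemma cv_simps: "cv (False, 0, 0) = 1" "cv (True, 0, 0) = ce" "cv (False, Suc 0, 0) = \<mu>" "cv (False, 0, Suc 0) = \<tau>"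
 "cv (False, Suc (Suc 0), 0) = \<mu> ^ 2" "cv (True, Suc 0, 0) = ce * \<mu>"
 by (simp_all add: cv_def power2_eq_square)

lemma fv_add: "fv (f3_add c c') = fv c + fv c'"
proof -
 have "(- 1 :: 'k) = 1 + 1" "(1 :: 'k) = - 1 + - 1" using three by (simp_all add: algebra_simps eq_neg_iff_add_eq_0)
 then show ?thesis by (cases c; cases c') simp_all
qed

lemma fv_mult: "fv (f3_mult c c') = fv c * fv c'"
 by (cases c; cases c') simp_all

lemma cv_mmul: "cv (mmul m m') = cv m * cv m'"
proof -
 have c: "(if i \<or> j then ce else 1) = (if i then ce else 1) * (if j then ce else 1)" for i j
  by (cases i; cases j) (simp_all only: ce if_True if_False simp_thms mult_1_left mult_1_right)
 obtain i j l i' j' l' where m: "m = (i, j, l)" "m' = (i', j', l')" by (cases m; cases m')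
 show ?thesis by (simp only: m cv_def mmul.simps prod.case power_add c ac_simps)
qed

lemma sv_ins: "sv (ins b m c l) = single b (cv m * fv c) + sv l"
proof (induction b m c l rule: ins.induct)
 case (2 b m c b' m' c' l)
 show ?case
 proof (cases "b = b' & m = m'")
  case True
  have "single b (cv m * fv (f3_add c c')) = single b (cv m * fv c) + single b (cv m * fv c')"
   by (simp add: fv_add distrib_left single_add)
  then show ?thesis using True by (auto simp: Let_def add.assoc simp flip: add.assoc)
 next
  case False
  then show ?thesis using 2 by (auto simp: add.left_commute)
 qed
qed simp

lemma sv_sadd: "sv (sadd m c l v) = scl (cv m * fv c) (sv l) + sv v"
 by (induction m c l v rule: sadd.induct) (simp_all add: sv_ins cv_mmul fv_mult ac_simps)

definition op :: "(idx => svec) => (idx \<Rightarrow>\<^sub>0 'k) => (idx \<Rightarrow>\<^sub>0 'k)" where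
 "op f = linext (%b. sv (f b))"

lemma sv_sapp: "sv (sapp f l) = op f (sv l)"
 by (induction f l rule: sapp.induct) (simp_all add: sv_sadd op_def)

lemma op_linm: "linm (op f)"
 by (simp add: op_def linext_linm)

lemma sv_sone: "sv (sone b) = bas b"
 by (simp add: cv_simps)

abbreviation "opH \<equiv> op htab"
abbreviation "opX \<equiv> op xtab"
abbreviation "opY \<equiv> op ytab"

lemmas sv_simps = sv_sadd sv_sapp cv_simps Let_def

lemma op_rules [simp]: "op f 0 = 0" "op f (u + v) = op f u + op f v" "op f (u - v) = op f u - op f v" "op f (- u) = - op f u"
 "op f (scl c u) = scl c (op f u)"
 by (simp_all add: op_def)

text \<open>The passage from lists to operators: the list function \<open>c\<close> represents the
  linear map \<open>F\<close>, so an empty list on every basis vector forces \<open>F\<close> to be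
  zero.\<close>

lemma op_eq_0:
 assumes F: "linm F" "!!u. sv (c u) = F (sv u)" and c: "!!b. c (sone b) = []"
 shows "F u = 0"
proof (rule linm_eqI[OF F(1) linm_zero])
 fix b
 have "F (bas b) = sv (c (sone b))" by (simp only: F(2) sv_sone)
 then show "F (bas b) = 0" by (simp add: c)
qed

lemmas linm_intros = linm_plus linm_sub linm_scaled linm_comp[OF op_linm] linm_id

lemma op_h: "opH (opH (opH u)) = 0"
 by (rule op_eq_0[where c = "%u. sH (spoly PH u)", OF _ _ allb_D[OF check_h]]) (intro linm_intros, simp add: sv_simps sxh_def syh_def syx_def algebra_simps)

lemma op_x: "opX (opX (opX u)) - scl ce (opX u) = 0"
 by (rule op_eq_0[where c = "%u. sX (spoly PX u)", OF _ _ allb_D[OF check_x]]) (intro linm_intros, simp add: sv_simps sxh_def syh_def syx_def algebra_simps)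

lemma check_y: "sY (spoly PY (sone b)) = []"
proof -
 obtain i j k where b: "b = (i, j, k)" by (metis prod.collapse)
 show ?thesis
  unfolding b using all3_D[OF all3_D[OF check_y0]] all3_D[OF all3_D[OF check_y1]] all3_D[OF all3_D[OF check_y2]]
  by (cases k) metis+
qed

lemma op_y: "opY (opY (opY u)) + scl ce (opY (opY u)) + scl (ce * \<mu>) (opY u) - scl \<tau> (opY u) - scl (\<mu> ^ 2) (opY u) = 0"
 by (rule op_eq_0[where c = "%u. sY (spoly PY u)", OF _ _ check_y]) (intro linm_intros, simp add: sv_simps sxh_def syh_def syx_def algebra_simps)

lemma op_xh: "opX (opH u) - opH (opX u) - scl ce (opH u) - scl ce (opH (opH u)) = 0"
 by (rule op_eq_0[where c = "sxh", OF _ _ allb_D[OF check_xh]]) (intro linm_intros, simp add: sv_simps sxh_def syh_def syx_def algebra_simps)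

lemma op_yh: "opY (opH u) - opH (opY u) - opX u - opX (opH u) + scl \<mu> (opH u) + scl \<mu> (opH (opH u)) = 0"
 by (rule op_eq_0[where c = "syh", OF _ _ allb_D[OF check_yh]]) (intro linm_intros, simp add: sv_simps sxh_def syh_def syx_def algebra_simps)

lemma op_yx: "opY (opX u) - opX (opY u) + opX (opX u) - scl \<mu> (opX u) - scl ce (opX u) - scl ce (opY u)
  - scl \<tau> (opH u) + scl \<tau> (opH (opH u)) = 0"
 by (rule op_eq_0[where c = "syx", OF _ _ allb_D[OF check_yx]]) (intro linm_intros, simp add: sv_simps sxh_def syh_def syx_def algebra_simps)

definition lact :: "lifting_gen => (idx \<Rightarrow>\<^sub>0 'k) => (idx \<Rightarrow>\<^sub>0 'k)" where
 "lact x = (case x of LG => (%u. u + opH u) | LX => opX | LY => opY)"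

lemma lact_linm: "linm (lact x)"
 by (cases x) (simp_all add: lact_def op_linm linm_plus linm_id)

abbreviation "S \<equiv> lifting_relations ce \<mu> \<tau>"
abbreviation "A \<equiv> lifting_algebra ce \<mu> \<tau>"
abbreviation "cls \<equiv> presented_class S"

lemma A_eq: "A = presented_algebra S"
 by (simp add: lifting_algebra_def)

lemma triple: "u + u + u = (0 :: 'b \<Rightarrow>\<^sub>0 'k)"
proof (rule poly_mapping_eqI)
 fix b
 have "3 * lookup u b = 0" using three by simp
 then show "lookup (u + u + u) b = lookup 0 b" by (simp add: lookup_add algebra_simps)
qed

lemma double: "u + u = - (u :: 'b \<Rightarrow>\<^sub>0 'k)"
 using triple[of u] by (simp add: eq_neg_iff_add_eq_0)

definition lh :: "pbw_gen => (lifting_gen, 'k) free_algebra" where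
 "lh i = (case i of PH => gen LG - 1 | PX => gen LX | PY => gen LY)"

text \<open>The relations, rewritten in terms of \<open>h = g - 1\<close>.\<close>

lemma relations_h:
 defines "h \<equiv> lh PH" and "x \<equiv> lh PX" and "y \<equiv> lh PY"
 shows "S = {h * (h * h), x * (x * x) - scl ce x, y * (y * y) - (scl (- ce) (y * y) - scl (\<mu> * ce - \<tau> - \<mu> ^ 2) y),
  y * h - (h * y + scl 1 (x + x * h) + scl (- \<mu>) (h + h * h)), x * h - (h * x + scl ce (h + h * h)),
  y * x - (x * y + scl (- 1) (x * x) + scl (\<mu> + ce) x + scl ce y + scl \<tau> (h + scl (- 1) (h * h)))}"
proof -
 have two: "(2 :: (lifting_gen, 'k) free_algebra) = - 1"
  using double[of "1 :: (lifting_gen, 'k) free_algebra"] by (simp only: one_add_one)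
 have hh: "h * h = gen LG ^ 2 + gen LG + 1"
  using double[of "gen LG"] by (simp add: h_def lh_def algebra_simps power2_eq_square)
 have hhh: "h * (h * h) = gen LG ^ 3 - 1"
  unfolding hh by (simp add: h_def lh_def algebra_simps power2_eq_square power3_eq_cube)
 have g2: "h + scl (- 1) (h * h) = 1 - gen LG ^ 2" "h + h * h = - (gen LG - gen LG ^ 2)"
  using double[of "gen LG"] unfolding hh by (simp_all add: h_def lh_def algebra_simps two)
 show ?thesis
  unfolding g2 hhh using scalar_mult[of \<tau> "1 :: (lifting_gen, 'k) free_algebra"]
  by (simp add: lifting_relations_def Let_def x_def y_def h_def lh_def scalar_mult scl_mult power2_eq_square power3_eq_cube algebra_simps)
qed

lemma frep_lh: "frep lact (lh PH) u = opH u" "frep lact (lh PX) u = opX u" "frep lact (lh PY) u = opY u"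
 by (simp_all add: lh_def frep_diff frep_gen frep_1 lact_def)

lemma frep_lifting: "r : S ==> frep lact r u = 0"
proof -
 note F = frep_add frep_diff frep_minus frep_scl frep_mult[of lact, OF lact_linm] frep_lh
 have d: "scl (a - b) v = scl a v - scl b v" for a b and v :: "idx \<Rightarrow>\<^sub>0 'k"
  using scl_add_left[of a "- b" v] by simp
 let ?h = "lh PH" and ?x = "lh PX" and ?y = "lh PY"
 have 1: "frep lact (?h * (?h * ?h)) u = 0" "frep lact (?x * (?x * ?x) - scl ce ?x) u = 0"
  by (simp_all only: F op_h op_x)
 have 2: "frep lact (?y * (?y * ?y) - (scl (- ce) (?y * ?y) - scl (\<mu> * ce - \<tau> - \<mu> ^ 2) ?y)) u = 0"
  using op_y[of u] by (simp add: F d scl_add_left algebra_simps)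
 have 3: "frep lact (?y * ?h - (?h * ?y + scl 1 (?x + ?x * ?h) + scl (- \<mu>) (?h + ?h * ?h))) u = 0"
  using op_yh[of u] by (simp add: F algebra_simps)
 have 4: "frep lact (?x * ?h - (?h * ?x + scl ce (?h + ?h * ?h))) u = 0"
  using op_xh[of u] by (simp add: F algebra_simps)
 have 5: "frep lact (?y * ?x - (?x * ?y + scl (- 1) (?x * ?x) + scl (\<mu> + ce) ?x + scl ce ?y + scl \<tau> (?h + scl (- 1) (?h * ?h)))) u = 0"
  using op_yx[of u] by (simp add: F scl_add_left algebra_simps)
 assume "r : S"
 then show ?thesis unfolding relations_h insert_iff empty_iff
  by (elim disjE FalseE) (simp_all only: 1 2 3 4 5)
qed

text \<open>The value at \<open>PH\<close> is 0 because (g - 1)^3 = g^3 - 1 in characteristic 3. The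
  other two values are the right sides of the relations for x^3 and y^3.\<close>

definition lpc :: "pbw_gen => nat \<Rightarrow>\<^sub>0 'k" where
 "lpc i = (case i of PH => 0 | PX => single 1 ce
   | PY => single 2 (- ce) + single 1 (- (\<mu> * ce - \<tau> - \<mu> ^ 2)))"

definition le :: "pbw_gen => (lifting_gen, 'k) free_algebra set" where "le i = cls (lh i)"

lemma eval_lifting: "r : S ==> eval_free (%z. case z of LG => 1 | LX => 0 | LY => 0) r = 0"
 by (auto simp: lifting_relations_def Let_def eval_free_simps)

lemma aug_eq: "lifting_aug = presented_aug (%z. case z of LG => 1 | LX => 0 | LY => (0 :: 'k))"
 by (simp add: lifting_aug_def)

sublocale kalg A
 unfolding A_eq by (rule presented_kalg)

sublocale kalg_gens A "%_. 3" jw le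
 by standard (auto simp: A_eq presented_carrier le_def jw_def split: pbw_gen.split)

abbreviation "b0 \<equiv> bas (F0, F0, F0) :: idx \<Rightarrow>\<^sub>0 'k"

definition f3_of :: "nat => f3" where "f3_of n = (if n = 0 then F0 else if n = 1 then F1 else F2)"

definition midx :: "mono => idx" where "midx m = (f3_of (m PH), f3_of (m PX), f3_of (m PY))"

lemma lprep:
 "a : carrier A ==> linm (prep lact a)"
 "a : carrier A ==> b : carrier A ==> prep lact (a \<oplus>\<^bsub>A\<^esub> b) u = prep lact a u + prep lact b u"
 "a : carrier A ==> b : carrier A ==> prep lact (a \<otimes>\<^bsub>A\<^esub> b) u = prep lact a (prep lact b u)"
 "a : carrier A ==> prep lact (c \<odot>\<^bsub>A\<^esub> a) u = scl c (prep lact a u)"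
 "prep lact \<one>\<^bsub>A\<^esub> u = u"
 unfolding A_eq by (rule prep_facts; (rule lact_linm | rule frep_lifting | assumption); assumption?)+

lemma laug:
 "a : carrier A ==> b : carrier A ==> lifting_aug (a \<oplus>\<^bsub>A\<^esub> b) = lifting_aug a + lifting_aug b"
 "a : carrier A ==> b : carrier A ==> lifting_aug (a \<otimes>\<^bsub>A\<^esub> b) = lifting_aug a * lifting_aug b"
 "a : carrier A ==> lifting_aug (c \<odot>\<^bsub>A\<^esub> a) = c * lifting_aug a"
 "lifting_aug \<one>\<^bsub>A\<^esub> = 1"
 unfolding A_eq aug_eq by (rule presented_aug_facts; (rule eval_lifting | assumption); assumption?)+

lemma cls_closed: "cls f : carrier A" and cls_zero: "\<zero>\<^bsub>A\<^esub> = cls 0" and cls_one: "\<one>\<^bsub>A\<^esub> = cls 1"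
 by (simp_all add: A_eq presented_carrier presented_zero presented_one)

lemma prep_wd: "prep lact (wd l) u = foldr (%i. frep lact (lh i)) l u"
proof (induction l)
 case (Cons i l)
 then show ?case
  by (simp add: lprep(3) e wd_closed) (simp add: le_def prep_class[OF lact_linm frep_lifting])
qed (simp add: lprep(5))

text \<open>On the vector that represents 1 each ordered monomial produces the basis vector of its
  own exponents. This turns the tables into a proof that the monomials are independent.\<close>

lemma prep_mon: "box m ==> prep lact (mon m) b0 = bas (midx m)"
proof -
 assume m: "box m"
 have F: "foldr (%i. frep lact (lh i)) (replicate k i) u = (frep lact (lh i) ^^ k) u" for k i u
  by (induction k) simp_all
 have c: "n = 0 \<or> n = 1 \<or> n = Suc 1" if "n < 3" for n :: nat using that by auto
 have lt: "m i < 3" for i using m by (simp add: box_def)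
 have Y: "(opY ^^ n) b0 = bas (F0, F0, f3_of n)" if "n < 3" for n
  using c[OF that] by (auto simp: op_def f3_of_def cv_simps)
 have X: "(opX ^^ n) (bas (F0, F0, k)) = bas (F0, f3_of n, k)" if "n < 3" for n k
  using c[OF that] by (auto simp: op_def f3_of_def cv_simps xred_def)
 have H: "(opH ^^ n) (bas (F0, j, k)) = bas (f3_of n, j, k)" if "n < 3" for n j k
  using c[OF that] by (auto simp: op_def f3_of_def cv_simps)
 have L: "frep lact (lh PH) = opH" "frep lact (lh PX) = opX" "frep lact (lh PY) = opY"
  by (simp_all add: fun_eq_iff frep_lh)
 show ?thesis by (simp add: mon_def nf_def prep_wd F L Y X H lt midx_def)
qed

lemma midx_inj: "inj_on midx {m. box m}"
proof (rule inj_onI)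
 have c: "n = 0 \<or> n = 1 \<or> n = 2" if "n < 3" for n :: nat using that by auto
 have f: "f3_of a = f3_of b ==> a < 3 ==> b < 3 ==> a = b" for a b
  using c[of a] c[of b] by (auto simp: f3_of_def)
 show "m = m'" if "m : {m. box m}" "m' : {m. box m}" "midx m = midx m'" for m m'
  using that f by (simp add: mono_eq_iff midx_def box_def)
qed

lemma independent:
 assumes u: "u : Kset box" and 0: "lev mon u = \<zero>\<^bsub>A\<^esub>"
 shows "u = 0"
proof -
 have "prep lact (lev mon u) b0 = linext (%m. prep lact (mon m) b0) u"
  by (rule rep_lev[where \<pi> = "%a. prep lact a b0"])
   (simp_all add: lprep mon_closed)
 also have "\<dots> = linext (%m. bas (midx m)) u"
  by (rule linm_eq_Kset[OF linext_linm linext_linm u]) (simp add: prep_mon)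
 finally have 1: "linext (%m. bas (midx m)) u = 0"
  using lprep(4)[of "\<zero>\<^bsub>A\<^esub>" 0 b0] by (simp add: 0 sm_zero_left)
 show ?thesis
 proof (rule poly_mapping_eqI)
  fix m
  have "lookup (linext (%m. bas (midx m)) u) (midx m) = lookup u m" if m: "box m"
   using u
  proof (induction rule: Kset_induct)
   case (single m' t)
   then show ?case using m inj_onD[OF midx_inj, of m m'] by (auto simp: lookup_single when_def)
  qed (simp_all add: lookup_add)
  moreover have "lookup u m = 0" if "\<not> box m" using that u by (auto simp: Kset_def in_keys_iff)
  ultimately show "lookup u m = lookup 0 m" by (cases "box m") (simp_all add: 1)
 qed
qed

lemma le_mult: "le i \<otimes>\<^bsub>A\<^esub> cls f = cls (lh i * f)" and le_mult2: "le i \<otimes>\<^bsub>A\<^esub> le j = cls (lh i * lh j)"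
 and cls_add: "cls f \<oplus>\<^bsub>A\<^esub> cls g = cls (f + g)" and cls_scl: "c \<odot>\<^bsub>A\<^esub> cls f = cls (scl c f)"
 by (simp_all add: A_eq le_def presented_mult presented_add presented_scl)

lemma le_rels:
 "le PX \<otimes>\<^bsub>A\<^esub> le PH = le PH \<otimes>\<^bsub>A\<^esub> le PX \<oplus>\<^bsub>A\<^esub> ce \<odot>\<^bsub>A\<^esub> (le PH \<oplus>\<^bsub>A\<^esub> le PH \<otimes>\<^bsub>A\<^esub> le PH)"
 "le PY \<otimes>\<^bsub>A\<^esub> le PH = le PH \<otimes>\<^bsub>A\<^esub> le PY \<oplus>\<^bsub>A\<^esub> 1 \<odot>\<^bsub>A\<^esub> (le PX \<oplus>\<^bsub>A\<^esub> le PX \<otimes>\<^bsub>A\<^esub> le PH)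
   \<oplus>\<^bsub>A\<^esub> (- \<mu>) \<odot>\<^bsub>A\<^esub> (le PH \<oplus>\<^bsub>A\<^esub> le PH \<otimes>\<^bsub>A\<^esub> le PH)"
 "le PY \<otimes>\<^bsub>A\<^esub> le PX = le PX \<otimes>\<^bsub>A\<^esub> le PY \<oplus>\<^bsub>A\<^esub> (- 1) \<odot>\<^bsub>A\<^esub> (le PX \<otimes>\<^bsub>A\<^esub> le PX) \<oplus>\<^bsub>A\<^esub> (\<mu> + ce) \<odot>\<^bsub>A\<^esub> le PX
   \<oplus>\<^bsub>A\<^esub> ce \<odot>\<^bsub>A\<^esub> le PY \<oplus>\<^bsub>A\<^esub> \<tau> \<odot>\<^bsub>A\<^esub> (le PH \<oplus>\<^bsub>A\<^esub> (- 1) \<odot>\<^bsub>A\<^esub> (le PH \<otimes>\<^bsub>A\<^esub> le PH))"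
 unfolding le_mult2 unfolding le_def cls_add cls_scl
 by (rule presented_rel_eq, simp only: relations_h insert_iff simp_thms)+

lemma wd_replicate: "wd (replicate k i) = cls (lh i ^ k)"
 by (induction k) (simp_all add: le_mult cls_one)

lemma le_pow: "wd (replicate 3 i) = lev (%k. wd (replicate k i)) (lpc i)"
proof -
 have p: "u ^ 3 = u * (u * u)" "u ^ 2 = u * u" "u ^ 1 = u" for u :: "(lifting_gen, 'k) free_algebra"
  by (simp_all add: power3_eq_cube power2_eq_square mult.assoc)
 have 1: "lev (%k. cls (lh i ^ k)) u = cls (linext (%k. lh i ^ k) u)" for u
 proof -
  have "u : Kset (%_. True)" by (simp add: Kset_def)
  then show ?thesis
   by (induction rule: Kset_induct)
    (simp_all add: lev_zero lev_single[OF cls_closed] lev_add[OF cls_closed] cls_scl cls_add cls_zero)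
 qed
 have 2: "linext (%k. lh PH ^ k) (lpc PH) = 0" "linext (%k. lh PX ^ k) (lpc PX) = scl ce (lh PX)"
  "linext (%k. lh PY ^ k) (lpc PY) = scl (- ce) (lh PY * lh PY) - scl (\<mu> * ce - \<tau> - \<mu> ^ 2) (lh PY)"
  by (simp_all add: lpc_def power2_eq_square del: minus_diff_eq)
 show ?thesis
  unfolding wd_replicate 1 unfolding p
  by (rule presented_rel_eq, cases i; simp only: relations_h insert_iff simp_thms 2 diff_zero)
qed

lemma lpc: "lpc i : Kset (%k. 0 < k & k < 3)"
 by (cases i) (simp_all add: lpc_def Kset_add Kset_single)

lemma generated: "a : carrier A ==> a : lspan (range wd)"
proof -
 assume "a : carrier A"
 then obtain f where a: "a = cls f" by (auto simp: A_eq presented_carrier)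
 have r: "range wd \<subseteq> carrier A" using wd_closed by auto
 have le_l: "le i \<otimes>\<^bsub>A\<^esub> b : lspan (range wd)" if "b : lspan (range wd)" for i b
 proof -
  have "le i \<otimes>\<^bsub>A\<^esub> b \<otimes>\<^bsub>A\<^esub> \<one>\<^bsub>A\<^esub> : lspan (range wd)"
  proof (rule lspan_mult[OF r e one_closed _ that])
   fix x assume "x : range wd"
   then obtain l where "x = wd l" by auto
   then have "le i \<otimes>\<^bsub>A\<^esub> x \<otimes>\<^bsub>A\<^esub> \<one>\<^bsub>A\<^esub> = wd (i # l)" using wd_closed[of "i # l"] by simp
   then show "le i \<otimes>\<^bsub>A\<^esub> x \<otimes>\<^bsub>A\<^esub> \<one>\<^bsub>A\<^esub> : lspan (range wd)" by (metis lspan.base rangeI)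
  qed
  then show ?thesis using lspan_closed[OF r that] e[of i] by simp
 qed
 have "cls f : lspan (range wd)"
 proof (induction rule: presented_induct[where Q = "%a. a : lspan (range wd)"])
  case one
  have "cls 1 = wd []" by (simp add: cls_one)
  then show ?case by (metis lspan.base rangeI)
 next
  case (gen x f)
  show ?case
  proof (cases x)
   case LG
   have "cls (gen x * f) = cls f \<oplus>\<^bsub>A\<^esub> le PH \<otimes>\<^bsub>A\<^esub> cls f"
    by (simp add: LG le_mult cls_add) (simp add: lh_def algebra_simps)
   then show ?thesis using lspan.add[OF gen le_l[OF gen]] by simp
  next
   case LX
   then show ?thesis using le_l[OF gen, of PX] by (simp add: le_mult lh_def)
  next
   case LY
   then show ?thesis using le_l[OF gen, of PY] by (simp add: le_mult lh_def)
  qed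
 next
  case (add f g)
  then show ?case by (simp flip: cls_add add: lspan.add)
 next
  case (scl c f)
  then show ?case by (simp flip: cls_scl add: lspan.smult)
 qed
 then show ?thesis by (simp add: a)
qed

lemma prep_le: "prep lact (le PH) u = opH u" "prep lact (le PX) u = opX u" "prep lact (le PY) u = opY u"
 by (simp_all add: le_def prep_class[OF lact_linm frep_lifting] frep_lh)

lemma aug_le: "lifting_aug (le i) = 0"
 unfolding aug_eq le_def
 by (subst presented_aug_class) (auto simp: eval_lifting lh_def eval_free_simps split: pbw_gen.split)

lemma sv_vecs:
 "prep lact (le PH) (sv (lvec i PX)) - prep lact (le PX) (sv (lvec i PH))
  + scl ce (sv (lvec i PH) + prep lact (le PH) (sv (lvec i PH))) = 0"
 "prep lact (le PH) (sv (lvec i PY)) - prep lact (le PY) (sv (lvec i PH))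
  + scl 1 (sv (lvec i PX) + prep lact (le PX) (sv (lvec i PH))) - scl \<mu> (sv (lvec i PH) + prep lact (le PH) (sv (lvec i PH))) = 0"
 "prep lact (le PX) (sv (lvec i PY)) - prep lact (le PY) (sv (lvec i PX)) + scl (- 1) (prep lact (le PX) (sv (lvec i PX)))
  + scl (\<mu> + ce) (sv (lvec i PX)) + scl ce (sv (lvec i PY)) + scl \<tau> (sv (lvec i PH) - prep lact (le PH) (sv (lvec i PH))) = 0"
proof -
 have 1: "sv (vxh u v) = opH (sv v) - opX (sv u) + scl ce (sv u + opH (sv u))" for u v
  by (simp add: vxh_def sv_simps algebra_simps)
 have 2: "sv (vyh u v w) = opH (sv w) - opY (sv u) + scl 1 (sv v + opX (sv u)) - scl \<mu> (sv u + opH (sv u))" for u v w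
  by (simp add: vyh_def sv_simps algebra_simps)
 have 3: "sv (vyx u v w) = opX (sv w) - opY (sv v) + scl (- 1) (opX (sv v)) + scl (\<mu> + ce) (sv v) + scl ce (sv w) + scl \<tau> (sv u - opH (sv u))" for u v w
  by (simp add: vyx_def sv_simps scl_add_left algebra_simps)
 show "prep lact (le PH) (sv (lvec i PX)) - prep lact (le PX) (sv (lvec i PH))
  + scl ce (sv (lvec i PH) + prep lact (le PH) (sv (lvec i PH))) = 0"
  "prep lact (le PH) (sv (lvec i PY)) - prep lact (le PY) (sv (lvec i PH))
  + scl 1 (sv (lvec i PX) + prep lact (le PX) (sv (lvec i PH))) - scl \<mu> (sv (lvec i PH) + prep lact (le PH) (sv (lvec i PH))) = 0"
  "prep lact (le PX) (sv (lvec i PY)) - prep lact (le PY) (sv (lvec i PX)) + scl (- 1) (prep lact (le PX) (sv (lvec i PX)))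
  + scl (\<mu> + ce) (sv (lvec i PX)) + scl ce (sv (lvec i PY)) + scl \<tau> (sv (lvec i PH) - prep lact (le PH) (sv (lvec i PH))) = 0"
  unfolding prep_le 1[symmetric] 2[symmetric] 3[symmetric]
  using allg_D[OF check_vec, of i] by (simp_all del: lvec.simps)
qed

lemma sv_pow: "(prep lact (le j) ^^ (3 - 1)) (sv (lvec i j)) - linext (%k. (prep lact (le j) ^^ (k - 1)) (sv (lvec i j))) (lpc j)
  = (if i = j then sv lint else 0)"
proof -
 have "sv (spoly j u) = (prep lact (le j) ^^ (3 - 1)) (sv u) - linext (%k. (prep lact (le j) ^^ (k - 1)) (sv u)) (lpc j)" for u
  by (cases j) (simp_all add: sv_simps prep_le lpc_def numeral_2_eq_2 algebra_simps, simp_all flip: scl_add_left scl_simps(8) add: algebra_simps)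
 moreover have "sv (sadd mO F2 (spoly j (lvec i j)) (if i = j then lint else [])) = 0"
  using check_pow unfolding allg_def by (cases i; cases j) (simp_all only: simp_thms sv.simps(1))
 then have "sv (spoly j (lvec i j)) = sv (if i = j then lint else [])"
  by (simp only: sv_sadd cv_simps fv_simps mult_1_left) (simp only: scl_simps neg_eq_iff_add_eq_0[symmetric] add.inverse_inverse)
 ultimately have "(prep lact (le j) ^^ (3 - 1)) (sv (lvec i j)) - linext (%k. (prep lact (le j) ^^ (k - 1)) (sv (lvec i j))) (lpc j)
  = sv (if i = j then lint else [])" by (simp only:)
 then show ?thesis by (cases "i = j") (simp_all only: if_True if_False sv.simps(1) simp_thms)
qed

lemma sv_int: "prep lact (le j) (sv lint) = 0"
 using check_int sv_sapp[of htab lint] sv_sapp[of xtab lint] sv_sapp[of ytab lint] by (cases j) (simp_all add: prep_le)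

text \<open>The entry at \<open>(F2, F2, F2)\<close> is -1 whatever the parameters are.\<close>

lemma sv_int_nz: "sv lint ~= 0"
proof
 assume "sv lint = 0"
 then have "lookup (sv lint) (F2, F2, F2) = 0" by simp
 then show False by (simp add: lint_def lookup_add lookup_single cv_simps)
qed

text \<open>The module given by the tables serves for all three slots, with the left integral
  \<open>lint\<close> as the common vector \<open>z\<close>.\<close>

theorem lifting_fg:
 assumes "projective_resolution A (trivial_module lifting_aug) P d \<eta>"
 shows "finitely_generated_algebra (cohomology_ring A lifting_aug P d \<eta>)"
proof -
 interpret J: jordan_type_rep A "%_. 3" le ce 1 \<mu> "- 1" "\<mu> + ce" ce \<tau> lpc lifting_aug "prep lact"
  "%i j. sv (lvec i j)" "%i. sv lint"
  by unfold_locales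
   (rule le_rels le_pow lpc generated independent laug aug_le lprep sv_vecs sv_pow sv_int sv_int_nz; assumption)+
 show ?thesis by (rule J.fg[OF assms])
qed

end

section \<open>Smash products as algebras and their covariant representations\<close>

section \<open>Smash products\<close>

lemma (in abelian_monoid) finsum_swap:
 assumes "finite A" "finite B" and f: "!!a b. a : A ==> b : B ==> f a b : carrier G"
 shows "(\<Oplus>a\<in>A. \<Oplus>b\<in>B. f a b) = (\<Oplus>b\<in>B. \<Oplus>a\<in>A. f a b)"
 using assms(1) f
proof (induction A)
 case empty
 have "(\<Oplus>b\<in>B. \<zero>) = \<zero>" by (rule add.finprod_one_eqI) simp
 then show ?case by simp
next
 case (insert x A)
 have c: "(%b. f x b) : B \<rightarrow> carrier G" "(%b. \<Oplus>a\<in>A. f a b) : B \<rightarrow> carrier G" "(%a. \<Oplus>b\<in>B. f a b) : A \<rightarrow> carrier G"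
  "(\<Oplus>b\<in>B. f x b) : carrier G"
  using insert.prems by (auto intro!: finsum_closed)
 have "(\<Oplus>b\<in>B. \<Oplus>a\<in>insert x A. f a b) = (\<Oplus>b\<in>B. f x b \<oplus> (\<Oplus>a\<in>A. f a b))"
  by (rule finsum_cong') (use insert c in \<open>auto intro!: finsum_closed\<close>)
 also have "\<dots> = (\<Oplus>b\<in>B. f x b) \<oplus> (\<Oplus>b\<in>B. \<Oplus>a\<in>A. f a b)" by (rule finsum_addf[OF c(1,2)])
 finally show ?case using insert c by simp
qed

locale smash = kalg R for R :: "('k::field, 'r) module" (structure) +
 fixes G :: "'g monoid" and \<rho> :: "'g => 'r => 'r"
 assumes group_G: "group G" and fin: "finite (carrier G)" and act: "algebra_action G R \<rho>"
begin

sublocale G: group G by (rule group_G)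

abbreviation "S \<equiv> smash_product R G \<rho>"

interpretation A: group_action G "carrier R" \<rho> using act by (simp add: algebra_action_def)

lemma \<rho>_closed [simp]: "a : carrier G ==> r : carrier R ==> \<rho> a r : carrier R"
 using A.element_image by blast

lemma \<rho>_add: "a : carrier G ==> r : carrier R ==> s : carrier R ==> \<rho> a (r \<oplus> s) = \<rho> a r \<oplus> \<rho> a s"
 and \<rho>_mult: "a : carrier G ==> r : carrier R ==> s : carrier R ==> \<rho> a (r \<otimes> s) = \<rho> a r \<otimes> \<rho> a s"
 and \<rho>_one: "a : carrier G ==> \<rho> a \<one> = \<one>"
 and \<rho>_smult: "a : carrier G ==> r : carrier R ==> \<rho> a (c \<odot>\<^bsub>R\<^esub> r) = c \<odot>\<^bsub>R\<^esub> \<rho> a r"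
 using act by (auto simp: algebra_action_def ring_hom_def)

lemma \<rho>_zero: "a : carrier G ==> \<rho> a \<zero> = \<zero>"
 using \<rho>_smult[of a \<zero> 0] by (simp add: sm_zero_left)

lemma \<rho>_comp: "a : carrier G ==> b : carrier G ==> r : carrier R ==> \<rho> (a \<otimes>\<^bsub>G\<^esub> b) r = \<rho> a (\<rho> b r)"
 by (rule A.composition_rule)

lemma \<rho>_id: "r : carrier R ==> \<rho> \<one>\<^bsub>G\<^esub> r = r"
 using A.id_eq_one by (metis restrict_apply')

lemma \<rho>_finsum:
 assumes a: "a : carrier G" and B: "finite B" and f: "f : B \<rightarrow> carrier R"
 shows "\<rho> a (\<Oplus>b\<in>B. f b) = (\<Oplus>b\<in>B. \<rho> a (f b))"
 using B f
proof (induction B)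
 case (insert x B)
 have "(%b. \<rho> a (f b)) : B \<rightarrow> carrier R" "(\<Oplus>b\<in>B. f b) : carrier R" using insert.prems a by (auto simp: Pi_iff intro!: finsum_closed)
 then show ?case using insert a by (simp add: \<rho>_add Pi_iff)
qed (simp add: \<rho>_zero a)

lemma S_carrier: "carrier S = carrier G \<rightarrow>\<^sub>E carrier R"
 by (simp add: smash_product_def)

lemma S_in: "f : carrier S ==> a : carrier G ==> f a : carrier R"
 by (auto simp: S_carrier)

lemma S_mult: "c : carrier G ==> (f \<otimes>\<^bsub>S\<^esub> h) c = (\<Oplus>a\<in>carrier G. f a \<otimes> \<rho> a (h (inv\<^bsub>G\<^esub> a \<otimes>\<^bsub>G\<^esub> c)))"
 and S_add: "c : carrier G ==> (f \<oplus>\<^bsub>S\<^esub> h) c = f c \<oplus> h c"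
 and S_smult: "c : carrier G ==> (t \<odot>\<^bsub>S\<^esub> f) c = t \<odot>\<^bsub>R\<^esub> f c"
 and S_one: "c : carrier G ==> \<one>\<^bsub>S\<^esub> c = (if c = \<one>\<^bsub>G\<^esub> then \<one> else \<zero>)"
 and S_zero: "c : carrier G ==> \<zero>\<^bsub>S\<^esub> c = \<zero>"
 by (simp_all add: smash_product_def)

lemma term_closed: "f : carrier S ==> h : carrier S ==> a : carrier G ==> c : carrier G ==>
  f a \<otimes> \<rho> a (h (inv\<^bsub>G\<^esub> a \<otimes>\<^bsub>G\<^esub> c)) : carrier R"
 by (simp add: S_in)

lemma S_closed:
 "f : carrier S ==> h : carrier S ==> f \<otimes>\<^bsub>S\<^esub> h : carrier S"
 "f : carrier S ==> h : carrier S ==> f \<oplus>\<^bsub>S\<^esub> h : carrier S"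
 "f : carrier S ==> t \<odot>\<^bsub>S\<^esub> f : carrier S" "\<one>\<^bsub>S\<^esub> : carrier S" "\<zero>\<^bsub>S\<^esub> : carrier S"
proof -
 show "f : carrier S ==> h : carrier S ==> f \<otimes>\<^bsub>S\<^esub> h : carrier S"
  unfolding S_carrier by (rule PiE_I) (subst S_mult, auto intro!: finsum_closed term_closed simp: S_carrier smash_product_def)
 show "t \<odot>\<^bsub>S\<^esub> f : carrier S" if "f : carrier S"
  using sm_closed[OF S_in[OF that]] by (auto simp: smash_product_def)
qed (auto simp: smash_product_def)

lemma S_eqI: "f : carrier S ==> h : carrier S ==> (!!c. c : carrier G ==> f c = h c) ==> f = h"
 unfolding S_carrier by (rule PiE_ext)

text \<open>The element \<open>r \<otimes> a\<close>.\<close>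

definition del :: "'r => 'g => 'g => 'r" where
 "del r a = (\<lambda>c\<in>carrier G. if c = a then r else \<zero>)"

lemma del_closed: "r : carrier R ==> del r a : carrier S"
 by (auto simp: del_def S_carrier)

lemma del_at: "c : carrier G ==> del r a c = (if c = a then r else \<zero>)"
 by (simp add: del_def)

lemma one_del: "\<one>\<^bsub>S\<^esub> = del \<one> \<one>\<^bsub>G\<^esub>"
 by (simp add: del_def smash_product_def)

lemma del_mult_at:
 assumes r: "r : carrier R" and a: "a : carrier G" and h: "h : carrier S" and c: "c : carrier G"
 shows "(del r a \<otimes>\<^bsub>S\<^esub> h) c = r \<otimes> \<rho> a (h (inv\<^bsub>G\<^esub> a \<otimes>\<^bsub>G\<^esub> c))"
proof -
 have "(del r a \<otimes>\<^bsub>S\<^esub> h) c = (\<Oplus>b\<in>carrier G. if b = a then r \<otimes> \<rho> b (h (inv\<^bsub>G\<^esub> b \<otimes>\<^bsub>G\<^esub> c)) else \<zero>)"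
  unfolding S_mult[OF c] by (rule finsum_cong') (use assms in \<open>auto simp: del_at S_in\<close>)
 also have "\<dots> = r \<otimes> \<rho> a (h (inv\<^bsub>G\<^esub> a \<otimes>\<^bsub>G\<^esub> c))"
  by (rule add.finprod_singleton_swap) (use assms fin in \<open>auto simp: S_in\<close>)
 finally show ?thesis .
qed

lemma del_mult:
 assumes r: "r : carrier R" and s: "s : carrier R" and a: "a : carrier G" and b: "b : carrier G"
 shows "del r a \<otimes>\<^bsub>S\<^esub> del s b = del (r \<otimes> \<rho> a s) (a \<otimes>\<^bsub>G\<^esub> b)"
proof (rule S_eqI)
 fix c assume c: "c : carrier G"
 have "inv\<^bsub>G\<^esub> a \<otimes>\<^bsub>G\<^esub> c = b \<longleftrightarrow> c = a \<otimes>\<^bsub>G\<^esub> b" using a b c by (metis G.inv_closed G.inv_inv G.inv_solve_left)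
 then show "(del r a \<otimes>\<^bsub>S\<^esub> del s b) c = del (r \<otimes> \<rho> a s) (a \<otimes>\<^bsub>G\<^esub> b) c"
  using assms c by (simp add: del_mult_at del_closed del_at \<rho>_zero)
qed (use assms in \<open>auto intro!: S_closed del_closed\<close>)

lemma del_add: "r : carrier R ==> s : carrier R ==> del r a \<oplus>\<^bsub>S\<^esub> del s a = del (r \<oplus> s) a"
 and del_smult: "r : carrier R ==> t \<odot>\<^bsub>S\<^esub> del r a = del (t \<odot>\<^bsub>R\<^esub> r) a"
 by (rule S_eqI; auto intro!: S_closed del_closed sm_closed simp: S_add S_smult del_at sm_zero_right)+

text \<open>After the two sums are exchanged, replacing \<open>b\<close> by \<open>a b\<close> in
  the inner one matches both sides: translation by \<open>a\<close> permutes the group, and the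
  action is multiplicative.\<close>

lemma S_assoc:
 assumes f: "f : carrier S" and h: "h : carrier S" and k: "k : carrier S"
 shows "(f \<otimes>\<^bsub>S\<^esub> h) \<otimes>\<^bsub>S\<^esub> k = f \<otimes>\<^bsub>S\<^esub> (h \<otimes>\<^bsub>S\<^esub> k)"
proof (rule S_eqI)
 fix c assume c: "c : carrier G"
 let ?F = "%a b. f a \<otimes> \<rho> a (h (inv\<^bsub>G\<^esub> a \<otimes>\<^bsub>G\<^esub> b)) \<otimes> \<rho> b (k (inv\<^bsub>G\<^esub> b \<otimes>\<^bsub>G\<^esub> c))"
 have F: "?F a b : carrier R" if "a : carrier G" "b : carrier G" for a b
  using that f h k c by (simp add: S_in)
 have "((f \<otimes>\<^bsub>S\<^esub> h) \<otimes>\<^bsub>S\<^esub> k) c = (\<Oplus>b\<in>carrier G. \<Oplus>a\<in>carrier G. ?F a b)"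
  unfolding S_mult[OF c]
 proof (rule finsum_cong'[OF refl])
  fix b assume b: "b : carrier G"
  show "(f \<otimes>\<^bsub>S\<^esub> h) b \<otimes> \<rho> b (k (inv\<^bsub>G\<^esub> b \<otimes>\<^bsub>G\<^esub> c)) = (\<Oplus>a\<in>carrier G. ?F a b)"
   unfolding S_mult[OF b] by (rule finsum_ldistr) (use fin f h k b c in \<open>auto simp: S_in\<close>)
 qed (use F in \<open>auto intro!: finsum_closed\<close>)
 also have "\<dots> = (\<Oplus>a\<in>carrier G. \<Oplus>b\<in>carrier G. ?F a b)"
  by (rule finsum_swap) (use fin F in auto)
 also have "\<dots> = (f \<otimes>\<^bsub>S\<^esub> (h \<otimes>\<^bsub>S\<^esub> k)) c"
  unfolding S_mult[OF c]
 proof (rule finsum_cong'[OF refl])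
  show "(%a. f a \<otimes> \<rho> a ((h \<otimes>\<^bsub>S\<^esub> k) (inv\<^bsub>G\<^esub> a \<otimes>\<^bsub>G\<^esub> c))) : carrier G \<rightarrow> carrier R"
   using f h k c by (auto simp: S_in S_closed)
  fix a assume a: "a : carrier G"
  have ac: "inv\<^bsub>G\<^esub> a \<otimes>\<^bsub>G\<^esub> c : carrier G" using a c by simp
  have H: "(%b. h b \<otimes> \<rho> b (k (inv\<^bsub>G\<^esub> b \<otimes>\<^bsub>G\<^esub> (inv\<^bsub>G\<^esub> a \<otimes>\<^bsub>G\<^esub> c)))) : carrier G \<rightarrow> carrier R"
   using h k ac by (auto simp: S_in)
  have "f a \<otimes> \<rho> a ((h \<otimes>\<^bsub>S\<^esub> k) (inv\<^bsub>G\<^esub> a \<otimes>\<^bsub>G\<^esub> c)) =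
    (\<Oplus>b\<in>carrier G. f a \<otimes> \<rho> a (h b \<otimes> \<rho> b (k (inv\<^bsub>G\<^esub> b \<otimes>\<^bsub>G\<^esub> (inv\<^bsub>G\<^esub> a \<otimes>\<^bsub>G\<^esub> c)))))"
   unfolding S_mult[OF ac] \<rho>_finsum[OF a fin H] by (rule finsum_rdistr) (use fin f a H in \<open>auto simp: S_in Pi_iff\<close>)
  also have "\<dots> = (\<Oplus>b\<in>carrier G. ?F a (a \<otimes>\<^bsub>G\<^esub> b))"
  proof (rule finsum_cong'[OF refl])
   fix b assume b: "b : carrier G"
   have "inv\<^bsub>G\<^esub> a \<otimes>\<^bsub>G\<^esub> (a \<otimes>\<^bsub>G\<^esub> b) = b" using a b by (simp flip: G.m_assoc)
   moreover have "inv\<^bsub>G\<^esub> (a \<otimes>\<^bsub>G\<^esub> b) \<otimes>\<^bsub>G\<^esub> c = inv\<^bsub>G\<^esub> b \<otimes>\<^bsub>G\<^esub> (inv\<^bsub>G\<^esub> a \<otimes>\<^bsub>G\<^esub> c)"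
    using a b c by (simp add: G.inv_mult_group G.m_assoc)
   ultimately show "f a \<otimes> \<rho> a (h b \<otimes> \<rho> b (k (inv\<^bsub>G\<^esub> b \<otimes>\<^bsub>G\<^esub> (inv\<^bsub>G\<^esub> a \<otimes>\<^bsub>G\<^esub> c)))) = ?F a (a \<otimes>\<^bsub>G\<^esub> b)"
    using a b c f h k by (simp add: S_in \<rho>_mult \<rho>_comp m_assoc)
  qed (use F a in auto)
  also have "\<dots> = (\<Oplus>b\<in>(%b. a \<otimes>\<^bsub>G\<^esub> b) ` carrier G. ?F a b)"
   by (rule add.finprod_reindex[symmetric]) (use F a in \<open>auto simp: inj_on_def\<close>)
  also have "(%b. a \<otimes>\<^bsub>G\<^esub> b) ` carrier G = carrier G"
  proof (intro equalityI subsetI)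
   fix b assume b: "b : carrier G"
   then have "b = a \<otimes>\<^bsub>G\<^esub> (inv\<^bsub>G\<^esub> a \<otimes>\<^bsub>G\<^esub> b)" using a by (simp flip: G.m_assoc)
   then show "b : (%b. a \<otimes>\<^bsub>G\<^esub> b) ` carrier G" using a b by (intro image_eqI[of _ _ "inv\<^bsub>G\<^esub> a \<otimes>\<^bsub>G\<^esub> b"]) auto
  qed (use a in auto)
  finally show "(\<Oplus>b\<in>carrier G. ?F a b) = f a \<otimes> \<rho> a ((h \<otimes>\<^bsub>S\<^esub> k) (inv\<^bsub>G\<^esub> a \<otimes>\<^bsub>G\<^esub> c))" by simp
 qed
 finally show "((f \<otimes>\<^bsub>S\<^esub> h) \<otimes>\<^bsub>S\<^esub> k) c = (f \<otimes>\<^bsub>S\<^esub> (h \<otimes>\<^bsub>S\<^esub> k)) c" .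
qed (use assms in \<open>auto intro!: S_closed\<close>)

lemma S_l_one: "f : carrier S ==> \<one>\<^bsub>S\<^esub> \<otimes>\<^bsub>S\<^esub> f = f"
 by (rule S_eqI) (simp_all add: S_closed one_del del_closed del_mult_at \<rho>_id S_in)

lemma S_r_one:
 assumes f: "f : carrier S"
 shows "f \<otimes>\<^bsub>S\<^esub> \<one>\<^bsub>S\<^esub> = f"
proof (rule S_eqI)
 fix c assume c: "c : carrier G"
 have "(f \<otimes>\<^bsub>S\<^esub> \<one>\<^bsub>S\<^esub>) c = (\<Oplus>a\<in>carrier G. if a = c then f a else \<zero>)"
  unfolding S_mult[OF c]
 proof (rule finsum_cong'[OF refl])
  fix a assume a: "a : carrier G"
  have "inv\<^bsub>G\<^esub> a \<otimes>\<^bsub>G\<^esub> c = \<one>\<^bsub>G\<^esub> \<longleftrightarrow> a = c" using a c by (metis G.inv_closed G.inv_inv G.l_inv G.inv_equality)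
  then show "f a \<otimes> \<rho> a (\<one>\<^bsub>S\<^esub> (inv\<^bsub>G\<^esub> a \<otimes>\<^bsub>G\<^esub> c)) = (if a = c then f a else \<zero>)"
   using a c f by (simp add: S_one \<rho>_one \<rho>_zero S_in)
 qed (use f in \<open>auto simp: S_in\<close>)
 also have "\<dots> = f c" by (rule add.finprod_singleton_swap) (use f c fin in \<open>auto simp: S_in\<close>)
 finally show "(f \<otimes>\<^bsub>S\<^esub> \<one>\<^bsub>S\<^esub>) c = f c" .
qed (use f in \<open>auto intro!: S_closed\<close>)

lemma S_distr:
 assumes f: "f : carrier S" and h: "h : carrier S" and k: "k : carrier S"
 shows "(f \<oplus>\<^bsub>S\<^esub> h) \<otimes>\<^bsub>S\<^esub> k = f \<otimes>\<^bsub>S\<^esub> k \<oplus>\<^bsub>S\<^esub> h \<otimes>\<^bsub>S\<^esub> k"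
  and "k \<otimes>\<^bsub>S\<^esub> (f \<oplus>\<^bsub>S\<^esub> h) = k \<otimes>\<^bsub>S\<^esub> f \<oplus>\<^bsub>S\<^esub> k \<otimes>\<^bsub>S\<^esub> h"
proof -
 show "(f \<oplus>\<^bsub>S\<^esub> h) \<otimes>\<^bsub>S\<^esub> k = f \<otimes>\<^bsub>S\<^esub> k \<oplus>\<^bsub>S\<^esub> h \<otimes>\<^bsub>S\<^esub> k"
 proof (rule S_eqI)
  fix c assume c: "c : carrier G"
  let ?k = "%a. \<rho> a (k (inv\<^bsub>G\<^esub> a \<otimes>\<^bsub>G\<^esub> c))"
  have "(\<Oplus>a\<in>carrier G. (f \<oplus>\<^bsub>S\<^esub> h) a \<otimes> ?k a) = (\<Oplus>a\<in>carrier G. f a \<otimes> ?k a \<oplus> h a \<otimes> ?k a)"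
   by (rule finsum_cong'[OF refl]) (use assms c in \<open>auto simp: S_in S_add l_distr\<close>)
  also have "\<dots> = (\<Oplus>a\<in>carrier G. f a \<otimes> ?k a) \<oplus> (\<Oplus>a\<in>carrier G. h a \<otimes> ?k a)"
   by (rule finsum_addf) (use assms c in \<open>auto simp: S_in\<close>)
  finally show "((f \<oplus>\<^bsub>S\<^esub> h) \<otimes>\<^bsub>S\<^esub> k) c = (f \<otimes>\<^bsub>S\<^esub> k \<oplus>\<^bsub>S\<^esub> h \<otimes>\<^bsub>S\<^esub> k) c"
   unfolding S_add[OF c] S_mult[OF c] .
 qed (use assms in \<open>auto intro!: S_closed\<close>)
 show "k \<otimes>\<^bsub>S\<^esub> (f \<oplus>\<^bsub>S\<^esub> h) = k \<otimes>\<^bsub>S\<^esub> f \<oplus>\<^bsub>S\<^esub> k \<otimes>\<^bsub>S\<^esub> h"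
 proof (rule S_eqI)
  fix c assume c: "c : carrier G"
  let ?t = "%a. inv\<^bsub>G\<^esub> a \<otimes>\<^bsub>G\<^esub> c"
  have "(\<Oplus>a\<in>carrier G. k a \<otimes> \<rho> a ((f \<oplus>\<^bsub>S\<^esub> h) (?t a))) = (\<Oplus>a\<in>carrier G. k a \<otimes> \<rho> a (f (?t a)) \<oplus> k a \<otimes> \<rho> a (h (?t a)))"
   by (rule finsum_cong'[OF refl]) (use assms c in \<open>auto simp: S_in S_add r_distr \<rho>_add\<close>)
  also have "\<dots> = (\<Oplus>a\<in>carrier G. k a \<otimes> \<rho> a (f (?t a))) \<oplus> (\<Oplus>a\<in>carrier G. k a \<otimes> \<rho> a (h (?t a)))"
   by (rule finsum_addf) (use assms c in \<open>auto simp: S_in\<close>)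
  finally show "(k \<otimes>\<^bsub>S\<^esub> (f \<oplus>\<^bsub>S\<^esub> h)) c = (k \<otimes>\<^bsub>S\<^esub> f \<oplus>\<^bsub>S\<^esub> k \<otimes>\<^bsub>S\<^esub> h) c"
   unfolding S_add[OF c] S_mult[OF c] .
 qed (use assms in \<open>auto intro!: S_closed\<close>)
qed

lemma sm_finsum: "finite B ==> f : B \<rightarrow> carrier R ==> t \<odot>\<^bsub>R\<^esub> (\<Oplus>b\<in>B. f b) = (\<Oplus>b\<in>B. t \<odot>\<^bsub>R\<^esub> f b)"
proof (induction B rule: finite_induct)
 case (insert x B)
 have "(%b. t \<odot>\<^bsub>R\<^esub> f b) : B \<rightarrow> carrier R" "(\<Oplus>b\<in>B. f b) : carrier R" using insert.prems by (auto intro!: finsum_closed sm_closed)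
 then show ?case using insert by (simp add: sm_add_right Pi_iff sm_closed)
qed (simp add: sm_zero_right)

lemma S_kalg: "kalg S"
proof (intro kalg.intro kalg_axioms.intro)
 show "ring S"
 proof (rule ringI)
  show "abelian_group S"
  proof (rule abelian_groupI)
   fix f assume f: "f : carrier S"
   have "(\<lambda>c\<in>carrier G. \<ominus> f c) : carrier S" using f by (auto simp: S_carrier)
   moreover from this have "(\<lambda>c\<in>carrier G. \<ominus> f c) \<oplus>\<^bsub>S\<^esub> f = \<zero>\<^bsub>S\<^esub>"
    by (rule S_eqI[OF S_closed(2)[OF _ f] S_closed(5)]) (use f in \<open>auto simp: S_add S_zero S_in l_neg\<close>)
   ultimately show "EX h:carrier S. h \<oplus>\<^bsub>S\<^esub> f = \<zero>\<^bsub>S\<^esub>" by blast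
  next
   fix f h k assume "f : carrier S" "h : carrier S" "k : carrier S"
   then show "f \<oplus>\<^bsub>S\<^esub> h \<oplus>\<^bsub>S\<^esub> k = f \<oplus>\<^bsub>S\<^esub> (h \<oplus>\<^bsub>S\<^esub> k)"
    by (intro S_eqI S_closed) (auto simp: S_add S_in a_assoc)
  next
   fix f h assume "f : carrier S" "h : carrier S"
   then show "f \<oplus>\<^bsub>S\<^esub> h = h \<oplus>\<^bsub>S\<^esub> f" by (intro S_eqI S_closed) (auto simp: S_add S_in a_comm)
  next
   fix f assume "f : carrier S"
   then show "\<zero>\<^bsub>S\<^esub> \<oplus>\<^bsub>S\<^esub> f = f" by (intro S_eqI S_closed) (auto simp: S_add S_zero S_in)
  qed (auto intro: S_closed)
  show "monoid S" by (rule monoidI) (auto intro: S_closed S_assoc S_l_one S_r_one)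
 qed (auto intro: S_distr)
 fix f h t t' assume f: "f : carrier S"
 show "t \<odot>\<^bsub>S\<^esub> f : carrier S" by (rule S_closed(3)[OF f])
 show "(t + t') \<odot>\<^bsub>S\<^esub> f = t \<odot>\<^bsub>S\<^esub> f \<oplus>\<^bsub>S\<^esub> t' \<odot>\<^bsub>S\<^esub> f"
  by (intro S_eqI S_closed f) (use f in \<open>auto simp: S_add S_smult S_in sm_add_left\<close>)
 show "(t * t') \<odot>\<^bsub>S\<^esub> f = t \<odot>\<^bsub>S\<^esub> (t' \<odot>\<^bsub>S\<^esub> f)"
  by (intro S_eqI S_closed f) (use f in \<open>auto simp: S_smult S_in sm_assoc\<close>)
 show "1 \<odot>\<^bsub>S\<^esub> f = f" by (intro S_eqI S_closed f) (use f in \<open>auto simp: S_smult S_in sm_one\<close>)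
 assume h: "h : carrier S"
 show "t \<odot>\<^bsub>S\<^esub> (f \<oplus>\<^bsub>S\<^esub> h) = t \<odot>\<^bsub>S\<^esub> f \<oplus>\<^bsub>S\<^esub> t \<odot>\<^bsub>S\<^esub> h"
  by (intro S_eqI S_closed f h) (use f h in \<open>auto simp: S_add S_smult S_in sm_add_right\<close>)
 show "(t \<odot>\<^bsub>S\<^esub> f) \<otimes>\<^bsub>S\<^esub> h = t \<odot>\<^bsub>S\<^esub> (f \<otimes>\<^bsub>S\<^esub> h)"
 proof (intro S_eqI S_closed f h)
  fix c assume c: "c : carrier G"
  show "((t \<odot>\<^bsub>S\<^esub> f) \<otimes>\<^bsub>S\<^esub> h) c = (t \<odot>\<^bsub>S\<^esub> (f \<otimes>\<^bsub>S\<^esub> h)) c"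
   unfolding S_smult[OF c] S_mult[OF c]
   by (subst sm_finsum[OF fin]) (use f h c in \<open>auto intro!: finsum_cong' sm_closed simp: S_in S_smult sm_mult_left\<close>)
 qed
 show "f \<otimes>\<^bsub>S\<^esub> (t \<odot>\<^bsub>S\<^esub> h) = t \<odot>\<^bsub>S\<^esub> (f \<otimes>\<^bsub>S\<^esub> h)"
 proof (intro S_eqI S_closed f h)
  fix c assume c: "c : carrier G"
  show "(f \<otimes>\<^bsub>S\<^esub> (t \<odot>\<^bsub>S\<^esub> h)) c = (t \<odot>\<^bsub>S\<^esub> (f \<otimes>\<^bsub>S\<^esub> h)) c"
   unfolding S_smult[OF c] S_mult[OF c]
   by (subst sm_finsum[OF fin]) (use f h c in \<open>auto intro!: finsum_cong' sm_closed simp: S_in S_smult \<rho>_smult sm_mult_right\<close>)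
 qed
qed

text \<open>Over a finite group each \<open>f\<close> is the finite sum of the elements
  \<open>del (f a) a\<close>, collected here one group element at a time.\<close>

lemma S_span:
 assumes L: "\<zero>\<^bsub>S\<^esub> : L" "!!x y. x : L ==> y : L ==> x \<oplus>\<^bsub>S\<^esub> y : L"
  and d: "!!r a. r : carrier R ==> a : carrier G ==> del r a : L" and f: "f : carrier S"
 shows "f : L"
proof -
 have "(\<lambda>c\<in>carrier G. if c : B then f c else \<zero>) : L" if "finite B" "B \<subseteq> carrier G" for B
  using that
 proof (induction B)
  case empty
  then show ?case using L(1) by (simp add: smash_product_def restrict_def)
 next
  case (insert a B)
  have e: "(\<lambda>c\<in>carrier G. if c : insert a B then f c else \<zero>) = del (f a) a \<oplus>\<^bsub>S\<^esub> (\<lambda>c\<in>carrier G. if c : B then f c else \<zero>)"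
   using insert f by (auto simp: smash_product_def del_def S_in fun_eq_iff)
  show ?case unfolding e by (rule L(2)[OF d insert.IH]) (use insert.prems f in \<open>auto simp: S_in\<close>)
 qed
 from this[OF fin] have "(\<lambda>c\<in>carrier G. if c : carrier G then f c else \<zero>) : L" by simp
 moreover have "(\<lambda>c\<in>carrier G. if c : carrier G then f c else \<zero>) = f" using f by (auto simp: S_carrier fun_eq_iff PiE_def extensional_def)
 ultimately show ?thesis by simp
qed

text \<open>A covariant pair of representations of the algebra and the group integrates to the smash product.\<close>

definition srep :: "('r => ('b \<Rightarrow>\<^sub>0 'k) => ('b \<Rightarrow>\<^sub>0 'k)) => ('g => ('b \<Rightarrow>\<^sub>0 'k) => ('b \<Rightarrow>\<^sub>0 'k)) => ('g => 'r) => ('b \<Rightarrow>\<^sub>0 'k) => ('b \<Rightarrow>\<^sub>0 'k)" where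
 "srep \<sigma> T f u = (\<Sum>a\<in>carrier G. \<sigma> (f a) (T a u))"

context
 fixes \<sigma> :: "'r => ('b \<Rightarrow>\<^sub>0 'k) => ('b \<Rightarrow>\<^sub>0 'k)" and T :: "'g => ('b \<Rightarrow>\<^sub>0 'k) => ('b \<Rightarrow>\<^sub>0 'k)"
 assumes \<sigma>_linm: "!!r. r : carrier R ==> linm (\<sigma> r)"
  and \<sigma>_add: "!!r s u. r : carrier R ==> s : carrier R ==> \<sigma> (r \<oplus> s) u = \<sigma> r u + \<sigma> s u"
  and \<sigma>_mult: "!!r s u. r : carrier R ==> s : carrier R ==> \<sigma> (r \<otimes> s) u = \<sigma> r (\<sigma> s u)"
  and \<sigma>_smult: "!!c r u. r : carrier R ==> \<sigma> (c \<odot>\<^bsub>R\<^esub> r) u = scl c (\<sigma> r u)"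
  and \<sigma>_one: "!!u. \<sigma> \<one> u = u"
  and T_linm: "!!a. linm (T a)"
  and T_mult: "!!a b u. a : carrier G ==> b : carrier G ==> T (a \<otimes>\<^bsub>G\<^esub> b) u = T a (T b u)"
  and T_one: "!!u. T \<one>\<^bsub>G\<^esub> u = u"
  and cov: "!!a r u. a : carrier G ==> r : carrier R ==> T a (\<sigma> r u) = \<sigma> (\<rho> a r) (T a u)"
begin

lemma \<sigma>_zero: "\<sigma> \<zero> u = 0"
 using \<sigma>_smult[of \<zero> 0 u] by (simp add: sm_zero_left)

lemma \<sigma>_finsum: "finite B ==> f : B \<rightarrow> carrier R ==> \<sigma> (\<Oplus>b\<in>B. f b) u = (\<Sum>b\<in>B. \<sigma> (f b) u)"
proof (induction B rule: finite_induct)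
 case (insert x B)
 have "(\<Oplus>b\<in>B. f b) : carrier R" using insert.prems by (auto intro!: finsum_closed)
 then show ?case using insert by (simp add: \<sigma>_add Pi_iff)
qed (simp add: \<sigma>_zero)

lemma srep_del: "r : carrier R ==> a : carrier G ==> srep \<sigma> T (del r a) u = \<sigma> r (T a u)"
proof -
 assume ra: "r : carrier R" "a : carrier G"
 have "srep \<sigma> T (del r a) u = (\<Sum>b\<in>carrier G. if b = a then \<sigma> r (T a u) else 0)"
  unfolding srep_def by (rule sum.cong) (auto simp: del_at \<sigma>_zero)
 then show ?thesis using ra fin by simp
qed

lemma srep_linm: "f : carrier S ==> linm (srep \<sigma> T f)"
proof -
 assume f: "f : carrier S"
 have "linm (%u. \<Sum>a\<in>B. \<sigma> (f a) (T a u))" if "finite B" "B \<subseteq> carrier G" for B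
  using that
  by (induction B) (auto simp: linm_zero S_in[OF f] intro!: linm_plus linm_comp[OF \<sigma>_linm T_linm])
 then show ?thesis unfolding srep_def[abs_def] using fin by simp
qed

lemma srep_add: "f : carrier S ==> h : carrier S ==> srep \<sigma> T (f \<oplus>\<^bsub>S\<^esub> h) u = srep \<sigma> T f u + srep \<sigma> T h u"
 by (simp add: srep_def S_add S_in \<sigma>_add sum.distrib)

lemma srep_smult: "f : carrier S ==> srep \<sigma> T (c \<odot>\<^bsub>S\<^esub> f) u = scl c (srep \<sigma> T f u)"
 by (simp add: srep_def S_smult S_in \<sigma>_smult scl_sum)

lemma srep_one: "srep \<sigma> T \<one>\<^bsub>S\<^esub> u = u"
 by (simp add: one_del srep_del T_one \<sigma>_one)

text \<open>Write the summation index as \<open>c = a b\<close>; then \<open>T c\<close> splits as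
  \<open>T a\<close> after \<open>T b\<close>, and covariance moves \<open>T a\<close> across the
  action of the algebra.\<close>

lemma srep_mult:
 assumes f: "f : carrier S" and h: "h : carrier S"
 shows "srep \<sigma> T (f \<otimes>\<^bsub>S\<^esub> h) u = srep \<sigma> T f (srep \<sigma> T h u)"
proof -
 have "srep \<sigma> T (f \<otimes>\<^bsub>S\<^esub> h) u = (\<Sum>c\<in>carrier G. \<Sum>a\<in>carrier G. \<sigma> (f a) (\<sigma> (\<rho> a (h (inv\<^bsub>G\<^esub> a \<otimes>\<^bsub>G\<^esub> c))) (T c u)))"
  unfolding srep_def
  by (rule sum.cong) (use f h fin in \<open>auto simp: S_mult \<sigma>_finsum S_in \<sigma>_mult Pi_iff\<close>)
 also have "\<dots> = (\<Sum>a\<in>carrier G. \<Sum>c\<in>carrier G. \<sigma> (f a) (\<sigma> (\<rho> a (h (inv\<^bsub>G\<^esub> a \<otimes>\<^bsub>G\<^esub> c))) (T c u)))" by (rule sum.swap)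
 also have "\<dots> = (\<Sum>a\<in>carrier G. \<Sum>b\<in>carrier G. \<sigma> (f a) (T a (\<sigma> (h b) (T b u))))"
 proof (rule sum.cong[OF refl])
  fix a assume a: "a : carrier G"
  show "(\<Sum>c\<in>carrier G. \<sigma> (f a) (\<sigma> (\<rho> a (h (inv\<^bsub>G\<^esub> a \<otimes>\<^bsub>G\<^esub> c))) (T c u))) = (\<Sum>b\<in>carrier G. \<sigma> (f a) (T a (\<sigma> (h b) (T b u))))"
  proof (rule sum.reindex_bij_witness[where i = "%b. a \<otimes>\<^bsub>G\<^esub> b" and j = "%c. inv\<^bsub>G\<^esub> a \<otimes>\<^bsub>G\<^esub> c"])
   fix c assume c: "c : carrier G"
   show e: "a \<otimes>\<^bsub>G\<^esub> (inv\<^bsub>G\<^esub> a \<otimes>\<^bsub>G\<^esub> c) = c" using a c by (simp flip: G.m_assoc)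
   show "inv\<^bsub>G\<^esub> a \<otimes>\<^bsub>G\<^esub> c : carrier G" using a c by simp
   have "T c u = T a (T (inv\<^bsub>G\<^esub> a \<otimes>\<^bsub>G\<^esub> c) u)" using T_mult[of a "inv\<^bsub>G\<^esub> a \<otimes>\<^bsub>G\<^esub> c" u] a c by (simp add: e)
   then show "\<sigma> (f a) (T a (\<sigma> (h (inv\<^bsub>G\<^esub> a \<otimes>\<^bsub>G\<^esub> c)) (T (inv\<^bsub>G\<^esub> a \<otimes>\<^bsub>G\<^esub> c) u))) = \<sigma> (f a) (\<sigma> (\<rho> a (h (inv\<^bsub>G\<^esub> a \<otimes>\<^bsub>G\<^esub> c))) (T c u))"
    using a c h by (simp add: cov S_in)
  next
   fix b assume b: "b : carrier G"
   show "inv\<^bsub>G\<^esub> a \<otimes>\<^bsub>G\<^esub> (a \<otimes>\<^bsub>G\<^esub> b) = b" using a b by (simp flip: G.m_assoc)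
   show "a \<otimes>\<^bsub>G\<^esub> b : carrier G" using a b by simp
  qed
 qed
 also have "\<dots> = srep \<sigma> T f (srep \<sigma> T h u)"
  unfolding srep_def
  by (rule sum.cong) (use f in \<open>auto simp: linm_sum[OF T_linm] linm_sum[OF \<sigma>_linm] S_in\<close>)
 finally show ?thesis .
qed

end

end

section \<open>The bosonization of the Jordan plane: a polynomial model\<close>

section \<open>The bosonization of the Jordan plane\<close>

lemma pascal_sum:
 fixes F :: "nat => ('b \<Rightarrow>\<^sub>0 'k::field)"
 shows "(\<Sum>k\<le>Suc n. scl (of_nat (Suc n choose k)) (F k)) =
  (\<Sum>k\<le>n. scl (of_nat (n choose k)) (F k)) + (\<Sum>k\<le>n. scl (of_nat (n choose k)) (F (Suc k)))"
proof -
 have "(\<Sum>k\<le>n. scl (of_nat (n choose k)) (F k)) = (\<Sum>k\<le>Suc n. scl (of_nat (n choose k)) (F k))" by (simp add: binomial_eq_0)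
 also have "\<dots> = F 0 + (\<Sum>k\<le>n. scl (of_nat (n choose Suc k)) (F (Suc k)))" by (subst sum.atMost_Suc_shift) simp
 finally have 1: "(\<Sum>k\<le>n. scl (of_nat (n choose k)) (F k)) = F 0 + (\<Sum>k\<le>n. scl (of_nat (n choose Suc k)) (F (Suc k)))" .
 show ?thesis unfolding 1 by (subst sum.atMost_Suc_shift) (simp add: scl_add_left sum.distrib add_ac)
qed

text \<open>A binomial theorem for an operator that moves a doubly indexed family one step in either
  direction. It is applied to y, with scalar factors hidden in the family, and to 1 + H.\<close>

lemma pascal_power:
 fixes E :: "nat => nat => ('b \<Rightarrow>\<^sub>0 'k::field)"
 assumes T: "linm T" and E: "!!k m. T (E k m) = E k (Suc m) + E (Suc k) m"
 shows "(T ^^ n) (E 0 0) = (\<Sum>k\<le>n. scl (of_nat (n choose k)) (E k (n - k)))"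
proof (induction n)
 case (Suc n)
 have "(T ^^ Suc n) (E 0 0) = (\<Sum>k\<le>n. scl (of_nat (n choose k)) (E k (Suc (n - k)) + E (Suc k) (n - k)))"
  by (simp add: Suc linm_sum[OF T] linm_scl[OF T] E)
 also have "\<dots> = (\<Sum>k\<le>n. scl (of_nat (n choose k)) (E k (Suc n - k))) + (\<Sum>k\<le>n. scl (of_nat (n choose k)) (E (Suc k) (Suc n - Suc k)))"
  by (simp add: sum.distrib Suc_diff_le)
 also have "\<dots> = (\<Sum>k\<le>Suc n. scl (of_nat (Suc n choose k)) (E k (Suc n - k)))"
  by (rule pascal_sum[of n "%k. E k (Suc n - k)", symmetric])
 finally show ?case .
qed simp

text \<open>The operator identity behind \<open>((1 + H)\<^sup>q - 1) / H = \<Sum>n<q. (1 + H)\<^sup>n\<close>.\<close>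

lemma geometric_power:
 fixes H :: "('b \<Rightarrow>\<^sub>0 'k::field) => ('b \<Rightarrow>\<^sub>0 'k)"
 assumes H: "linm H"
 shows "(\<Sum>k<q. scl (of_nat (q choose Suc k)) ((H ^^ k) v)) = (\<Sum>n<q. ((%u. u + H u) ^^ n) v)"
proof (induction q)
 case (Suc q)
 have T: "linm (%u. u + H u)" by (rule linm_plus[OF linm_id H])
 have P: "((%u. u + H u) ^^ q) v = (\<Sum>k\<le>q. scl (of_nat (q choose k)) ((H ^^ k) v))"
  using pascal_power[OF T, of "%k m. (H ^^ k) v" q] by simp
 have "(\<Sum>k<Suc q. scl (of_nat (Suc q choose Suc k)) ((H ^^ k) v)) =
   (\<Sum>k\<le>q. scl (of_nat (q choose k)) ((H ^^ k) v)) + (\<Sum>k<Suc q. scl (of_nat (q choose Suc k)) ((H ^^ k) v))"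
  by (simp add: scl_add_left sum.distrib lessThan_Suc_atMost flip: lessThan_Suc_atMost del: sum.lessThan_Suc)
 then show ?case by (simp add: Suc P add_ac binomial_eq_0)
qed simp

locale jordan_smash =
 fixes p :: nat and G :: "'g monoid" and g :: 'g
  and \<rho> :: "'g => (jordan_gen, 'k::field) free_algebra set => (jordan_gen, 'k) free_algebra set"
 assumes p: "Factorial_Ring.prime p" "p > 2" "CHAR('k) = p"
  and G: "group G" "finite (carrier G)" "p dvd order G" "g : carrier G" "generate G {g} = carrier G"
  and act: "algebra_action G (jordan_algebra p) \<rho>"
  and \<rho>x: "\<rho> g (jordan_x p) = jordan_x p"
  and \<rho>y: "\<rho> g (jordan_y p) = jordan_x p \<oplus>\<^bsub>jordan_algebra p\<^esub> jordan_y p"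
begin

abbreviation "J \<equiv> jordan_algebra p :: ('k, (jordan_gen, 'k) free_algebra set) module"
abbreviation "JR \<equiv> jordan_relations p :: (jordan_gen, 'k) free_algebra set"
abbreviation "q \<equiv> order G"
abbreviation "cls \<equiv> presented_class JR"

lemma J_eq: "J = presented_algebra JR" by (simp add: jordan_algebra_def)

sublocale J: smash J G \<rho>
proof -
 have "kalg J" unfolding J_eq by (rule presented_kalg)
 then show "smash J G \<rho>" using G act by (simp add: smash_def smash_axioms_def)
qed

abbreviation "A \<equiv> smash_product J G \<rho>"

sublocale A: kalg A by (rule J.S_kalg)

lemma q: "2 < q"
proof -
 have "q ~= 0" using J.G.order_gt_0_iff_finite G(2) by simp
 then show ?thesis using dvd_imp_le[OF G(3)] p(2) by simp
qed

lemma pow_eq: "g [^]\<^bsub>G\<^esub> (n::nat) = g [^]\<^bsub>G\<^esub> (m::nat) \<longleftrightarrow> int q dvd int m - int n"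
proof -
 have "group.ord G g = q" using J.G.generate_pow_card[OF G(4)] by (simp add: G(5) order_def)
 then show ?thesis using J.G.int_pow_eq[OF G(4), of "int n" "int m"] by (simp add: int_pow_int)
qed

lemma pow_bij: "bij_betw (%n. g [^]\<^bsub>G\<^esub> n) {..<q} (carrier G)"
proof -
 have inj: "inj_on (%n. g [^]\<^bsub>G\<^esub> n) {..<q}"
 proof (rule inj_onI)
  fix n m assume nm: "n : {..<q}" "m : {..<q}" "g [^]\<^bsub>G\<^esub> n = g [^]\<^bsub>G\<^esub> m"
  then have "int q dvd int m - int n" by (simp add: pow_eq)
  moreover have "\<bar>int m - int n\<bar> < int q" using nm by auto
  ultimately show "n = m" using dvd_imp_le_int[of "int m - int n" "int q"] by (cases "m = n") auto
 qed
 moreover have "(%n. g [^]\<^bsub>G\<^esub> n) ` {..<q} = carrier G"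
  by (rule card_subset_eq[OF G(2)]) (use G(4) card_image[OF inj] in \<open>auto simp: order_def\<close>)
 ultimately show ?thesis by (simp add: bij_betw_def)
qed

lemma pow_exists: "a : carrier G ==> \<exists>n::nat. a = g [^]\<^bsub>G\<^esub> n"
 using pow_bij by (auto simp: bij_betw_def)

lemma of_nat_p: "(of_nat n :: 'k) = 0 \<longleftrightarrow> p dvd n"
 using of_nat_eq_0_iff_char_dvd[of n, where ?'a = 'k] p(3) by simp

lemma two: "(2 :: 'k) ~= 0"
 using of_nat_p[of 2] p(2) by (auto dest: dvd_imp_le)

text \<open>The additive character with \<open>\<chi> g = 1\<close>; it exists since \<open>p\<close> divides the order of \<open>g\<close>.\<close>

definition chr :: "'g => 'k" where "chr a = of_nat (SOME n. a = g [^]\<^bsub>G\<^esub> (n::nat))"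

text \<open>The chosen exponent differs from \<open>n\<close> by a multiple of \<open>q\<close>,
  hence of \<open>p\<close>, and such multiples vanish in the field.\<close>

lemma chr_pow: "chr (g [^]\<^bsub>G\<^esub> (n::nat)) = of_nat n"
proof -
 let ?m = "SOME m. g [^]\<^bsub>G\<^esub> n = g [^]\<^bsub>G\<^esub> (m::nat)"
 have "g [^]\<^bsub>G\<^esub> n = g [^]\<^bsub>G\<^esub> ?m" by (rule someI) (rule refl)
 then have "int q dvd int ?m - int n" by (simp only: pow_eq)
 then have "int p dvd int ?m - int n" using G(3) by (meson dvd_trans int_dvd_int_iff)
 then have "of_int (int ?m - int n) = (0 :: 'k)" unfolding of_int_eq_0_iff_char_dvd p(3) .
 then show ?thesis by (simp add: chr_def)
qed

lemma chr_mult: "a : carrier G ==> b : carrier G ==> chr (a \<otimes>\<^bsub>G\<^esub> b) = chr a + chr b"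
proof -
 assume "a : carrier G" "b : carrier G"
 then obtain n m :: nat where "a = g [^]\<^bsub>G\<^esub> n" "b = g [^]\<^bsub>G\<^esub> m" using pow_exists by meson
 then show ?thesis using G(4) by (simp add: J.G.nat_pow_mult chr_pow)
qed

lemma chr_g: "chr g = 1" and chr_one: "chr \<one>\<^bsub>G\<^esub> = 0"
 using chr_pow[of 1] chr_pow[of 0] G(4) by simp_all

lemma jx: "jordan_x p = cls (gen JX)" and jy: "jordan_y p = cls (gen JY)"
 by (simp_all add: jordan_x_def jordan_y_def)

lemma cls_closed [simp]: "cls f : carrier J" and cls_add: "cls f \<oplus>\<^bsub>J\<^esub> cls h = cls (f + h)"
 and cls_mult: "cls f \<otimes>\<^bsub>J\<^esub> cls h = cls (f * h)" and cls_scl: "c \<odot>\<^bsub>J\<^esub> cls f = cls (scl c f)"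
 and cls_one: "\<one>\<^bsub>J\<^esub> = cls 1" and cls_zero: "\<zero>\<^bsub>J\<^esub> = cls 0"
 by (simp_all add: J_eq presented_carrier presented_add presented_mult presented_scl presented_one presented_zero)

lemma J_cases: "r : carrier J ==> EX f. r = cls f"
 by (auto simp: J_eq presented_carrier)

text \<open>Operators satisfying the relations of the Jordan plane, together with a group action that is
 covariant on the generators.\<close>

context
 fixes T :: "jordan_gen => ('b \<Rightarrow>\<^sub>0 'k) => ('b \<Rightarrow>\<^sub>0 'k)" and U :: "'g => ('b \<Rightarrow>\<^sub>0 'k) => ('b \<Rightarrow>\<^sub>0 'k)"
 assumes T_linm: "!!x. linm (T x)" and T_rel: "!!r u. r : JR ==> frep T r u = 0"
  and U_linm: "!!a. linm (U a)" and U_mult: "!!a b u. a : carrier G ==> b : carrier G ==> U (a \<otimes>\<^bsub>G\<^esub> b) u = U a (U b u)"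
  and U_one: "!!u. U \<one>\<^bsub>G\<^esub> u = u"
  and cov_x: "!!u. U g (T JX u) = T JX (U g u)" and cov_y: "!!u. U g (T JY u) = T JX (U g u) + T JY (U g u)"
begin

lemma prep_cls: "prep T (cls f) u = frep T f u"
 by (rule prep_class[OF T_linm T_rel])

lemma prep_J:
 "r : carrier J ==> linm (prep T r)"
 "r : carrier J ==> s : carrier J ==> prep T (r \<oplus>\<^bsub>J\<^esub> s) u = prep T r u + prep T s u"
 "r : carrier J ==> s : carrier J ==> prep T (r \<otimes>\<^bsub>J\<^esub> s) u = prep T r (prep T s u)"
 "r : carrier J ==> prep T (c \<odot>\<^bsub>J\<^esub> r) u = scl c (prep T r u)"
 "prep T \<one>\<^bsub>J\<^esub> u = u"
 unfolding J_eq by (rule prep_facts; (rule T_linm | rule T_rel | assumption); assumption?)+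

text \<open>Covariance passes to products and linear combinations, so the generators x and y decide.
  From \<open>g\<close> it extends to its powers in \<open>prep_cov\<close>, and these exhaust the
  group.\<close>

lemma prep_cov_g: "U g (prep T (cls f) u) = prep T (\<rho> g (cls f)) (U g u)"
proof -
 note \<rho>c = J.\<rho>_closed[OF G(4)]
 have "ALL u. U g (prep T (cls f) u) = prep T (\<rho> g (cls f)) (U g u)"
 proof (induction f rule: presented_induct[where Q = "%r. ALL u. U g (prep T r u) = prep T (\<rho> g r) (U g u)"])
  case one
  show ?case using J.\<rho>_one[OF G(4)] prep_J(5) by (simp add: cls_one)
 next
  case (gen x f)
  have r: "\<rho> g (cls (gen x * f)) = \<rho> g (cls (gen x)) \<otimes>\<^bsub>J\<^esub> \<rho> g (cls f)"
   using J.\<rho>_mult[OF G(4), of "cls (gen x)" "cls f"] by (simp add: cls_mult)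
  show ?case
  proof
   fix u
   have "prep T (\<rho> g (cls (gen x * f))) (U g u) = prep T (\<rho> g (cls (gen x))) (U g (prep T (cls f) u))"
    unfolding r using gen by (simp add: prep_J(3) \<rho>c)
   also have "\<dots> = U g (T x (prep T (cls f) u))"
    using \<rho>x \<rho>y by (cases x) (simp_all add: jx jy prep_J(2) prep_cls frep_gen cov_x cov_y)
   finally show "U g (prep T (cls (gen x * f)) u) = prep T (\<rho> g (cls (gen x * f))) (U g u)"
    by (simp add: prep_cls frep_mult[OF T_linm] frep_gen)
  qed
 next
  case (add f h)
  have r: "\<rho> g (cls (f + h)) = \<rho> g (cls f) \<oplus>\<^bsub>J\<^esub> \<rho> g (cls h)"
   using J.\<rho>_add[OF G(4), of "cls f" "cls h"] by (simp add: cls_add)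
  have l: "prep T (cls (f + h)) u = prep T (cls f) u + prep T (cls h) u" for u by (simp add: prep_cls frep_add)
  show ?case unfolding r l using add by (simp add: prep_J(2) \<rho>c linm_add[OF U_linm])
 next
  case (scl c f)
  have r: "\<rho> g (cls (scl c f)) = c \<odot>\<^bsub>J\<^esub> \<rho> g (cls f)"
   using J.\<rho>_smult[OF G(4), of "cls f" c] by (simp add: cls_scl)
  have l: "prep T (cls (scl c f)) u = scl c (prep T (cls f) u)" for u by (simp add: prep_cls frep_scl)
  show ?case unfolding r l using scl by (simp add: prep_J(4) \<rho>c linm_scl[OF U_linm])
 qed
 then show ?thesis by blast
qed

lemma prep_cov: "a : carrier G ==> r : carrier J ==> U a (prep T r u) = prep T (\<rho> a r) (U a u)"
proof -
 have "U (g [^]\<^bsub>G\<^esub> (n::nat)) (prep T r u) = prep T (\<rho> (g [^]\<^bsub>G\<^esub> n) r) (U (g [^]\<^bsub>G\<^esub> n) u)" if r: "r : carrier J" for n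
 proof (induction n)
  case 0
  then show ?case using r by (simp add: U_one J.\<rho>_id)
 next
  case (Suc n)
  obtain f where f: "\<rho> (g [^]\<^bsub>G\<^esub> n) r = cls f" using J_cases J.\<rho>_closed r G(4) by (meson J.G.nat_pow_closed)
  have "U (g [^]\<^bsub>G\<^esub> Suc n) (prep T r u) = U g (prep T (cls f) (U (g [^]\<^bsub>G\<^esub> n) u))"
   using Suc G(4) by (simp only: J.G.nat_pow_Suc2 U_mult J.G.nat_pow_closed f)
  also have "\<dots> = prep T (\<rho> g (\<rho> (g [^]\<^bsub>G\<^esub> n) r)) (U g (U (g [^]\<^bsub>G\<^esub> n) u))"
   by (simp only: prep_cov_g f)
  also have "\<dots> = prep T (\<rho> (g [^]\<^bsub>G\<^esub> Suc n) r) (U (g [^]\<^bsub>G\<^esub> Suc n) u)"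
   using G(4) r by (simp only: J.G.nat_pow_Suc2 U_mult J.G.nat_pow_closed J.\<rho>_comp)
  finally show ?case .
 qed
 then show "a : carrier G ==> r : carrier J ==> U a (prep T r u) = prep T (\<rho> a r) (U a u)"
  using pow_exists by metis
qed

lemmas sm_facts = J.srep_linm[of "prep T" U] J.srep_add[of "prep T" U] J.srep_mult[of "prep T" U] J.srep_smult[of "prep T" U]
 J.srep_one[of "prep T" U] J.srep_del[of "prep T" U]

lemma srep_A:
 "f : carrier A ==> linm (J.srep (prep T) U f)"
 "f : carrier A ==> h : carrier A ==> J.srep (prep T) U (f \<oplus>\<^bsub>A\<^esub> h) u = J.srep (prep T) U f u + J.srep (prep T) U h u"
 "f : carrier A ==> h : carrier A ==> J.srep (prep T) U (f \<otimes>\<^bsub>A\<^esub> h) u = J.srep (prep T) U f (J.srep (prep T) U h u)"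
 "f : carrier A ==> J.srep (prep T) U (c \<odot>\<^bsub>A\<^esub> f) u = scl c (J.srep (prep T) U f u)"
 "J.srep (prep T) U \<one>\<^bsub>A\<^esub> u = u"
 "r : carrier J ==> a : carrier G ==> J.srep (prep T) U (J.del r a) u = prep T r (U a u)"
 by (rule sm_facts; (rule prep_J U_linm U_mult U_one prep_cov | assumption); assumption?)+

end

text \<open>The augmentation as a one-dimensional representation in which x and y act as 0 and the
  group acts trivially. The laws of \<open>smash_aug\<close> then follow from those of
  \<open>srep\<close>.\<close>

definition zero_op :: "jordan_gen => (unit \<Rightarrow>\<^sub>0 'k) => (unit \<Rightarrow>\<^sub>0 'k)" where "zero_op = (%_. scl 0)"

lemma eval_rel: "r : JR ==> eval_free (%_. 0 :: 'k) r = 0"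
 using p(2) by (auto simp: jordan_relations_def Let_def eval_free_simps)

lemma aug_cls: "jordan_aug (cls f) = eval_free (%_. 0) f"
 unfolding jordan_aug_def by (rule presented_aug_class[OF eval_rel])

lemma zero_op_facts: "linm (zero_op x)" "r : JR ==> frep zero_op r u = 0" "zero_op x u = 0"
 using frep_eval[of "%_. 0" r u] eval_rel by (simp_all add: zero_op_def linm_scaled linm_id linm_zero)

lemma smash_aug_srep: "f : carrier A ==> J.srep (prep zero_op) (%a u. u) f u = scl (smash_aug G jordan_aug f) u"
proof -
 assume f: "f : carrier A"
 have "prep zero_op (f a) u = scl (jordan_aug (f a)) u" if a: "a : carrier G" for a
 proof -
  obtain w where "f a = cls w" using J_cases J.S_in[OF f a] by blast
  then show ?thesis
   using frep_eval[of "%_. 0" w u] by (simp add: aug_cls prep_class[OF zero_op_facts(1,2)]) (simp add: zero_op_def)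
 qed
 moreover have "(\<Sum>a\<in>B. scl (c a) u) = scl (\<Sum>a\<in>B. c a) u" for B and c :: "'g => 'k"
  by (induction B rule: infinite_finite_induct) (simp_all add: scl_add_left)
 ultimately show ?thesis by (simp add: J.srep_def smash_aug_def)
qed

lemma scl_unit: "scl c (bas ()) = scl d (bas ()) \<longleftrightarrow> c = (d :: 'k)"
 by (metis lookup_scl lookup_single_eq mult.right_neutral)

lemma aug_A:
 "f : carrier A ==> h : carrier A ==> smash_aug G jordan_aug (f \<oplus>\<^bsub>A\<^esub> h) = smash_aug G jordan_aug f + smash_aug G jordan_aug h"
 "f : carrier A ==> h : carrier A ==> smash_aug G jordan_aug (f \<otimes>\<^bsub>A\<^esub> h) = smash_aug G jordan_aug f * smash_aug G jordan_aug h"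
 "f : carrier A ==> smash_aug G jordan_aug (c \<odot>\<^bsub>A\<^esub> f) = c * smash_aug G jordan_aug f"
 "smash_aug G jordan_aug \<one>\<^bsub>A\<^esub> = 1"
 "r : carrier J ==> a : carrier G ==> smash_aug G jordan_aug (J.del r a) = jordan_aug r"
proof -
 note Z = srep_A[of zero_op "%a u. u", OF zero_op_facts(1,2) linm_id refl refl, simplified zero_op_facts(3), simplified]
 note K = smash_aug_srep scl_unit[symmetric]
 show "f : carrier A ==> h : carrier A ==> smash_aug G jordan_aug (f \<oplus>\<^bsub>A\<^esub> h) = smash_aug G jordan_aug f + smash_aug G jordan_aug h"
  using Z(2)[of f h "bas ()"] J.S_closed(2)[of f h] smash_aug_srep[of _ "bas ()"] by (subst scl_unit[symmetric]) (simp only: scl_add_left)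
 show "f : carrier A ==> h : carrier A ==> smash_aug G jordan_aug (f \<otimes>\<^bsub>A\<^esub> h) = smash_aug G jordan_aug f * smash_aug G jordan_aug h"
  using Z(3)[of f h "bas ()"] J.S_closed(1)[of f h] smash_aug_srep by (subst scl_unit[symmetric]) (simp only: scl_simps)
 show "f : carrier A ==> smash_aug G jordan_aug (c \<odot>\<^bsub>A\<^esub> f) = c * smash_aug G jordan_aug f"
  using Z(4)[of f c "bas ()"] J.S_closed(3)[of f c] smash_aug_srep by (subst scl_unit[symmetric]) (simp only: scl_simps)
 show "smash_aug G jordan_aug \<one>\<^bsub>A\<^esub> = 1"
  using Z(5)[of "bas ()"] J.S_closed(4) smash_aug_srep by (subst scl_unit[symmetric]) (simp only: scl_simps)
 show "smash_aug G jordan_aug (J.del r a) = jordan_aug r" if "r : carrier J" "a : carrier G"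
 proof -
  have "smash_aug G jordan_aug (J.del r a) = (\<Sum>b\<in>carrier G. if b = a then jordan_aug r else 0)"
   unfolding smash_aug_def
   by (rule sum.cong) (auto simp: J.del_at cls_zero aug_cls eval_free_simps)
  then show ?thesis using that G(2) by simp
 qed
qed

text \<open>The basis vector \<open>(a, i, j)\<close> stands for \<open>a x\<^sup>i y\<^sup>j\<close> in
 \<open>k[g, x, y] / (g\<^sup>q - 1, x\<^sup>p, y\<^sup>p)\<close>, on which \<open>y\<close> acts as \<open>y + x\<^sup>2 \<partial>\<^sub>x / 2 - x g \<partial>\<^sub>g\<close>.\<close>

definition t :: "'g => nat => nat => ('g \<times> nat \<times> nat \<Rightarrow>\<^sub>0 'k)" where
 "t a i j = (if a : carrier G & i < p & j < p then bas (a, i, j) else 0)"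

text \<open>The term of y that raises the exponent of x. The value grows by 1/2 with
  \<open>i\<close>, which gives y x - x y = x^2 / 2, and drops by 1 when \<open>a\<close> is
  multiplied by \<open>g\<close>, which gives g y = (x + y) g.\<close>

definition co :: "'g => nat => 'k" where "co a i = of_nat i / 2 - chr a"

definition vop :: "jordan_gen => ('g \<times> nat \<times> nat \<Rightarrow>\<^sub>0 'k) => ('g \<times> nat \<times> nat \<Rightarrow>\<^sub>0 'k)" where
 "vop x = linext (%(a, i, j). case x of JX => t a (Suc i) j | JY => t a i (Suc j) + scl (co a i) (t a (Suc i) j))"

text \<open>Basis vectors whose first index lies outside the group are left fixed, so that the unit
  of the group acts as the identity on the whole coordinate space.\<close>

definition gop :: "'g => ('g \<times> nat \<times> nat \<Rightarrow>\<^sub>0 'k) => ('g \<times> nat \<times> nat \<Rightarrow>\<^sub>0 'k)" where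
 "gop b = linext (%(a, i, j). if a : carrier G then bas (b \<otimes>\<^bsub>G\<^esub> a, i, j) else bas (a, i, j))"

abbreviation "vX \<equiv> vop JX"
abbreviation "vY \<equiv> vop JY"

lemma t_out: "p \<le> i \<or> p \<le> j ==> t a i j = 0"
 by (auto simp: t_def)

lemma t_p: "t a p j = 0" "t a i p = 0"
 by (simp_all add: t_def)

lemma vop_linm: "linm (vop x)" and gop_linm: "linm (gop b)"
 by (simp_all add: vop_def gop_def linext_linm)

lemma vX_t: "vX (t a i j) = t a (Suc i) j"
 by (auto simp: vop_def t_def)

lemma vY_t: "vY (t a i j) = t a i (Suc j) + scl (co a i) (t a (Suc i) j)"
 by (auto simp: vop_def t_def)

lemma vop_out: "\<not> (a : carrier G & i < p & j < p) ==> vop x (bas (a, i, j)) = 0"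
 by (cases x) (auto simp: vop_def t_def)

lemma gop_t: "b : carrier G ==> a : carrier G ==> gop b (t a i j) = t (b \<otimes>\<^bsub>G\<^esub> a) i j"
 by (auto simp: gop_def t_def)

text \<open>The index type is larger than the basis of the model; indices out of range are a
  separate case, in which x and y act as zero.\<close>

lemma op_ext:
 assumes "linm F" and "!!a i j. a : carrier G ==> F (t a i j) = 0"
  and "!!a i j. \<not> (a : carrier G & i < p & j < p) ==> F (bas (a, i, j)) = 0"
 shows "F u = 0"
proof (rule linm_eqI[OF assms(1) linm_zero])
 fix b :: "'g \<times> nat \<times> nat"
 obtain a i j where b: "b = (a, i, j)" by (cases b)
 show "F (bas b) = 0"
 proof (cases "a : carrier G & i < p & j < p")
  case True
  then show ?thesis using assms(2)[of a i j] by (simp add: b t_def)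
 qed (simp add: b assms(3))
qed

lemma linm_pow: "linm T ==> linm ((T :: ('b \<Rightarrow>\<^sub>0 'k) => ('b \<Rightarrow>\<^sub>0 'k)) ^^ n)"
proof (induction n)
 case (Suc n)
 then show ?case using linm_comp[of T "T ^^ n"] by (simp add: comp_def)
qed (simp add: id_def linm_id)

lemma vX_pow: "(vX ^^ n) (t a i j) = t a (i + n) j"
 by (induction n) (simp_all add: vX_t)

lemma vY_pow: "(vY ^^ n) (t a i j) = (\<Sum>k\<le>n. scl (of_nat (n choose k)) (scl (\<Prod>m<k. co a (i + m)) (t a (i + k) (j + (n - k)))))"
 using pascal_power[OF vop_linm, of JY "%k m. scl (\<Prod>m<k. co a (i + m)) (t a (i + k) (j + m))" n]
 by (simp add: linm_scl[OF vop_linm] vY_t mult.commute)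

text \<open>In the binomial expansion all coefficients except those for 0 and \<open>p\<close> are
  divisible by \<open>p\<close>. The two exceptional terms overflow the exponent of y or of
  x.\<close>

lemma vY_p: "(vY ^^ p) (t a i j) = 0"
 unfolding vY_pow
proof (rule sum.neutral, rule ballI)
 fix k assume k: "k : {..p}"
 have "p dvd (p choose k)" if "k ~= 0" "k ~= p"
  using dvd_choose_prime[of k p] that k p by auto
 then have "k = 0 \<or> k = p \<or> (of_nat (p choose k) :: 'k) = 0" using of_nat_p by blast
 then show "scl (of_nat (p choose k)) (scl (\<Prod>m<k. co a (i + m)) (t a (i + k) (j + (p - k)))) = 0"
  by (auto simp: t_out)
qed

lemma vop_rel: "r : JR ==> frep vop r u = 0"
proof -
 note F = frep_add frep_diff frep_minus frep_1 frep_gen frep_mult[of vop, OF vop_linm] frep_power[of vop, OF vop_linm] scalar_mult frep_scl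
 have s: "frep vop (gen x) = vop x" for x by (simp add: fun_eq_iff frep_gen)
 have p0: "p = Suc (p - 1)" using p(2) by simp
 have out: "(vop x ^^ p) (bas (a, i, j)) = 0" if "\<not> (a : carrier G & i < p & j < p)" for x a i j
  by (subst p0, subst funpow_Suc_right) (simp add: vop_out[OF that] linm_0[OF linm_pow[OF vop_linm]])
 have X: "(vX ^^ p) u = 0"
  by (rule op_ext[OF linm_pow[OF vop_linm]]) (simp_all add: vX_pow t_out out)
 have Y: "(vY ^^ p) u = 0"
  by (rule op_ext[OF linm_pow[OF vop_linm]]) (simp_all add: vY_p out)
 have YX: "vY (vX u) - vX (vY u) - scl (1 / 2) (vX (vX u)) = 0"
 proof (rule op_ext[of "%u. vY (vX u) - vX (vY u) - scl (1 / 2) (vX (vX u))"])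
  show "linm (%u. vY (vX u) - vX (vY u) - scl (1 / 2) (vX (vX u)))"
   by (intro linm_sub linm_scaled linm_comp[OF vop_linm] vop_linm)
  fix a i j
  have "co a (Suc i) = co a i + 1 / 2" by (simp add: co_def add_divide_distrib)
  then show "vY (vX (t a i j)) - vX (vY (t a i j)) - scl (1 / 2) (vX (vX (t a i j))) = 0"
   by (simp add: vX_t vY_t linm_add[OF vop_linm] linm_scl[OF vop_linm] scl_add_left)
 qed (simp add: vop_out linm_0[OF vop_linm])
 assume "r : JR"
 then show ?thesis using X Y YX by (auto simp: jordan_relations_def Let_def F s power2_eq_square)
qed

lemma gop_facts:
 "b : carrier G ==> c : carrier G ==> gop (b \<otimes>\<^bsub>G\<^esub> c) u = gop b (gop c u)" "gop \<one>\<^bsub>G\<^esub> u = u"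
 "gop g (vX u) = vX (gop g u)" "gop g (vY u) = vX (gop g u) + vY (gop g u)"
proof -
 show "gop (b \<otimes>\<^bsub>G\<^esub> c) u = gop b (gop c u)" if "b : carrier G" "c : carrier G"
  by (rule linm_eqI[OF gop_linm linm_comp[OF gop_linm gop_linm]]) (use that in \<open>auto simp: gop_def J.G.m_assoc split: prod.splits\<close>)
 show "gop \<one>\<^bsub>G\<^esub> u = u"
  by (rule linm_eqI[OF gop_linm linm_id]) (auto simp: gop_def split: prod.splits)
 have out: "vop x (gop g (bas (a, i, j))) = 0" if "\<not> (a : carrier G & i < p & j < p)" for x a i j
  using that vop_out G(4) by (auto simp: gop_def)
 have "gop g (vX u) - vX (gop g u) = 0"
  by (rule op_ext[of "%u. gop g (vX u) - vX (gop g u)"])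
   (auto intro!: linm_sub linm_comp[OF gop_linm vop_linm] linm_comp[OF vop_linm gop_linm] simp: vX_t gop_t G(4) vop_out out linm_0[OF gop_linm])
 then show "gop g (vX u) = vX (gop g u)" by simp
 have "gop g (vY u) - (vX (gop g u) + vY (gop g u)) = 0"
 proof (rule op_ext[of "%u. gop g (vY u) - (vX (gop g u) + vY (gop g u))"])
  fix a i j assume a: "a : carrier G"
  have "co (g \<otimes>\<^bsub>G\<^esub> a) i = co a i - 1" using a G(4) by (simp add: co_def chr_mult chr_g)
  moreover have "scl (c - 1) w = scl c w - w" for c and w :: "'g \<times> nat \<times> nat \<Rightarrow>\<^sub>0 'k"
   using scl_add_left[of c "-1" w] by simp
  ultimately show "gop g (vY (t a i j)) - (vX (gop g (t a i j)) + vY (gop g (t a i j))) = 0"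
   using a by (simp add: vX_t vY_t gop_t G(4) linm_add[OF gop_linm] linm_scl[OF gop_linm])
 qed (auto intro!: linm_sub linm_plus linm_comp[OF gop_linm vop_linm] linm_comp[OF vop_linm gop_linm] simp: vop_out out linm_0[OF gop_linm])
 then show "gop g (vY u) = vX (gop g u) + vY (gop g u)" by simp
qed

definition \<pi> :: "('g => (jordan_gen, 'k) free_algebra set) => ('g \<times> nat \<times> nat \<Rightarrow>\<^sub>0 'k) => ('g \<times> nat \<times> nat \<Rightarrow>\<^sub>0 'k)" where
 "\<pi> = J.srep (prep vop) gop"

lemmas \<pi>_facts = srep_A[of vop gop, OF vop_linm vop_rel gop_linm gop_facts, folded \<pi>_def]

end

lemma (in kalg_gens) lspan_wd_mult:
 assumes x: "x : lspan (range wd)" and y: "y : lspan (range wd)"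
 shows "x \<otimes> y : lspan (range wd)"
proof -
 have r: "range wd \<subseteq> carrier R" using wd_closed by auto
 note c = lspan_closed[OF r]
 show ?thesis
  using x
 proof induction
  case zero
  then show ?case using c[OF y] by (simp add: lspan.zero)
 next
  case (base x)
  then obtain l where l: "x = wd l" by auto
  have "wd l \<otimes> y \<otimes> \<one> : lspan (range wd)"
  proof (rule lspan_mult[OF r wd_closed one_closed _ y])
   fix z assume "z : range wd"
   then obtain m where "z = wd m" by auto
   then have "wd l \<otimes> z \<otimes> \<one> = wd (l @ m)" by (simp add: wd_append wd_closed)
   then show "wd l \<otimes> z \<otimes> \<one> : lspan (range wd)" using lspan.base[of "wd (l @ m)"] by simp
  qed
  then show ?case using c[OF y] by (simp add: l wd_closed)
 next
  case (add x x')
  then show ?case using c y by (simp add: l_distr lspan.add)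
 next
  case (smult x t)
  then show ?case using c y by (simp add: sm_mult_left lspan.smult)
 qed
qed

section \<open>Generators, relations and spanning words of the bosonization\<close>

context jordan_smash
begin

definition NN :: "pbw_gen => nat" where "NN i = (case i of PH => q | PX => p | PY => p)"

abbreviation "gam a \<equiv> J.del \<one>\<^bsub>J\<^esub> a"
abbreviation "iot f \<equiv> J.del (cls f) \<one>\<^bsub>G\<^esub>"

definition je :: "pbw_gen => 'g => (jordan_gen, 'k) free_algebra set" where
 "je i = (case i of PH => gam g \<oplus>\<^bsub>A\<^esub> (- 1) \<odot>\<^bsub>A\<^esub> \<one>\<^bsub>A\<^esub> | PX => iot (gen JX) | PY => iot (gen JY))"

lemma del_in [simp]: "J.del (cls f) a : carrier A" "gam a : carrier A"
 by (simp_all add: J.del_closed cls_one)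

sublocale K: kalg_gens A NN jw je
proof
 show "2 \<le> NN i" for i using q p(2) by (cases i) (simp_all add: NN_def)
 show "0 < jw i" for i by (cases i) simp_all
 show "je i : carrier A" for i by (cases i) (simp_all add: je_def A.sm_closed)
qed

lemma je_simps: "je PH = gam g \<oplus>\<^bsub>A\<^esub> (- 1) \<odot>\<^bsub>A\<^esub> \<one>\<^bsub>A\<^esub>" "je PX = iot (gen JX)" "je PY = iot (gen JY)"
 by (simp_all add: je_def)

lemma iot_mult: "iot f \<otimes>\<^bsub>A\<^esub> J.del (cls h) a = J.del (cls (f * h)) a" if "a : carrier G" for a
 using J.del_mult[of "cls f" "cls h" "\<one>\<^bsub>G\<^esub>" a] that by (simp add: J.\<rho>_id cls_mult)

lemma gam_mult: "gam a \<otimes>\<^bsub>A\<^esub> gam b = gam (a \<otimes>\<^bsub>G\<^esub> b)" if "a : carrier G" "b : carrier G" for a b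
 using J.del_mult[of "\<one>\<^bsub>J\<^esub>" "\<one>\<^bsub>J\<^esub>" a b] that by (simp add: J.\<rho>_one)

lemma gam_iot: "gam g \<otimes>\<^bsub>A\<^esub> iot f = J.del (\<rho> g (cls f)) g"
 using J.del_mult[of "\<one>\<^bsub>J\<^esub>" "cls f" g "\<one>\<^bsub>G\<^esub>"] G(4) by (simp add: J.\<rho>_closed[OF G(4)])

lemma iot_gam: "a : carrier G ==> iot f \<otimes>\<^bsub>A\<^esub> gam a = J.del (cls f) a"
 using iot_mult[of a f 1] by (simp add: cls_one)

lemma one_iot: "\<one>\<^bsub>A\<^esub> = iot 1" and one_gam: "\<one>\<^bsub>A\<^esub> = gam \<one>\<^bsub>G\<^esub>"
 by (simp_all add: J.one_del cls_one)

lemma iot_add: "J.del (cls f) a \<oplus>\<^bsub>A\<^esub> J.del (cls h) a = J.del (cls (f + h)) a"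
 and iot_scl: "c \<odot>\<^bsub>A\<^esub> J.del (cls f) a = J.del (cls (scl c f)) a"
 by (simp_all add: J.del_add J.del_smult cls_add cls_scl)

lemma h_mult: "je PH \<otimes>\<^bsub>A\<^esub> iot f = J.del (\<rho> g (cls f)) g \<oplus>\<^bsub>A\<^esub> iot (scl (- 1) f)"
 "iot f \<otimes>\<^bsub>A\<^esub> je PH = J.del (cls f) g \<oplus>\<^bsub>A\<^esub> iot (scl (- 1) f)"
proof -
 have c: "(- 1) \<odot>\<^bsub>A\<^esub> \<one>\<^bsub>A\<^esub> : carrier A" by (simp add: A.sm_closed)
 show "je PH \<otimes>\<^bsub>A\<^esub> iot f = J.del (\<rho> g (cls f)) g \<oplus>\<^bsub>A\<^esub> iot (scl (- 1) f)"
  unfolding je_simps A.l_distr[OF del_in(2) c del_in(1)]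
  by (simp add: gam_iot A.sm_mult_left iot_scl)
 show "iot f \<otimes>\<^bsub>A\<^esub> je PH = J.del (cls f) g \<oplus>\<^bsub>A\<^esub> iot (scl (- 1) f)"
  unfolding je_simps A.r_distr[OF del_in(2) c del_in(1)]
  by (simp add: iot_gam G(4) A.sm_mult_right iot_scl)
qed

lemma one_h: "\<one>\<^bsub>A\<^esub> \<oplus>\<^bsub>A\<^esub> je PH = gam g"
 using A.a_lcomm[of "\<one>\<^bsub>A\<^esub>" "gam g" "\<ominus>\<^bsub>A\<^esub> \<one>\<^bsub>A\<^esub>"] by (simp add: je_simps A.sm_minus A.r_neg)

text \<open>With g = 1 + h, the rule g y = (x + y) g becomes y h = h y - (x + x h), and g x = x g
  makes x and h commute. Terms with coefficient 0 are added to reach the common form of the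
  relations.\<close>

lemma je_rels:
 "je PX \<otimes>\<^bsub>A\<^esub> je PH = je PH \<otimes>\<^bsub>A\<^esub> je PX \<oplus>\<^bsub>A\<^esub> 0 \<odot>\<^bsub>A\<^esub> (je PH \<oplus>\<^bsub>A\<^esub> je PH \<otimes>\<^bsub>A\<^esub> je PH)"
 "je PY \<otimes>\<^bsub>A\<^esub> je PH = je PH \<otimes>\<^bsub>A\<^esub> je PY \<oplus>\<^bsub>A\<^esub> (- 1) \<odot>\<^bsub>A\<^esub> (je PX \<oplus>\<^bsub>A\<^esub> je PX \<otimes>\<^bsub>A\<^esub> je PH)
   \<oplus>\<^bsub>A\<^esub> (- 0) \<odot>\<^bsub>A\<^esub> (je PH \<oplus>\<^bsub>A\<^esub> je PH \<otimes>\<^bsub>A\<^esub> je PH)"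
 "je PY \<otimes>\<^bsub>A\<^esub> je PX = je PX \<otimes>\<^bsub>A\<^esub> je PY \<oplus>\<^bsub>A\<^esub> (1 / 2) \<odot>\<^bsub>A\<^esub> (je PX \<otimes>\<^bsub>A\<^esub> je PX) \<oplus>\<^bsub>A\<^esub> 0 \<odot>\<^bsub>A\<^esub> je PX
   \<oplus>\<^bsub>A\<^esub> 0 \<odot>\<^bsub>A\<^esub> je PY \<oplus>\<^bsub>A\<^esub> 0 \<odot>\<^bsub>A\<^esub> (je PH \<oplus>\<^bsub>A\<^esub> (- 1) \<odot>\<^bsub>A\<^esub> (je PH \<otimes>\<^bsub>A\<^esub> je PH))"
proof -
 note c = K.e A.m_closed A.a_closed A.sm_closed
 have z: "u \<oplus>\<^bsub>A\<^esub> 0 \<odot>\<^bsub>A\<^esub> v = u" if "u : carrier A" "v : carrier A" for u v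
  using that by (simp add: A.sm_zero_left)
 have x: "\<rho> g (cls (gen JX)) = cls (gen JX)" and y: "\<rho> g (cls (gen JY)) = cls (gen JX + gen JY)"
  using \<rho>x \<rho>y by (simp_all add: jx jy cls_add)
 show "je PX \<otimes>\<^bsub>A\<^esub> je PH = je PH \<otimes>\<^bsub>A\<^esub> je PX \<oplus>\<^bsub>A\<^esub> 0 \<odot>\<^bsub>A\<^esub> (je PH \<oplus>\<^bsub>A\<^esub> je PH \<otimes>\<^bsub>A\<^esub> je PH)"
  by (subst z, intro c, intro c) (simp only: je_simps(2,3) h_mult x)
 have "je PY \<otimes>\<^bsub>A\<^esub> je PH = je PH \<otimes>\<^bsub>A\<^esub> je PY \<oplus>\<^bsub>A\<^esub> (- 1) \<odot>\<^bsub>A\<^esub> (je PX \<oplus>\<^bsub>A\<^esub> je PX \<otimes>\<^bsub>A\<^esub> je PH)"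
 proof (rule J.S_eqI)
  fix c assume "c : carrier G"
  then show "(je PY \<otimes>\<^bsub>A\<^esub> je PH) c = (je PH \<otimes>\<^bsub>A\<^esub> je PY \<oplus>\<^bsub>A\<^esub> (- 1) \<odot>\<^bsub>A\<^esub> (je PX \<oplus>\<^bsub>A\<^esub> je PX \<otimes>\<^bsub>A\<^esub> je PH)) c"
   by (simp only: je_simps(2,3) h_mult x y J.S_add J.S_smult J.del_at cls_zero)
    (simp add: cls_add cls_scl algebra_simps)
 qed (intro c)+
 moreover have "\<dots> = \<dots> \<oplus>\<^bsub>A\<^esub> 0 \<odot>\<^bsub>A\<^esub> (je PH \<oplus>\<^bsub>A\<^esub> je PH \<otimes>\<^bsub>A\<^esub> je PH)"
  by (rule z[symmetric]; intro c)
 ultimately show "je PY \<otimes>\<^bsub>A\<^esub> je PH = je PH \<otimes>\<^bsub>A\<^esub> je PY \<oplus>\<^bsub>A\<^esub> (- 1) \<odot>\<^bsub>A\<^esub> (je PX \<oplus>\<^bsub>A\<^esub> je PX \<otimes>\<^bsub>A\<^esub> je PH)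
   \<oplus>\<^bsub>A\<^esub> (- 0) \<odot>\<^bsub>A\<^esub> (je PH \<oplus>\<^bsub>A\<^esub> je PH \<otimes>\<^bsub>A\<^esub> je PH)" by (simp only: minus_zero)
 have "gen JY * gen JX - (gen JX * gen JY + scl (1 / 2) (gen JX * gen JX)) : JR"
  by (simp add: jordan_relations_def Let_def scalar_mult power2_eq_square algebra_simps)
 then have "cls (gen JY * gen JX) = cls (gen JX * gen JY + scl (1 / 2) (gen JX * gen JX))" by (rule presented_rel_eq)
 then have "je PY \<otimes>\<^bsub>A\<^esub> je PX = je PX \<otimes>\<^bsub>A\<^esub> je PY \<oplus>\<^bsub>A\<^esub> (1 / 2) \<odot>\<^bsub>A\<^esub> (je PX \<otimes>\<^bsub>A\<^esub> je PX)"
  by (simp add: je_simps(2,3) iot_mult iot_scl iot_add)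
 also have "\<dots> = \<dots> \<oplus>\<^bsub>A\<^esub> 0 \<odot>\<^bsub>A\<^esub> je PX" by (rule z[symmetric]; intro c)
 also have "\<dots> = \<dots> \<oplus>\<^bsub>A\<^esub> 0 \<odot>\<^bsub>A\<^esub> je PY" by (rule z[symmetric]; intro c)
 also have "\<dots> = \<dots> \<oplus>\<^bsub>A\<^esub> 0 \<odot>\<^bsub>A\<^esub> (je PH \<oplus>\<^bsub>A\<^esub> (- 1) \<odot>\<^bsub>A\<^esub> (je PH \<otimes>\<^bsub>A\<^esub> je PH))" by (rule z[symmetric]; intro c)
 finally show "je PY \<otimes>\<^bsub>A\<^esub> je PX = je PX \<otimes>\<^bsub>A\<^esub> je PY \<oplus>\<^bsub>A\<^esub> (1 / 2) \<odot>\<^bsub>A\<^esub> (je PX \<otimes>\<^bsub>A\<^esub> je PX) \<oplus>\<^bsub>A\<^esub> 0 \<odot>\<^bsub>A\<^esub> je PX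
   \<oplus>\<^bsub>A\<^esub> 0 \<odot>\<^bsub>A\<^esub> je PY \<oplus>\<^bsub>A\<^esub> 0 \<odot>\<^bsub>A\<^esub> (je PH \<oplus>\<^bsub>A\<^esub> (- 1) \<odot>\<^bsub>A\<^esub> (je PH \<otimes>\<^bsub>A\<^esub> je PH))" .
qed

text \<open>This is (1 + h)^q = 1 solved for h^q. The order \<open>q\<close> is a multiple of
  \<open>p\<close> but need not be a power of it, so intermediate binomial coefficients can
  survive.\<close>

definition jpc :: "pbw_gen => nat \<Rightarrow>\<^sub>0 'k" where
 "jpc i = (case i of PH => - (\<Sum>k\<in>{0<..<q}. single k (of_nat (q choose k))) | _ => 0)"

lemma jpc: "jpc i : Kset (%k. 0 < k & k < NN i)"
 by (cases i) (auto simp: jpc_def NN_def intro!: Kset_minus Kset_sum Kset_single)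

lemma wd_iot: "K.wd (replicate k PX) = iot (gen JX ^ k)" "K.wd (replicate k PY) = iot (gen JY ^ k)"
 by (induction k) (simp_all add: one_iot je_simps(2,3) iot_mult)

abbreviation "W \<equiv> %k. K.wd (replicate k PH)"

text \<open>Here \<open>nat \<Rightarrow>\<^sub>0 'k\<close> is the polynomial ring \<open>k[X]\<close>, evaluated at \<open>h = g - 1\<close>.\<close>

lemma eval_h_pow: "A.lev W ((1 + single 1 1) ^ n) = gam (g [^]\<^bsub>G\<^esub> n)"
proof (induction n)
 case 0
 have "A.lev W (single 0 1) = \<one>\<^bsub>A\<^esub>" by (subst A.lev_single[OF K.wd_closed]) (simp add: A.sm_one)
 then show ?case by (simp add: one_gam)
next
 case (Suc n)
 have X: "A.lev W (single 1 1 * u) = je PH \<otimes>\<^bsub>A\<^esub> A.lev W u" for u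
 proof -
  have "u : Kset (%_. True)" by (simp add: Kset_def)
  then show ?thesis
  proof (induction rule: Kset_induct)
   case (single k c)
   then show ?case by (simp add: mult_single A.lev_single[OF K.wd_closed] A.sm_mult_right K.e K.wd_closed)
  qed (simp_all add: A.lev_zero K.e A.lev_add[OF K.wd_closed] distrib_left A.r_distr A.lev_closed[OF K.wd_closed])
 qed
 have "A.lev W ((1 + single 1 1) ^ Suc n) = A.lev W ((1 + single 1 1) ^ n) \<oplus>\<^bsub>A\<^esub> je PH \<otimes>\<^bsub>A\<^esub> A.lev W ((1 + single 1 1) ^ n)"
  by (simp only: power_Suc distrib_right mult_1_left A.lev_add[OF K.wd_closed] X)
 also have "\<dots> = (\<one>\<^bsub>A\<^esub> \<oplus>\<^bsub>A\<^esub> je PH) \<otimes>\<^bsub>A\<^esub> gam (g [^]\<^bsub>G\<^esub> n)" by (simp only: Suc A.l_distr A.one_closed K.e del_in A.l_one)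
 also have "\<dots> = gam (g [^]\<^bsub>G\<^esub> Suc n)" unfolding one_h using G(4) by (simp only: gam_mult J.G.nat_pow_closed J.G.nat_pow_Suc2)
 finally show ?case .
qed

lemma binomial_poly: "(1 + single 1 1) ^ q + jpc PH = (single q 1 + 1 :: nat \<Rightarrow>\<^sub>0 'k)"
proof -
 have P: "(single 1 1 :: nat \<Rightarrow>\<^sub>0 'k) ^ k = single k 1" for k
  by (induction k) (simp_all add: mult_single)
 have C: "of_nat c * u = scl (of_nat c) (u :: nat \<Rightarrow>\<^sub>0 'k)" for c u
  by (induction c) (simp_all add: distrib_right scl_add_left)
 have "(1 + single 1 1 :: nat \<Rightarrow>\<^sub>0 'k) ^ q = (\<Sum>k\<le>q. single k (of_nat (q choose k)))"
  by (subst add.commute, subst binomial_ring) (simp add: P[unfolded One_nat_def] C)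
 also have "{..q} = insert 0 (insert q {0<..<q})" using q by auto
 also have "(\<Sum>k\<in>insert 0 (insert q {0<..<q}). single k (of_nat (q choose k))) =
   1 + (single q 1 + (\<Sum>k\<in>{0<..<q}. single k (of_nat (q choose k) :: 'k)))"
  using q by simp
 finally show ?thesis by (simp add: jpc_def add_ac)
qed

lemma del_zero: "J.del \<zero>\<^bsub>J\<^esub> a = \<zero>\<^bsub>A\<^esub>"
 by (simp add: J.del_def smash_product_def)

lemma je_pow: "K.wd (replicate (NN i) i) = A.lev (%k. K.wd (replicate k i)) (jpc i)"
proof (cases i)
 case PH
 note L = A.lev_add[OF K.wd_closed] A.lev_single[OF K.wd_closed] A.lev_closed[OF K.wd_closed]
 have o: "A.lev W 1 = \<one>\<^bsub>A\<^esub>" using eval_h_pow[of 0] by (simp add: one_gam)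
 have gq: "gam (g [^]\<^bsub>G\<^esub> q) = \<one>\<^bsub>A\<^esub>" using J.G.pow_order_eq_1[OF G(4)] by (simp add: one_gam)
 have "\<one>\<^bsub>A\<^esub> \<oplus>\<^bsub>A\<^esub> A.lev W (jpc PH) = A.lev W (single q 1 + 1)"
  unfolding binomial_poly[symmetric] L(1) eval_h_pow gq ..
 also have "\<dots> = \<one>\<^bsub>A\<^esub> \<oplus>\<^bsub>A\<^esub> W q" by (simp add: L o A.sm_one K.wd_closed A.a_comm)
 finally have e: "\<one>\<^bsub>A\<^esub> \<oplus>\<^bsub>A\<^esub> A.lev W (jpc PH) = \<one>\<^bsub>A\<^esub> \<oplus>\<^bsub>A\<^esub> W q" .
 have "A.lev W (jpc PH) = \<ominus>\<^bsub>A\<^esub> \<one>\<^bsub>A\<^esub> \<oplus>\<^bsub>A\<^esub> (\<one>\<^bsub>A\<^esub> \<oplus>\<^bsub>A\<^esub> A.lev W (jpc PH))" by (simp only: A.r_neg1 A.one_closed L(3))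
 also have "\<dots> = W q" unfolding e by (simp only: A.r_neg1 A.one_closed K.wd_closed)
 finally show ?thesis by (simp add: PH NN_def)
next
 case PX
 have "cls (gen JX ^ p) = \<zero>\<^bsub>J\<^esub>" unfolding J_eq by (rule presented_rel) (simp add: jordan_relations_def Let_def)
 then have "K.wd (replicate p PX) = \<zero>\<^bsub>A\<^esub>" by (simp only: wd_iot del_zero)
 then show ?thesis by (simp add: PX NN_def jpc_def A.lev_zero)
next
 case PY
 have "cls (gen JY ^ p) = \<zero>\<^bsub>J\<^esub>" unfolding J_eq by (rule presented_rel) (simp add: jordan_relations_def Let_def)
 then have "K.wd (replicate p PY) = \<zero>\<^bsub>A\<^esub>" by (simp only: wd_iot del_zero)
 then show ?thesis by (simp add: PY NN_def jpc_def A.lev_zero)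
qed

text \<open>Powers of \<open>gam g\<close> are reached through g = 1 + h, elements of the Jordan
  plane through words in x and y, and the elements \<open>J.del r a\<close> are products of the two
  kinds.\<close>

lemma generated: "f : carrier A ==> f : A.lspan (range K.wd)"
proof (rule J.S_span[of "A.lspan (range K.wd)"])
 let ?L = "A.lspan (range K.wd)"
 have one: "\<one>\<^bsub>A\<^esub> : ?L" using A.lspan.base[OF rangeI[of K.wd "[]"]] by simp
 have je: "je i : ?L" for i using A.lspan.base[OF rangeI[of K.wd "[i]"]] K.e by simp
 show add: "x \<oplus>\<^bsub>A\<^esub> y : ?L" if "x : ?L" "y : ?L" for x y using that by (rule A.lspan.add)
 have "gam g : ?L" using add[OF one je[of PH]] by (simp add: one_h)
 then have gam: "gam (g [^]\<^bsub>G\<^esub> (n::nat)) : ?L" for n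
 proof (induction n)
  case 0
  show ?case using one by (simp add: one_gam)
 next
  case (Suc n)
  have "gam g \<otimes>\<^bsub>A\<^esub> gam (g [^]\<^bsub>G\<^esub> n) : ?L" by (rule K.lspan_wd_mult[OF Suc.prems Suc.IH[OF Suc.prems]])
  then show ?case using G(4) by (simp only: gam_mult J.G.nat_pow_closed J.G.nat_pow_Suc2)
 qed
 have iot: "iot f : ?L" for f
 proof (induction f rule: presented_induct[where Q = "%r. J.del r \<one>\<^bsub>G\<^esub> : ?L"])
  case one
  show ?case using \<open>\<one>\<^bsub>A\<^esub> : ?L\<close> by (simp only: one_iot)
 next
  case (gen x f)
  have "iot (gen x) : ?L" using je[of PX] je[of PY] by (cases x) (simp_all add: je_simps)
  from K.lspan_wd_mult[OF this gen] show ?case by (simp add: iot_mult)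
 next
  case (add f h)
  then show ?case using A.lspan.add[OF add] by (simp add: iot_add)
 next
  case (scl c f)
  then show ?case using A.lspan.smult[OF scl, of c] by (simp add: iot_scl)
 qed
 show "J.del r a : ?L" if ra: "r : carrier J" "a : carrier G" for r a
 proof -
  obtain f where r: "r = cls f" using J_cases[OF ra(1)] by blast
  obtain n :: nat where a: "a = g [^]\<^bsub>G\<^esub> n" using pow_exists[OF ra(2)] by blast
  have "iot f \<otimes>\<^bsub>A\<^esub> gam a : ?L" unfolding a by (rule K.lspan_wd_mult[OF iot gam])
  then show ?thesis by (simp add: iot_gam ra(2) r)
 qed
qed (rule A.lspan.zero)

lemma aug_je: "smash_aug G jordan_aug (je i) = 0"
proof -
 have "smash_aug G jordan_aug (je PH) = 0"
  unfolding je_simps by (subst aug_A(1)) (simp_all add: A.sm_closed aug_A(3,4,5) G(4) cls_one aug_cls eval_free_simps)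
 then show ?thesis by (cases i) (simp_all add: je_simps aug_A(5) aug_cls eval_free_simps)
qed

end

section \<open>Independence of the ordered monomials, and the test vectors\<close>

context jordan_smash
begin

lemma \<pi>_je: "\<pi> (je PH) u = gop g u - u" "\<pi> (je PX) u = vX u" "\<pi> (je PY) u = vY u"
proof -
 have o: "prep vop (cls f) u = frep vop f u" for f u by (rule prep_class[OF vop_linm vop_rel])
 have g: "\<pi> (gam g) u = gop g u" unfolding cls_one by (simp add: \<pi>_facts(6) G(4) o frep_1)
 show "\<pi> (je PH) u = gop g u - u"
  unfolding je_simps by (simp add: \<pi>_facts(2,4,5) A.sm_closed g)
 show "\<pi> (je PX) u = vX u" "\<pi> (je PY) u = vY u"
  by (simp_all add: je_simps \<pi>_facts(6) o frep_gen gop_facts(2))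
qed

lemma \<pi>_wd: "\<pi> (K.wd l) u = foldr (%i. \<pi> (je i)) l u"
 by (induction l) (simp_all add: \<pi>_facts(3,5) K.e K.wd_closed)

abbreviation "v0 \<equiv> t \<one>\<^bsub>G\<^esub> 0 0"

lemma pow_inj: "n < q ==> m < q ==> g [^]\<^bsub>G\<^esub> n = g [^]\<^bsub>G\<^esub> m ==> n = m"
 using pow_bij by (auto simp: bij_betw_def inj_on_def)

lemma pow_in: "g [^]\<^bsub>G\<^esub> (n::nat) : carrier G"
 using G(4) by simp

text \<open>Powers of g - 1 are triangular with respect to powers of g. The support of
  \<open>w\<close> is recorded exactly, so that a top coefficient can be isolated later.\<close>

lemma h_pow: "EX w:Kset (%(a, i, j). i = b & j = c & (\<exists>n<k. a = g [^]\<^bsub>G\<^esub> (n::nat))).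
  ((%u. gop g u - u) ^^ k) (t \<one>\<^bsub>G\<^esub> b c) = t (g [^]\<^bsub>G\<^esub> k) b c + w"
proof (induction k)
 case (Suc k)
 let ?Q = "%k (a, i, j). i = b & j = c & (\<exists>n<k. a = g [^]\<^bsub>G\<^esub> (n::nat))"
 obtain w where w: "w : Kset (?Q k)" "((%u. gop g u - u) ^^ k) (t \<one>\<^bsub>G\<^esub> b c) = t (g [^]\<^bsub>G\<^esub> k) b c + w" using Suc by blast
 have s: "g \<otimes>\<^bsub>G\<^esub> g [^]\<^bsub>G\<^esub> n = g [^]\<^bsub>G\<^esub> Suc n" for n :: nat using G(4) by (simp only: J.G.nat_pow_Suc2)
 have gw: "gop g w : Kset (?Q (Suc k))"
 proof (rule linm_Kset[OF gop_linm w(1)])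
  fix x assume "?Q k x"
  then obtain n where n: "n < k" "x = (g [^]\<^bsub>G\<^esub> n, b, c)" by auto
  then have "gop g (bas x) = bas (g [^]\<^bsub>G\<^esub> Suc n, b, c)" by (simp add: gop_def pow_in s del: J.G.nat_pow_Suc)
  then show "gop g (bas x) : Kset (?Q (Suc k))" using n(1) by (auto simp del: J.G.nat_pow_Suc)
 qed
 have tk: "t (g [^]\<^bsub>G\<^esub> k) b c : Kset (?Q (Suc k))" by (auto simp: t_def)
 have w': "w : Kset (?Q (Suc k))" by (rule Kset_mono[OF w(1)]) (clarsimp, use less_SucI in blast)
 have "((%u. gop g u - u) ^^ Suc k) (t \<one>\<^bsub>G\<^esub> b c) = t (g [^]\<^bsub>G\<^esub> Suc k) b c + (gop g w - t (g [^]\<^bsub>G\<^esub> k) b c - w)"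
  by (simp add: w(2) linm_add[OF gop_linm] gop_t G(4) pow_in s del: J.G.nat_pow_Suc)
 then show ?case using Kset_diff[OF Kset_diff[OF gw tk] w'] by (intro bexI)
qed (intro bexI[of _ 0], simp_all)

lemma \<pi>_mon: "K.box m ==> EX w:Kset (%(a, i, j). i = m PX & j = m PY & (\<exists>n<m PH. a = g [^]\<^bsub>G\<^esub> (n::nat))).
  \<pi> (K.mon m) v0 = bas (g [^]\<^bsub>G\<^esub> m PH, m PX, m PY) + w"
proof -
 assume m: "K.box m"
 have F: "foldr (%i. \<pi> (je i)) (replicate k i) u = (\<pi> (je i) ^^ k) u" for k i u by (induction k) simp_all
 have L: "\<pi> (je PH) = (%u. gop g u - u)" "\<pi> (je PX) = vX" "\<pi> (je PY) = vY" by (simp_all add: fun_eq_iff \<pi>_je)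
 have "(vY ^^ k) v0 = t \<one>\<^bsub>G\<^esub> 0 k" for k
  by (induction k) (simp_all add: vY_t co_def chr_one)
 then have "\<pi> (K.mon m) v0 = ((%u. gop g u - u) ^^ m PH) (t \<one>\<^bsub>G\<^esub> (m PX) (m PY))"
  by (simp add: K.mon_def K.nf_def \<pi>_wd F L vX_pow)
 moreover have "t (g [^]\<^bsub>G\<^esub> m PH) (m PX) (m PY) = bas (g [^]\<^bsub>G\<^esub> m PH, m PX, m PY)"
  using m by (auto simp: t_def K.box_def NN_def pow_in all_pbw_gen)
 ultimately show ?thesis using h_pow[of "m PX" "m PY" "m PH"] by simp
qed

text \<open>Among the monomials of \<open>u\<close> take one with the largest exponent of h. By
  triangularity its top vector occurs in the image of no other monomial of \<open>u\<close>, so its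
  coefficient can be read off and would have to be 0.\<close>

lemma independent:
 assumes u: "u : Kset K.box" and 0: "A.lev K.mon u = \<zero>\<^bsub>A\<^esub>"
 shows "u = 0"
proof (rule ccontr)
 assume "u ~= 0"
 then have ne: "keys u ~= {}" by simp
 obtain m where m: "m : keys u" "!!m'. m' : keys u ==> m' PH \<le> m PH"
 proof -
  let ?M = "Max ((%m. m PH) ` keys u)"
  have "?M : (%m. m PH) ` keys u" by (rule Max_in) (use ne in auto)
  then obtain m where "m : keys u" "?M = m PH" by auto
  then show thesis using that[of m] by (metis Max_ge finite_imageI finite_keys imageI)
 qed
 let ?b = "(g [^]\<^bsub>G\<^esub> m PH, m PX, m PY)"
 have box: "K.box m'" if "m' : keys u" for m' using u that by (auto simp: Kset_def)
 have lt: "m' PH < q" if "m' : keys u" for m' using box[OF that] by (auto simp: K.box_def all_pbw_gen NN_def)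
 have F: "lookup (\<pi> (K.mon m') v0) ?b = (if m' = m then 1 else 0)" if m': "m' : keys u" for m'
 proof -
  obtain w where w: "w : Kset (%(a, i, j). i = m' PX & j = m' PY & (\<exists>n<m' PH. a = g [^]\<^bsub>G\<^esub> (n::nat)))"
   "\<pi> (K.mon m') v0 = bas (g [^]\<^bsub>G\<^esub> m' PH, m' PX, m' PY) + w" using \<pi>_mon[OF box[OF m']] by blast
  have "lookup w ?b = 0"
  proof (rule ccontr)
   assume "lookup w ?b ~= 0"
   then have "?b : keys w" by (simp add: in_keys_iff)
   from bspec[OF w(1)[unfolded Kset_def mem_Collect_eq] this]
   obtain n where n: "n < m' PH" "g [^]\<^bsub>G\<^esub> m PH = g [^]\<^bsub>G\<^esub> n" by auto
   then have "m PH = n" using pow_inj[of "m PH" n] lt[OF m(1)] lt[OF m'] by simp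
   then show False using n(1) m(2)[OF m'] by simp
  qed
  moreover have "(g [^]\<^bsub>G\<^esub> m' PH, m' PX, m' PY) = ?b \<longleftrightarrow> m' = m"
   using pow_inj[OF lt[OF m'] lt[OF m(1)]] by (auto simp: mono_eq_iff)
  ultimately show ?thesis by (simp add: w(2) lookup_add lookup_single when_def)
 qed
 have "\<pi> (A.lev K.mon u) v0 = linext (%m. \<pi> (K.mon m) v0) u"
  by (rule A.rep_lev[where \<pi> = "%a. \<pi> a v0"]) (simp_all add: \<pi>_facts K.mon_closed)
 moreover have "\<pi> (A.lev K.mon u) v0 = 0"
  using \<pi>_facts(4)[of "\<zero>\<^bsub>A\<^esub>" 0 v0] by (simp add: 0 A.sm_zero_left)
 ultimately have "lookup (linext (%m. \<pi> (K.mon m) v0) u) ?b = 0" by simp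
 also have "lookup (linext (%m. \<pi> (K.mon m) v0) u) ?b =
   (\<Sum>m'\<in>keys u. lookup u m' * lookup (\<pi> (K.mon m') v0) ?b)"
  by (simp add: linext_def lookup_sum)
 also have "\<dots> = (\<Sum>m'\<in>keys u. if m' = m then lookup u m else 0)"
  by (rule sum.cong) (auto simp: F)
 also have "\<dots> = lookup u m" using m(1) by simp
 finally show False using m(1) by (simp add: in_keys_iff)
qed

text \<open>The sum over the group carries the top powers of x and y: translation by
  \<open>g\<close> permutes the summands, and x and y overflow. So g - 1, x and y all kill
  it.\<close>

definition jz :: "'g \<times> nat \<times> nat \<Rightarrow>\<^sub>0 'k" where "jz = (\<Sum>a\<in>carrier G. t a (p - 1) (p - 1))"

text \<open>For \<open>PH\<close> and \<open>PY\<close> a single entry is enough: the norm of g,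
  respectively y^(p-1), takes it to \<open>jz\<close>, and the remaining relations hold trivially.
  For \<open>PX\<close> the relation between y and h asks for a \<open>PY\<close> entry whose image
  under g - 1 is the \<open>PX\<close> entry; weighting by \<open>co\<close> achieves this, and the
  argument \<open>p - 1\<close> makes the relation between y and x hold as well, by
  \<open>co_p\<close>.\<close>

definition jv :: "pbw_gen => pbw_gen => ('g \<times> nat \<times> nat \<Rightarrow>\<^sub>0 'k)" where
 "jv i j = (case i of
    PH => (case j of PH => t \<one>\<^bsub>G\<^esub> (p - 1) (p - 1) | _ => 0)
   | PX => (case j of PH => 0 | PX => (\<Sum>a\<in>carrier G. t a 0 (p - 1)) | PY => (\<Sum>a\<in>carrier G. scl (co a (p - 1)) (t a 0 (p - 1))))
   | PY => (case j of PY => (\<Sum>a\<in>carrier G. t a (p - 1) 0) | _ => 0))"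

lemma sum_shift: "(\<Sum>a\<in>carrier G. f (g \<otimes>\<^bsub>G\<^esub> a)) = (\<Sum>a\<in>carrier G. f a)"
proof (rule sum.reindex_bij_witness[where i = "%a. inv\<^bsub>G\<^esub> g \<otimes>\<^bsub>G\<^esub> a" and j = "%a. g \<otimes>\<^bsub>G\<^esub> a"])
 fix a assume a: "a : carrier G"
 show "inv\<^bsub>G\<^esub> g \<otimes>\<^bsub>G\<^esub> (g \<otimes>\<^bsub>G\<^esub> a) = a" "g \<otimes>\<^bsub>G\<^esub> (inv\<^bsub>G\<^esub> g \<otimes>\<^bsub>G\<^esub> a) = a"
  using a G(4) by (simp_all flip: J.G.m_assoc)
qed (use G(4) in auto)

lemma p1: "Suc (p - 1) = p" "Suc (p - Suc 0) = p" "p - Suc 0 < p" using p(2) by auto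

lemma op_sum: "vop x (\<Sum>a\<in>carrier G. f a) = (\<Sum>a\<in>carrier G. vop x (f a))"
 "gop b (\<Sum>a\<in>carrier G. f a) = (\<Sum>a\<in>carrier G. gop b (f a))"
 by (rule linm_sum[OF vop_linm] linm_sum[OF gop_linm])+

lemma gop_sum: "gop g (\<Sum>a\<in>carrier G. t a i j) = (\<Sum>a\<in>carrier G. t a i j)"
 unfolding op_sum using sum_shift[of "%a. t a i j"] by (simp add: gop_t G(4) cong: sum.cong)

text \<open>Since \<open>p\<close> is zero in the field, p - 1 and -1 agree there. This fixes the
  argument of \<open>co\<close> in \<open>jv\<close>.\<close>

lemma co_p: "co a (p - Suc 0) + 1 / 2 = co a 0"
proof -
 have "(of_nat (p - Suc 0) :: 'k) + 1 = of_nat p"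
  using arg_cong[OF p1(2), of "of_nat :: nat => 'k"] by (simp add: add.commute)
 then have "(of_nat (p - Suc 0) :: 'k) + 1 = 0" using of_nat_p[of p] by simp
 then have "(of_nat (p - Suc 0) + 1) / 2 = (0 :: 'k)" by simp
 then show ?thesis by (simp add: co_def add_divide_distrib algebra_simps)
qed

text \<open>For \<open>a = g ^ n\<close> the factor at the residue of \<open>2 n\<close> modulo
  \<open>p\<close> vanishes. Division by 2 is legitimate because \<open>p > 2\<close>.\<close>

lemma co_prod: "a : carrier G ==> (\<Prod>m<p. co a m) = 0"
proof -
 assume "a : carrier G"
 then obtain n :: nat where a: "a = g [^]\<^bsub>G\<^esub> n" using pow_exists by blast
 have "(of_nat (2 * n) :: 'k) = of_nat ((2 * n) mod p) + of_nat p * of_nat ((2 * n) div p)"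
  by (simp flip: of_nat_mult of_nat_add)
 then have "(of_nat ((2 * n) mod p) :: 'k) = 2 * of_nat n" using of_nat_p[of p] by simp
 then have "co a ((2 * n) mod p) = 0" using two by (simp add: co_def a chr_pow)
 then show ?thesis using p(2) by (intro prod_zero) (auto intro!: bexI[of _ "(2 * n) mod p"])
qed

lemma vY_pow_top: "(vY ^^ n) (t a i (p - 1)) = scl (\<Prod>m<n. co a (i + m)) (t a (i + n) (p - 1))"
 by (induction n) (simp_all add: linm_scl[OF vop_linm] vY_t p1 t_p mult.commute)

lemma vY_pow_right: "(vY ^^ n) (t a (p - 1) j) = t a (p - 1) (j + n)"
 by (induction n) (simp_all add: vY_t p1 t_p)

lemma jv_rels:
 "\<pi> (je PH) (jv i PX) - \<pi> (je PX) (jv i PH) + scl 0 (jv i PH + \<pi> (je PH) (jv i PH)) = 0"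
 "\<pi> (je PH) (jv i PY) - \<pi> (je PY) (jv i PH) + scl (- 1) (jv i PX + \<pi> (je PX) (jv i PH)) - scl 0 (jv i PH + \<pi> (je PH) (jv i PH)) = 0"
 "\<pi> (je PX) (jv i PY) - \<pi> (je PY) (jv i PX) + scl (1 / 2) (\<pi> (je PX) (jv i PX)) + scl 0 (jv i PX) + scl 0 (jv i PY)
  + scl 0 (jv i PH - \<pi> (je PH) (jv i PH)) = 0"
proof -
 note Z = linm_0[OF vop_linm] linm_0[OF gop_linm]
 have c1: "scl (c - 1) w = scl c w - w" for c and w :: "'g \<times> nat \<times> nat \<Rightarrow>\<^sub>0 'k"
  using scl_add_left[of c "-1" w] by simp
 \<comment> \<open>Translation by \<open>g\<close> lowers \<open>co\<close> by 1. Expressed through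
   the new index the coefficient is therefore increased by 1, and the increase adds up to
   \<open>jv PX PX\<close>.\<close>
 have "gop g (jv PX PY) = (\<Sum>a\<in>carrier G. scl (co (g \<otimes>\<^bsub>G\<^esub> a) (p - 1) + 1) (t (g \<otimes>\<^bsub>G\<^esub> a) 0 (p - 1)))"
  unfolding jv_def pbw_gen.case op_sum
  by (rule sum.cong) (simp_all add: linm_scl[OF gop_linm] gop_t G(4) co_def chr_mult chr_g)
 also have "\<dots> = (\<Sum>a\<in>carrier G. scl (co a (p - 1) + 1) (t a 0 (p - 1)))" by (rule sum_shift)
 also have "\<dots> = jv PX PY + jv PX PX" by (simp add: jv_def scl_add_left sum.distrib)
 finally have xy: "gop g (jv PX PY) = jv PX PY + jv PX PX" .
 have yx: "vX (jv PX PY) - vY (jv PX PX) + scl (1 / 2) (vX (jv PX PX)) = 0"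
 proof -
  have "vX (jv PX PY) + scl (1 / 2) (vX (jv PX PX)) =
    (\<Sum>a\<in>carrier G. scl (co a (p - 1)) (t a 1 (p - 1)) + scl (1 / 2) (t a 1 (p - 1)))"
   by (simp add: jv_def op_sum linm_scl[OF vop_linm] vX_t scl_sum sum.distrib)
  also have "\<dots> = (\<Sum>a\<in>carrier G. vY (t a 0 (p - 1)))"
   by (rule sum.cong) (simp_all add: vY_t p1 t_p co_p[unfolded One_nat_def] flip: scl_add_left)
  also have "\<dots> = vY (jv PX PX)" by (simp add: jv_def op_sum)
  finally show ?thesis by (simp add: algebra_simps)
 qed
 have top: "vX (t a (p - 1) j) = 0" "vY (t a (p - 1) (p - 1)) = 0" for a j by (simp_all add: vX_t vY_t p1 t_p)
 show "\<pi> (je PH) (jv i PX) - \<pi> (je PX) (jv i PH) + scl 0 (jv i PH + \<pi> (je PH) (jv i PH)) = 0"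
  unfolding \<pi>_je by (cases i) (simp_all add: jv_def Z gop_sum top[unfolded One_nat_def])
 show "\<pi> (je PH) (jv i PY) - \<pi> (je PY) (jv i PH) + scl (- 1) (jv i PX + \<pi> (je PX) (jv i PH)) - scl 0 (jv i PH + \<pi> (je PH) (jv i PH)) = 0"
  unfolding \<pi>_je using xy by (cases i) (simp_all add: jv_def Z gop_sum top[unfolded One_nat_def])
 show "\<pi> (je PX) (jv i PY) - \<pi> (je PY) (jv i PX) + scl (1 / 2) (\<pi> (je PX) (jv i PX)) + scl 0 (jv i PX) + scl 0 (jv i PY)
  + scl 0 (jv i PH - \<pi> (je PH) (jv i PH)) = 0"
  unfolding \<pi>_je using yx by (cases i) (simp_all add: jv_def Z op_sum top[unfolded One_nat_def])
qed

lemma jv_pow: "(\<pi> (je j) ^^ (NN j - 1)) (jv i j) - linext (%k. (\<pi> (je j) ^^ (k - 1)) (jv i j)) (jpc j)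
  = (if i = j then jz else 0)"
proof -
 have L: "\<pi> (je PX) = vX" "\<pi> (je PY) = vY" by (simp_all add: fun_eq_iff \<pi>_je)
 have S: "(vop x ^^ n) (\<Sum>a\<in>carrier G. f a) = (\<Sum>a\<in>carrier G. (vop x ^^ n) (f a))" for x n f
  by (rule linm_sum[OF linm_pow[OF vop_linm]])
 have Z: "(vop x ^^ n) 0 = 0" for x n by (rule linm_0[OF linm_pow[OF vop_linm]])
 define H where "H = (%u. gop g u - u)"
 have H: "linm H" unfolding H_def by (rule linm_sub[OF gop_linm linm_id])
 have LH: "\<pi> (je PH) = H" by (simp add: fun_eq_iff \<pi>_je H_def)
 \<comment> \<open>Removing one factor h from (1 + h)^q - 1 leaves the norm 1 + g + ... + g^(q-1);
   \<open>geometric_power\<close> states this for operators.\<close>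
 have uH: "(H ^^ (q - 1)) w - linext (%k. (H ^^ (k - 1)) w) (jpc PH) = (\<Sum>n<q. (gop g ^^ n) w)" for w
 proof -
  obtain q' where q': "q = Suc q'" using q by (cases q) auto
  have "linext (%k. (H ^^ (k - 1)) w) (jpc PH) = - (\<Sum>k\<in>{0<..<q}. scl (of_nat (q choose k)) ((H ^^ (k - 1)) w))"
   by (simp add: jpc_def linm_sum[OF linext_linm])
  also have "(\<Sum>k\<in>{0<..<q}. scl (of_nat (q choose k)) ((H ^^ (k - 1)) w)) = (\<Sum>k<q'. scl (of_nat (q choose Suc k)) ((H ^^ k) w))"
   by (rule sum.reindex_bij_witness[where i = Suc and j = "%k. k - 1"]) (auto simp: q')
  finally have "(H ^^ (q - 1)) w - linext (%k. (H ^^ (k - 1)) w) (jpc PH) = (\<Sum>k<q. scl (of_nat (q choose Suc k)) ((H ^^ k) w))"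
   by (simp add: q' add.commute binomial_eq_0)
  also have "\<dots> = (\<Sum>n<q. (gop g ^^ n) w)" unfolding geometric_power[OF H] by (simp add: H_def)
  finally show ?thesis .
 qed
 have gn: "(gop g ^^ n) (t \<one>\<^bsub>G\<^esub> i j) = t (g [^]\<^bsub>G\<^esub> n) i j" for n i j
  by (induction n) (simp_all add: gop_t G(4) pow_in, simp only: J.G.nat_pow_Suc2[OF G(4), symmetric] J.G.nat_pow_Suc)
 have gz: "(gop g ^^ n) 0 = 0" for n by (rule linm_0[OF linm_pow[OF gop_linm]])
 have zz: "(\<Sum>n<q. t (g [^]\<^bsub>G\<^esub> n) (p - 1) (p - 1)) = jz"
  unfolding jz_def by (rule sum.reindex_bij_betw[OF pow_bij])
 \<comment> \<open>Applying y^(p-1) to \<open>t a 0 (p - 1)\<close> multiplies it by the values of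
   \<open>co a\<close> below \<open>p - 1\<close>, up to a shift in the exponent of x. The
   coefficient \<open>co a (p - 1)\<close> completes the product over all residues, which is zero by
   \<open>co_prod\<close>.\<close>
 have yx: "(\<Sum>a\<in>carrier G. scl (co a (p - 1)) ((vY ^^ (p - 1)) (t a 0 (p - 1)))) = 0"
 proof (rule sum.neutral, rule ballI)
  fix a assume "a : carrier G"
  then have "co a (p - 1) * (\<Prod>m<p - 1. co a m) = 0" using co_prod[of a] prod.lessThan_Suc[of "co a" "p - 1"] by (simp only: p1 mult.commute)
  then show "scl (co a (p - 1)) ((vY ^^ (p - 1)) (t a 0 (p - 1))) = 0" by (simp only: vY_pow_top scl_simps add_0)
 qed
 show ?thesis
 proof (cases j)
  case PH
  have "(\<Sum>n<q. (gop g ^^ n) (jv i PH)) = (if i = PH then jz else 0)"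
   by (cases i) (simp_all add: jv_def gn gz zz[unfolded One_nat_def])
  then show ?thesis unfolding PH NN_def pbw_gen.case LH uH .
 next
  case PX
  have "(vX ^^ (p - 1)) (jv i PX) = (if i = PX then jz else 0)"
   by (cases i) (simp_all add: jv_def S Z vX_pow jz_def)
  then show ?thesis by (simp add: PX NN_def jpc_def L)
 next
  case PY
  have "(vY ^^ (p - 1)) (jv i PY) = (if i = PY then jz else 0)"
   using yx by (cases i) (simp_all add: jv_def S Z linm_scl[OF linm_pow[OF vop_linm]] vY_pow_right[unfolded One_nat_def] jz_def)
  then show ?thesis by (simp add: PY NN_def jpc_def L)
 qed
qed

lemma jz_killed: "\<pi> (je j) jz = 0"
 by (cases j) (simp_all add: \<pi>_je jz_def gop_sum, simp_all add: op_sum vX_t vY_t p1 t_p)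

lemma jz_nz: "jz ~= 0"
proof
 assume "jz = 0"
 then have "0 = lookup jz (\<one>\<^bsub>G\<^esub>, p - 1, p - 1)" by simp
 also have "\<dots> = (\<Sum>a\<in>carrier G. if a = \<one>\<^bsub>G\<^esub> then 1 else 0)"
  unfolding jz_def lookup_sum by (rule sum.cong) (use p1 in \<open>auto simp: t_def lookup_single when_def\<close>)
 also have "\<dots> = 1" using G(2) by simp
 finally show False by simp
qed

theorem smash_fg:
 assumes "projective_resolution A (trivial_module (smash_aug G jordan_aug)) P d \<eta>"
 shows "finitely_generated_algebra (cohomology_ring A (smash_aug G jordan_aug) P d \<eta>)"
proof -
 interpret X: jordan_type_rep A NN je 0 "- 1" 0 "1 / 2" 0 0 0 jpc "smash_aug G jordan_aug" \<pi> jv "%_. jz"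
  by unfold_locales
   (rule je_rels je_pow jpc generated independent aug_A(1-4) aug_je \<pi>_facts(1-5) jv_rels jv_pow jz_killed jz_nz; assumption)+
 show ?thesis by (rule X.fg[OF assms])
qed

end

theorem mainTheorem1:
  fixes p :: nat
  assumes "Factorial_Ring.prime p" and "p > 2" and "CHAR('k::alg_closed_field) = p"
  shows
    "(\<forall>(G :: 'g monoid) g q
        (\<rho> :: 'g \<Rightarrow> (jordan_gen, 'k) free_algebra set \<Rightarrow> (jordan_gen, 'k) free_algebra set)
        (P :: nat \<Rightarrow> ('g \<Rightarrow> (jordan_gen, 'k) free_algebra set, 'm) module) d \<eta>.
        group G \<and> finite (carrier G) \<and> order G = q \<and> p dvd q \<and>
        g \<in> carrier G \<and> generate G {g} = carrier G \<and>
        algebra_action G (jordan_algebra p) \<rho> \<and>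
        \<rho> g (jordan_x p) = jordan_x p \<and>
        \<rho> g (jordan_y p) = jordan_x p \<oplus>\<^bsub>jordan_algebra p\<^esub> jordan_y p \<and>
        projective_resolution (smash_product (jordan_algebra p) G \<rho>)
          (trivial_module (smash_aug G jordan_aug)) P d \<eta> \<longrightarrow>
        finitely_generated_algebra
          (cohomology_ring (smash_product (jordan_algebra p) G \<rho>) (smash_aug G jordan_aug)
             P d \<eta>)) \<and>
     (\<forall>(e :: 'k) \<mu> \<tau> (P :: nat \<Rightarrow> ((lifting_gen, 'k) free_algebra set, 'n) module) d \<eta>.
        p = 3 \<and> e \<in> {0, 1} \<and>
        projective_resolution (lifting_algebra e \<mu> \<tau>) (trivial_module lifting_aug) P d \<eta> \<longrightarrow>
        finitely_generated_algebra
          (cohomology_ring (lifting_algebra e \<mu> \<tau>) lifting_aug P d \<eta>))"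
proof (intro conjI allI impI; elim conjE)
  fix G :: "'g monoid" and g q and \<rho> :: "'g \<Rightarrow> (jordan_gen, 'k) free_algebra set \<Rightarrow> (jordan_gen, 'k) free_algebra set"
    and P :: "nat \<Rightarrow> ('g \<Rightarrow> (jordan_gen, 'k) free_algebra set, 'm) module" and d \<eta>
  assume a: "group G" "finite (carrier G)" "order G = q" "p dvd q" "g \<in> carrier G" "generate G {g} = carrier G"
    "algebra_action G (jordan_algebra p) \<rho>" "\<rho> g (jordan_x p) = jordan_x p"
    "\<rho> g (jordan_y p) = jordan_x p \<oplus>\<^bsub>jordan_algebra p\<^esub> jordan_y p"
    and P: "projective_resolution (smash_product (jordan_algebra p) G \<rho>) (trivial_module (smash_aug G jordan_aug)) P d \<eta>"
  have "jordan_smash p G g \<rho>" by (rule jordan_smash.intro) (use assms a in simp_all)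
  then show "finitely_generated_algebra (cohomology_ring (smash_product (jordan_algebra p) G \<rho>) (smash_aug G jordan_aug) P d \<eta>)"
    using P by (rule jordan_smash.smash_fg)
next
  fix e \<mu> \<tau> :: 'k and P :: "nat \<Rightarrow> ((lifting_gen, 'k) free_algebra set, 'n) module" and d \<eta>
  assume p: "p = 3" and e: "e \<in> {0, 1}" and P: "projective_resolution (lifting_algebra e \<mu> \<tau>) (trivial_module lifting_aug) P d \<eta>"
  have "(of_nat 3 :: 'k) = 0" using of_nat_CHAR[where ?'a = 'k] assms(3) p by simp
  then have "lifting_params e" using e by unfold_locales auto
  then show "finitely_generated_algebra (cohomology_ring (lifting_algebra e \<mu> \<tau>) lifting_aug P d \<eta>)"
    using P by (rule lifting_params.lifting_fg)
qed

end
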